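(* Let $$Q_7(r)=864r^4+2160r^3-6060r^2+4972r-1 .$$ There is a unique root $r_7$ of $Q_7$ in the interval $(0,1/4900)$, and every dissection $D$ of the unit square into seven nondegenerate triangles satisfies $$R(D)\ge r_7 .$$ Numerically, $r_7=0.0002011756316409390820336285676\ldots$. Define $$H_7=\frac{1+3r_7}{7},\qquad L_7=\frac{1-4r_7}{7}.$$ Then a dissection of the unit square into seven nondegenerate triangles is minimizing if and only if the multiset of its triangle areas is $$\{H_7,H_7,H_7,H_7,L_7,L_7,L_7\}.$$ In particular, every minimizing seven-triangle dissection has exactly two distinct areas, four triangles having the high area $H_7$ and three having the low area $L_7$.
   Context: A dissection of the unit square $[0,1]^2$ into $n$ triangles is a collection of $n$ nondegenerate (positive-area) closed triangles with pairwise disjoint interiors whose union is the square. It need not be a simplicial triangulation: T-junctions are allowed, i.e. a vertex of one triangle may lie in the relative interior of a side of another triangle. If $D$ is a dissection whose triangles have areas $a_1,\dots,a_n$, its area range is $R(D)=\max_i a_i-\min_i a_i$. Let $\Delta(n)=\inf_D R(D)$, the infimum over all dissections of the unit square into $n$ nondegenerate triangles; this infimum is attained for every $n\ge 2$. A seven-triangle dissection $D$ is called minimizing if $R(D)=\Delta(7)$. *)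

theory Defs
  imports "HOL-Analysis.Analysis" "HOL-Library.Multiset"
begin

abbreviation area :: "(real^2) set \<Rightarrow> real" where
  "area S \<equiv> measure lborel S"

definition unit_square :: "(real^2) set" where
  "unit_square = {p. 0 \<le> p$1 \<and> p$1 \<le> 1 \<and> 0 \<le> p$2 \<and> p$2 \<le> 1}"

definition nondegenerate_triangle :: "(real^2) set \<Rightarrow> bool" where
  "nondegenerate_triangle T \<longleftrightarrow> (\<exists>a b c. T = convex hull {a, b, c}) \<and> 0 < area T"

text \<open>
  A dissection is a set of triangles rather than an indexed family; nothing is lost, since
  triangles of positive area with disjoint interiors are distinct.  There is no condition on how
  the triangles meet along their boundaries, so T-junctions are allowed.
\<close>

definition dissection :: "nat \<Rightarrow> (real^2) set set \<Rightarrow> bool" where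
  "dissection n D \<longleftrightarrow>
     finite D \<and> card D = n \<and>
     (\<forall>T\<in>D. nondegenerate_triangle T) \<and>
     (\<forall>S\<in>D. \<forall>T\<in>D. S \<noteq> T \<longrightarrow> interior S \<inter> interior T = {}) \<and>
     \<Union>D = unit_square"

definition area_range :: "(real^2) set set \<Rightarrow> real" where
  "area_range D = Max (area ` D) - Min (area ` D)"

definition \<Delta> :: "nat \<Rightarrow> real" where
  "\<Delta> n = Inf {area_range D | D. dissection n D}"

definition minimizing :: "(real^2) set set \<Rightarrow> bool" where
  "minimizing D \<longleftrightarrow> dissection 7 D \<and> area_range D = \<Delta> 7"

definition area_mset :: "(real^2) set set \<Rightarrow> real multiset" where
  "area_mset D = image_mset area (mset_set D)"

definition Q7 :: "real \<Rightarrow> real" where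
  "Q7 r = 864 * r^4 + 2160 * r^3 - 6060 * r^2 + 4972 * r - 1"

definition r7 :: real where
  "r7 = (THE r. 0 < r \<and> r < 1/4900 \<and> Q7 r = 0)"

definition H7 :: real where
  "H7 = (1 + 3 * r7) / 7"

definition L7 :: real where
  "L7 = (1 - 4 * r7) / 7"

end

(*
Among the tilings of the square by triangles that are unions of pieces of the dissection take one with
the fewest triangles. If the pieces have nearly equal areas, a triangle made of w pieces has area close to
w/7. By minimality, any three vertices joined by segments that cross no triangle span a triangle of the
tiling. The sides of the triangles and the reversed sides of the square can be completed by flat triangles,
with three collinear vertices, so that every directed side is matched by its reverse. So the tiling can be
explored by repeatedly attaching a proper or flat triangle to an unmatched side. The search is finite since
counting the entries of a generic direction into the triangles bounds the number of vertices, and branches die when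
area bounds shrink the boxes that contain the vertices to nothing. A verified checker follows precomputed
certificates of this search. Only six configurations survive, and all of them impose the same
relation on the areas of five pieces. At nearly equal areas, the slopes of this relation exceed their mean over all seven
areas for four of the pieces and are below it for the other three; so the range is least
when those four have the largest area and the other three the smallest one, and the relation becomes Q7(r) = 0.
*)
theory Submission
 imports Defs
begin

subsection \<open>Triangles in the plane\<close>

text \<open>T-junctions are the obstacle: several triangles may lie across one side, so sides do not
  match in pairs. Once flat triangles are added, every directed side has one owner, and what lies
  beyond an unmatched side is given by a third vertex: a known one, a new T-vertex, or a new vertex
  in no open side. A dissection of range at most \<open>r7\<close> has all areas within
  \<open>r7\<close> of their mean 1/7. The search only uses that they are within 0.00021 of it, a
  little more than \<open>r7\<close>, which leaves room for rounding to integers. So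
  \<open>r7\<close> itself does not enter the search, and one search serves both the lower bound and
  the uniqueness of the areas. The search is split up to symmetry: one run for ears, triangles over
  a side of the square with apex on an adjacent side, and one run for each of six patterns telling
  which sides of the square are sides of a single triangle. Every survivor contains a triangle made
  of two pieces. These are the two pieces that the relation leaves out; their slope is 0, so they
  belong to the three small ones.\<close>

definition crs :: "real^2 => real^2 => real" where
 "crs u v = u$1 * v$2 - u$2 * v$1"

text \<open>Twice the signed area of the triangle, positive if \<open>a\<close>, \<open>b\<close>,
  \<open>c\<close> run counterclockwise.\<close>

definition orient :: "real^2 => real^2 => real^2 => real" where
 "orient a b c = (b$1 - a$1) * (c$2 - a$2) - (c$1 - a$1) * (b$2 - a$2)"

type_synonym triple = "(real^2) \<times> (real^2) \<times> (real^2)"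

text \<open>Meant for counterclockwise triples. The encoding by half-planes turns membership into
  signs of \<open>orient\<close> and is invariant under rotation of the triple;
  \<open>convex_hull_ctri\<close> links it to convex hulls.\<close>

fun ctri :: "triple => (real^2) set" where
 "ctri (a, b, c) = {z. 0 <= orient a b z & 0 <= orient b c z & 0 <= orient c a z}"

fun otri :: "triple => (real^2) set" where
 "otri (a, b, c) = {z. 0 < orient a b z & 0 < orient b c z & 0 < orient c a z}"

fun tor :: "triple => real" where
 "tor (a, b, c) = orient a b c"

fun tverts :: "triple => (real^2) set" where
 "tverts (a, b, c) = {a, b, c}"

fun tedges :: "triple => ((real^2) \<times> (real^2)) set" where
 "tedges (a, b, c) = {(a, b), (b, c), (c, a)}"

lemma vec2_eq_iff: "(x :: real^2) = y \<longleftrightarrow> x$1 = y$1 & x$2 = y$2"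
 by (simp add: vec_eq_iff forall_2)

lemma orient_rot: "orient b c a = orient a b c" "orient c a b = orient a b c"
 by (simp_all add: orient_def algebra_simps)

lemma orient_swap: "orient b a c = - orient a b c"
 by (simp add: orient_def algebra_simps)

lemma orient_self [simp]: "orient a b a = 0" "orient a b b = 0" "orient a a b = 0"
 by (simp_all add: orient_def algebra_simps)

lemma orient_sum: "orient a b z + orient b c z + orient c a z = orient a b c"
 by (simp add: orient_def algebra_simps)

lemma orient_add: "orient a b (z + s *\<^sub>R v) = orient a b z + s * crs (b - a) v"
 by (simp add: orient_def crs_def algebra_simps)

lemma orient_comb: "orient a b ((1 - u) *\<^sub>R p + u *\<^sub>R q) = (1 - u) * orient a b p + u * orient a b q"
 by (simp add: orient_def algebra_simps)

lemma continuous_orient [continuous_intros]: "continuous_on S (%z. orient a b z)"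
 unfolding orient_def by (intro continuous_intros)

lemma in_open_segmentE:
 assumes "z : open_segment p q"
 obtains u where "0 < u" "u < 1" "z = (1 - u) *\<^sub>R p + u *\<^sub>R q" "p ~= q"
 using assms by (auto simp: in_segment)

lemma in_open_segmentI: "0 < u ==> u < 1 ==> p ~= q ==> (1 - u) *\<^sub>R p + u *\<^sub>R q : open_segment p q"
 by (auto simp: in_segment)

lemma orient_on_segment: "z : open_segment a b ==> orient a b z = 0"
 by (elim in_open_segmentE) (simp add: orient_comb)

section \<open>Topology and convexity of open and closed triangles\<close>

lemma open_otri: "open (otri t)"
proof (cases t)
 case (fields a b c)
 have "otri t = {z. 0 < orient a b z} Int {z. 0 < orient b c z} Int {z. 0 < orient c a z}"
  by (auto simp: fields)
 moreover have "open {z. 0 < orient p q z}" for p q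
  by (intro open_Collect_less continuous_intros)
 ultimately show ?thesis by (simp only: open_Int)
qed

lemma closed_ctri: "closed (ctri t)"
proof (cases t)
 case (fields a b c)
 have "ctri t = {z. 0 <= orient a b z} Int {z. 0 <= orient b c z} Int {z. 0 <= orient c a z}"
  by (auto simp: fields)
 moreover have "closed {z. 0 <= orient p q z}" for p q
  by (intro closed_Collect_le continuous_intros)
 ultimately show ?thesis by (simp only: closed_Int)
qed

lemma convex_halfplane: "convex {z. 0 < orient p q z}" "convex {z. 0 <= orient p q z}"
proof -
 have "0 < orient p q ((1 - u) *\<^sub>R x + u *\<^sub>R y)"
  if "0 < orient p q x" "0 < orient p q y" "0 <= u" "u <= 1" for x y u
 proof (cases "u = 0")
  case False
  then have "0 < u * orient p q y" using that by simp
  moreover have "0 <= (1 - u) * orient p q x" using that by simp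
  ultimately show ?thesis by (simp add: orient_comb)
 qed (use that in simp)
 then show "convex {z. 0 < orient p q z}" by (auto simp: convex_alt)
 show "convex {z. 0 <= orient p q z}"
  by (auto simp: convex_alt orient_comb)
qed

lemma convex_otri: "convex (otri t)"
proof (cases t)
 case (fields a b c)
 have "otri t = {z. 0 < orient a b z} Int {z. 0 < orient b c z} Int {z. 0 < orient c a z}"
  by (auto simp: fields)
 then show ?thesis by (simp add: convex_halfplane convex_Int)
qed

lemma convex_ctri: "convex (ctri t)"
proof (cases t)
 case (fields a b c)
 have "ctri t = {z. 0 <= orient a b z} Int {z. 0 <= orient b c z} Int {z. 0 <= orient c a z}"
  by (auto simp: fields)
 then show ?thesis by (simp add: convex_halfplane convex_Int)
qed

lemma otri_subset_ctri: "otri t <= ctri t"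
 by (cases t) auto

lemma tverts_ctri: "0 < tor t ==> tverts t <= ctri t"
 by (cases t) (auto simp: orient_rot)

lemma ctri_barycentric:
 assumes "0 < orient a b c"
 shows "z = (orient b c z / orient a b c) *\<^sub>R a + (orient c a z / orient a b c) *\<^sub>R b
   + (orient a b z / orient a b c) *\<^sub>R c"
proof -
 have "orient a b c * z$i = orient b c z * a$i + orient c a z * b$i + orient a b z * c$i" if "i = 1 | i = 2" for i
  using that by (auto simp: orient_def algebra_simps)
 from this[of 1] this[of 2] show ?thesis using assms
  by (simp add: vec2_eq_iff field_simps)
qed

lemma convex_hull_ctri:
 assumes "0 < orient a b c"
 shows "convex hull {a, b, c} = ctri (a, b, c)"
proof
 show "convex hull {a, b, c} <= ctri (a, b, c)"
  using tverts_ctri[of "(a, b, c)"] assms by (intro hull_minimal convex_ctri) auto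
 show "ctri (a, b, c) <= convex hull {a, b, c}"
 proof
  fix z assume z: "z : ctri (a, b, c)"
  let ?u = "orient b c z / orient a b c" and ?v = "orient c a z / orient a b c" and ?w = "orient a b z / orient a b c"
  have "?u + ?v + ?w = 1" using orient_sum[of a b z c] assms by (simp add: field_simps)
  moreover have "0 <= ?u" "0 <= ?v" "0 <= ?w" using z assms by auto
  ultimately show "z : convex hull {a, b, c}"
   unfolding convex_hull_3 using ctri_barycentric[OF assms, of z] by blast
 qed
qed

text \<open>The witness is \<open>d\<close> turned by a quarter; its cross product with
  \<open>d\<close> is the squared length of \<open>d\<close>.\<close>

lemma ex_left_vector: "(d :: real^2) ~= 0 ==> EX v. crs d v > 0"
proof -
 assume "d ~= 0"
 then have "0 < d$1 * d$1 + d$2 * d$2"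
  by (auto simp: vec2_eq_iff intro: add_pos_nonneg add_nonneg_pos simp flip: power2_eq_square)
 then have "crs d (vector [- d$2, d$1]) > 0"
  by (simp add: crs_def)
 then show ?thesis by blast
qed

text \<open>For leaving a point in a prescribed direction without leaving an open set. The
  \<open>+ 1\<close> in the step length covers \<open>v = 0\<close>.\<close>

lemma small_move:
 fixes z v :: "real^2"
 assumes "0 < e"
 obtains s where "0 < s" "!!r. 0 <= r ==> r <= s ==> z + r *\<^sub>R v : ball z e"
proof
 let ?s = "e / (2 * (norm v + 1))"
 show "0 < ?s" using assms by (simp add: add_nonneg_pos)
 fix r assume r: "0 <= r" "r <= ?s"
 have "r * norm v <= ?s * norm v" using r by (intro mult_right_mono) auto
 also have "... < e"
 proof -
  have "norm v < 2 * (norm v + 1)" by (smt (verit) norm_ge_zero)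
  then have "norm v / (2 * (norm v + 1)) < 1" by (smt (verit) norm_ge_zero divide_less_eq_1)
  then have "e * (norm v / (2 * (norm v + 1))) < e * 1" using assms by (intro mult_strict_left_mono)
  then show ?thesis by simp
 qed
 finally show "z + r *\<^sub>R v : ball z e" using r by (simp add: dist_norm)
qed

lemma orient_nz_ne: "orient a b c ~= 0 ==> a ~= b & b ~= c & c ~= a"
 by auto

text \<open>If \<open>z\<close> were on the line, a small step against a left vector would stay in
  the ball but cross to the right of the line.\<close>

lemma interior_halfplane:
 assumes "a ~= b" and "ball z e <= {z. 0 <= orient a b z}" and "0 < e"
 shows "0 < orient a b z"
proof -
 obtain v where v: "crs (b - a) v > 0" using ex_left_vector[of "b - a"] assms(1) by auto
 obtain s where s: "0 < s" "!!r. 0 <= r ==> r <= s ==> z + r *\<^sub>R (- v) : ball z e"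
  using small_move[OF assms(3), of z "- v"] by blast
 have "0 <= orient a b (z + s *\<^sub>R (- v))" using s(1) s(2)[of s] assms(2) by (auto dest!: subsetD)
 then have "s * crs (b - a) v <= orient a b z" unfolding orient_add by (simp add: crs_def algebra_simps)
 then show ?thesis using s(1) v by (smt (verit) mult_pos_pos)
qed

lemma interior_ctri:
 assumes "0 < tor t"
 shows "interior (ctri t) = otri t"
proof (cases t)
 case (fields a b c)
 have ne: "a ~= b" "b ~= c" "c ~= a" using assms fields orient_nz_ne[of a b c] by auto
 show ?thesis
 proof
  show "otri t <= interior (ctri t)"
   by (simp add: interior_maximal open_otri otri_subset_ctri)
  show "interior (ctri t) <= otri t"
  proof
   fix z assume "z : interior (ctri t)"
   then obtain e where e: "0 < e" "ball z e <= ctri t" using mem_interior by blast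
   from e(2) have "ball z e <= {z. 0 <= orient a b z}" "ball z e <= {z. 0 <= orient b c z}"
    "ball z e <= {z. 0 <= orient c a z}" unfolding fields by auto
   then show "z : otri t" using interior_halfplane[OF ne(1) _ e(1), of z] interior_halfplane[OF ne(2) _ e(1), of z]
     interior_halfplane[OF ne(3) _ e(1), of z] unfolding fields by auto
  qed
 qed
qed

text \<open>A closed convex set with nonempty interior is the closure of its interior; here the
  centroid is an interior point.\<close>

lemma closure_otri:
 assumes "0 < tor t"
 shows "closure (otri t) = ctri t"
proof -
 obtain a b c where t: "t = (a, b, c)" by (cases t)
 have "orient a b ((1/3) *\<^sub>R (a + b + c)) = orient a b c / 3" for a b c
  by (simp add: orient_def field_simps)
 from this[of a b c] this[of b c a] this[of c a b] have "(1/3) *\<^sub>R (a + b + c) : otri t"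
  using assms by (simp add: t orient_rot algebra_simps)
 then have "interior (ctri t) ~= {}" using interior_ctri[OF assms] by auto
 then show ?thesis
  using convex_closure_interior[OF convex_ctri, of t] closed_ctri[of t] interior_ctri[OF assms] by simp
qed

lemma otri_nonempty: "0 < tor t ==> otri t ~= {}"
proof
 assume "0 < tor t" "otri t = {}"
 then have "ctri t = {}" "tverts t <= ctri t" using closure_otri[of t] tverts_ctri[of t] by simp_all
 then show False by (cases t) auto
qed

lemma area_ctri:
 assumes "0 < tor t"
 shows "measure lborel (ctri t) = tor t / 2"
proof (cases t)
 case (fields a b c)
 have "0 < orient a b c" using assms fields by simp
 then have "measure lborel (ctri t) = measure lborel (convex hull {a, b, c})"
  using convex_hull_ctri fields by simp
 also have "... = \<bar>(c $ 1 - a $ 1) * (b $ 2 - a $ 2) - (b $ 1 - a $ 1) * (c $ 2 - a $ 2)\<bar> / 2"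
  by (rule content_triangle)
 also have "... = tor t / 2" using \<open>0 < orient a b c\<close> by (simp add: fields orient_def)
 finally show ?thesis .
qed

text \<open>At a point of an open side the functionals of the two other sides are positive, so near
  this point the triangle is cut out by the first half-plane alone.\<close>

lemma side_half_disc:
 assumes "0 < orient a b c" "z : open_segment a b"
 obtains e where "0 < e" "!!y. y : ball z e ==> 0 < orient a b y ==> y : otri (a, b, c)"
   "!!y. y : ball z e ==> 0 <= orient a b y ==> y : ctri (a, b, c)"
proof -
 obtain u where u: "0 < u" "u < 1" "z = (1 - u) *\<^sub>R a + u *\<^sub>R b" using assms(2) by (auto elim: in_open_segmentE)
 have "orient b c z = (1 - u) * orient a b c" "orient c a z = u * orient a b c"
  by (simp_all add: u(3) orient_def algebra_simps)
 then have "z : {y. 0 < orient b c y} Int {y. 0 < orient c a y}" using u assms by simp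
 moreover have "open ({y. 0 < orient b c y} Int {y. 0 < orient c a y})"
  by (intro open_Int open_Collect_less continuous_intros)
 ultimately obtain e where e: "0 < e" "ball z e <= {y. 0 < orient b c y} Int {y. 0 < orient c a y}"
  by (meson openE)
 show ?thesis
  by (rule that[OF e(1)]) (use e(2) in \<open>auto simp: subset_iff less_imp_le\<close>)
qed

lemma zero_orient_cases:
 assumes "0 < orient a b c" "z : ctri (a, b, c)" "orient a b z = 0"
 shows "z = a | z = b | z : open_segment a b"
proof -
 define u where "u = orient c a z / orient a b c"
 have s: "orient b c z + orient c a z = orient a b c" using orient_sum[of a b z c] assms(3) by simp
 then have "orient b c z / orient a b c = 1 - u" using assms(1) by (simp add: u_def field_simps)
 then have z: "z = (1 - u) *\<^sub>R a + u *\<^sub>R b"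
  using ctri_barycentric[OF assms(1), of z] assms(3) by (simp add: u_def)
 have "0 <= u" "u <= 1" using assms s by (auto simp: u_def)
 moreover have "a ~= b" using assms(1) by auto
 ultimately show ?thesis using z in_open_segmentI[of u a b]
  by (cases "u = 0 | u = 1") auto
qed

lemma ctri_cases:
 assumes "0 < tor t" "z : ctri t"
 shows "z : otri t | z : tverts t | (EX p q. (p, q) : tedges t & z : open_segment p q)"
proof (cases t)
 case (fields a b c)
 then have o: "0 < orient a b c" "0 < orient b c a" "0 < orient c a b" using assms by (auto simp: orient_rot)
 have zz: "z : ctri (a, b, c)" "z : ctri (b, c, a)" "z : ctri (c, a, b)" using assms fields by auto
 consider "z : otri t" | "orient a b z = 0" | "orient b c z = 0" | "orient c a z = 0"
  using zz(1) fields by force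
 then show ?thesis
 proof cases
  case 2 then show ?thesis using zero_orient_cases[OF o(1) zz(1)] unfolding fields by auto
 next
  case 3 then show ?thesis using zero_orient_cases[OF o(2) zz(2)] unfolding fields by auto
 next
  case 4 then show ?thesis using zero_orient_cases[OF o(3) zz(3)] unfolding fields by auto
 qed simp
qed

text \<open>Everything attached to a triple is invariant under rotation, so an arbitrary side may be
  taken to be the first one.\<close>

lemma edge_rotation:
 assumes "(p, q) : tedges t"
 obtains g where "ctri t = ctri (p, q, g)" "otri t = otri (p, q, g)" "tor t = tor (p, q, g)"
   "tedges t = tedges (p, q, g)" "tverts t = tverts (p, q, g)"
proof (cases t)
 case (fields a b c)
 consider "p = a" "q = b" | "p = b" "q = c" | "p = c" "q = a" using assms fields by auto
 then show ?thesis
 proof cases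
  case 1 then show ?thesis by (intro that[of c]) (auto simp: fields)
 next
  case 2 then show ?thesis by (intro that[of a]) (auto simp: fields orient_rot)
 next
  case 3 then show ?thesis by (intro that[of b]) (auto simp: fields orient_rot)
 qed
qed

text \<open>If the cross product of the directions were nonzero, one of \<open>d' - d\<close> and
  \<open>d - d'\<close> would lie to the left of both. So they are parallel, and a common left
  vector is missing only if they point in opposite ways.\<close>

lemma opposite_directions:
 assumes "d ~= 0" "d' ~= 0" "!!v. ~ (0 < crs d v & 0 < crs d' v)"
 shows "EX c>0. d' = - c *\<^sub>R d"
proof -
 have "crs d d' = 0"
 proof (rule ccontr)
  assume "crs d d' ~= 0"
  then consider "0 < crs d d'" | "crs d d' < 0" by linarith
  then show False
  proof cases
   case 1
   then show False using assms(3)[of "d' - d"] by (simp add: crs_def algebra_simps)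
  next
   case 2
   then show False using assms(3)[of "d - d'"] by (simp add: crs_def algebra_simps)
  qed
 qed
 then obtain k where k: "d' = k *\<^sub>R d"
 proof -
  have n: "0 < d$1 * d$1 + d$2 * d$2" using assms(1)
   by (auto simp: vec2_eq_iff intro: add_pos_nonneg add_nonneg_pos simp flip: power2_eq_square)
  have c: "d$1 * d'$2 = d$2 * d'$1" using \<open>crs d d' = 0\<close> by (simp add: crs_def)
  \<comment> \<open>The coefficient of the orthogonal projection of \<open>d'\<close> to the line of
    \<open>d\<close>.\<close>
  let ?k = "(d$1 * d'$1 + d$2 * d'$2) / (d$1 * d$1 + d$2 * d$2)"
  have "d'$1 * (d$1 * d$1 + d$2 * d$2) = (d$1 * d'$1 + d$2 * d'$2) * d$1"
   using c by (simp add: algebra_simps)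
  moreover have "d'$2 * (d$1 * d$1 + d$2 * d$2) = (d$1 * d'$1 + d$2 * d'$2) * d$2"
   using c by (simp add: algebra_simps)
  ultimately have "d'$1 = ?k * d$1" "d'$2 = ?k * d$2" using n by (auto simp: eq_divide_eq)
  then have "d' = ?k *\<^sub>R d" by (simp add: vec2_eq_iff)
  then show ?thesis by (rule that)
 qed
 obtain v where v: "0 < crs d v" using ex_left_vector[OF assms(1)] by auto
 have "crs d' v = k * crs d v" by (simp add: k crs_def algebra_simps)
 then have "k <= 0" using assms(3)[of v] v by (metis mult_pos_pos not_le)
 moreover have "k ~= 0" using assms(2) k by auto
 ultimately show ?thesis using k by (intro exI[of _ "- k"]) auto
qed

subsection \<open>Completing a set of edges by flat triangles\<close>

type_synonym edge = "(real^2) \<times> (real^2)"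

definition dirv :: "edge => real^2" where "dirv e = snd e - fst e"
definition oseg :: "edge => (real^2) set" where "oseg e = open_segment (fst e) (snd e)"
definition anti :: "edge => edge => bool" where "anti e f \<longleftrightarrow> (EX c>0. dirv f = - c *\<^sub>R dirv e)"
definition codir :: "edge => edge => bool" where "codir e f \<longleftrightarrow> (EX c>0. dirv f = c *\<^sub>R dirv e)"
definition ends :: "edge set => (real^2) set" where "ends X = fst ` X Un snd ` X"

lemma anti_sym: "anti e f ==> anti f e"
 unfolding anti_def by (elim exE conjE, rule_tac x="inverse c" in exI) simp

lemma codir_sym: "codir e f ==> codir f e"
 unfolding codir_def by (elim exE conjE, rule_tac x="inverse c" in exI) simp

lemma anti_anti: "anti e f ==> anti f g ==> codir e g"
 unfolding anti_def codir_def by (elim exE conjE, rule_tac x="c * ca" in exI) simp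

lemma codir_anti: "codir e f ==> anti f g ==> anti e g"
 unfolding anti_def codir_def by (elim exE conjE, rule_tac x="c * ca" in exI) simp

lemma anti_codir: "anti e f ==> codir f g ==> anti e g"
 unfolding anti_def codir_def by (elim exE conjE, rule_tac x="c * ca" in exI) simp

lemma codir_trans: "codir e f ==> codir f g ==> codir e g"
 unfolding anti_def codir_def by (elim exE conjE, rule_tac x="c * ca" in exI) simp

lemma codir_refl: "codir e e"
 unfolding codir_def by (rule exI[of _ 1]) simp

lemma not_codir_anti: "dirv e ~= 0 ==> codir e f ==> anti e f ==> False"
proof -
 assume d: "dirv e ~= 0" and "codir e f" "anti e f"
 then obtain a b where "a > 0" "b > 0" "a *\<^sub>R dirv e = - b *\<^sub>R dirv e" by (auto simp: anti_def codir_def)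
 then have "(a + b) *\<^sub>R dirv e = 0" by (simp add: scaleR_left_distrib)
 then show False using d \<open>a > 0\<close> \<open>b > 0\<close> by simp
qed

text \<open>Edges may overlap in part, so sides are matched pointwise: off a finite set, in which
  edges may begin and end, each point of an edge has exactly one antiparallel edge through
  it.\<close>

definition balanced :: "(real^2) set => edge set => bool" where
 "balanced F X \<longleftrightarrow> finite X & finite F & (ALL e:X. fst e ~= snd e) &
   (ALL e:X. ALL z:oseg e - F. EX! f. f : X & z : oseg f & anti e f)"

text \<open>Makes sure that a T-vertex becomes the middle of at most one flat triangle.\<close>

definition vertex_once :: "edge set => bool" where
 "vertex_once X \<longleftrightarrow> (ALL v:ends X. ALL e:X. ALL f:X. v : oseg e --> v : oseg f --> e = f)"

fun tmid :: "triple => real^2" where "tmid (a, m, b) = m"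
fun flat :: "triple => bool" where "flat (a, m, b) \<longleftrightarrow> m : open_segment a b"

text \<open>Besides matching every edge with its reverse, this records what the search relies on: no
  two flat triangles share a side or a middle vertex. The last clause, that off \<open>F\<close>
  their sides run along edges of \<open>X\<close>, shows later that these sides are clean, and it
  also drives the induction: where no edge of \<open>X\<close> is left, no flat triangle can
  appear.\<close>

definition closes :: "(real^2) set => edge set => triple set => bool" where
 "closes F X G \<longleftrightarrow> finite G & finite F &
   (ALL k:G. flat k & (EX e:X. tmid k : oseg e)) &
   (ALL k:G. ALL k':G. tedges k Int tedges k' ~= {} --> k = k') &
   (ALL k:G. tedges k Int X = {}) &
   (ALL p q. (p, q) : X Un \<Union>(tedges ` G) --> (q, p) : X Un \<Union>(tedges ` G)) &
   (ALL k:G. ALL k':G. tmid k = tmid k' --> k = k') &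
   (ALL k:G. ALL f:tedges k. fst f : ends X & snd f : ends X &
    (ALL z:oseg f - F. EX e:X. z : oseg e & (codir e f | anti e f)))"

lemma closesD:
 assumes "closes F X G"
 shows "finite G" "finite F" "k : G ==> flat k" "k : G ==> EX e:X. tmid k : oseg e"
  "k : G ==> k' : G ==> f : tedges k ==> f : tedges k' ==> k = k'"
  "k : G ==> tedges k Int X = {}"
  "(p, q) : X Un \<Union>(tedges ` G) ==> (q, p) : X Un \<Union>(tedges ` G)"
  "k : G ==> k' : G ==> tmid k = tmid k' ==> k = k'"
  "k : G ==> f : tedges k ==> fst f : ends X" "k : G ==> f : tedges k ==> snd f : ends X"
  "k : G ==> f : tedges k ==> z : oseg f ==> z ~: F ==> EX e:X. z : oseg e & (codir e f | anti e f)"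
proof -
 note c = assms[unfolded closes_def]
 show "finite G" "finite F" using c by simp_all
 show "k : G ==> flat k" "k : G ==> EX e:X. tmid k : oseg e" using c by simp_all
 show "k : G ==> k' : G ==> f : tedges k ==> f : tedges k' ==> k = k'" using c by (metis disjoint_iff)
 show "k : G ==> tedges k Int X = {}" using c by simp
 from c have "ALL p q. (p, q) : X Un \<Union>(tedges ` G) --> (q, p) : X Un \<Union>(tedges ` G)" by (elim conjE)
 then show "(p, q) : X Un \<Union>(tedges ` G) ==> (q, p) : X Un \<Union>(tedges ` G)" by blast
 show "k : G ==> k' : G ==> tmid k = tmid k' ==> k = k'" using c by simp
 from c have l: "ALL k:G. ALL f:tedges k. fst f : ends X & snd f : ends X &
    (ALL z:oseg f - F. EX e:X. z : oseg e & (codir e f | anti e f))" by (elim conjE)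
 show "k : G ==> f : tedges k ==> fst f : ends X" "k : G ==> f : tedges k ==> snd f : ends X"
  "k : G ==> f : tedges k ==> z : oseg f ==> z ~: F ==> EX e:X. z : oseg e & (codir e f | anti e f)"
  using bspec[OF bspec[OF l], of k f] by (blast intro: DiffI)+
qed

text \<open>Puts segments of one line on a common parameter, so that relations between them become
  relations between intervals.\<close>

lemma seg_param:
 assumes "x < y" "d ~= (0 :: real^2)"
 shows "open_segment (a + x *\<^sub>R d) (a + y *\<^sub>R d) = (%s. a + s *\<^sub>R d) ` {x<..<y}"
proof
 show "open_segment (a + x *\<^sub>R d) (a + y *\<^sub>R d) <= (%s. a + s *\<^sub>R d) ` {x<..<y}"
 proof
  fix z assume "z : open_segment (a + x *\<^sub>R d) (a + y *\<^sub>R d)"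
  then obtain u where u: "0 < u" "u < 1" "z = (1 - u) *\<^sub>R (a + x *\<^sub>R d) + u *\<^sub>R (a + y *\<^sub>R d)"
   by (auto elim: in_open_segmentE)
  have "z = a + (x + u * (y - x)) *\<^sub>R d" by (simp add: u(3) algebra_simps)
  moreover have "0 < u * (y - x)" "u * (y - x) < 1 * (y - x)"
   using u assms(1) by (auto intro: mult_strict_right_mono)
  ultimately show "z : (%s. a + s *\<^sub>R d) ` {x<..<y}" by (auto intro!: image_eqI[of _ _ "x + u * (y - x)"])
 qed
 show "(%s. a + s *\<^sub>R d) ` {x<..<y} <= open_segment (a + x *\<^sub>R d) (a + y *\<^sub>R d)"
 proof clarify
  fix s assume s: "s : {x<..<y}"
  let ?u = "(s - x) / (y - x)"
  have "0 < ?u" "?u < 1" using s assms(1) by auto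
  moreover have "a + s *\<^sub>R d = (1 - ?u) *\<^sub>R (a + x *\<^sub>R d) + ?u *\<^sub>R (a + y *\<^sub>R d)"
  proof -
   have "(1 - u) * x + u * y = x + u * (y - x)" for u by (simp add: algebra_simps)
   then have "(1 - ?u) * x + ?u * y = x + ?u * (y - x)" .
   then have e: "(1 - ?u) * x + ?u * y = s" using assms(1) by simp
   have "(1 - u) *\<^sub>R (a + x *\<^sub>R d) + u *\<^sub>R (a + y *\<^sub>R d) = a + ((1 - u) * x + u * y) *\<^sub>R d" for u
    by (simp add: algebra_simps)
   then show ?thesis using e by metis
  qed
  ultimately show "a + s *\<^sub>R d : open_segment (a + x *\<^sub>R d) (a + y *\<^sub>R d)"
   using in_open_segmentI[of ?u "a + x *\<^sub>R d" "a + y *\<^sub>R d"] assms by auto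
 qed
qed

text \<open>Supplies the witness for every argument that works off a finite set of exceptional
  points.\<close>

lemma infinite_seg: "p ~= q ==> finite F ==> EX z. z : open_segment p q - (F :: (real^2) set)"
proof (rule ccontr)
 assume pq: "p ~= q" "finite F" "\<nexists>z. z : open_segment p q - F"
 then have "finite (open_segment p q)" using finite_subset[of "open_segment p q" F] by blast
 moreover have "open_segment p q = (%s. p + s *\<^sub>R (q - p)) ` {0<..<1}"
  using seg_param[of 0 1 "q - p" p] pq(1) by simp
 moreover have "inj_on (%s. p + s *\<^sub>R (q - p)) {0<..<1}" using pq(1) by (auto simp: inj_on_def)
 ultimately have "finite {0<..<1::real}" using finite_imageD by metis
 then show False by (simp add: infinite_Ioo)
qed

text \<open>Codirected edges through \<open>z\<close> share their antiparallel partner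
  \<open>f\<close>, and \<open>f\<close> in turn has only one partner at \<open>z\<close>.\<close>

lemma balanced_unique_codir:
 assumes "balanced F X" "e : X" "e' : X" "z : oseg e" "z : oseg e'" "z ~: F" "codir e e'"
 shows "e = e'"
proof -
 obtain f where f: "f : X" "z : oseg f" "anti e f" using assms unfolding balanced_def by blast
 have "EX! g. g : X & z : oseg g & anti f g" using assms f unfolding balanced_def by blast
 moreover have "anti f e" "anti f e'" using f(3) assms(7) anti_sym anti_codir by blast+
 ultimately show ?thesis using assms by blast
qed

lemma balanced_unique_anti:
 assumes "balanced F X" "e : X" "f : X" "g : X" "z : oseg e" "z : oseg f" "z : oseg g" "z ~: F" "anti e f" "anti e g"
 shows "f = g"
 using assms unfolding balanced_def by (metis DiffI)

lemma balanced_partner: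
 assumes "balanced F X" "e : X" "z : oseg e" "z ~: F"
 obtains f where "f : X" "z : oseg f" "anti e f"
 using assms unfolding balanced_def by (metis DiffI)

lemma balancedI:
 assumes "finite X" "finite F" "!!e. e : X ==> fst e ~= snd e"
  "!!e z. e : X ==> z : oseg e ==> z ~: F ==> EX f. f : X & z : oseg f & anti e f"
  "!!e z f g. e : X ==> z : oseg e ==> z ~: F ==> f : X ==> g : X ==> z : oseg f ==> z : oseg g ==> anti e f
    ==> anti e g ==> f = g"
 shows "balanced F X"
 unfolding balanced_def using assms by (metis DiffE)

text \<open>Two antiparallel edges from a common end: the shorter one, \<open>S\<close>, is cancelled, and the
 part \<open>N\<close> of the longer one, \<open>L\<close>, beyond it is kept.\<close>

locale trim =
 fixes F :: "(real^2) set" and X :: "edge set" and L S N :: edge and m :: "real^2" and t :: triple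
 assumes bal: "balanced F X" and once: "vertex_once X"
  and LX: "L : X" and SX: "S : X" and LS: "anti L S" and LN: "codir L N" and Nne: "fst N ~= snd N"
  and NL: "oseg N <= oseg L" and SL: "oseg S <= oseg L" and Lcov: "oseg L <= oseg S Un oseg N Un {m}"
  and SN: "oseg S Int oseg N = {}" and mL: "m : oseg L" and mN: "m ~: oseg N" and mF: "m : F"
  and Sne: "fst S ~= snd S"
  and tm: "tmid t = m" and tf: "flat t"
  and te: "tedges t = {prod.swap L, prod.swap S, N}"
  and Nends: "fst N : ends X" "snd N : ends X" and mend: "m : ends X"
begin

definition "X' = insert N (X - {L, S})"

lemma fin: "finite X" "finite F" using bal by (auto simp: balanced_def)

lemma dirL: "dirv L ~= 0" "~ anti L L"
proof -
 show d: "dirv L ~= 0" using bal LX by (auto simp: balanced_def dirv_def)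
 show "~ anti L L" using not_codir_anti[OF d] codir_refl by blast
qed

lemma oseg_LS: "oseg L ~= oseg S"
proof
 assume "oseg L = oseg S"
 then have "oseg N = {}" using NL SN by blast
 then show False using infinite_seg[OF Nne, of "{}"] by (simp add: oseg_def)
qed

text \<open>In \<open>X\<close> the edge \<open>N\<close> would be codirected with \<open>L\<close>
  and overlap it, hence be equal to \<open>L\<close>; but \<open>m\<close> lies on \<open>L\<close>
  and not on \<open>N\<close>.\<close>

lemma N_notin: "N ~: X"
proof
 assume "N : X"
 obtain z where z: "z : oseg N" "z ~: F" using infinite_seg[OF Nne fin(2)] by (auto simp: oseg_def)
 then have "L = N" using balanced_unique_codir[OF bal LX \<open>N : X\<close> _ z(1,2) LN] NL by blast
 then show False using mL mN by simp
qed

lemma ends_X': "ends X' <= ends X"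
 using Nends by (auto simp: X'_def ends_def)

lemma card_X': "card X' < card X"
proof -
 have "L ~= S" using LS dirL by blast
 then have "card (X - {L, S}) = card X - 2" using LX SX fin by (simp add: card_Diff_subset)
 moreover have "2 <= card X" using \<open>L ~= S\<close> LX SX fin by (metis card_2_iff card_mono empty_subsetI insert_subset)
 moreover have "card X' = Suc (card (X - {L, S}))" unfolding X'_def using fin N_notin by simp
 ultimately show ?thesis by linarith
qed

lemma once_X': "vertex_once X'"
 unfolding vertex_once_def
proof (intro ballI impI)
 fix v e f assume v: "v : ends X'" and e: "e : X'" and f: "f : X'" and ve: "v : oseg e" and vf: "v : oseg f"
 have vX: "v : ends X" using v ends_X' by blast
 have o: "g = h" if "g : X" "h : X" "v : oseg g" "v : oseg h" for g h
  using once vX that unfolding vertex_once_def by blast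
 show "e = f"
  using o[of e f] o[of L e] o[of L f] e f ve vf NL LX unfolding X'_def by auto
qed

text \<open>Apart from \<open>m\<close>, a point of \<open>L\<close> is on \<open>S\<close> or on
  \<open>N\<close>. Over \<open>S\<close> the edges \<open>L\<close> and \<open>S\<close> were
  partners of each other and vanish together; over \<open>N\<close> the edge \<open>N\<close> takes
  the place of \<open>L\<close>.\<close>

lemma bal_X': "balanced F X'"
proof (rule balancedI)
 show "finite X'" "finite F" using fin by (auto simp: X'_def)
 show "fst e ~= snd e" if "e : X'" for e
  using that bal Nne by (auto simp: X'_def balanced_def)
next
 fix e z assume e: "e : X'" and z: "z : oseg e" "z ~: F"
 show "EX f. f : X' & z : oseg f & anti e f"
 proof (cases "e = N")
  case True
  then have zL: "z : oseg L" using z NL by blast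
  obtain f where f: "f : X" "z : oseg f" "anti L f" using balanced_partner[OF bal LX zL z(2)] .
  have "f ~= S" using f(2) SN z True by blast
  moreover have "f ~= L" using f(3) dirL by blast
  ultimately show ?thesis using f True LN codir_sym codir_anti unfolding X'_def by blast
 next
  case False
  then have eX: "e : X" "e ~= L" "e ~= S" using e by (auto simp: X'_def)
  obtain f where f: "f : X" "z : oseg f" "anti e f" using balanced_partner[OF bal eX(1) z] .
  show ?thesis
  proof (cases "f = L | f = S")
   case False
   then show ?thesis using f by (intro exI[of _ f]) (simp add: X'_def)
  next
   case True
   then consider "f = L" "z : oseg N" | "z : oseg S" "z : oseg L"
    using f(2) Lcov mF z(2) SL by blast
   then show ?thesis
   proof cases
    case 1
    then show ?thesis using f(3) LN anti_codir unfolding X'_def by blast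
   next
    case 2
    have "anti L S" "anti S L" using LS anti_sym by blast+
    then have "e = L | e = S"
     using True f(3) anti_sym balanced_unique_anti[OF bal LX SX eX(1) 2(2,1) z(1,2) LS]
      balanced_unique_anti[OF bal SX LX eX(1) 2(1,2) z(1,2)] by blast
    then show ?thesis using eX by blast
   qed
  qed
 qed
next
 fix e z f g
 assume e: "e : X'" and z: "z : oseg e" "z ~: F" and f: "f : X'" and g: "g : X'" and zf: "z : oseg f" and zg: "z : oseg g"
  and ef: "anti e f" and eg: "anti e g"
 \<comment> \<open>Reading \<open>N\<close> as \<open>L\<close> turns two partners in
   \<open>X'\<close> into two partners in \<open>X\<close>, where uniqueness is known.\<close>
 define h where "h = (%x. if x = N then L else x)"
 have hX: "h x : X & h x ~= S" if "x : X'" for x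
  using that LX LS dirL by (auto simp: h_def X'_def)
 have hz: "z : oseg (h x)" if "z : oseg x" for x using that NL by (auto simp: h_def)
 have hc: "codir x (h x)" for x using LN codir_sym codir_refl by (auto simp: h_def)
 have "anti (h e) (h f)" "anti (h e) (h g)" using ef eg hc codir_sym codir_anti anti_codir by metis+
 then have "h f = h g"
  using balanced_unique_anti[OF bal, of "h e" "h f" "h g" z] hX hz e f g z zf zg by blast
 then show "f = g" using f g unfolding h_def X'_def by (auto split: if_splits)
qed

lemma swap_oseg: "oseg (prod.swap e) = oseg e"
 by (simp add: oseg_def open_segment_commute)

lemma swap_anti: "anti e (prod.swap e)" "anti (prod.swap e) e"
 unfolding anti_def by (rule exI[of _ 1]; simp add: dirv_def)+

text \<open>\<open>L\<close> and \<open>S\<close> were the only edges over \<open>S\<close> in their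
  directions, so no edge of \<open>X'\<close> in the direction of \<open>S\<close> or against it is
  left there. Hence no flat triangle that closes \<open>X'\<close> has a side along
  \<open>S\<close>.\<close>

lemma not_covered:
 assumes "!!z. z : oseg S ==> z ~: F' ==> EX e:X'. z : oseg e & (codir e S | anti e S)" "F <= F'" "finite F'"
 shows False
proof -
 obtain z where z: "z : oseg S" "z ~: F'" using infinite_seg[OF Sne assms(3)] by (auto simp: oseg_def)
 then obtain e where e: "e : X'" "z : oseg e" "codir e S | anti e S" using assms(1) by blast
 have "e ~= N" using e z SN by blast
 then have eX: "e : X" "e ~= L" "e ~= S" using e by (auto simp: X'_def)
 have zF: "z ~: F" "z : oseg L" using z assms(2) SL by auto
 show False
  using e(3) balanced_unique_codir[OF bal eX(1) SX e(2) z(1) zF(1)]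
   balanced_unique_anti[OF bal SX eX(1) LX z(1) e(2) zF(2) zF(1)] anti_sym[OF LS] anti_sym[of e S] eX by blast
qed

lemma t_edges_notin: "tedges t Int X = {}"
proof -
 obtain z where z: "z : oseg S" "z ~: F" using infinite_seg[OF Sne fin(2)] by (auto simp: oseg_def)
 have zL: "z : oseg L" using z SL by blast
 have False if "prod.swap L : X"
 proof -
  have "prod.swap L = S"
   using balanced_unique_anti[OF bal LX that SX zL _ z(1,2) swap_anti(1) LS] zL swap_oseg by blast
  then show False using swap_oseg oseg_LS by metis
 qed
 moreover have False if "prod.swap S : X"
 proof -
  have "prod.swap S = L"
   using balanced_unique_anti[OF bal SX that LX z(1) _ zL z(2) swap_anti(1) anti_sym[OF LS]] z swap_oseg by blast
  then show False using swap_oseg oseg_LS by metis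
 qed
 ultimately show ?thesis using te N_notin by auto
qed

text \<open>The sides of \<open>t\<close> are the reverses of \<open>L\<close> and \<open>S\<close>,
  and \<open>N\<close>, which \<open>G\<close> has already matched. A triangle of \<open>G\<close>
  cannot share a side with \<open>t\<close>, because \<open>N\<close> is in \<open>X'\<close> and
  nothing in \<open>G\<close> runs along \<open>S\<close>; it cannot share the middle, because no
  edge of \<open>X'\<close> passes through \<open>m\<close>.\<close>

lemma closes_insert:
 assumes cl: "closes F' X' G" and FF: "F <= F'"
 shows "closes F' X (insert t G)"
proof -
 have finF: "finite F'" "finite G" using closesD(1,2)[OF cl] by auto
 have cov: "EX e:X'. z : oseg e & (codir e f | anti e f)" if "k : G" "f : tedges k" "z : oseg f" "z ~: F'" for k f z
  using closesD(11)[OF cl] that by blast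
 have swS: "codir e S | anti e S" if "codir e f | anti e f" "f = prod.swap L | f = prod.swap S" for e f
 proof -
  have "anti S (prod.swap S)" "codir (prod.swap L) S" "anti (prod.swap S) S"
   using swap_anti LS anti_anti by blast+
  then show ?thesis using that codir_trans anti_codir codir_anti anti_anti by metis
 qed
 have disj: "tedges k Int tedges t = {}" if k: "k : G" for k
 proof -
  have "N ~: tedges k" using closesD(6)[OF cl k] by (auto simp: X'_def)
  moreover have False if f: "f : tedges k" "f = prod.swap L | f = prod.swap S" for f
  proof (rule not_covered[OF _ FF finF(1)])
   fix z assume z: "z : oseg S" "z ~: F'"
   then have "z : oseg f" using f(2) swap_oseg SL by blast
   then show "EX e:X'. z : oseg e & (codir e S | anti e S)"
    using cov[OF k f(1) _ z(2)] swS f(2) by blast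
  qed
  ultimately show ?thesis using te by blast
 qed
 have midd: "tmid k ~= m" if "k : G" for k
 proof
  assume "tmid k = m"
  moreover have "EX e:X'. tmid k : oseg e" using closesD(4)[OF cl that] .
  ultimately obtain e where e: "e : X'" "m : oseg e" by metis
  then have "e : X" "e ~= L" using mN by (auto simp: X'_def)
  then show False using once mend mL LX e(2) unfolding vertex_once_def by blast
 qed
 have lift: "EX e:X. z : oseg e & (codir e f | anti e f)"
  if ex: "EX e:X'. z : oseg e & (codir e f | anti e f)" for z f
 proof -
  from ex obtain e where e: "e : X'" "z : oseg e" "codir e f | anti e f" by blast
  show ?thesis
  proof (cases "e = N")
   case True
   then have "codir L f | anti L f" using e(3) LN codir_trans codir_anti by blast
   then show ?thesis using LX e NL True by blast
  qed (use e in \<open>auto simp: X'_def\<close>)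
 qed
 have tcov: "fst f : ends X & snd f : ends X & (ALL z:oseg f - F'. EX e:X. z : oseg e & (codir e f | anti e f))"
  if "f : tedges t" for f
 proof -
  have "f = prod.swap L | f = prod.swap S | f = N" using that te by blast
  then have "oseg f <= oseg L & (codir L f | anti L f) & fst f : ends X & snd f : ends X"
  proof (elim disjE)
   assume "f = prod.swap L" then show ?thesis using swap_oseg swap_anti LX by (auto simp: ends_def)
  next
   assume "f = prod.swap S" then show ?thesis using swap_oseg swap_anti SX SL anti_anti[OF LS] by (auto simp: ends_def)
  next
   assume "f = N" then show ?thesis using NL LN Nends by auto
  qed
  then show ?thesis using LX by blast
 qed
 have XU: "X Un \<Union>(tedges ` insert t G) = (X' Un \<Union>(tedges ` G)) Un {L, S, prod.swap L, prod.swap S}"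
  using te LX SX by (auto simp: X'_def)
 have conv: "(q, p) : X Un \<Union>(tedges ` insert t G)" if pq: "(p, q) : X Un \<Union>(tedges ` insert t G)" for p q
 proof (cases "(p, q) : X' Un \<Union>(tedges ` G)")
  case True
  then have "(q, p) : X' Un \<Union>(tedges ` G)" using closesD(7)[OF cl] by blast
  then show ?thesis using XU by blast
 next
  case False
  then have "(p, q) : {L, S, prod.swap L, prod.swap S}" using XU pq by blast
  then have "(q, p) : {L, S, prod.swap L, prod.swap S}" by (metis insert_iff prod.swap_def fst_conv snd_conv singletonD prod.collapse)
  then show ?thesis using XU by blast
 qed
 show ?thesis
  unfolding closes_def
 proof (intro conjI)
  show "finite (insert t G)" "finite F'" using finF by auto
  have "EX e:X. tmid k : oseg e" if k: "k : G" for k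
  proof -
   obtain e where "e : X'" "tmid k : oseg e" using closesD(4)[OF cl k] by blast
   then show ?thesis using NL LX by (cases "e = N") (auto simp: X'_def)
  qed
  then show "ALL k:insert t G. flat k & (EX e:X. tmid k : oseg e)"
   using closesD(3)[OF cl] tf tm mL LX by auto
  show "ALL k:insert t G. ALL k':insert t G. tedges k Int tedges k' ~= {} --> k = k'"
  proof (intro ballI impI)
   fix k k' assume k: "k : insert t G" "k' : insert t G" and n: "tedges k Int tedges k' ~= {}"
   have "k : G \<longleftrightarrow> k' : G" if "k ~= k'" using k n disj[of k] disj[of k'] that by auto
   then show "k = k'" using k n closesD(5)[OF cl, of k k'] by blast
  qed
  have "tedges k Int X = {}" if k: "k : G" for k
  proof -
   have "tedges k Int X' = {}" using closesD(6)[OF cl k] .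
   moreover have "L ~: tedges k & S ~: tedges k"
   proof -
    have False if f: "f : tedges k" "f = L | f = S" for f
    proof (rule not_covered[OF _ FF finF(1)])
     fix z assume z: "z : oseg S" "z ~: F'"
     then have "z : oseg f" using f(2) SL by blast
     then obtain e where e: "e : X'" "z : oseg e" "codir e f | anti e f" using cov[OF k f(1) _ z(2)] by blast
     have "codir e S | anti e S"
      using e(3) f(2) LS codir_anti[of e L S] anti_anti[of e L S] by auto
     then show "EX e:X'. z : oseg e & (codir e S | anti e S)" using e by blast
    qed
    then show ?thesis by blast
   qed
   ultimately show ?thesis by (auto simp: X'_def)
  qed
  then show "ALL k:insert t G. tedges k Int X = {}" using t_edges_notin by blast
  show "ALL p q. (p, q) : X Un \<Union> (tedges ` insert t G) --> (q, p) : X Un \<Union> (tedges ` insert t G)"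
   using conv by blast
  show "ALL k:insert t G. ALL k':insert t G. tmid k = tmid k' --> k = k'"
  proof (intro ballI impI)
   fix k k' assume k: "k : insert t G" "k' : insert t G" and n: "tmid k = tmid k'"
   show "k = k'" using k n midd[of k] midd[of k'] tm closesD(8)[OF cl, of k k'] by (metis insertE)
  qed
  show "ALL k:insert t G. ALL f:tedges k. fst f : ends X & snd f : ends X &
    (ALL z:oseg f - F'. EX e:X. z : oseg e & (codir e f | anti e f))"
  proof (intro ballI)
   fix k f assume k: "k : insert t G" and f: "f : tedges k"
   show "fst f : ends X & snd f : ends X & (ALL z:oseg f - F'. EX e:X. z : oseg e & (codir e f | anti e f))"
   proof (cases "k = t")
    case True then show ?thesis using tcov f by blast
   next
    case False
    then have kG: "k : G" using k by blast
    then have "fst f : ends X' & snd f : ends X'" using closesD(9,10)[OF cl kG f] by blast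
    then show ?thesis using ends_X' cov[OF kG f] lift by blast
   qed
  qed
 qed
qed

end


text \<open>Here the outgoing edge is the longer one; \<open>trim_far\<close> treats the incoming
  one. The end \<open>l\<close> of the shorter edge joins the exceptional set because the remaining
  edge begins there.\<close>

lemma trim_near:
 assumes bal: "balanced F X" and once: "vertex_once X" and LX: "(a, u) : X" and SX: "(l, a) : X"
  and r: "0 < r" "r < 1" "l = a + r *\<^sub>R (u - a)"
 shows "trim (insert l F) X (a, u) (l, a) (l, u) l (a, l, u)"
proof -
 let ?d = "u - a"
 have au: "a ~= u" using bal LX by (auto simp: balanced_def)
 then have d: "?d ~= 0" by simp
 have p: "a = a + 0 *\<^sub>R ?d" "u = a + 1 *\<^sub>R ?d" by simp_all
 have sg: "open_segment a u = (%s. a + s *\<^sub>R ?d) ` {0<..<1}"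
  "open_segment l a = (%s. a + s *\<^sub>R ?d) ` {0<..<r}"
  "open_segment l u = (%s. a + s *\<^sub>R ?d) ` {r<..<1}"
  using seg_param[of 0 1 ?d a] seg_param[of 0 r ?d a] seg_param[of r 1 ?d a] r d
  by (simp_all add: open_segment_commute)
 have inj: "a + s *\<^sub>R ?d = a + s' *\<^sub>R ?d \<longleftrightarrow> s = s'" for s s' using d by simp
 show ?thesis
 proof
  show "balanced (insert l F) X" using bal unfolding balanced_def by blast
  show "anti (a, u) (l, a)" unfolding anti_def dirv_def using r by (intro exI[of _ r]) (simp add: algebra_simps)
  show "codir (a, u) (l, u)" unfolding codir_def dirv_def using r by (intro exI[of _ "1 - r"]) (simp add: algebra_simps)
  show "fst (l, u) ~= snd (l, u)" using inj[of r 1] r by simp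
  show "fst (l, a) ~= snd (l, a)" using inj[of r 0] r by simp
  show "oseg (l, u) <= oseg (a, u)" "oseg (l, a) <= oseg (a, u)"
   unfolding oseg_def fst_conv snd_conv sg using r(1,2) by auto
  show "oseg (a, u) <= oseg (l, a) Un oseg (l, u) Un {l}"
  proof
   fix z assume "z : oseg (a, u)"
   then obtain s where s: "0 < s" "s < 1" "z = a + s *\<^sub>R ?d" by (auto simp: oseg_def sg)
   have "z = l" if "s = r" using s r(3) that by simp
   then show "z : oseg (l, a) Un oseg (l, u) Un {l}"
    using s unfolding oseg_def fst_conv snd_conv sg by (cases s r rule: linorder_cases) auto
  qed
  show "oseg (l, a) Int oseg (l, u) = {}" using inj by (auto simp: oseg_def sg)
  show "l : oseg (a, u)" using r by (auto simp: oseg_def sg)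
  show "l ~: oseg (l, u)" by (simp add: oseg_def open_segment_def)
  show "flat (a, l, u)" unfolding flat.simps sg using r by auto
  show "tedges (a, l, u) = {prod.swap (a, u), prod.swap (l, a), (l, u)}" by auto
  show "fst (l, u) : ends X" "snd (l, u) : ends X" "l : ends X" using LX SX by (force simp: ends_def)+
 qed (use once LX SX in auto)
qed

lemma trim_far:
 assumes bal: "balanced F X" and once: "vertex_once X" and SX: "(a, u) : X" and LX: "(l, a) : X"
  and r: "0 < r" "r < 1" "u = a + r *\<^sub>R (l - a)"
 shows "trim (insert u F) X (l, a) (a, u) (l, u) u (l, u, a)"
proof -
 let ?d = "l - a"
 have au: "a ~= l" using bal LX by (auto simp: balanced_def)
 then have d: "?d ~= 0" by simp
 have sg: "open_segment l a = (%s. a + s *\<^sub>R ?d) ` {0<..<1}"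
  "open_segment a u = (%s. a + s *\<^sub>R ?d) ` {0<..<r}"
  "open_segment l u = (%s. a + s *\<^sub>R ?d) ` {r<..<1}"
  using seg_param[of 0 1 ?d a] seg_param[of 0 r ?d a] seg_param[of r 1 ?d a] r d
  by (simp_all add: open_segment_commute)
 have inj: "a + s *\<^sub>R ?d = a + s' *\<^sub>R ?d \<longleftrightarrow> s = s'" for s s' using d by simp
 show ?thesis
 proof
  show "balanced (insert u F) X" using bal unfolding balanced_def by blast
  show "anti (l, a) (a, u)" unfolding anti_def dirv_def using r by (intro exI[of _ r]) (simp add: algebra_simps)
  show "codir (l, a) (l, u)" unfolding codir_def dirv_def using r by (intro exI[of _ "1 - r"]) (simp add: algebra_simps)
  show "fst (l, u) ~= snd (l, u)" using inj[of r 1] r by simp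
  show "fst (a, u) ~= snd (a, u)" using inj[of r 0] r by simp
  show "oseg (l, u) <= oseg (l, a)" "oseg (a, u) <= oseg (l, a)"
   unfolding oseg_def fst_conv snd_conv sg using r(1,2) by auto
  show "oseg (l, a) <= oseg (a, u) Un oseg (l, u) Un {u}"
  proof
   fix z assume "z : oseg (l, a)"
   then obtain s where s: "0 < s" "s < 1" "z = a + s *\<^sub>R ?d" by (auto simp: oseg_def sg)
   have "z = u" if "s = r" using s r(3) that by simp
   then show "z : oseg (a, u) Un oseg (l, u) Un {u}"
    using s unfolding oseg_def fst_conv snd_conv sg by (cases s r rule: linorder_cases) auto
  qed
  show "oseg (a, u) Int oseg (l, u) = {}" using inj by (auto simp: oseg_def sg)
  show "u : oseg (l, a)" using r by (auto simp: oseg_def sg)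
  show "u ~: oseg (l, u)" by (simp add: oseg_def open_segment_def)
  show "flat (l, u, a)" unfolding flat.simps sg using r by auto
  show "tedges (l, u, a) = {prod.swap (l, a), prod.swap (a, u), (l, u)}" by auto
  show "fst (l, u) : ends X" "snd (l, u) : ends X" "u : ends X" using LX SX by (force simp: ends_def)+
 qed (use once LX SX in auto)
qed

lemma trim_step:
 assumes "trim F X L S N m t"
 obtains X' where "balanced F X'" "vertex_once X'" "card X' < card X"
  "!!F' G. closes F' X' G ==> F <= F' ==> closes F' X (insert t G)"
proof -
 interpret trim F X L S N m t by fact
 show ?thesis using that[OF bal_X' once_X' card_X' closes_insert] by blast
qed

text \<open>The case of equal lengths: the two edges match each other and need no flat
  triangle.\<close>

lemma cancel_pair:
 assumes bal: "balanced F X" and once: "vertex_once X" and A: "(a, u) : X" and B: "(u, a) : X"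
 shows "balanced F (X - {(a, u), (u, a)})" "vertex_once (X - {(a, u), (u, a)})"
  "closes F' (X - {(a, u), (u, a)}) G ==> F <= F' ==> closes F' X G"
proof -
 let ?X = "X - {(a, u), (u, a)}"
 have an: "anti (a, u) (u, a)" "anti (u, a) (a, u)"
  unfolding anti_def dirv_def by (rule exI[of _ 1]; simp)+
 have os: "oseg (u, a) = oseg (a, u)" by (simp add: oseg_def open_segment_commute)
 have ne: "a ~= u" using bal A by (auto simp: balanced_def)
 have key: "f : ?X" if "e : ?X" "f : X" "z : oseg e" "z : oseg f" "z ~: F" "anti e f" for e f z
 proof -
  have "anti f e" using that(6) by (rule anti_sym)
  then have "e = (u, a)" if "f = (a, u)"
   using balanced_unique_anti[OF bal A B, of e z] an os that \<open>e : ?X\<close> \<open>z : oseg e\<close> \<open>z : oseg f\<close> \<open>z ~: F\<close> by auto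
  moreover have "e = (a, u)" if "f = (u, a)"
   using balanced_unique_anti[OF bal B A, of e z] an os that \<open>anti f e\<close> \<open>e : ?X\<close> \<open>z : oseg e\<close> \<open>z : oseg f\<close> \<open>z ~: F\<close> by auto
  ultimately show ?thesis using that by blast
 qed
 show "balanced F ?X"
 proof (rule balancedI)
  show "finite ?X" "finite F" "!!e. e : ?X ==> fst e ~= snd e" using bal by (auto simp: balanced_def)
  show "EX f. f : ?X & z : oseg f & anti e f" if e: "e : ?X" "z : oseg e" "z ~: F" for e z
  proof -
   have "e : X" using e by blast
   then obtain f where "f : X" "z : oseg f" "anti e f" using balanced_partner[OF bal _ e(2,3)] by blast
   then show ?thesis using key[OF e(1) _ e(2) _ e(3)] by blast
  qed
  show "f = g" if "e : ?X" "z : oseg e" "z ~: F" "f : ?X" "g : ?X" "z : oseg f" "z : oseg g" "anti e f" "anti e g"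
   for e z f g using balanced_unique_anti[OF bal, of e f g z] that by blast
 qed
 show "vertex_once ?X" using once unfolding vertex_once_def ends_def by blast
 assume cl: "closes F' ?X G" and FF: "F <= F'"
 have sw: "\<Union>(tedges ` G) Un X = (\<Union>(tedges ` G) Un ?X) Un {(a, u), (u, a)}" using A B by blast
 have notin: "(a, u) ~: tedges k & (u, a) ~: tedges k" if k: "k : G" for k
 proof (rule ccontr)
  assume "~ ?thesis"
  then obtain f where f: "f : tedges k" "f = (a, u) | f = (u, a)" by blast
  obtain z where z: "z : oseg (a, u)" "z ~: F'" using infinite_seg[OF ne closesD(2)[OF cl]] by (auto simp: oseg_def)
  then have zf: "z : oseg f" "z ~: F" using f os FF by auto
  then obtain e where e: "e : ?X" "z : oseg e" "codir e f | anti e f" using closesD(11)[OF cl k f(1) _ z(2)] by blast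
  have "f : X" using f A B by blast
  then show False using e key[OF e(1) _ e(2) zf] balanced_unique_codir[OF bal _ _ e(2) zf] f(2) by blast
 qed
 show "closes F' X G"
  unfolding closes_def
 proof (intro conjI)
  show "finite G" "finite F'" using closesD(1,2)[OF cl] .
  show "ALL k:G. flat k & (EX e:X. tmid k : oseg e)" using closesD(3,4)[OF cl] by blast
  show "ALL k:G. ALL k':G. tedges k Int tedges k' ~= {} --> k = k'" using closesD(5)[OF cl] by blast
  show "ALL k:G. tedges k Int X = {}" using closesD(6)[OF cl] notin by blast
  show "ALL p q. (p, q) : X Un \<Union> (tedges ` G) --> (q, p) : X Un \<Union> (tedges ` G)"
  proof (intro allI impI)
   fix p q assume "(p, q) : X Un \<Union> (tedges ` G)"
   then have "(p, q) : ?X Un \<Union> (tedges ` G) | (p, q) : {(a, u), (u, a)}" by blast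
   then show "(q, p) : X Un \<Union> (tedges ` G)" using closesD(7)[OF cl, of p q] A B by blast
  qed
  show "ALL k:G. ALL k':G. tmid k = tmid k' --> k = k'" using closesD(8)[OF cl] by blast
  have "ends ?X <= ends X" by (auto simp: ends_def)
  then show "ALL k:G. ALL f:tedges k. fst f : ends X & snd f : ends X &
    (ALL z:oseg f - F'. EX e:X. z : oseg e & (codir e f | anti e f))"
   using closesD(9-11)[OF cl] by blast
 qed
qed

text \<open>An end of largest norm is an extreme point, so the edges covering a neighbourhood of it on
 one ray all have an end there.\<close>

lemma extreme_partner:
 assumes bal: "balanced F X" and ne: "X ~= {}"
 obtains a u l r where "(a, u) : X" "(l, a) : X" "0 < r" "u - a = r *\<^sub>R (l - a)"
proof -
 have fin: "finite (ends X)" "ends X ~= {}" using bal ne by (auto simp: balanced_def ends_def)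
 obtain a where a: "a : ends X" "!!v. v : ends X ==> norm v <= norm a"
  using finite_has_maximal[of "norm ` ends X"] fin by (auto simp: image_iff) (metis linorder_le_cases)
 obtain e b where e: "e : X" "e = (a, b) | e = (b, a)" using a(1) unfolding ends_def by force
 have ab: "a ~= b" using e bal by (auto simp: balanced_def)
 \<comment> \<open>These points of \<open>e\<close> tend to \<open>a\<close>. Infinitely many of
   them lie on one edge \<open>f\<close> antiparallel to \<open>e\<close>, so \<open>a\<close> is in
   the closed segment of \<open>f\<close>, and by extremality it is an end of
   \<open>f\<close>.\<close>
 define A where "A = (%n::nat. a + (1 / (n + 2)) *\<^sub>R (b - a))"
 have Aseg: "A n : oseg e" for n
 proof -
  have "A n : open_segment a b" using ab
   by (auto simp: A_def in_segment algebra_simps intro!: exI[of _ "1 / (real n + 2)"])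
  then show ?thesis using e by (auto simp: oseg_def open_segment_commute)
 qed
 have injA: "inj A" using ab by (auto simp: A_def inj_on_def)
 have finF: "finite F" "finite X" using bal by (auto simp: balanced_def)
 have "finite {n. A n : F}" using finite_vimageI[OF finF(1) injA] by (simp add: vimage_def)
 then have "infinite (UNIV - {n. A n : F})" by (intro Diff_infinite_finite) auto
 moreover have "UNIV - {n. A n : F} = {n. A n ~: F}" by blast
 ultimately have infG: "infinite {n. A n ~: F}" by simp
 have "{n. A n ~: F} <= (\<Union>f\<in>{f : X. anti e f}. {n. A n : oseg f})"
 proof
  fix n assume "n : {n. A n ~: F}"
  then obtain f where "f : X" "A n : oseg f" "anti e f" using balanced_partner[OF bal e(1) Aseg] by blast
  then show "n : (\<Union>f\<in>{f : X. anti e f}. {n. A n : oseg f})" by blast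
 qed
 then have "infinite (\<Union>f\<in>{f : X. anti e f}. {n. A n : oseg f})" using infG finite_subset by blast
 then obtain f where f: "f : X" "anti e f" "infinite {n. A n : oseg f}" using finF(2) by auto
 have "a : closed_segment (fst f) (snd f)"
 proof (rule ccontr)
  assume "a ~: closed_segment (fst f) (snd f)"
  then obtain d where d: "0 < d" "ball a d <= - closed_segment (fst f) (snd f)"
   using openE[of "- closed_segment (fst f) (snd f)" a] by (auto simp: open_Compl)
  obtain s where s: "0 < s" "!!r. 0 <= r ==> r <= s ==> a + r *\<^sub>R (b - a) : ball a d"
   using small_move[OF d(1), of a "b - a"] by blast
  obtain k :: nat where k: "1 / s < k" using reals_Archimedean2 by blast
  obtain n where n: "n > k" "A n : oseg f" using f(3) unfolding infinite_nat_iff_unbounded by blast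
  have "1 / (real n + 2) <= s" using k n s(1) by (auto simp: field_simps) (smt (verit) mult_left_mono of_nat_less_iff)
  then have "A n : ball a d" unfolding A_def by (intro s(2)) auto
  then show False using d n by (auto simp: oseg_def open_segment_def)
 qed
 moreover have "a ~: open_segment (fst f) (snd f)"
 proof
  assume "a : open_segment (fst f) (snd f)"
  then have "norm a < max (norm (fst f)) (norm (snd f))"
   using dist_decreases_open_segment[of a "fst f" "snd f" 0] by (auto simp: less_max_iff_disj)
  moreover have "fst f : ends X" "snd f : ends X" using f by (auto simp: ends_def)
  ultimately show False using a(2)[of "fst f"] a(2)[of "snd f"] by (auto simp: max_def split: if_splits)
 qed
 ultimately have af: "a = fst f | a = snd f" by (auto simp: open_segment_def)
 obtain n where n: "A n : oseg f" using f(3) by (metis (mono_tags) Collect_empty_eq finite.emptyI)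
 obtain c where c: "0 < c" "dirv f = - c *\<^sub>R dirv e" using f(2) by (auto simp: anti_def)
 define s where "s = 1 / (real n + 2)"
 have s: "0 < s" "A n = a + s *\<^sub>R (b - a)" by (auto simp: s_def A_def)
 have nz: "b - a ~= 0" using ab by simp
 from e(2) show ?thesis
 proof
  assume eab: "e = (a, b)"
  have "a = snd f"
  proof (rule ccontr)
   assume "a ~= snd f"
   then have "a = fst f" using af by blast
   then have sf: "snd f = a - c *\<^sub>R (b - a)" using c eab by (simp add: dirv_def algebra_simps)
   obtain u where u: "0 < u" "u < 1" "A n = (1 - u) *\<^sub>R a + u *\<^sub>R (a - c *\<^sub>R (b - a))"
    using n \<open>a = fst f\<close> sf unfolding oseg_def by (auto elim: in_open_segmentE)
   have "A n = a - (u * c) *\<^sub>R (b - a)" by (simp add: u(3) algebra_simps)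
   then have "(s + u * c) *\<^sub>R (b - a) = 0" using s by (simp add: algebra_simps)
   then show False using nz s u c by (simp add: add_pos_pos less_imp_neq[symmetric])
  qed
  then have "(fst f, a) : X" using f by simp
  moreover have "fst f - a = c *\<^sub>R (b - a)" using c eab \<open>a = snd f\<close> by (simp add: dirv_def algebra_simps)
  then have "b - a = (1 / c) *\<^sub>R (fst f - a)" using c by simp
  ultimately show ?thesis using that[of a b "fst f" "1 / c"] e eab c by auto
 next
  assume eab: "e = (b, a)"
  have "a = fst f"
  proof (rule ccontr)
   assume "a ~= fst f"
   then have "a = snd f" using af by blast
   then have sf: "fst f = a - c *\<^sub>R (b - a)" using c eab by (simp add: dirv_def algebra_simps)
   obtain u where u: "0 < u" "u < 1" "A n = (1 - u) *\<^sub>R (a - c *\<^sub>R (b - a)) + u *\<^sub>R a"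
    using n \<open>a = snd f\<close> sf unfolding oseg_def by (auto elim: in_open_segmentE)
   have "A n = a - ((1 - u) * c) *\<^sub>R (b - a)" by (simp add: u(3) algebra_simps)
   then have "(s + (1 - u) * c) *\<^sub>R (b - a) = 0" using s by (simp add: algebra_simps)
   then show False using nz s u c by (simp add: add_pos_pos less_imp_neq[symmetric])
  qed
  then have "(a, snd f) : X" using f by simp
  moreover have "snd f - a = c *\<^sub>R (b - a)" using c eab \<open>a = fst f\<close> by (simp add: dirv_def algebra_simps)
  ultimately show ?thesis using that[of a "snd f" b c] e eab c by auto
 qed
qed

text \<open>Induction on the number of edges. At an extreme end an outgoing and an incoming edge lie
  on one ray; if their lengths agree they cancel, otherwise the longer one is trimmed, which
  replaces two edges by one.\<close>

theorem closes_ex: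
 assumes "balanced F X" "vertex_once X"
 shows "EX F' G. F <= F' & closes F' X G"
 using assms
proof (induction "card X" arbitrary: X F rule: less_induct)
 case less
 note bal = less.prems(1) and once = less.prems(2)
 show ?case
 proof (cases "X = {}")
  case True
  then have "closes F X {}" using bal by (auto simp: closes_def balanced_def)
  then show ?thesis by blast
 next
  case False
  then obtain a u l r where au: "(a, u) : X" and la: "(l, a) : X" and r: "0 < r" "u - a = r *\<^sub>R (l - a)"
   using extreme_partner[OF bal] by blast
  have finX: "finite X" using bal by (auto simp: balanced_def)
  have step: "EX F' G. F <= F' & closes F' X G" if tr: "trim F1 X L S N m t" "F <= F1" for F1 L S N m t
  proof -
   obtain X' where X': "balanced F1 X'" "vertex_once X'" "card X' < card X"
    "!!F' G. closes F' X' G ==> F1 <= F' ==> closes F' X (insert t G)" using trim_step[OF tr(1)] by blast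
   obtain F' G where "F1 <= F'" "closes F' X' G" using less.hyps[OF X'(3,1,2)] by blast
   then show ?thesis using X'(4) tr(2) by blast
  qed
  consider "r = 1" | "r < 1" | "1 < r" by linarith
  then show ?thesis
  proof cases
   case 1
   then have "l = u" using r by simp
   then have ua: "(u, a) : X" using la by simp
   have "card (X - {(a, u), (u, a)}) < card X" using finX au by (intro psubset_card_mono) auto
   from less.hyps[OF this cancel_pair(1,2)[OF bal once au ua]]
   show ?thesis using cancel_pair(3)[OF bal once au ua] by blast
  next
   case 2
   have "u = a + r *\<^sub>R (l - a)" using r(2) by (simp add: algebra_simps)
   from step[OF trim_far[OF bal once au la r(1) 2 this]] show ?thesis by blast
  next
   case 3
   have "(1 / r) *\<^sub>R (u - a) = l - a" using r by simp
   then have "l = a + (1 / r) *\<^sub>R (u - a)" by (simp add: algebra_simps)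
   moreover have "0 < 1 / r" "1 / r < 1" using r 3 by auto
   ultimately show ?thesis using step[OF trim_near[OF bal once au la]] by blast
  qed
 qed
qed

subsection \<open>Packings and tilings by triangles\<close>

definition pt :: "real => real => real^2" where "pt x y = vector [x, y]"

lemma pt_nth [simp]: "pt x y $ 1 = x" "pt x y $ 2 = y"
 by (simp_all add: pt_def)

lemma pt_eq_iff [simp]: "pt x y = pt x' y' \<longleftrightarrow> x = x' & y = y'"
 by (simp add: vec2_eq_iff)

lemma crs_scale: "crs d (r *\<^sub>R v) = r * crs d v"
 by (simp add: crs_def algebra_simps)

locale packing =
 fixes P :: "triple set"
 assumes fin: "finite P" and pos: "t : P ==> 0 < tor t"
  and disj: "s : P ==> t : P ==> s ~= t ==> otri s Int otri t = {}"
begin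

lemma half_disc:
 assumes t: "t : P" and e: "e : tedges t" and z: "z : oseg e"
 shows "EX d>0. ALL y:ball z d. 0 < crs (dirv e) (y - z) --> y : otri t"
proof -
 obtain p q where pq: "e = (p, q)" by (cases e)
 obtain g where g: "otri t = otri (p, q, g)" "tor t = tor (p, q, g)" using edge_rotation e pq by metis
 have zo: "z : open_segment p q" using z pq by (simp add: oseg_def)
 have og: "0 < orient p q g" using pos[OF t] g(2) by simp
 obtain d where d: "0 < d" "!!y. y : ball z d ==> 0 < orient p q y ==> y : otri (p, q, g)"
   "!!y. y : ball z d ==> 0 <= orient p q y ==> y : ctri (p, q, g)"
  by (rule side_half_disc[OF og zo]) (rule that)
 have "orient p q y = crs (dirv e) (y - z)" for y
  using orient_add[of p q z 1 "y - z"] orient_on_segment[OF zo] by (simp add: pq dirv_def)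
 then show ?thesis using d(1,2) g(1) by auto
qed

lemma edge_ne: "t : P ==> e : tedges t ==> fst e ~= snd e"
proof -
 assume t: "t : P" and e: "e : tedges t"
 obtain a b c where "t = (a, b, c)" by (cases t)
 then show ?thesis using pos[OF t] e orient_nz_ne[of a b c] by auto
qed

lemma edge_dirv: "t : P ==> e : tedges t ==> dirv e ~= 0"
 using edge_ne[of t e] by (simp add: dirv_def)

text \<open>From a point of an open side a small step to the left leads into \<open>t\<close>; if
  the point were inside \<open>s\<close>, that step would end in both triangles.\<close>

lemma otri_not_oseg:
 assumes "t : P" "s : P" "e : tedges t" "z : oseg e" shows "z ~: otri s"
proof
 assume zs: "z : otri s"
 show False
 proof (cases "s = t")
  case True
  then show False using zs assms(3,4) by (cases t) (auto simp: oseg_def dest: orient_on_segment)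
 next
  case False
  obtain d where d: "0 < d" "ALL y:ball z d. 0 < crs (dirv e) (y - z) --> y : otri t" using half_disc assms by blast
  obtain d' where d': "0 < d'" "ball z d' <= otri s" using zs open_otri openE by blast
  obtain v where v: "0 < crs (dirv e) v" using ex_left_vector edge_dirv assms by blast
  obtain r where r: "0 < r" "!!x. 0 <= x ==> x <= r ==> z + x *\<^sub>R v : ball z (min d d')"
   using small_move[of "min d d'" z v] d d' by auto
  have "0 < crs (dirv e) ((z + r *\<^sub>R v) - z)" using v r(1) by (simp add: crs_scale)
  then have "z + r *\<^sub>R v : otri t Int otri s" using d d' r(2)[of r] r(1) by auto
  then show False using disj[of s t] assms False by blast
 qed
qed

text \<open>Open sides of one triangle are disjoint. For two triangles, a direction to the left of
  both sides would lead into both of them; only antiparallel sides have no such direction.\<close>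

lemma edges_anti:
 assumes t: "t : P" "e : tedges t" "z : oseg e" and s: "s : P" "f : tedges s" "z : oseg f"
  and ne: "t ~= s | e ~= f"
 shows "t ~= s" "anti e f"
proof -
 show "t ~= s"
 proof
  assume ts: "t = s"
  then have "e ~= f" using ne by simp
  obtain a b c where tt: "t = (a, b, c)" by (cases t)
  have o: "0 < orient a b c" using pos t tt by force
  have one: False if "z : open_segment a b" "z : open_segment b c" "0 < orient a b c" for a b c
  proof -
   from that(1) obtain u where "0 < u" "u < 1" "z = (1 - u) *\<^sub>R a + u *\<^sub>R b" by (auto elim: in_open_segmentE)
   then have "orient b c z = (1 - u) * orient a b c" by (simp add: orient_comb orient_rot)
   then show False using orient_on_segment[OF that(2)] \<open>u < 1\<close> that(3) by simp
  qed
  show False using t(2,3) s(2,3) \<open>e ~= f\<close> ts one[of a b c] one[of b c a] one[of c a b] o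
   unfolding tt by (auto simp: oseg_def orient_rot)
 qed
 obtain d where d: "0 < d" "ALL y:ball z d. 0 < crs (dirv e) (y - z) --> y : otri t" using half_disc t by blast
 obtain d' where d': "0 < d'" "ALL y:ball z d'. 0 < crs (dirv f) (y - z) --> y : otri s" using half_disc s by blast
 have "~ (0 < crs (dirv e) v & 0 < crs (dirv f) v)" for v
 proof
  assume v: "0 < crs (dirv e) v & 0 < crs (dirv f) v"
  obtain r where r: "0 < r" "!!x. 0 <= x ==> x <= r ==> z + x *\<^sub>R v : ball z (min d d')"
   using small_move[of "min d d'" z v] d d' by auto
  have "z + r *\<^sub>R v : otri t Int otri s" using d d' r(2)[of r] r(1) v by (auto simp: crs_scale)
  then show False using disj[OF t(1) s(1) \<open>t ~= s\<close>] by blast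
 qed
 then show "anti e f" using opposite_directions[of "dirv e" "dirv f"] edge_dirv t s unfolding anti_def by blast
qed

lemma finite_choice:
 assumes "!!n::nat. EX t:P. Q t n"
 obtains t where "t : P" "infinite {n. Q t n}"
proof -
 have "UNIV <= (\<Union>t\<in>P. {n. Q t n})" using assms by auto
 then have "infinite (\<Union>t\<in>P. {n. Q t n})" using infinite_UNIV_nat finite_subset by blast
 then show ?thesis using that fin by auto
qed

text \<open>Infinitely many of points tending to \<open>z\<close> along the ray fall into one closed
  triangle. It contains \<open>z\<close> because it is closed, and an initial segment of the ray
  because it is convex.\<close>

lemma ray_start:
 assumes cov: "0 < r" "!!x. 0 < x ==> x <= r ==> z + x *\<^sub>R v : \<Union>(ctri ` P)"
 obtains t r' where "t : P" "0 < r'" "!!x. 0 <= x ==> x <= r' ==> z + x *\<^sub>R v : ctri t"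
proof -
 define y where "y n = z + (r / (real n + 1)) *\<^sub>R v" for n :: nat
 have "EX t:P. y n : ctri t" for n using cov(2)[of "r / (real n + 1)"] cov(1) by (auto simp: y_def field_simps)
 then obtain t where t: "t : P" "infinite {n. y n : ctri t}" by (rule finite_choice)
 have zt: "z : ctri t"
 proof (rule ccontr)
  assume "z ~: ctri t"
  then obtain d where d: "0 < d" "ball z d <= - ctri t" using openE[of "- ctri t" z] closed_ctri by (auto simp: open_Compl)
  obtain s where s: "0 < s" "!!x. 0 <= x ==> x <= s ==> z + x *\<^sub>R v : ball z d" using small_move[OF d(1)] by blast
  obtain k :: nat where k: "r / s < k" using reals_Archimedean2 by blast
  obtain n where n: "n > k" "y n : ctri t" using t(2) unfolding infinite_nat_iff_unbounded by blast
  have "r / s < real n + 1" using k n by linarith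
  then have "r < (real n + 1) * s" using s(1) by (simp add: divide_less_eq)
  then have "r / (real n + 1) <= s" by (simp add: divide_le_eq mult.commute)
  then have "y n : ball z d" unfolding y_def using cov(1) by (intro s(2)) auto
  then show False using d n by auto
 qed
 obtain n where n: "y n : ctri t" using t(2) by (metis (mono_tags) Collect_empty_eq finite.emptyI)
 define r' where "r' = r / (real n + 1)"
 have r': "0 < r'" using cov(1) by (simp add: r'_def)
 have zr: "z + r' *\<^sub>R v : ctri t" using n by (simp add: y_def r'_def)
 have "z + x *\<^sub>R v : ctri t" if x: "0 <= x" "x <= r'" for x
 proof -
  have "z + x *\<^sub>R v = (1 - x / r') *\<^sub>R z + (x / r') *\<^sub>R (z + r' *\<^sub>R v)"
   using r' by (simp add: algebra_simps)
  moreover have "0 <= x / r'" "x / r' <= 1" using x r' by auto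
  ultimately show ?thesis using convexD_alt[OF convex_ctri[of t] zt zr, of "x / r'"] by simp
 qed
 then show ?thesis using that t(1) r' by blast
qed

text \<open>A step from \<open>z\<close> to the right of \<open>e\<close> leads to a triangle other
  than \<open>t\<close>. It contains \<open>z\<close>, not in its interior and not as a vertex,
  hence in an open side, and sides through a common point are antiparallel.\<close>

lemma edge_partner:
 assumes t: "t : P" "e : tedges t" "z : oseg e" and nv: "!!s. s : P ==> z ~: tverts s"
  and int: "z : interior (\<Union>(ctri ` P))"
 obtains s f where "s : P" "f : tedges s" "z : oseg f" "anti e f"
proof -
 obtain v where v: "0 < crs (dirv e) v" using ex_left_vector edge_dirv t by blast
 obtain d where d: "0 < d" "ball z d <= \<Union>(ctri ` P)" using int mem_interior by blast
 obtain r where r: "0 < r" "!!x. 0 <= x ==> x <= r ==> z + x *\<^sub>R (- v) : ball z d" using small_move[OF d(1)] by blast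
 have cov: "z + x *\<^sub>R (- v) : \<Union>(ctri ` P)" if "0 < x" "x <= r" for x
  by (rule subsetD[OF d(2) r(2)]) (use that in auto)
 obtain s r' where s: "s : P" "0 < r'" "!!x. 0 <= x ==> x <= r' ==> z + x *\<^sub>R (- v) : ctri s"
  by (rule ray_start[OF r(1) cov]) (assumption | rule that)+
 have zs: "z : ctri s" using s(3)[of 0] s(2) by simp
 have "s ~= t"
 proof
  assume "s = t"
  obtain p q where pq: "e = (p, q)" by (cases e)
  obtain g where g: "ctri t = ctri (p, q, g)" using edge_rotation t(2) pq by metis
  have "0 <= orient p q (z + r' *\<^sub>R (- v))" using s(3)[of r'] s(2) \<open>s = t\<close> g by auto
  moreover have "orient p q (z + r' *\<^sub>R (- v)) = - (r' * crs (dirv e) v)"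
   using orient_on_segment[of z p q] t(3) unfolding orient_add by (simp add: pq oseg_def dirv_def crs_def algebra_simps)
  ultimately show False using s(2) v by (simp add: mult_le_0_iff)
 qed
 consider "z : otri s" | p q where "(p, q) : tedges s" "z : open_segment p q"
  using ctri_cases[OF pos[OF s(1)] zs] nv[OF s(1)] by blast
 then show ?thesis
 proof cases
  case 1
  then show ?thesis using otri_not_oseg[OF t(1) s(1) t(2,3)] by blast
 next
  case 2
  then have f: "(p, q) : tedges s" "z : oseg (p, q)" by (auto simp: oseg_def)
  show ?thesis using that[OF s(1) f] edges_anti(2)[OF t s(1) f] \<open>s ~= t\<close> by blast
 qed
qed

text \<open>With two owners the edge would be antiparallel to itself.\<close>

lemma edge_owner:
 assumes "t : P" "e : tedges t" "s : P" "e : tedges s" shows "t = s"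
proof (rule ccontr)
 assume ne: "t ~= s"
 obtain z where "z : oseg e" using infinite_seg[OF edge_ne[OF assms(1,2)], of "{}"] by (auto simp: oseg_def)
 then have "anti e e" using edges_anti(2)[of t e z s e] assms ne by blast
 then show False using not_codir_anti[OF edge_dirv[OF assms(1,2)]] codir_refl by blast
qed

lemma vertex_not_oseg_same: "t : P ==> e : tedges t ==> v : tverts t ==> v ~: oseg e"
proof
 assume t: "t : P" and e: "e : tedges t" and v: "v : tverts t" "v : oseg e"
 obtain p q where pq: "e = (p, q)" by (cases e)
 obtain g where g: "tverts t = tverts (p, q, g)" "tor t = tor (p, q, g)" using edge_rotation e pq by metis
 have "orient p q v = 0" using v(2) pq orient_on_segment by (auto simp: oseg_def)
 moreover have "v ~= p" "v ~= q" using v(2) pq by (auto simp: oseg_def open_segment_def)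
 ultimately show False using v(1) g pos[OF t] by auto
qed

lemma vertex_not_otri: "t : P ==> s : P ==> v : tverts t ==> v ~: otri s"
proof
 assume t: "t : P" and s: "s : P" and v: "v : tverts t" "v : otri s"
 have "v : closure (otri t)" using closure_otri[OF pos[OF t]] tverts_ctri[OF pos[OF t]] v by auto
 then have "otri s Int otri t ~= {}" using v(2) open_otri[of s] by (meson closure_iff_nhds_not_empty disjoint_iff order_refl)
 then have "s = t" using disj s t by blast
 then show False using v by (cases t) auto
qed

text \<open>Two antiparallel sides through \<open>v\<close> bound half-discs that fill a
  neighbourhood of \<open>v\<close> up to a line. A triangle with vertex \<open>v\<close> would
  overlap one of them, so it would be \<open>t\<close> or \<open>s\<close>; but a vertex of a
  triangle lies in none of its open sides.\<close>

lemma vertex_once: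
 assumes w: "w : P" "v : tverts w" and t: "t : P" "e : tedges t" "v : oseg e"
  and s: "s : P" "f : tedges s" "v : oseg f"
 shows "t = s & e = f"
proof (rule ccontr)
 assume ne: "~ ?thesis"
 then have an: "anti e f" and ts: "t ~= s" using edges_anti[OF t s] by blast+
 obtain c where c: "0 < c" "dirv f = - c *\<^sub>R dirv e" using an by (auto simp: anti_def)
 obtain d where d: "0 < d" "ALL y:ball v d. 0 < crs (dirv e) (y - v) --> y : otri t" using half_disc t by blast
 obtain d' where d': "0 < d'" "ALL y:ball v d'. 0 < crs (dirv f) (y - v) --> y : otri s" using half_disc s by blast
 have "v : closure (otri w)" using closure_otri[OF pos[OF w(1)]] tverts_ctri[OF pos[OF w(1)]] w by auto
 moreover have "0 < min d d'" using d d' by simp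
 ultimately obtain y where "y : otri w" "dist y v < min d d'" unfolding closure_approachable by blast
 then have y: "y : otri w" "y : ball v (min d d')" by (simp_all add: dist_commute)
 obtain d2 where d2: "0 < d2" "ball y d2 <= otri w Int ball v (min d d')"
  using y open_otri[of w] openE[of "otri w Int ball v (min d d')" y] by auto
 obtain u where u: "0 < crs (dirv e) u" using ex_left_vector edge_dirv t by blast
 obtain r where r: "0 < r" "!!x. 0 <= x ==> x <= r ==> y + x *\<^sub>R u : ball y d2" using small_move[OF d2(1)] by blast
 have lin: "crs (dirv e) (y + r *\<^sub>R u - v) = crs (dirv e) (y - v) + r * crs (dirv e) u"
  by (simp add: crs_def algebra_simps)
 \<comment> \<open>If \<open>y\<close> happens to lie on the common line, a small move inside the
   triangle \<open>w\<close> takes it off.\<close>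
 have "EX y':ball y d2. crs (dirv e) (y' - v) ~= 0"
 proof (cases "crs (dirv e) (y - v) = 0")
  case True
  then show ?thesis using lin r u by (intro bexI[of _ "y + r *\<^sub>R u"]) auto
 next
  case False
  then show ?thesis using d2 by (intro bexI[of _ y]) auto
 qed
 then obtain y' where y': "y' : ball y d2" "crs (dirv e) (y' - v) ~= 0" by blast
 have yy: "y' : otri w" "y' : ball v d" "y' : ball v d'" using y' d2 by auto
 have "crs (dirv f) (y' - v) = - c * crs (dirv e) (y' - v)" by (simp add: c crs_def algebra_simps)
 then have "0 < crs (dirv e) (y' - v) | 0 < crs (dirv f) (y' - v)"
  using y'(2) c(1) by (smt (verit) mult_pos_neg minus_mult_left)
 then have "y' : otri t | y' : otri s" using d d' yy by blast
 then have "w = t | w = s" using disj yy w t s by blast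
 then show False using vertex_not_oseg_same w t s by blast
qed

end

section \<open>The square and the triangles around it\<close>

fun corner :: "nat => real^2" where
 "corner 0 = pt 0 0"
| "corner (Suc 0) = pt 1 0"
| "corner (Suc (Suc 0)) = pt 1 1"
| "corner (Suc (Suc (Suc n))) = pt 0 1"

definition "corner_set = {pt 0 0, pt 1 0, pt 1 1, pt 0 1}"

text \<open>Together with these triangles outside, each side of the square is an inner side of a packing.\<close>

definition outer :: "triple set" where
 "outer = {(pt 1 0, pt 0 0, pt (1/2) (-1)), (pt 1 1, pt 1 0, pt 2 (1/2)),
  (pt 0 1, pt 1 1, pt (1/2) 2), (pt 0 0, pt 0 1, pt (-1) (1/2))}"

text \<open>Directed clockwise: these are the reverses that triangles along the boundary have to
  find.\<close>

definition oedges :: "edge set" where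
 "oedges = {(pt 1 0, pt 0 0), (pt 1 1, pt 1 0), (pt 0 1, pt 1 1), (pt 0 0, pt 0 1)}"

lemma usq_iff: "z : unit_square \<longleftrightarrow> 0 <= z$1 & z$1 <= 1 & 0 <= z$2 & z$2 <= 1"
 by (simp add: unit_square_def)

lemma convex_usq: "convex unit_square"
 unfolding convex_alt
proof (intro ballI allI impI)
 fix x y :: "real^2" and u :: real assume "x : unit_square" "y : unit_square" "0 <= u & u <= 1"
 moreover from this have "(1 - u) * x$i + u * y$i <= (1 - u) * 1 + u * 1" if "i = 1 | i = 2" for i
  using that by (intro add_mono mult_left_mono) (auto simp: usq_iff)
 from this[of 1] this[of 2] have "(1 - u) * x$1 + u * y$1 <= 1" "(1 - u) * x$2 + u * y$2 <= 1" by simp_all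
 ultimately show "(1 - u) *\<^sub>R x + u *\<^sub>R y : unit_square" by (simp add: usq_iff)
qed

lemma convex_combo01: "0 <= (x::real) ==> x <= 1 ==> 0 <= y ==> y <= 1 ==> 0 < u ==> u < 1 ==>
  (1 - u) * x + u * y = 0 ==> x = 0 & y = 0"
 by (smt (verit) mult_nonneg_nonneg mult_eq_0_iff)

text \<open>Each coordinate of a corner is 0 or 1, and a proper average of numbers in the unit
  interval has such a value only if both numbers have it.\<close>

lemma corner_extreme:
 assumes "p : unit_square" "q : unit_square" "c : corner_set" shows "c ~: open_segment p q"
proof
 assume "c : open_segment p q"
 then obtain u where u: "0 < u" "u < 1" "c = (1 - u) *\<^sub>R p + u *\<^sub>R q" "p ~= q" by (auto elim: in_open_segmentE)
 have lo: "x = 0 & y = 0" if "(1 - u) * x + u * y = 0" "0 <= x" "x <= 1" "0 <= y" "y <= 1" for x y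
  using convex_combo01[of x y u] that u by auto
 have hi: "x = 1 & y = 1" if "(1 - u) * x + u * y = 1" "0 <= x" "x <= 1" "0 <= y" "y <= 1" for x y
  using convex_combo01[of "1 - x" "1 - y" u] that u by (auto simp: algebra_simps)
 have c: "c$1 = (1 - u) * p$1 + u * q$1" "c$2 = (1 - u) * p$2 + u * q$2" using u by simp_all
 have "(c$1 = 0 | c$1 = 1) & (c$2 = 0 | c$2 = 1)" using assms(3) by (auto simp: corner_set_def)
 then have "p$1 = q$1" "p$2 = q$2"
  using lo[of "p$1" "q$1"] hi[of "p$1" "q$1"] lo[of "p$2" "q$2"] hi[of "p$2" "q$2"] c assms(1,2)
  unfolding usq_iff by metis+
 then show False using u(4) by (simp add: vec2_eq_iff)
qed

lemma oseg_usq: "fst e : unit_square ==> snd e : unit_square ==> oseg e <= unit_square"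
 unfolding oseg_def using convex_usq by (meson convex_contains_open_segment)

lemma outer_pos: "t : outer ==> 0 < tor t"
 by (auto simp: outer_def orient_def)

lemma outer_otri: "t : outer ==> otri t Int unit_square = {}"
 by (auto simp: outer_def orient_def usq_iff)

lemma outer_disj: "s : outer ==> t : outer ==> s ~= t ==> otri s Int otri t = {}"
 unfolding outer_def by (elim insertE emptyE; simp; auto simp: orient_def; linarith)

lemma oedges_usq: "e : oedges ==> fst e : unit_square & snd e : unit_square"
 by (auto simp: oedges_def usq_iff)

lemma oedges_outer: "oedges <= \<Union>(tedges ` outer)"
 by (auto simp: oedges_def outer_def)

text \<open>The two other open sides of an outer triangle avoid the square.\<close>

lemma outer_legs:
 assumes "t : outer" "e : tedges t" "z : oseg e" "z : unit_square" shows "e : oedges"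
proof -
 have "z : open_segment (fst e) (snd e)" using assms(3) by (simp add: oseg_def)
 then obtain u where u: "0 < u" "u < 1" "z = (1 - u) *\<^sub>R fst e + u *\<^sub>R snd e" by (auto elim: in_open_segmentE)
 have z: "z$1 = (1 - u) * fst e$1 + u * snd e$1" "z$2 = (1 - u) * fst e$2 + u * snd e$2" using u(3) by simp_all
 have "e : oedges | e : {(pt 0 0, pt (1/2) (-1)), (pt (1/2) (-1), pt 1 0)} |
   e : {(pt 1 0, pt 2 (1/2)), (pt 2 (1/2), pt 1 1)} | e : {(pt 1 1, pt (1/2) 2), (pt (1/2) 2, pt 0 1)} |
   e : {(pt 0 1, pt (-1) (1/2)), (pt (-1) (1/2), pt 0 0)}"
  using assms(1,2) unfolding outer_def oedges_def by (elim insertE emptyE) auto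
 then have "e : oedges | z$2 < 0 | 1 < z$1 | 1 < z$2 | z$1 < 0"
  using u(1,2) z by (elim disjE insertE emptyE) simp_all
 then show ?thesis using assms(4) by (auto simp: usq_iff)
qed

lemma interior_cover:
 assumes "z : unit_square" "z ~: corner_set"
 shows "z : interior (unit_square Un \<Union>(ctri ` outer))"
proof -
 \<comment> \<open>Each \<open>U i\<close> is an open region across side \<open>i\<close> which the
   square and the outer triangle at this side cover without gap. Together the four regions contain
   all points of the square but the corners.\<close>
 define U :: "nat => (real^2) set" where "U = (%i.
   if i = 0 then {z. 0 < z$1} Int {z. z$1 < 1} Int {z. z$2 < 1} Int {z. - z$2 < 2 * z$1} Int {z. 2 * z$1 < 2 + z$2}
   else if i = 1 then {z. 0 < z$2} Int {z. z$2 < 1} Int {z. 0 < z$1} Int {z. z$1 - 1 < 2 * z$2} Int {z. 2 * z$2 < 3 - z$1}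
   else if i = 2 then {z. 0 < z$1} Int {z. z$1 < 1} Int {z. 0 < z$2} Int {z. z$2 - 1 < 2 * z$1} Int {z. 2 * z$1 < 3 - z$2}
   else {z. 0 < z$2} Int {z. z$2 < 1} Int {z. z$1 < 1} Int {z. - z$1 < 2 * z$2} Int {z. 2 * z$2 < 2 + z$1})"
 have op: "open (U i)" for i
  unfolding U_def by (auto intro!: open_Int open_Collect_less continuous_intros)
 have sub: "U i <= unit_square Un \<Union>(ctri ` outer)" for i
 proof
  fix z assume z: "z : U i"
  have "z : unit_square | z : ctri (pt 1 0, pt 0 0, pt (1/2) (-1)) | z : ctri (pt 1 1, pt 1 0, pt 2 (1/2))
   | z : ctri (pt 0 1, pt 1 1, pt (1/2) 2) | z : ctri (pt 0 0, pt 0 1, pt (-1) (1/2))"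
  proof (cases "z : unit_square")
   case False
   consider "i = 0" | "i = 1" | "i = 2" | "i ~= 0" "i ~= 1" "i ~= 2" by blast
   then show ?thesis
   proof cases
    case 1
    then have "z : ctri (pt 1 0, pt 0 0, pt (1/2) (-1))" using z False by (auto simp: U_def usq_iff orient_def field_simps)
    then show ?thesis by blast
   next
    case 2
    then have "z : ctri (pt 1 1, pt 1 0, pt 2 (1/2))" using z False by (auto simp: U_def usq_iff orient_def field_simps)
    then show ?thesis by blast
   next
    case 3
    then have "z : ctri (pt 0 1, pt 1 1, pt (1/2) 2)" using z False by (auto simp: U_def usq_iff orient_def field_simps)
    then show ?thesis by blast
   next
    case 4
    then have "z : ctri (pt 0 0, pt 0 1, pt (-1) (1/2))" using z False by (auto simp: U_def usq_iff orient_def field_simps)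
    then show ?thesis by blast
   qed
  qed simp
  moreover have "(pt 1 0, pt 0 0, pt (1/2) (-1)) : outer" "(pt 1 1, pt 1 0, pt 2 (1/2)) : outer"
   "(pt 0 1, pt 1 1, pt (1/2) 2) : outer" "(pt 0 0, pt 0 1, pt (-1) (1/2)) : outer"
   by (simp_all add: outer_def)
  ultimately show "z : unit_square Un \<Union>(ctri ` outer)" by blast
 qed
 have "z : U 0 | z : U 1 | z : U 2 | z : U 3"
 proof -
  have b: "0 <= z$1" "z$1 <= 1" "0 <= z$2" "z$2 <= 1" using assms(1) by (simp_all add: usq_iff)
  have c: "~ ((z$1 = 0 | z$1 = 1) & (z$2 = 0 | z$2 = 1))"
   using assms(2) by (simp add: corner_set_def vec2_eq_iff) blast
  consider "0 < z$1" "z$1 < 1" "z$2 < 1" | "0 < z$1" "z$1 < 1" "z$2 = 1" | "z$1 = 1" "0 < z$2" "z$2 < 1"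
   | "z$1 = 0" "0 < z$2" "z$2 < 1" using b c by linarith
  then show ?thesis
  proof cases
   case 1 then have "z : U 0" using b by (simp add: U_def) then show ?thesis by blast
  next
   case 2 then have "z : U 2" by (simp add: U_def) then show ?thesis by blast
  next
   case 3 then have "z : U 1" by (simp add: U_def) then show ?thesis by blast
  next
   case 4 then have "z : U 3" by (simp add: U_def) then show ?thesis by blast
  qed
 qed
 then show ?thesis using op sub by (meson interior_maximal subsetD)
qed

section \<open>Edges, T-vertices and clean segments of a tiling\<close>

locale tiling = packing +
 assumes cover: "\<Union>(ctri ` P) = unit_square"
begin

definition "Vs = \<Union>(tverts ` P)"
text \<open>Surrounding the square makes points of its sides interior points of a covered region, so
  sides of triangles inside and reversed sides of the square are treated alike.\<close>

definition "PP = P Un outer"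
definition "X = \<Union>(tedges ` P) Un oedges"

lemma ctri_usq: "t : P ==> ctri t <= unit_square"
 using cover by auto

lemma otri_usq: "t : P ==> otri t <= unit_square"
 using ctri_usq otri_subset_ctri by blast

lemma tverts_usq: "t : P ==> tverts t <= unit_square"
 using ctri_usq tverts_ctri[OF pos] by blast

lemma Vs_usq: "v : Vs ==> v : unit_square"
 using tverts_usq by (auto simp: Vs_def)

lemma tedges_tverts: "e : tedges t ==> fst e : tverts t & snd e : tverts t"
 by (cases t) auto

sublocale PP: packing PP
proof
 show "finite PP" using fin by (simp add: PP_def outer_def)
 show "0 < tor t" if "t : PP" for t using that pos[of t] outer_pos[of t] by (metis PP_def UnE)
 show "otri s Int otri t = {}" if "s : PP" "t : PP" "s ~= t" for s t
  using that disj outer_disj outer_otri otri_usq unfolding PP_def by blast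
qed

lemma P_outer: "P Int outer = {}"
 using outer_otri otri_usq otri_nonempty pos by blast

lemma X_PP: "e : X ==> EX t:PP. e : tedges t"
 using oedges_outer by (auto simp: X_def PP_def)

lemma X_usq: "e : X ==> fst e : unit_square & snd e : unit_square"
 using oedges_usq tedges_tverts tverts_usq unfolding X_def by blast

lemma oseg_X_usq: "e : X ==> oseg e <= unit_square"
 using oseg_usq X_usq by blast

lemma PP_X: "t : PP ==> e : tedges t ==> z : oseg e ==> z : unit_square ==> e : X"
 using outer_legs[of t e z] unfolding PP_def X_def by blast

lemma cover_PP: "\<Union>(ctri ` PP) = unit_square Un \<Union>(ctri ` outer)"
 using cover by (auto simp: PP_def)

definition "VF = \<Union>(tverts ` PP)"

lemma corner_VF: "corner_set <= VF"
 by (auto simp: VF_def PP_def outer_def corner_set_def)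

lemma finite_tverts: "finite (tverts t)" by (cases t) auto
lemma finite_tedges: "finite (tedges t)" by (cases t) auto

text \<open>A point of an edge that is no vertex is interior to the region covered by
  \<open>PP\<close>, so a partner exists. Two different partners would be codirected, having a
  common antiparallel edge, and antiparallel, as sides through one point.\<close>

lemma balanced_X: "balanced VF X"
proof (rule balancedI)
 show "finite X" using fin finite_tedges by (auto simp: X_def oedges_def)
 show "finite VF" using PP.fin finite_tverts by (auto simp: VF_def)
 show "fst e ~= snd e" if "e : X" for e using X_PP[OF that] PP.edge_ne by blast
next
 fix e z assume e: "e : X" "z : oseg e" "z ~: VF"
 obtain t where t: "t : PP" "e : tedges t" using X_PP e by blast
 have z: "z : unit_square" using oseg_X_usq e by blast
 have "z : interior (\<Union>(ctri ` PP))" using interior_cover[OF z] corner_VF e(3) cover_PP by auto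
 moreover have "z ~: tverts s" if "s : PP" for s using e(3) that by (auto simp: VF_def)
 ultimately obtain s f where s: "s : PP" "f : tedges s" "z : oseg f" "anti e f"
  using PP.edge_partner[OF t e(2)] by blast
 then show "EX f. f : X & z : oseg f & anti e f" using PP_X z by blast
next
 fix e z f g assume e: "e : X" "z : oseg e" "z ~: VF" and f: "f : X" "z : oseg f" "anti e f"
  and g: "g : X" "z : oseg g" "anti e g"
 obtain s t where s: "s : PP" "f : tedges s" and t: "t : PP" "g : tedges t" using X_PP f g by metis
 show "f = g"
 proof (rule ccontr)
  assume "f ~= g"
  then have "anti f g" using PP.edges_anti(2)[OF s f(2) t g(2)] by blast
  moreover have "codir f g" using f(3) g(3) anti_sym anti_anti by blast
  ultimately show False using not_codir_anti PP.edge_dirv s by blast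
 qed
qed

lemma ends_X: "v : ends X ==> EX w:PP. v : tverts w"
 using X_PP tedges_tverts unfolding ends_def by (metis UnE imageE)

lemma vertex_once_X: "Submission.vertex_once X"
 unfolding Submission.vertex_once_def using PP.vertex_once ends_X X_PP by meson

lemma corner_vertex: "corner_set <= Vs"
proof
 fix c assume c: "c : corner_set"
 then have "c : unit_square" by (auto simp: corner_set_def usq_iff)
 then obtain t where t: "t : P" "c : ctri t" using cover by blast
 have "c ~: otri t"
 proof
  assume "c : otri t"
  then have i: "c : interior unit_square" using otri_usq t open_otri by (meson interior_maximal subsetD)
  then obtain e where e: "0 < e" "ball c e <= unit_square" using mem_interior by blast
  define v where "v = pt (c$1 - 1/2) (c$2 - 1/2)"
  obtain s where s: "0 < s" "!!r. 0 <= r ==> r <= s ==> c + r *\<^sub>R v : ball c e" using small_move[OF e(1)] by blast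
  have "c + s *\<^sub>R v : unit_square" using s e(2) by (meson less_imp_le order_refl subsetD)
  then show False using c s(1) by (auto simp: corner_set_def usq_iff v_def)
 qed
 moreover have "c ~: open_segment p q" if "(p, q) : tedges t" for p q
  using corner_extreme[OF _ _ c, of p q] tedges_tverts[OF that] tverts_usq[OF t(1)] by auto
 ultimately have "c : tverts t" using ctri_cases[OF pos[OF t(1)] t(2)] by blast
 then show "c : Vs" using t by (auto simp: Vs_def)
qed

lemma oedges_ends: "e : oedges ==> fst e : corner_set & snd e : corner_set"
 by (auto simp: oedges_def corner_set_def)

lemma ends_X_Vs: "ends X <= Vs"
 using corner_vertex oedges_ends tedges_tverts unfolding ends_def X_def Vs_def by blast

lemma Vs_ends_X: "Vs <= ends X"
proof
 fix v assume "v : Vs"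
 then obtain t where t: "t : P" "v : tverts t" by (auto simp: Vs_def)
 then have "EX w. (v, w) : tedges t" by (cases t) auto
 then show "v : ends X" using t unfolding ends_def X_def by force
qed

text \<open>For a vertex \<open>v\<close>: it is a T-junction, possibly on a side of the
  square.\<close>

definition "tv v \<longleftrightarrow> (EX e:X. v : oseg e)"

lemma corner_not_tv: "c : corner_set ==> ~ tv c"
 using corner_extreme X_usq by (auto simp: tv_def oseg_def)

definition clean :: "real^2 => real^2 => bool" where
 "clean p q \<longleftrightarrow> (ALL t:P. open_segment p q Int otri t = {})"

lemma clean_sym: "clean p q ==> clean q p"
 by (simp add: clean_def open_segment_commute)

lemma X_clean: "e : X ==> t : P ==> oseg e Int otri t = {}"
proof -
 assume e: "e : X" and t: "t : P"
 obtain s where "s : PP" "e : tedges s" using X_PP[OF e] by blast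
 then show ?thesis using PP.otri_not_oseg[of s t e] t unfolding PP_def by blast
qed

lemma Vs_not_otri: "v : Vs ==> t : P ==> v ~: otri t"
 using vertex_not_otri[of _ t v] unfolding Vs_def by blast

lemma open_seg_split:
 fixes m p q :: "real^2"
 assumes "m : open_segment p q" shows "open_segment p q <= open_segment p m Un open_segment m q Un {m}"
proof -
 obtain u where u: "0 < u" "u < 1" "m = (1 - u) *\<^sub>R p + u *\<^sub>R q" "p ~= q" using assms by (auto elim: in_open_segmentE)
 let ?d = "q - p"
 have m: "m = p + u *\<^sub>R ?d" by (simp add: u(3) algebra_simps)
 have d: "?d ~= 0" using u by simp
 have "open_segment p q = (%s. p + s *\<^sub>R ?d) ` {0<..<1}" "open_segment p m = (%s. p + s *\<^sub>R ?d) ` {0<..<u}"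
  "open_segment m q = (%s. p + s *\<^sub>R ?d) ` {u<..<1}"
  using seg_param[of 0 1 ?d p] seg_param[of 0 u ?d p] seg_param[of u 1 ?d p] u(1,2) d m by simp_all
 note sg = this
 show ?thesis
 proof
  fix z assume "z : open_segment p q"
  then obtain s where s: "0 < s" "s < 1" "z = p + s *\<^sub>R ?d" by (auto simp: sg)
  then show "z : open_segment p m Un open_segment m q Un {m}"
   unfolding sg using m by (cases s u rule: linorder_cases) auto
 qed
qed

lemma clean_join:
 assumes "m : open_segment p q" "m : Vs" "clean p m" "clean m q" shows "clean p q"
 using assms open_seg_split[OF assms(1)] Vs_not_otri unfolding clean_def by blast

text \<open>A segment that meets an open triangle has a whole subsegment in it, hence a point
  outside \<open>F\<close>, which would lie on an edge and inside a triangle. This applies to the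
  sides of flat triangles.\<close>

lemma cover_clean:
 assumes "finite F" "!!z. z : open_segment p q ==> z ~: F ==> EX e:X. z : oseg e"
 shows "clean p q"
 unfolding clean_def
proof (intro ballI)
 fix t assume t: "t : P"
 show "open_segment p q Int otri t = {}"
 proof (rule ccontr)
  assume "open_segment p q Int otri t ~= {}"
  then obtain z where z: "z : open_segment p q" "z : otri t" by blast
  then obtain u where u: "0 < u" "u < 1" "z = (1 - u) *\<^sub>R p + u *\<^sub>R q" "p ~= q" by (auto elim: in_open_segmentE)
  obtain d where d: "0 < d" "ball z d <= otri t" using z(2) open_otri openE by blast
  obtain s where s: "0 < s" "!!r. 0 <= r ==> r <= s ==> z + r *\<^sub>R (q - p) : ball z d" using small_move[OF d(1)] by blast
  define r where "r = min s ((1 - u) / 2)"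
  have r: "0 < r" "r <= s" "u + r < 1" using s u by (auto simp: r_def min_def field_simps)
  have zz: "z = p + u *\<^sub>R (q - p)" by (simp add: u(3) algebra_simps)
  have sg: "open_segment z (z + r *\<^sub>R (q - p)) = (%s. p + s *\<^sub>R (q - p)) ` {u<..<u + r}"
   using seg_param[of u "u + r" "q - p" p] r u by (simp add: zz algebra_simps)
  have sg1: "open_segment p q = (%s. p + s *\<^sub>R (q - p)) ` {0<..<1}"
   using seg_param[of 0 1 "q - p" p] u by simp
  have "z ~= z + r *\<^sub>R (q - p)" using r u by simp
  then obtain y where y: "y : open_segment z (z + r *\<^sub>R (q - p))" "y ~: F" using infinite_seg[OF _ assms(1)] by blast
  then obtain x where x: "u < x" "x < u + r" "y = p + x *\<^sub>R (q - p)" by (auto simp: sg)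
  have "y : open_segment p q" unfolding sg1 using x u(1) r by auto
  then obtain e where e: "e : X" "y : oseg e" using assms(2) y by blast
  have "y = z + (x - u) *\<^sub>R (q - p)" by (simp add: zz x(3) algebra_simps)
  then have "y : otri t" using s(2)[of "x - u"] x r d(2) by auto
  then show False using X_clean[OF e(1) t] e(2) by blast
 qed
qed

end

subsection \<open>Counting vertices\<close>

definition enters :: "real^2 => real^2 => triple => bool" where
 "enters v d t \<longleftrightarrow> v : tverts t & (EX r>0. ALL x. 0 < x & x <= r --> v + x *\<^sub>R d : otri t)"

definition generic :: "real^2 => triple => bool" where
 "generic d t \<longleftrightarrow> (ALL e:tedges t. crs (dirv e) d ~= 0)"

lemma crs_sum: "crs (b - a) d + crs (c - b) d + crs (a - c) d = 0"
 by (simp add: crs_def algebra_simps)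

lemma enters_signs:
 assumes "enters v d (a, b, c)"
 shows "v = a & 0 < crs (b - a) d & 0 < crs (a - c) d | v = b & 0 < crs (c - b) d & 0 < crs (b - a) d
  | v = c & 0 < crs (a - c) d & 0 < crs (c - b) d"
proof -
 obtain r where r: "0 < r" "v + r *\<^sub>R d : otri (a, b, c)" using assms unfolding enters_def by (meson order_refl)
 have o: "0 < orient a b v + r * crs (b - a) d" "0 < orient b c v + r * crs (c - b) d"
  "0 < orient c a v + r * crs (a - c) d" using r(2) by (simp_all add: orient_add)
 have "v = a | v = b | v = c" using assms by (auto simp: enters_def)
 then show ?thesis using o r(1) by (auto simp: zero_less_mult_iff)
qed

text \<open>Seen in a generic direction, exactly one vertex of a triangle lies between the two others,
 and only from there the triangle is entered, in exactly one of the two opposite directions.\<close>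

lemma enters_unique:
 assumes "enters v (s *\<^sub>R d) t" "enters v' (s' *\<^sub>R d) t" "s = 1 | s = -1" "s' = 1 | s' = (-1::real)"
 shows "v = v' & s = s'"
proof -
 obtain a b c where t: "t = (a, b, c)" by (cases t)
 define A B C where "A = crs (b - a) d" and "B = crs (c - b) d" and "C = crs (a - c) d"
 have sum: "A + B + C = 0" unfolding A_def B_def C_def by (rule crs_sum)
 have sg: "w = a & 0 < r * A & 0 < r * C | w = b & 0 < r * B & 0 < r * A | w = c & 0 < r * C & 0 < r * B"
  if "enters w (r *\<^sub>R d) t" for w r
  using enters_signs[OF that[unfolded t]] unfolding crs_scale A_def B_def C_def .
 have one: "(w = a & 0 < A & 0 < C | w = b & 0 < B & 0 < A | w = c & 0 < C & 0 < B) & r = 1 |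
   (w = a & A < 0 & C < 0 | w = b & B < 0 & A < 0 | w = c & C < 0 & B < 0) & r = -1"
  if "enters w (r *\<^sub>R d) t" "r = 1 | r = -1" for w r
  using sg[OF that(1)] that(2) by (elim disjE) simp_all
 have n: "~ (0 < A & 0 < B & 0 < C)" "~ (A < 0 & B < 0 & C < 0)" using sum by linarith+
 have nn: "~ (0 < A & A < 0)" "~ (0 < B & B < 0)" "~ (0 < C & C < 0)" by linarith+
 show ?thesis
  using one[OF assms(1,3)] one[OF assms(2,4)] n nn by (smt (verit))
qed

context tiling
begin

text \<open>In a generic direction the ray runs along no side, so its initial segment inside the
  closed triangle becomes strictly inside once it is shortened.\<close>

lemma ray_in_otri:
 assumes g: "!!t. t : P ==> generic d t" and r: "0 < r" "!!x. 0 < x ==> x <= r ==> v + x *\<^sub>R d : unit_square"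
 obtains t r' where "t : P" "0 < r'" "!!x. 0 < x ==> x <= r' ==> v + x *\<^sub>R d : otri t" "v : ctri t"
proof -
 have cov: "v + x *\<^sub>R d : \<Union>(ctri ` P)" if "0 < x" "x <= r" for x using r(2)[OF that] cover by simp
 obtain t r1 where t: "t : P" "0 < r1" "!!x. 0 <= x ==> x <= r1 ==> v + x *\<^sub>R d : ctri t"
  by (rule ray_start[OF r(1) cov]) (assumption | rule that)+
 obtain a b c where tt: "t = (a, b, c)" by (cases t)
 \<comment> \<open>Half of the length is kept: a functional that decreases along the ray is still
   nonnegative at \<open>r1\<close>, hence positive up to \<open>r1 / 2\<close>.\<close>
 have strict: "0 < orient p q (v + x *\<^sub>R d)"
  if e: "(p, q) : tedges t" and x: "0 < x" "x <= r1 / 2" for p q x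
 proof -
  have ge: "0 <= orient p q (v + y *\<^sub>R d)" if "0 <= y" "y <= r1" for y
   using t(3)[OF that] e tt by auto
  have nz: "crs (q - p) d ~= 0" using g[OF t(1)] e by (force simp: generic_def dirv_def)
  have a: "0 <= orient p q v" using ge[of 0] t(2) by simp
  have b: "0 <= orient p q v + r1 * crs (q - p) d" using ge[of r1] t(2) by (simp add: orient_add)
  have "0 < orient p q v + x * crs (q - p) d"
  proof (cases "0 < crs (q - p) d")
   case True then show ?thesis using a x by (simp add: add_nonneg_pos)
  next
   case False
   then have "crs (q - p) d < 0" using nz by simp
   then have "r1 * crs (q - p) d < x * crs (q - p) d" using x t(2) by (simp add: mult_less_cancel_right)
   then show ?thesis using b by linarith
  qed
  then show ?thesis by (simp add: orient_add)
 qed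
 have "v + x *\<^sub>R d : otri t" if "0 < x" "x <= r1 / 2" for x
  using strict[OF _ that] tt by simp
 moreover have "v : ctri t" using t(3)[of 0] t(2) by simp
 ultimately show ?thesis using that[of t "r1 / 2"] t by auto
qed

lemma boundary_oedge:
 assumes "v : unit_square" "v ~: corner_set" "v$1 = 0 | v$1 = 1 | v$2 = 0 | v$2 = 1"
 obtains e where "e : oedges" "v : oseg e"
proof -
 have b: "0 <= v$1" "v$1 <= 1" "0 <= v$2" "v$2 <= 1" using assms(1) by (simp_all add: usq_iff)
 have c: "~ ((v$1 = 0 | v$1 = 1) & (v$2 = 0 | v$2 = 1))"
  using assms(2) by (simp add: corner_set_def vec2_eq_iff) blast
 have seg: "v : oseg (p, q)" if "0 < u" "u < 1" "v = (1 - u) *\<^sub>R p + u *\<^sub>R q" "p ~= q" for p q u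
  using that by (auto simp: oseg_def in_segment)
 consider "v$2 = 0" "0 < v$1" "v$1 < 1" | "v$1 = 1" "0 < v$2" "v$2 < 1" | "v$2 = 1" "0 < v$1" "v$1 < 1"
  | "v$1 = 0" "0 < v$2" "v$2 < 1" using b c assms(3) by linarith
 then show ?thesis
 proof cases
  case 1 then show ?thesis by (intro that[of "(pt 1 0, pt 0 0)"] seg[of "1 - v$1"]) (auto simp: oedges_def vec2_eq_iff)
 next
  case 2 then show ?thesis by (intro that[of "(pt 1 1, pt 1 0)"] seg[of "1 - v$2"]) (auto simp: oedges_def vec2_eq_iff)
 next
  case 3 then show ?thesis by (intro that[of "(pt 0 1, pt 1 1)"] seg[of "v$1"]) (auto simp: oedges_def vec2_eq_iff)
 next
  case 4 then show ?thesis by (intro that[of "(pt 0 0, pt 0 1)"] seg[of "v$2"]) (auto simp: oedges_def vec2_eq_iff)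
 qed
qed

lemma interior_ray:
 assumes "0 < v$1" "v$1 < 1" "0 < v$2" "v$2 < 1"
 obtains r where "0 < r" "!!x. 0 < x ==> x <= r ==> v + x *\<^sub>R d : unit_square"
proof -
 have "open ({z::real^2. 0 < z$1} Int {z. z$1 < 1} Int {z. 0 < z$2} Int {z. z$2 < 1})"
  by (intro open_Int open_Collect_less continuous_intros)
 then obtain e where e: "0 < e" "ball v e <= {z. 0 < z$1} Int {z. z$1 < 1} Int {z. 0 < z$2} Int {z. z$2 < 1}"
  using assms openE by (metis (mono_tags, lifting) IntI mem_Collect_eq)
 obtain r where r: "0 < r" "!!x. 0 <= x ==> x <= r ==> v + x *\<^sub>R d : ball v e" using small_move[OF e(1)] by blast
 have "v + x *\<^sub>R d : unit_square" if "0 < x" "x <= r" for x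
  using subsetD[OF e(2) r(2)[of x]] that by (auto simp: usq_iff)
 then show ?thesis using that r(1) by blast
qed

text \<open>The triangle that the ray enters could have \<open>v\<close> in an open side instead of
  a vertex. The hypothesis \<open>side\<close> excludes this, since the ray would then leave that
  side to the right.\<close>

lemma enters_ex:
 assumes g: "!!t. t : P ==> generic d t" and v: "v : Vs"
  and r: "0 < r" "!!x. 0 < x ==> x <= r ==> v + x *\<^sub>R d : unit_square"
  and side: "!!e. e : X ==> v : oseg e ==> crs (dirv e) d < 0"
 shows "EX t:P. enters v d t"
proof -
 obtain t r' where t: "t : P" "0 < r'" "!!x. 0 < x ==> x <= r' ==> v + x *\<^sub>R d : otri t" "v : ctri t"
  by (rule ray_in_otri[OF g r]) (assumption | rule that)+
 have "~ (EX p q. (p, q) : tedges t & v : open_segment p q)"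
 proof
  assume "EX p q. (p, q) : tedges t & v : open_segment p q"
  then obtain p q where pq: "(p, q) : tedges t" "v : open_segment p q" by blast
  then have "(p, q) : X" using t(1) by (auto simp: X_def)
  then have neg: "crs (q - p) d < 0" using side[of "(p, q)"] pq(2) by (simp add: oseg_def dirv_def)
  have "0 < orient p q (v + r' *\<^sub>R d)" using t(3)[of r'] t(2) pq(1) by (cases t) auto
  then have "0 < r' * crs (q - p) d" using orient_on_segment[OF pq(2)] by (simp add: orient_add)
  then show False using neg t(2) by (simp add: zero_less_mult_iff)
 qed
 then have "v : tverts t" using ctri_cases[OF pos[OF t(1)] t(4)] Vs_not_otri[OF v t(1)] by blast
 then show ?thesis using t unfolding enters_def by blast
qed

text \<open>Finitely many slopes have to be avoided. With this sign of \<epsilon> the direction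
  leads from (1, 0) into the square and its opposite from (0, 1), while from the other two corners
  both lead outside.\<close>

lemma generic_ex: "EX \<epsilon>. 0 < \<epsilon> & \<epsilon> < 1 & (ALL t:P. generic (pt (- \<epsilon>) 1) t)"
proof -
 let ?E = "\<Union>(tedges ` P)"
 have "finite ((%e. - (dirv e$1) / dirv e$2) ` ?E)" using fin finite_tedges by auto
 then obtain \<epsilon> where eps: "\<epsilon> : {0<..<1}" "\<epsilon> ~: (%e. - (dirv e$1) / dirv e$2) ` ?E"
  using infinite_Ioo[of "0::real" 1] by (meson finite_subset subsetI zero_less_one)
 have "crs (dirv e) (pt (- \<epsilon>) 1) ~= 0" if t: "t : P" "e : tedges t" for t e
 proof
  assume "crs (dirv e) (pt (- \<epsilon>) 1) = 0"
  then have z: "dirv e$1 = - (\<epsilon> * dirv e$2)" by (simp add: crs_def algebra_simps)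
  have "dirv e$2 ~= 0" using z edge_dirv[OF t] by (auto simp: vec2_eq_iff)
  then have "\<epsilon> = - (dirv e$1) / dirv e$2" using z by simp
  then show False using eps(2) t by blast
 qed
 then show ?thesis using eps(1) unfolding generic_def by auto
qed

text \<open>Sends a vertex, with one of the two senses of a generic direction, to the triangle
  entered from there; no triangle is hit twice. A vertex in no open side is entered in both senses,
  a T-vertex in one, and two of the corners contribute the final 2.\<close>

lemma euler_count:
 assumes A: "finite A" "A <= Vs" "!!v. v : A ==> ~ tv v & v ~: corner_set" and B: "finite B" "B <= Vs" "!!v. v : B ==> tv v"
 shows "2 * card A + card B + 2 <= card P"
proof -
 obtain \<epsilon> where eps: "0 < \<epsilon>" "\<epsilon> < 1" and gen: "!!t. t : P ==> generic (pt (- \<epsilon>) 1) t" using generic_ex by blast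
 define d where "d = pt (- \<epsilon>) 1"
 have g1: "generic (s *\<^sub>R d) t" if "t : P" "s = 1 | s = -1" for s t
  using gen[OF that(1)] that(2) by (auto simp: generic_def d_def crs_def)
 have Vsq: "v : unit_square" if "v : Vs" for v using Vs_usq that .
 have inA: "EX t:P. enters v (s *\<^sub>R d) t" if v: "v : A" and s: "s = 1 | s = -1" for v s
 proof -
  have nb: "~ (v$1 = 0 | v$1 = 1 | v$2 = 0 | v$2 = 1)"
  proof
   assume "v$1 = 0 | v$1 = 1 | v$2 = 0 | v$2 = 1"
   then obtain e where "e : oedges" "v : oseg e" using boundary_oedge Vsq A v by blast
   then show False using A(3)[OF v] by (auto simp: tv_def X_def)
  qed
  moreover have "v : unit_square" using Vsq A v by blast
  ultimately have i: "0 < v$1" "v$1 < 1" "0 < v$2" "v$2 < 1" by (auto simp: usq_iff less_le)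
  obtain r where r: "0 < r" "!!x. 0 < x ==> x <= r ==> v + x *\<^sub>R (s *\<^sub>R d) : unit_square"
   by (rule interior_ray[OF i, of "s *\<^sub>R d"]) (assumption | rule that)+
  show ?thesis
   by (rule enters_ex[OF g1 _ r]) (use s v A in \<open>auto simp: tv_def\<close>)
 qed
 have inB: "EX s. (s = 1 | s = -1) & (EX t:P. enters v (s *\<^sub>R d) t)" if v: "v : B" for v
 proof -
  obtain e where e: "e : X" "v : oseg e" using B(3)[OF v] by (auto simp: tv_def)
  have vV: "v : Vs" using v B by blast
  have once: "f = e" if "f : X" "v : oseg f" for f
   using vertex_once_X that e vV Vs_ends_X unfolding Submission.vertex_once_def by blast
  have nz: "crs (dirv e) d ~= 0"
  proof (cases "e : oedges")
   case True then show ?thesis using eps by (auto simp: oedges_def crs_def d_def dirv_def)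
  next
   case False
   then obtain t where "t : P" "e : tedges t" using e by (auto simp: X_def)
   then show ?thesis using gen unfolding generic_def d_def by blast
  qed
  \<comment> \<open>The sense that points to the right of \<open>e\<close>, away from the triangle
    having \<open>v\<close> in an open side. For a side of the square, directed clockwise, this is
    the inner side.\<close>
  define s :: real where "s = (if 0 < crs (dirv e) d then -1 else 1)"
  have s: "s = 1 | s = -1" "crs (dirv e) (s *\<^sub>R d) < 0" using nz by (auto simp: s_def crs_def)
  have "EX r>0. ALL x. 0 < x & x <= r --> v + x *\<^sub>R (s *\<^sub>R d) : unit_square"
  proof (cases "v$1 = 0 | v$1 = 1 | v$2 = 0 | v$2 = 1")
   case False
   then have i: "0 < v$1" "v$1 < 1" "0 < v$2" "v$2 < 1" using Vsq[OF vV] by (auto simp: usq_iff less_le)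
   show ?thesis by (rule interior_ray[OF i, of "s *\<^sub>R d"]) blast
  next
   case True
   have nc: "v ~: corner_set" using B(3)[OF v] corner_not_tv by blast
   then obtain f where f: "f : oedges" "v : oseg f" using boundary_oedge[OF Vsq[OF vV] _ True] by blast
   then have eo: "e : oedges" using once[of f] by (auto simp: X_def)
   obtain u where u: "0 < u" "u < 1" "v = (1 - u) *\<^sub>R fst e + u *\<^sub>R snd e"
    using e(2) unfolding oseg_def by (auto elim: in_open_segmentE)
   define r where "r = min u (1 - u)"
   have r: "0 < r" "r <= u" "r <= 1 - u" "r < 1" using u by (auto simp: r_def)
   have v12: "v$1 = (1 - u) * fst e$1 + u * snd e$1" "v$2 = (1 - u) * fst e$2 + u * snd e$2" using u by simp_all
   have "v + x *\<^sub>R (s *\<^sub>R d) : unit_square" if x: "0 < x" "x <= r" for x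
   proof -
    have "0 <= x * \<epsilon>" "x * \<epsilon> <= x * 1" using x eps by (auto intro: mult_left_mono)
    then have xe: "0 <= x * \<epsilon>" "x * \<epsilon> <= r" "- u <= x * \<epsilon>" using x u by linarith+
    show ?thesis using eo s v12 r x xe eps unfolding oedges_def
     by (elim insertE emptyE) (auto simp: usq_iff d_def crs_def dirv_def)
   qed
   then show ?thesis using r(1) by blast
  qed
  then obtain r where r: "0 < r" "!!x. 0 < x ==> x <= r ==> v + x *\<^sub>R (s *\<^sub>R d) : unit_square" by blast
  have "EX t:P. enters v (s *\<^sub>R d) t"
   by (rule enters_ex[OF g1 vV r]) (use s once in auto)
  then show ?thesis using s by blast
 qed
 have inC: "EX t:P. enters (pt 1 0) (1 *\<^sub>R d) t" "EX t:P. enters (pt 0 1) ((-1) *\<^sub>R d) t"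
 proof -
  have c: "pt 1 0 : corner_set" "pt 0 1 : corner_set" by (auto simp: corner_set_def)
  have le: "0 <= x * \<epsilon> & x * \<epsilon> <= 1" if "0 < x" "x <= 1" for x
   using that eps mult_mono[of x 1 \<epsilon> 1] by auto
  show "EX t:P. enters (pt 1 0) (1 *\<^sub>R d) t"
   by (rule enters_ex[OF g1, of _ _ 1])
    (use c corner_vertex corner_not_tv le in \<open>auto simp: usq_iff d_def tv_def\<close>)
  show "EX t:P. enters (pt 0 1) ((-1) *\<^sub>R d) t"
   by (rule enters_ex[OF g1, of _ _ 1])
    (use c corner_vertex corner_not_tv le in \<open>auto simp: usq_iff d_def tv_def\<close>)
 qed
 define sB where "sB = (%v. SOME s::real. (s = 1 | s = -1) & (EX t:P. enters v (s *\<^sub>R d) t))"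
 have sB: "(sB v = 1 | sB v = -1) & (EX t:P. enters v (sB v *\<^sub>R d) t)" if "v : B" for v
  unfolding sB_def using someI_ex[OF inB[OF that]] .
 define Q where "Q = A \<times> {1, -1 :: real} Un (%v. (v, sB v)) ` B Un {(pt 1 0, 1), (pt 0 1, -1)}"
 have Q: "(snd q = 1 | snd q = -1) & (EX t:P. enters (fst q) (snd q *\<^sub>R d) t)" if qQ: "q : Q" for q
 proof -
  consider "fst q : A" "snd q = 1 | snd q = -1" | v where "v : B" "q = (v, sB v)" | "q = (pt 1 0, 1)" | "q = (pt 0 1, -1)"
   using qQ unfolding Q_def by (elim UnE) auto
  then show ?thesis
  proof cases
   case 1 then show ?thesis using inA by blast
  next
   case 2 then show ?thesis using sB by simp
  next
   case 3 then show ?thesis using inC(1) by simp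
  next
   case 4 then show ?thesis using inC(2) by (metis fst_conv snd_conv)
  qed
 qed
 define f where "f = (%q. SOME t. t : P & enters (fst q) (snd q *\<^sub>R d) t)"
 have f: "f q : P & enters (fst q) (snd q *\<^sub>R d) (f q)" if "q : Q" for q
 proof -
  have "EX t. t : P & enters (fst q) (snd q *\<^sub>R d) t" using Q[OF that] by blast
  then show ?thesis unfolding f_def by (rule someI_ex)
 qed
 have "inj_on f Q"
 proof (rule inj_onI)
  fix q q' assume q: "q : Q" "q' : Q" "f q = f q'"
  have "fst q = fst q' & snd q = snd q'"
   using enters_unique[of "fst q" "snd q" d "f q" "fst q'" "snd q'"] f[OF q(1)] f[OF q(2)] Q[OF q(1)] Q[OF q(2)] q(3) by simp
  then show "q = q'" by (simp add: prod_eq_iff)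
 qed
 then have "card Q <= card P" using f fin by (intro card_inj_on_le[of f]) auto
 moreover have "card Q = 2 * card A + card B + 2"
 proof -
  have AB: "A Int B = {}" using A(3) B(3) by blast
  have cc: "pt 1 0 : corner_set" "pt 0 1 : corner_set" by (auto simp: corner_set_def)
  have BC: "pt 1 0 ~: B" "pt 0 1 ~: B" "pt 1 0 ~: A" "pt 0 1 ~: A" using B(3) A(3) corner_not_tv cc by blast+
  have "card ((%v. (v, sB v)) ` B) = card B" by (intro card_image) (auto simp: inj_on_def)
  moreover have "card (A \<times> {1, -1::real}) = 2 * card A" by (simp add: card_cartesian_product)
  moreover have "card ((A \<times> {1, -1 :: real}) Un (%v. (v, sB v)) ` B) = card (A \<times> {1, -1 :: real}) + card ((%v. (v, sB v)) ` B)"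
   by (rule card_Un_disjoint) (use A B AB in auto)
  moreover have "card Q = card ((A \<times> {1, -1 :: real}) Un (%v. (v, sB v)) ` B) + card {(pt 1 0, 1::real), (pt 0 1, -1)}"
   unfolding Q_def by (rule card_Un_disjoint) (use A B BC in auto)
  ultimately show ?thesis by simp
 qed
 ultimately show ?thesis by simp
qed

end

subsection \<open>Coarse tilings\<close>

fun rots :: "triple => triple set" where
 "rots (a, b, c) = {(a, b, c), (b, c, a), (c, a, b)}"

text \<open>The functional of the opposite side attains its maximum over the triangle only at
  \<open>a\<close>.\<close>

lemma vertex_extreme:
 assumes o: "0 < orient a b c" and p: "p : ctri (a, b, c)" and q: "q : ctri (a, b, c)"
 shows "a ~: open_segment p q"
proof
 assume "a : open_segment p q"
 then obtain u where u: "0 < u" "u < 1" "a = (1 - u) *\<^sub>R p + u *\<^sub>R q" "p ~= q" by (auto elim: in_open_segmentE)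
 have le: "orient b c z <= orient a b c" if "z : ctri (a, b, c)" for z
  using that orient_sum[of a b z c] by auto
 have eq: "z = a" if z: "z : ctri (a, b, c)" "orient b c z = orient a b c" for z
 proof -
  have "orient a b z = 0" "orient c a z = 0" using z orient_sum[of a b z c] by auto
  then show ?thesis using ctri_barycentric[OF o, of z] z(2) o by simp
 qed
 have "(1 - u) * orient b c p + u * orient b c q = orient a b c"
  using orient_comb[of b c u p q] u(3) by (simp add: orient_rot)
 moreover have "(1 - u) * orient b c p <= (1 - u) * orient a b c" "u * orient b c q <= u * orient a b c"
  using le[OF p] le[OF q] u by (auto intro: mult_left_mono)
 moreover have "(1 - u) * orient a b c + u * orient a b c = orient a b c" by (simp add: algebra_simps)
 ultimately have e: "(1 - u) * orient b c p = (1 - u) * orient a b c" "u * orient b c q = u * orient a b c" by linarith+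
 have "orient b c p = orient a b c" by (rule mult_left_cancel[THEN iffD1, OF _ e(1)]) (use u(2) in simp)
 moreover have "orient b c q = orient a b c" by (rule mult_left_cancel[THEN iffD1, OF _ e(2)]) (use u(1) in simp)
 ultimately have "p = a" "q = a" using eq[OF p] eq[OF q] by blast+
 then show False using u(4) by blast
qed

lemma vertex_of_equal:
 assumes o: "0 < orient a b c" and t: "0 < tor t" and eq: "ctri t = ctri (a, b, c)"
 shows "a : tverts t"
proof -
 have a: "a : ctri t" using eq o by (auto simp: orient_rot)
 have "a ~: otri (a, b, c)" by simp
 moreover have "otri t = otri (a, b, c)" using interior_ctri[OF t] interior_ctri[of "(a, b, c)"] o eq by simp
 moreover have "a ~: open_segment p q" if "(p, q) : tedges t" for p q
 proof -
  have "p : ctri t & q : ctri t" using tverts_ctri[OF t] that by (cases t) auto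
  then show ?thesis using vertex_extreme[OF o] eq by simp
 qed
 ultimately show ?thesis using ctri_cases[OF t a] by blast
qed

text \<open>The extreme points determine the three vertices, and the orientation determines their
  cyclic order.\<close>

lemma same_ctri_rots:
 assumes o: "0 < orient a b c" and t: "0 < tor t" and eq: "ctri t = ctri (a, b, c)"
 shows "t : rots (a, b, c)"
proof -
 obtain x y z where xyz: "t = (x, y, z)" by (cases t)
 have e: "ctri (b, c, a) = ctri (a, b, c)" "ctri (c, a, b) = ctri (a, b, c)" by auto
 have v: "a : tverts t" "b : tverts t" "c : tverts t"
  using vertex_of_equal[OF o t eq] vertex_of_equal[of b c a t] vertex_of_equal[of c a b t] o t eq e
  by (simp_all add: orient_rot)
 have ne: "a ~= b" "b ~= c" "c ~= a" using orient_nz_ne[of a b c] o by auto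
 have pos: "0 < orient x y z" using t xyz by simp
 have odd: "orient x z y = - orient x y z" "orient z y x = - orient x y z" "orient y x z = - orient x y z"
  by (simp_all add: orient_def algebra_simps)
 have "(a, b, c) : {(x, y, z), (y, z, x), (z, x, y), (x, z, y), (z, y, x), (y, x, z)}"
  using v ne unfolding xyz by auto
 then consider "a = x" "b = y" "c = z" | "a = y" "b = z" "c = x" | "a = z" "b = x" "c = y"
  | "orient a b c = - orient x y z" using odd by blast
 then show ?thesis
 proof cases
  case 4 then show ?thesis using o pos by linarith
 qed (simp_all add: xyz)
qed

section \<open>Merging the triangles inside a clean triangle\<close>

lemma frontier_otri: "0 < tor t ==> frontier (otri t) = ctri t - otri t"
 using closure_otri open_otri by (simp add: frontier_def interior_open)

context tiling
begin

text \<open>An open triangle is connected. If it met the clean triangle and stuck out, it would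
  contain a frontier point, that is a vertex of the tiling or a point of a clean segment.\<close>

lemma clean_inside:
 assumes o: "0 < orient a b c" and V: "a : Vs" "b : Vs" "c : Vs"
  and cl: "clean a b" "clean b c" "clean c a" and t: "t : P" "otri t Int otri (a, b, c) ~= {}"
 shows "otri t <= otri (a, b, c)"
proof (rule ccontr)
 assume "~ otri t <= otri (a, b, c)"
 then have "otri t Int frontier (otri (a, b, c)) ~= {}"
  using connected_Int_frontier[of "otri t" "otri (a, b, c)"] t(2) convex_connected[OF convex_otri] by blast
 then obtain z where z: "z : otri t" "z : ctri (a, b, c)" "z ~: otri (a, b, c)"
  using frontier_otri[of "(a, b, c)"] o by auto
 have "z : {a, b, c} | (EX p q. (p, q) : tedges (a, b, c) & z : open_segment p q)"
  using ctri_cases[of "(a, b, c)" z] o z by auto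
 moreover have "z ~= v" if "v : Vs" for v using Vs_not_otri[OF that t(1)] z(1) by blast
 moreover have "z ~: open_segment p q" if "clean p q" for p q
  using that t(1) z(1) unfolding clean_def by blast
 ultimately show False using V cl by (elim disjE exE conjE) (simp, metis insertE emptyE prod.inject tedges.simps)
qed

text \<open>The triangles that meet the interior of the clean one lie inside it and, being finitely
  many closed sets, cover it; so it may replace them.\<close>

lemma merge_tiling:
 assumes o: "0 < orient a b c" and V: "a : Vs" "b : Vs" "c : Vs"
  and cl: "clean a b" "clean b c" "clean c a"
 defines "S \<equiv> {t : P. otri t <= otri (a, b, c)}"
 shows "tiling (insert (a, b, c) (P - S))" "S ~= {}" "!!t. t : S ==> ctri t <= ctri (a, b, c)"
  "ctri (a, b, c) <= \<Union>(ctri ` S)"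
proof -
 let ?T = "(a, b, c)"
 have oT: "0 < tor ?T" using o by simp
 have in_S: "t : S" if "t : P" "otri t Int otri ?T ~= {}" for t
  using clean_inside[OF o V cl that] that(1) by (simp add: S_def)
 show sub: "ctri t <= ctri ?T" if "t : S" for t
 proof -
  have t: "t : P" "otri t <= otri ?T" using that by (auto simp: S_def)
  show ?thesis using closure_mono[OF t(2)] closure_otri[OF pos[OF t(1)]] closure_otri[OF oT] by simp
 qed
 have Tsq: "ctri ?T <= unit_square"
  using hull_minimal[of "{a, b, c}" unit_square convex] V Vs_usq convex_usq convex_hull_ctri[OF o] by auto
 show cov: "ctri ?T <= \<Union>(ctri ` S)"
 proof -
  have "otri ?T <= \<Union>(ctri ` S)"
  proof
   fix y assume y: "y : otri ?T"
   then have "y : unit_square" using Tsq otri_subset_ctri by blast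
   then obtain t where t: "t : P" "y : ctri t" using cover by blast
   then have "y : closure (otri t)" using closure_otri[OF pos] by simp
   then have "otri ?T Int otri t ~= {}" using open_otri[of ?T] y open_Int_closure_eq_empty by blast
   then show "y : \<Union>(ctri ` S)" using in_S t by blast
  qed
  moreover have "closed (\<Union>(ctri ` S))" using fin closed_ctri by (intro closed_Union) (auto simp: S_def)
  ultimately show ?thesis using closure_minimal closure_otri[OF oT] by metis
 qed
 show "S ~= {}"
 proof
  assume "S = {}"
  then show False using cov tverts_ctri[OF oT] by auto
 qed
 show "tiling (insert ?T (P - S))"
 proof
  show "finite (insert ?T (P - S))" using fin by simp
  show "0 < tor t" if "t : insert ?T (P - S)" for t using that pos[of t] oT by blast
  show "otri s Int otri t = {}" if "s : insert ?T (P - S)" "t : insert ?T (P - S)" "s ~= t" for s t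
   using that disj[of s t] in_S[of s] in_S[of t] by blast
  have "\<Union>(ctri ` insert ?T (P - S)) = ctri ?T Un \<Union>(ctri ` (P - S))" by blast
  also have "... = unit_square"
  proof
   show "ctri ?T Un \<Union>(ctri ` (P - S)) <= unit_square" using Tsq cover by blast
   show "unit_square <= ctri ?T Un \<Union>(ctri ` (P - S))" unfolding cover[symmetric] using sub by blast
  qed
  finally show "\<Union>(ctri ` insert ?T (P - S)) = unit_square" .
 qed
qed

lemma area_otri_ctri:
 assumes "0 < tor t" shows "measure lborel (otri t) = tor t / 2"
proof -
 have "bounded (ctri t)"
 proof -
  obtain a b c where "t = (a, b, c)" by (cases t)
  then show ?thesis using convex_hull_ctri[of a b c] assms finite_imp_bounded_convex_hull[of "{a, b, c}"] by simp
 qed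
 then have "measure lebesgue (interior (ctri t)) = measure lebesgue (ctri t)"
  by (intro measure_interior negligible_convex_frontier convex_ctri)
 moreover have "measure lebesgue (otri t) = measure lborel (otri t)" using open_otri by (simp add: measure_completion)
 moreover have "measure lebesgue (ctri t) = measure lborel (ctri t)" using closed_ctri by (simp add: measure_completion)
 ultimately show ?thesis using interior_ctri[OF assms] area_ctri[OF assms] by simp
qed

end

section \<open>Areas add up\<close>

lemma area_disjoint_sum:
 assumes "finite S" "!!t. t : S ==> 0 < tor t" "!!s t. s : S ==> t : S ==> s ~= t ==> otri s Int otri t = {}"
 shows "measure lborel (\<Union>(otri ` S)) = (\<Sum>t\<in>S. measure lborel (otri t))"
proof (rule measure_finite_Union)
 show "finite S" by fact
 show "otri ` S <= sets lborel" using open_otri by auto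
 show "disjoint_family_on otri S" using assms(3) by (auto simp: disjoint_family_on_def)
 show "emeasure lborel (otri t) ~= \<infinity>" if "t : S" for t
 proof -
  obtain a b c where t: "t = (a, b, c)" by (cases t)
  have "bounded (ctri t)" using convex_hull_ctri[of a b c] assms(2)[OF that] finite_imp_bounded_convex_hull[of "{a, b, c}"] t by simp
  then have "bounded (otri t)" using otri_subset_ctri bounded_subset by blast
  then show ?thesis using emeasure_bounded_finite by force
 qed
qed

lemma usq_cbox: "unit_square = cbox (pt 0 0) (pt 1 1)"
 by (auto simp: unit_square_def mem_box_cart forall_2)

lemma area_usq: "measure lborel unit_square = 1"
proof -
 note usq_cbox
 moreover have "measure lborel (cbox (pt 0 0) (pt 1 1)) = 1"
 proof -
  have "pt 0 0 : cbox (pt 0 0) (pt 1 1)" by (simp add: mem_box_cart forall_2)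
  then have "cbox (pt 0 0) (pt 1 1) ~= {}" by blast
  then have "measure lborel (cbox (pt 0 0) (pt 1 1)) = (\<Prod>i\<in>UNIV. pt 1 1 $ i - pt 0 0 $ i)" by (rule content_cbox_cart)
  then show ?thesis by (simp add: prod_2 UNIV_2)
 qed
 ultimately show ?thesis by simp
qed

text \<open>The open triangles miss only the finitely many boundaries, which are negligible. The
  value 2 is twice the area of the square.\<close>

lemma (in tiling) total_area: "(\<Sum>t\<in>P. tor t) = 2"
proof -
 have "open (\<Union>(otri ` P))" using open_otri by blast
 then have m: "\<Union>(otri ` P) : sets lborel" by simp
 have "measure lborel (\<Union>(ctri ` P)) = measure lborel (\<Union>(otri ` P))"
 proof (rule measure_eq_AE)
  have "negligible (\<Union>t\<in>P. ctri t - otri t)"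
  proof (rule negligible_Union)
   show "finite ((%t. ctri t - otri t) ` P)" using fin by simp
   fix s assume "s : (%t. ctri t - otri t) ` P"
   then obtain t where t: "t : P" "s = ctri t - otri t" by blast
   then have "s = frontier (ctri t)" using interior_ctri[OF pos[OF t(1)]] closed_ctri by (simp add: frontier_def)
   then show "negligible s" using negligible_convex_frontier[OF convex_ctri] by simp
  qed
  then have n: "(\<Union>t\<in>P. ctri t - otri t) : null_sets lebesgue" by (simp add: negligible_iff_null_sets)
  moreover have "(\<Union>t\<in>P. ctri t - otri t) : sets lborel"
   using fin closed_ctri open_otri by (intro sets.finite_UN sets.Diff) auto
  ultimately have "(\<Union>t\<in>P. ctri t - otri t) : null_sets lborel" by (simp add: null_sets_completion_iff)
  then have "AE x in lborel. x ~: (\<Union>t\<in>P. ctri t - otri t)" by (rule AE_not_in)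
  then show "AE x in lborel. (x : \<Union>(ctri ` P)) = (x : \<Union>(otri ` P))"
  proof (rule AE_mp, intro AE_I2 impI)
   fix x assume "x ~: (\<Union>t\<in>P. ctri t - otri t)"
   then show "(x : \<Union>(ctri ` P)) = (x : \<Union>(otri ` P))" using otri_subset_ctri by blast
  qed
  show "\<Union>(otri ` P) : sets lborel" by (rule m)
  show "\<Union>(ctri ` P) : sets lborel" using fin closed_ctri by (intro sets.finite_UN) auto
 qed
 also have "... = (\<Sum>t\<in>P. measure lborel (otri t))" by (rule area_disjoint_sum[OF fin pos disj])
 also have "... = (\<Sum>t\<in>P. tor t / 2)" by (intro sum.cong refl area_otri_ctri pos)
 finally show ?thesis using cover area_usq by (simp add: sum_divide_distrib[symmetric])
qed


text \<open>A tiling coarser than a dissection, with as few triangles as possible; the weight of a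
 triangle is the number of pieces it contains.\<close>

locale wtiling = tiling +
 fixes wt :: "triple => nat"
 assumes wt_pos: "t : P ==> 1 <= wt t" and wt_sum: "(\<Sum>t\<in>P. wt t) = 7"
  and tor_lo: "t : P ==> 19145775 * real (wt t) <= 67108864 * tor t"
  and tor_hi: "t : P ==> 67108864 * tor t <= 19202147 * real (wt t)"
  and merge: "a : Vs ==> b : Vs ==> c : Vs ==> clean a b ==> clean b c ==> clean c a ==>
   0 < orient a b c ==> rots (a, b, c) Int P ~= {}"

definition coarse :: "triple set => triple set => bool" where
 "coarse D P \<longleftrightarrow> tiling P & (ALL d:D. EX t:P. ctri d <= ctri t)"

lemma ctri_subset_otri:
 assumes "0 < tor d" "0 < tor t" "ctri d <= ctri t" shows "otri d <= otri t"
 using interior_mono[OF assms(3)] interior_ctri assms(1,2) by simp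

text \<open>In a coarser tiling with fewest triangles, the pieces inside a triangle have at most its
  area; since both totals agree, equality holds for each triangle, and its weight bounds its area.
  By minimality a merge replaces just one triangle, which then coincides with the merged
  one.\<close>

lemma coarse_wtiling:
 assumes D: "tiling D" and cD: "card D = 7"
  and area: "!!d. d : D ==> 19145775 <= 67108864 * tor d & 67108864 * tor d <= 19202147"
 shows "EX P wt. wtiling P wt & (ALL t:P. wt t = 1 --> (EX d:D. ctri d <= ctri t & tor d = tor t))"
proof -
 interpret D: tiling D by fact
 have "coarse D D" using D by (auto simp: coarse_def)
 then obtain P where P: "coarse D P" and min: "!!Q. coarse D Q ==> card P <= card Q"
  using ex_has_least_nat[of "coarse D" D card] by blast
 interpret P: tiling P using P by (simp add: coarse_def)
 have inP: "EX t:P. ctri d <= ctri t" if "d : D" for d using P that by (auto simp: coarse_def)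
 define C where "C t = {d : D. ctri d <= ctri t}" for t
 have finC: "finite (C t)" for t using D.fin by (simp add: C_def)
 have CD: "d : D" if "d : C t" for d t using that by (simp add: C_def)
 have Cuniq: "t = s" if "d : C t" "d : C s" "t : P" "s : P" for d t s
 proof (rule ccontr)
  assume "t ~= s"
  have d: "0 < tor d" using D.pos CD that(1) by blast
  have "otri d <= otri t" "otri d <= otri s"
   using ctri_subset_otri[OF d P.pos[OF that(3)]] ctri_subset_otri[OF d P.pos[OF that(4)]] that(1,2)
   unfolding C_def by blast+
  then show False using P.disj[OF that(3,4) \<open>t ~= s\<close>] otri_nonempty[OF d] by blast
 qed
 have UC: "(\<Union>t\<in>P. C t) = D" using inP by (auto simp: C_def)
 have sumD: "(\<Sum>t\<in>P. \<Sum>d\<in>C t. f d) = (\<Sum>d\<in>D. f d)" for f :: "triple => 'a::comm_monoid_add"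
  unfolding UC[symmetric] by (rule sum.UNION_disjoint[symmetric]) (use P.fin finC Cuniq in auto)
 define wt where "wt t = card (C t)" for t
 have le: "(\<Sum>d\<in>C t. tor d) <= tor t" if t: "t : P" for t
 proof -
  have posd: "0 < tor d" if "d : C t" for d using D.pos[OF CD[OF that]] .
  have sub: "\<Union>(otri ` C t) <= otri t"
   using ctri_subset_otri[OF posd P.pos[OF t]] unfolding C_def by blast
  have "(\<Sum>d\<in>C t. tor d / 2) = (\<Sum>d\<in>C t. measure lborel (otri d))"
   by (intro sum.cong refl D.area_otri_ctri[symmetric] posd)
  also have "... = measure lborel (\<Union>(otri ` C t))"
   by (rule area_disjoint_sum[symmetric, OF finC posd]) (use D.disj CD in blast)+
  also have "... <= measure lborel (otri t)"
  proof (rule measure_mono_fmeasurable[OF sub])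
   have "open (\<Union>(otri ` C t))" using open_otri by blast
   then show "\<Union>(otri ` C t) : sets lborel" by simp
   have "bounded (otri t)"
    using bounded_subset[OF bounded_cbox, of "otri t" "pt 0 0" "pt 1 1"] P.otri_usq[OF t] usq_cbox by simp
   from emeasure_bounded_finite[OF this] show "otri t : fmeasurable lborel"
    using open_otri[of t] by (intro fmeasurableI) simp_all
  qed
  also have "... = tor t / 2" by (rule P.area_otri_ctri[OF P.pos[OF t]])
  finally show ?thesis by (simp add: sum_divide_distrib[symmetric])
 qed
 have "(\<Sum>t\<in>P. tor t - (\<Sum>d\<in>C t. tor d)) = 0"
  using P.total_area D.total_area sumD[of tor] by (simp add: sum_subtractf)
 then have eq: "(\<Sum>d\<in>C t. tor d) = tor t" if "t : P" for t
  using sum_nonneg_eq_0_iff[OF P.fin, of "%t. tor t - (\<Sum>d\<in>C t. tor d)"] le that by fastforce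
 have "wtiling P wt"
 proof
  fix t assume t: "t : P"
  show "1 <= wt t"
  proof (rule ccontr)
   assume "~ 1 <= wt t"
   then have "card (C t) = 0" unfolding wt_def by linarith
   then have "C t = {}" using finC by simp
   then show False using eq[OF t] P.pos[OF t] by simp
  qed
  have "(\<Sum>d\<in>C t. 19145775) <= (\<Sum>d\<in>C t. 67108864 * tor d)" using area CD by (intro sum_mono) blast
  then show "19145775 * real (wt t) <= 67108864 * tor t" using eq[OF t] by (simp add: wt_def sum_distrib_left[symmetric])
  have "(\<Sum>d\<in>C t. 67108864 * tor d) <= (\<Sum>d\<in>C t. 19202147)" using area CD by (intro sum_mono) blast
  then show "67108864 * tor t <= 19202147 * real (wt t)" using eq[OF t] by (simp add: wt_def sum_distrib_left[symmetric])
 next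
  have "(\<Sum>t\<in>P. \<Sum>d\<in>C t. 1::nat) = card D" unfolding sumD by simp
  then show "(\<Sum>t\<in>P. wt t) = 7" using cD by (simp add: wt_def)
 next
  fix a b c assume h: "a : P.Vs" "b : P.Vs" "c : P.Vs" "P.clean a b" "P.clean b c" "P.clean c a" "0 < orient a b c"
  define S where "S = {t : P. otri t <= otri (a, b, c)}"
  note m = P.merge_tiling[OF h(7,1-6), folded S_def]
  have "coarse D (insert (a, b, c) (P - S))"
   unfolding coarse_def using m(1,3) inP by blast
  from min[OF this] have "card P <= card (insert (a, b, c) (P - S))" .
  also have "... <= Suc (card (P - S))" by (rule card_insert_le_m1) (auto simp: P.fin)
  also have "card (P - S) = card P - card S" using P.fin by (intro card_Diff_subset) (auto simp: S_def)
  finally have "card S <= 1" using card_mono[of P S] P.fin by (auto simp: S_def)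
  moreover have "finite S" using P.fin by (simp add: S_def)
  moreover have "card S ~= 0" using m(2) \<open>finite S\<close> by simp
  ultimately have "card S = 1" by linarith
  then obtain t where t: "S = {t}" using card_1_singletonE by blast
  then have "ctri t = ctri (a, b, c)" "t : P" using m(3)[of t] m(4) by (auto simp: S_def)
  then show "rots (a, b, c) Int P ~= {}" using same_ctri_rots[OF h(7) P.pos] by blast
 qed
 moreover have "EX d:D. ctri d <= ctri t & tor d = tor t" if t: "t : P" "wt t = 1" for t
 proof -
  obtain d where d: "C t = {d}" using t(2) card_1_singletonE unfolding wt_def by blast
  then have "d : D" "ctri d <= ctri t" by (auto simp: C_def)
  moreover have "tor d = tor t" using eq[OF t(1)] d by simp
  ultimately show ?thesis by blast
 qed
 ultimately show ?thesis by blast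
qed

subsection \<open>The checker\<close>

text \<open>The checker is run by the simplifier. Hence it branches by auxiliary functions on constructors,
 which rewrite faster than conditionals, and it avoids numerals, which the equations on \<open>Suc\<close>
 would not match.\<close>

abbreviation (input) "n0 \<equiv> 0::nat"
abbreviation (input) "n1 \<equiv> Suc n0"
abbreviation (input) "n2 \<equiv> Suc n1"
abbreviation (input) "n3 \<equiv> Suc n2"
abbreviation (input) "n4 \<equiv> Suc n3"
abbreviation (input) "n5 \<equiv> Suc n4"
abbreviation (input) "n6 \<equiv> Suc n5"
abbreviation (input) "n7 \<equiv> Suc n6"

text \<open>Coordinates are in units of 1/8192. The kind of a vertex is 0 for corners of the square, 1 for vertices in
 no open side, 2 and 3 for vertices in the open side of a triangle, 3 if the flat triangle with this middle
 vertex is known; the list contains the ends of the sides leaving it. A triangle has its weight as fourth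
 component, 0 if it is flat. A state consists of vertices, triangles, known middle points of segments,
 the weight and the number of vertices (vertices of kind 1 count twice) that are left, a selected triangle, and the
 configuration: masks for the sides of the square, and whether ears are excluded and the apex of the
 first side is assumed in the left half.\<close>

datatype box = Bx int int int int

datatype vtx = Vx nat "nat list" box

datatype tri = Tr nat nat nat nat

datatype cfg = Cfg "nat list" bool bool

datatype st = St "vtx list" "tri list" "(nat \<times> nat \<times> nat) list" nat nat tri cfg

fun eqn :: "nat => nat => bool" where
 "eqn 0 0 = True"
| "eqn 0 (Suc n) = False"
| "eqn (Suc m) 0 = False"
| "eqn (Suc m) (Suc n) = eqn m n"

fun orf :: "bool => bool => bool" where
 "orf True b = True"
| "orf False b = b"

fun andf :: "bool => bool => bool" where
 "andf True b = b"
| "andf False b = False"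

fun mem :: "nat => nat list => bool" where
 "mem x [] = False"
| "mem x (y # ys) = orf (eqn x y) (mem x ys)"

fun vget :: "vtx list => nat => vtx" where
 "vget [] n = Vx 0 [] (Bx 0 0 0 0)"
| "vget (x # xs) 0 = x"
| "vget (x # xs) (Suc n) = vget xs n"

fun vbox :: "vtx => box" where "vbox (Vx k os b) = b"
fun vkind :: "vtx => nat" where "vkind (Vx k os b) = k"
fun vouts :: "vtx => nat list" where "vouts (Vx k os b) = os"

definition used :: "vtx list => nat => nat => bool" where
 "used vs p q = mem q (vouts (vget vs p))"

fun set_box :: "vtx list => nat => box => vtx list" where
 "set_box [] n b = []"
| "set_box (Vx k os c # xs) 0 b = Vx k os b # xs"
| "set_box (x # xs) (Suc n) b = x # set_box xs n b"

fun set_mid :: "vtx list => nat => box => vtx list" where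
 "set_mid [] n b = []"
| "set_mid (Vx k os c # xs) 0 b = Vx (Suc (Suc (Suc 0))) os b # xs"
| "set_mid (x # xs) (Suc n) b = x # set_mid xs n b"

fun add_out :: "nat => vtx list => nat => vtx list" where
 "add_out j [] n = []"
| "add_out j (Vx k os c # xs) 0 = Vx k (j # os) c # xs"
| "add_out j (x # xs) (Suc n) = x # add_out j xs n"

definition add_edges :: "vtx list => nat => nat => nat => vtx list" where
 "add_edges vs a b c = add_out b (add_out c (add_out a vs c) b) a"

section \<open>Interval bounds for orientations\<close>

fun ite :: "bool => 'a => 'a => 'a" where
 "ite True a b = a"
| "ite False a b = b"

text \<open>Lower bound of a product of numbers from [a, b] and [c, d]; the flags say whether
  \<open>0 <= a\<close>, \<open>b <= 0\<close>, \<open>0 <= c\<close> and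
  \<open>d <= 0\<close>.\<close>

fun prod_low1 :: "bool => bool => bool => bool => int => int => int => int => int" where
 "prod_low1 True _ True _ a b c d = a * c"
| "prod_low1 True _ False _ a b c d = b * c"
| "prod_low1 False True _ True a b c d = b * d"
| "prod_low1 False True _ False a b c d = a * d"
| "prod_low1 False False True _ a b c d = a * d"
| "prod_low1 False False False True a b c d = b * c"
| "prod_low1 False False False False a b c d = ite (a * d <= b * c) (a * d) (b * c)"

definition prod_low :: "int => int => int => int => int" where
 "prod_low a b c d = prod_low1 (0 <= a) (b <= 0) (0 <= c) (d <= 0) a b c d"

text \<open>Both products are taken with respect to the first vertex as base point; the second one
  absorbs its minus sign by reversing one difference.\<close>

fun orient_low :: "box => box => box => int" where
 "orient_low (Bx axl axh ayl ayh) (Bx bxl bxh byl byh) (Bx cxl cxh cyl cyh) =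
   prod_low (bxl - axh) (bxh - axl) (cyl - ayh) (cyh - ayl)
   + prod_low (axl - cxh) (axh - cxl) (byl - ayh) (byh - ayl)"

fun orient_neg :: "box => box => box => int" where
 "orient_neg (Bx axl axh ayl ayh) (Bx bxl bxh byl byh) (Bx cxl cxh cyl cyh) =
   prod_low (axl - bxh) (axh - bxl) (cyl - ayh) (cyh - ayl)
   + prod_low (cxl - axh) (cxh - axl) (byl - ayh) (byh - ayl)"

text \<open>Twice the area of a triangle of weight \<open>w\<close>, in units of \<open>1/8192^2\<close>, where each piece has an area
 between \<open>1/7 - 0.00021\<close> and \<open>1/7 + 0.00021\<close>.\<close>

fun tlo :: "nat => int" where
 "tlo 0 = 0"
| "tlo (Suc 0) = 19145775"
| "tlo (Suc (Suc 0)) = 38291550"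
| "tlo (Suc (Suc (Suc n))) = 57437325"

fun thi :: "nat => int" where
 "thi 0 = 0"
| "thi (Suc 0) = 19202147"
| "thi (Suc (Suc 0)) = 38404294"
| "thi (Suc (Suc (Suc n))) = 57606441"

text \<open>The flag selects the bound to be refuted: \<open>False\<close> means that the area is
  too large throughout the boxes, \<open>True\<close> that it is too small.\<close>

fun deadb :: "bool => nat => box => box => box => bool" where
 "deadb False w a b c = (thi w < orient_low a b c)"
| "deadb True w a b c = (- tlo w < orient_neg a b c)"

text \<open>The interval bound depends on the base point of the formula, so the certificate chooses
  among the three rotations.\<close>

fun dead3 :: "nat => bool => nat => box => box => box => bool" where
 "dead3 0 dir w a b c = deadb dir w a b c"
| "dead3 (Suc 0) dir w a b c = deadb dir w b c a"
| "dead3 (Suc (Suc n)) dir w a b c = deadb dir w c a b"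

fun dead_sub :: "nat => nat => bool => nat => box => box => box => box => bool" where
 "dead_sub r 0 dir w x a b c = dead3 r dir w x b c"
| "dead_sub r (Suc 0) dir w x a b c = dead3 r dir w a x c"
| "dead_sub r (Suc (Suc n)) dir w x a b c = dead3 r dir w a b x"

section \<open>Shrinking boxes\<close>

fun sel :: "nat => nat => nat => nat => nat" where
 "sel 0 a b c = a"
| "sel (Suc 0) a b c = b"
| "sel (Suc (Suc n)) a b c = c"

text \<open>The first component is the slab to be cut off, the list is the remainder. If the step
  reaches across the interval, the slab is everything and the list is empty.\<close>

fun spl_lo :: "bool => int => int => int => (int \<times> int) \<times> (int \<times> int) list" where
 "spl_lo True n l h = ((l, n), [(n, h)])"
| "spl_lo False n l h = ((l, h), [])"

fun spl_hi :: "bool => int => int => int => (int \<times> int) \<times> (int \<times> int) list" where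
 "spl_hi True n l h = ((n, h), [(l, n)])"
| "spl_hi False n l h = ((l, h), [])"

fun spl :: "bool => int => int => int => (int \<times> int) \<times> (int \<times> int) list" where
 "spl False d l h = spl_lo (l + d < h) (l + d) l h"
| "spl True d l h = spl_hi (l < h - d) (h - d) l h"

fun mk_x :: "(int \<times> int) \<times> (int \<times> int) list => int => int => box \<times> box list" where
 "mk_x ((a, b), []) l h = (Bx a b l h, [])"
| "mk_x ((a, b), (c, d) # r) l h = (Bx a b l h, [Bx c d l h])"

fun mk_y :: "(int \<times> int) \<times> (int \<times> int) list => int => int => box \<times> box list" where
 "mk_y ((a, b), []) l h = (Bx l h a b, [])"
| "mk_y ((a, b), (c, d) # r) l h = (Bx l h a b, [Bx l h c d])"

fun split_box :: "bool => bool => int => box => box \<times> box list" where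
 "split_box False sd d (Bx xl xh yl yh) = mk_x (spl sd d xl xh) yl yh"
| "split_box True sd d (Bx xl xh yl yh) = mk_y (spl sd d yl yh) xl xh"

fun rest_states :: "box list => nat => st => st list" where
 "rest_states [] v s = []"
| "rest_states (b # bs) v (St vs ts fs W e t cf) = [St (set_box vs v b) ts fs W e t cf]"

fun cut2 :: "bool => box list => nat => st => st list" where
 "cut2 True bs v s = rest_states bs v s"
| "cut2 False bs v s = [s]"

fun cut1 :: "nat => nat => bool => nat => box \<times> box list => box => box => box => nat => st => st list" where
 "cut1 r v dir w (x, bs) a b c u s = cut2 (dead_sub r v dir w x a b c) bs u s"

text \<open>Removes a slab of width \<open>d\<close> from the box of a vertex if the selected
  triangle cannot have its area with the vertex in the slab. A slab that is the whole box kills the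
  state.\<close>

fun cut :: "nat => nat => bool => bool => bool => int => st => st list" where
 "cut r v k sd dir d (St vs ts fs W e (Tr a b c w) cf) =
   cut1 r v dir w (split_box k sd d (vbox (vget vs (sel v a b c))))
    (vbox (vget vs a)) (vbox (vget vs b)) (vbox (vget vs c)) (sel v a b c)
    (St vs ts fs W e (Tr a b c w) cf)"

fun imin :: "int => int => int" where "imin a b = ite (a <= b) a b"
fun imax :: "int => int => int" where "imax a b = ite (a <= b) b a"

text \<open>Bounds for a flat triangle: \<open>m\<close> is its middle vertex.\<close>

fun mid_lo :: "int => int => int => int" where
 "mid_lo al cl ml = imax ml (imin al cl)"
fun mid_hi :: "int => int => int => int" where
 "mid_hi ah ch mh = imin mh (imax ah ch)"
text \<open>The middle vertex bounds one end only if the other end is known to lie beyond it on the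
  opposite side.\<close>

fun end_lo :: "int => int => int => int" where
 "end_lo ah ml cl = ite (ah <= ml) (imax cl ml) cl"
fun end_hi :: "int => int => int => int" where
 "end_hi al mh ch = ite (mh <= al) (imin ch mh) ch"

fun mid_box :: "box => box => box => box" where
 "mid_box (Bx axl axh ayl ayh) (Bx mxl mxh myl myh) (Bx cxl cxh cyl cyh) =
   Bx (mid_lo axl cxl mxl) (mid_hi axh cxh mxh) (mid_lo ayl cyl myl) (mid_hi ayh cyh myh)"

fun end_box :: "box => box => box => box" where
 "end_box (Bx axl axh ayl ayh) (Bx mxl mxh myl myh) (Bx cxl cxh cyl cyh) =
   Bx (end_lo axh mxl cxl) (end_hi axl mxh cxh) (end_lo ayh myl cyl) (end_hi ayl myh cyh)"

fun nonempty :: "box => bool" where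
 "nonempty (Bx xl xh yl yh) = andf (xl <= xh) (yl <= yh)"

fun guard :: "bool => 'a list => 'a list" where
 "guard True l = l"
| "guard False l = []"

fun squeeze4 :: "box => box => box => st => st list" where
 "squeeze4 x y z (St vs ts fs W e (Tr a b c w) cf) =
   guard (andf (nonempty x) (andf (nonempty y) (nonempty z)))
    [St (set_box (set_box (set_box vs a x) b y) c z) ts fs W e (Tr a b c w) cf]"

fun squeeze3 :: "box => box => box => st => st list" where
 "squeeze3 x y z s = squeeze4 (end_box z y x) y z s"

fun squeeze2 :: "box => box => box => st => st list" where
 "squeeze2 x y z s = squeeze3 x y (end_box x y z) s"

fun squeeze1 :: "box => box => box => st => st list" where
 "squeeze1 x y z s = squeeze2 x (mid_box x y z) z s"

fun squeeze :: "st => st list" where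
 "squeeze (St vs ts fs W e (Tr a b c 0) cf) =
   squeeze1 (vbox (vget vs a)) (vbox (vget vs b)) (vbox (vget vs c)) (St vs ts fs W e (Tr a b c 0) cf)"
| "squeeze (St vs ts fs W e (Tr a b c (Suc w)) cf) = [St vs ts fs W e (Tr a b c (Suc w)) cf]"

section \<open>Selecting and attaching triangles\<close>

fun tget :: "tri list => nat => tri => tri" where
 "tget [] n t = t"
| "tget (x # xs) 0 t = x"
| "tget (x # xs) (Suc n) t = tget xs n t"

fun set_reg :: "nat => st => st" where
 "set_reg i (St vs ts fs W e t cf) = St vs ts fs W e (tget ts i t) cf"

text \<open>Possible weights, each with the weight and the vertex budget left. A triangle of weight
  \<open>w\<close> costs \<open>w - 1\<close> units of budget, since it reduces the number of
  triangles to come. Weight 4 is impossible because no triangle fills more than half of the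
  square.\<close>

fun wcand :: "nat => nat => (nat \<times> nat \<times> nat) list" where
 "wcand 0 e = []"
| "wcand (Suc 0) e = [(Suc 0, 0, e)]"
| "wcand (Suc (Suc W)) 0 = [(Suc 0, Suc W, 0)]"
| "wcand (Suc (Suc 0)) (Suc e) = [(Suc 0, Suc 0, Suc e), (Suc (Suc 0), 0, e)]"
| "wcand (Suc (Suc (Suc W))) (Suc 0) = [(Suc 0, Suc (Suc W), Suc 0), (Suc (Suc 0), Suc W, 0)]"
| "wcand (Suc (Suc (Suc W))) (Suc (Suc e)) =
   [(Suc 0, Suc (Suc W), Suc (Suc e)), (Suc (Suc 0), Suc W, Suc e), (Suc (Suc (Suc 0)), W, e)]"

fun put_real :: "nat => nat => nat => nat => nat => nat => st => st" where
 "put_real p q g w W' e' (St vs ts fs W e t cf) =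
   St (add_edges vs p q g) (Tr p q g w # ts) fs W' e' (Tr p q g w) cf"

fun put_flat1 :: "box => nat => nat => nat => st => st list" where
 "put_flat1 x a m c (St vs ts fs W e t cf) =
   guard (nonempty x) [St (add_edges (set_mid vs m x) a m c) (Tr a m c 0 # ts) ((a, m, c) # fs) W e (Tr a m c 0) cf]"

fun put_flat :: "nat => nat => nat => st => st list" where
 "put_flat a m c (St vs ts fs W e t cf) =
   put_flat1 (mid_box (vbox (vget vs a)) (vbox (vget vs m)) (vbox (vget vs c))) a m c (St vs ts fs W e t cf)"

text \<open>\<open>ng\<close> is minus the upper bound of the orientation.\<close>

fun real_kids :: "int => int => nat => nat => nat => st => (nat \<times> nat \<times> nat) list => st list" where
 "real_kids lo ng p q g s [] = []"
| "real_kids lo ng p q g s ((w, W', e') # l) =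
   guard (andf (lo <= thi w) (ng <= - tlo w)) [put_real p q g w W' e' s] @ real_kids lo ng p q g s l"

text \<open>Only kind 2 qualifies: the middle has to be a T-vertex whose flat triangle, of which
  there is just one, is still unknown.\<close>

fun flat_if :: "nat => nat => nat => nat => st => st list" where
 "flat_if (Suc (Suc 0)) a m c s = put_flat a m c s"
| "flat_if 0 a m c s = []"
| "flat_if (Suc 0) a m c s = []"
| "flat_if (Suc (Suc (Suc n))) a m c s = []"

fun flat_kids :: "bool => nat => nat => nat => st => st list" where
 "flat_kids False p q g s = []"
| "flat_kids True p q g (St vs ts fs W e t cf) =
   flat_if (vkind (vget vs g)) q g p (St vs ts fs W e t cf)
   @ flat_if (vkind (vget vs p)) g p q (St vs ts fs W e t cf)
   @ flat_if (vkind (vget vs q)) p q g (St vs ts fs W e t cf)"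

text \<open>The mask records which kinds of triangles are admitted: 1 proper ones, 2 flat ones,
 anything else both.\<close>

fun kids3 :: "nat => int => int => nat => nat => nat => st => st list" where
 "kids3 (Suc 0) lo ng p q g (St vs ts fs W e t cf) =
   real_kids lo ng p q g (St vs ts fs W e t cf) (wcand W e)"
| "kids3 (Suc (Suc 0)) lo ng p q g (St vs ts fs W e t cf) =
   flat_kids (andf (lo <= 0) (ng <= 0)) p q g (St vs ts fs W e t cf)"
| "kids3 0 lo ng p q g (St vs ts fs W e t cf) =
   real_kids lo ng p q g (St vs ts fs W e t cf) (wcand W e)
   @ flat_kids (andf (lo <= 0) (ng <= 0)) p q g (St vs ts fs W e t cf)"
| "kids3 (Suc (Suc (Suc n))) lo ng p q g (St vs ts fs W e t cf) =
   real_kids lo ng p q g (St vs ts fs W e t cf) (wcand W e)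
   @ flat_kids (andf (lo <= 0) (ng <= 0)) p q g (St vs ts fs W e t cf)"

fun kids2 :: "nat => box => box => box => nat => nat => nat => st => st list" where
 "kids2 m x y z p q g s = kids3 m (orient_low x y z) (orient_neg x y z) p q g s"

fun kids1 :: "bool => nat => nat => nat => nat => st => st list" where
 "kids1 True m p q g s = []"
| "kids1 False m p q g (St vs ts fs W e t cf) =
   kids2 m (vbox (vget vs p)) (vbox (vget vs q)) (vbox (vget vs g)) p q g (St vs ts fs W e t cf)"

text \<open>If one of the two other sides is used, it belongs to another triangle, and
  \<open>g\<close> cannot be the third vertex.\<close>

fun kids :: "nat => nat => nat => nat => st => st list" where
 "kids m p q g (St vs ts fs W e t cf) =
   kids1 (orf (used vs q g) (used vs g p)) m p q g (St vs ts fs W e t cf)"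

fun named_kids :: "vtx list => nat => nat => nat => nat => st => st list" where
 "named_kids [] m p q g s = []"
| "named_kids (v # vs) m p q g s = kids m p q g s @ named_kids vs m p q (Suc g) s"

fun add_vtx :: "nat => nat => st => st" where
 "add_vtx k e' (St vs ts fs W e t cf) = St (vs @ [Vx k [] (Bx 0 8192 0 8192)]) ts fs W e' t cf"

text \<open>A new T-vertex costs one unit of budget, a new vertex in no open side two units, as in
  \<open>euler_count\<close>.\<close>

fun new_kids :: "nat => nat => nat => nat => nat => st => st list" where
 "new_kids 0 m p q g s = []"
| "new_kids (Suc 0) m p q g s = kids m p q g (add_vtx (Suc (Suc 0)) 0 s)"
| "new_kids (Suc (Suc e)) m p q g s =
   kids m p q g (add_vtx (Suc 0) e s) @ kids m p q g (add_vtx (Suc (Suc 0)) (Suc e) s)"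

fun nget :: "nat list => nat => nat" where
 "nget [] n = 0"
| "nget (x # xs) 0 = x"
| "nget (x # xs) (Suc n) = nget xs n"

fun mask1 :: "bool => nat => nat list => nat" where
 "mask1 True p l = nget l p"
| "mask1 False p l = 0"

fun is_side :: "nat => nat => bool" where
 "is_side 0 q = eqn q (Suc 0)"
| "is_side (Suc 0) q = eqn q (Suc (Suc 0))"
| "is_side (Suc (Suc 0)) q = eqn q (Suc (Suc (Suc 0)))"
| "is_side (Suc (Suc (Suc 0))) q = eqn q 0"
| "is_side (Suc (Suc (Suc (Suc n)))) q = False"

fun mask :: "cfg => nat => nat => nat" where
 "mask (Cfg l nf hf) p q = mask1 (is_side p q) p l"

fun branch1 :: "bool => nat => nat => st => st list" where
 "branch1 False p q s = [s]"
| "branch1 True p q (St vs ts fs W e t cf) =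
   named_kids vs (mask cf p q) p q 0 (St vs ts fs W e t cf)
   @ new_kids e (mask cf p q) p q (length vs) (St vs ts fs W e t cf)"

text \<open>An edge that is free while its reverse is used has one owner still to be placed; all
  third vertices and both sorts of triangles are tried. Otherwise the state is kept, as with every
  command whose condition fails, so no certificate can be unsound.\<close>

fun branch :: "nat => nat => st => st list" where
 "branch p q (St vs ts fs W e t cf) =
   branch1 (andf (used vs q p) (ite (used vs p q) False True)) p q (St vs ts fs W e t cf)"

section \<open>Collinear vertices, merging, ears and symmetry\<close>

fun is_fact :: "nat => nat => nat => (nat \<times> nat \<times> nat) list => bool" where
 "is_fact a m c [] = False"
| "is_fact a m c ((x, y, z) # l) =
   orf (andf (eqn m y) (orf (andf (eqn a x) (eqn c z)) (andf (eqn a z) (eqn c x)))) (is_fact a m c l)"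

fun is_span :: "nat => nat => (nat \<times> nat \<times> nat) list => bool" where
 "is_span a c [] = False"
| "is_span a c ((x, y, z) # l) =
   orf (orf (andf (eqn a x) (eqn c z)) (andf (eqn a z) (eqn c x))) (is_span a c l)"

fun chain1 :: "bool => nat => nat => nat => nat => st => st list" where
 "chain1 False a m x c s = [s]"
| "chain1 True a m x c (St vs ts fs W e t cf) =
   [St vs ts ((a, m, x) # (m, x, c) # (a, x, c) # (a, m, c) # fs) W e t cf]"

text \<open>For four points in the order \<open>a\<close>, \<open>m\<close>, \<open>x\<close>,
  \<open>c\<close> on a line, each of the three pairs of betweenness facts tested here implies all
  four facts.\<close>

fun chain :: "nat => nat => nat => nat => st => st list" where
 "chain a m x c (St vs ts fs W e t cf) =
   chain1 (orf (andf (is_fact a m c fs) (is_fact m x c fs))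
    (orf (andf (is_fact a m x fs) (is_fact m x c fs)) (andf (is_fact a x c fs) (is_fact a m x fs))))
    a m x c (St vs ts fs W e t cf)"

fun is_clean :: "nat => nat => st => bool" where
 "is_clean a b (St vs ts fs W e t cf) = orf (orf (used vs a b) (used vs b a)) (is_span a b fs)"

fun same_real :: "nat => nat => nat => tri => bool" where
 "same_real a b c (Tr x y z 0) = False"
| "same_real a b c (Tr x y z (Suc w)) =
   orf (andf (eqn a x) (andf (eqn b y) (eqn c z)))
    (orf (andf (eqn a y) (andf (eqn b z) (eqn c x))) (andf (eqn a z) (andf (eqn b x) (eqn c y))))"

fun has_real :: "nat => nat => nat => tri list => bool" where
 "has_real a b c [] = False"
| "has_real a b c (t # ts) = orf (same_real a b c t) (has_real a b c ts)"

fun merge3 :: "bool => int => int => nat => nat => nat => st => st list" where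
 "merge3 True lo ng a b c s = []"
| "merge3 False lo ng a b c (St vs ts fs W e t cf) =
   real_kids lo ng a b c (St vs ts fs W e t cf) (wcand W e)"

fun merge2 :: "bool => int => int => nat => nat => nat => st => st list" where
 "merge2 False lo ng a b c s = [s]"
| "merge2 True lo ng a b c (St vs ts fs W e t cf) =
   merge3 (orf (used vs a b) (orf (used vs b c) (used vs c a))) lo ng a b c (St vs ts fs W e t cf)"

fun merge1 :: "bool => int => int => nat => nat => nat => st => st list" where
 "merge1 False lo ng a b c s = [s]"
| "merge1 True lo ng a b c (St vs ts fs W e t cf) =
   merge2 (andf (0 < lo) (ite (has_real a b c ts) False True)) lo ng a b c (St vs ts fs W e t cf)"

text \<open>Uses the minimality of the tiling: a positively oriented triple joined by clean segments
  is one of its triangles. If it is not yet placed, it is attached; if one of its sides is already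
  used by another triangle, the state dies.\<close>

fun merge :: "nat => nat => nat => st => st list" where
 "merge a b c (St vs ts fs W e t cf) =
   merge1 (andf (is_clean a b (St vs ts fs W e t cf))
     (andf (is_clean b c (St vs ts fs W e t cf)) (is_clean c a (St vs ts fs W e t cf))))
    (orient_low (vbox (vget vs a)) (vbox (vget vs b)) (vbox (vget vs c)))
    (orient_neg (vbox (vget vs a)) (vbox (vget vs b)) (vbox (vget vs c))) a b c (St vs ts fs W e t cf)"

fun pinned :: "nat => box => bool" where
 "pinned 0 (Bx xl xh yl yh) = (yh <= 0)"
| "pinned (Suc 0) (Bx xl xh yl yh) = (8192 <= xl)"
| "pinned (Suc (Suc 0)) (Bx xl xh yl yh) = (8192 <= yl)"
| "pinned (Suc (Suc (Suc n))) (Bx xl xh yl yh) = (xh <= 0)"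

fun next_side :: "nat => nat" where
 "next_side 0 = Suc 0"
| "next_side (Suc 0) = Suc (Suc 0)"
| "next_side (Suc (Suc 0)) = Suc (Suc (Suc 0))"
| "next_side (Suc (Suc (Suc n))) = 0"

fun ear1 :: "bool => st => st list" where
 "ear1 True s = []"
| "ear1 False s = [s]"

text \<open>Rejects a triangle over a side of the square whose apex is pinned to a neighbouring
  side. Such ears are searched separately from \<open>start_ear\<close>.\<close>

fun ear :: "nat => nat => st => st list" where
 "ear p g (St vs ts fs W e t (Cfg l nf hf)) =
   ear1 (andf nf (andf (is_side p (next_side p)) (andf (has_real p (next_side p) g ts)
     (orf (pinned (next_side p) (vbox (vget vs g)))
       (pinned (next_side (next_side (next_side p))) (vbox (vget vs g)))))))
    (St vs ts fs W e t (Cfg l nf hf))"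

fun half2 :: "box => box" where
 "half2 (Bx xl xh yl yh) = Bx xl (imin xh 4096) yl yh"

fun half1 :: "bool => nat => st => st list" where
 "half1 False g s = [s]"
| "half1 True g (St vs ts fs W e t cf) = [St (set_box vs g (half2 (vbox (vget vs g)))) ts fs W e t cf]"

fun half :: "nat => st => st list" where
 "half g (St vs ts fs W e t (Cfg l nf hf)) =
   half1 (andf hf (has_real 0 (Suc 0) g ts)) g (St vs ts fs W e t (Cfg l nf hf))"

fun bisect2 :: "box \<times> box list => nat => st => st list" where
 "bisect2 (x, bs) v s = rest_states [x] v s @ rest_states bs v s"

fun bisect :: "nat => bool => int => st => st list" where
 "bisect v k d (St vs ts fs W e t cf) =
   bisect2 (split_box k False d (vbox (vget vs v))) v (St vs ts fs W e t cf)"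

fun eqt :: "tri => tri => bool" where
 "eqt (Tr a b c w) (Tr x y z u) = andf (eqn a x) (andf (eqn b y) (andf (eqn c z) (eqn w u)))"

fun tmem :: "tri => tri list => bool" where
 "tmem t [] = False"
| "tmem t (x # xs) = orf (eqt t x) (tmem t xs)"

fun tsub :: "tri list => tri list => bool" where
 "tsub [] l = True"
| "tsub (x # xs) l = andf (tmem x l) (tsub xs l)"

text \<open>The six surviving configurations. Vertices 0 to 3 are the corners and 4 is the apex of
  an ear over the bottom side, lying on the right side. Up to rotation of triples, lists 0 and 1
  differ only in the flat triangles that subdivide the line from vertex 4 to vertex 0, and lists 2
  and 3 in those on the top side.\<close>

fun opt_list :: "nat => tri list" where
 "opt_list n0 = [Tr n0 n1 n4 n1, Tr n2 n4 n1 n0, Tr n4 n2 n5 n1, Tr n3 n0 n6 n1, Tr n4 n5 n0 n0,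
  Tr n5 n2 n7 n2, Tr n5 n6 n0 n0, Tr n6 n5 n7 n1, Tr n3 n6 n7 n1, Tr n3 n7 n2 n0]"
| "opt_list n1 = [Tr n0 n1 n4 n1, Tr n2 n4 n1 n0, Tr n4 n2 n5 n1, Tr n3 n0 n6 n1, Tr n4 n5 n6 n0,
  Tr n3 n7 n2 n0, Tr n4 n6 n0 n0, Tr n6 n5 n7 n1, Tr n2 n7 n5 n2, Tr n3 n6 n7 n1]"
| "opt_list n2 = [Tr n0 n1 n4 n1, Tr n2 n4 n1 n0, Tr n4 n2 n5 n1, Tr n3 n0 n6 n1, Tr n4 n5 n7 n2,
  Tr n4 n7 n0 n0, Tr n0 n7 n6 n1, Tr n6 n7 n5 n1, Tr n3 n5 n2 n0, Tr n3 n6 n5 n0]"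
| "opt_list n3 = [Tr n0 n1 n4 n1, Tr n2 n4 n1 n0, Tr n4 n2 n5 n1, Tr n3 n0 n6 n1, Tr n4 n5 n7 n2,
  Tr n4 n7 n0 n0, Tr n0 n7 n6 n1, Tr n6 n7 n5 n1, Tr n3 n6 n2 n0, Tr n6 n5 n2 n0]"
| "opt_list n4 = [Tr n0 n1 n4 n1, Tr n2 n4 n1 n0, Tr n2 n5 n4 n0, Tr n3 n0 n6 n1, Tr n4 n5 n6 n1,
  Tr n2 n3 n7 n1, Tr n5 n2 n7 n1, Tr n6 n7 n3 n0, Tr n5 n7 n6 n2, Tr n4 n6 n0 n0]"
| "opt_list (Suc (Suc (Suc (Suc (Suc n))))) = [Tr n0 n1 n4 n1, Tr n2 n4 n1 n0, Tr n2 n5 n4 n0, Tr n3 n0 n6 n1, Tr n4 n5 n7 n1,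
  Tr n5 n2 n6 n1, Tr n0 n4 n7 n1, Tr n0 n7 n6 n0, Tr n5 n6 n7 n2, Tr n3 n6 n2 n0]"

fun opt1 :: "bool => st => st list" where
 "opt1 True s = []"
| "opt1 False s = [s]"

fun opt :: "nat => st => st list" where
 "opt i (St vs ts fs W e t cf) = opt1 (tsub (opt_list i) ts) (St vs ts fs W e t cf)"

section \<open>Decoding of commands and runs of the checker\<close>

datatype cmd = Cut nat nat bool bool bool | Reg | Hull | Branch | Merge | Chain | Ear | Bisect | Opt | Half | Nop

fun op12 :: "bool => bool => bool => cmd" where
 "op12 True False False = Reg"
| "op12 False True False = Hull"
| "op12 True True False = Branch"
| "op12 False False True = Merge"
| "op12 True False True = Chain"
| "op12 False True True = Ear"
| "op12 True True True = Bisect"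
| "op12 False False False = Nop"

fun op15 :: "bool => bool => bool => cmd" where
 "op15 False False False = Opt"
| "op15 True b c = Half"
| "op15 False True c = Half"
| "op15 False False True = Half"

text \<open>Four bits choose among the nine cuts, by base point and vertex, and the three low bits
  are the flags of the cut; two further values leave the low bits to name another command. All other
  codes are \<open>Nop\<close>, so every character is a command.\<close>

fun opb :: "bool => bool => bool => bool => bool => bool => bool => cmd" where
 "opb True False True False x y z = Cut 0 0 x y z"
| "opb False True True False x y z = Cut 0 (Suc 0) x y z"
| "opb True True True False x y z = Cut 0 (Suc (Suc 0)) x y z"
| "opb False False False True x y z = Cut (Suc 0) 0 x y z"
| "opb True False False True x y z = Cut (Suc 0) (Suc 0) x y z"
| "opb False True False True x y z = Cut (Suc 0) (Suc (Suc 0)) x y z"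
| "opb True True False True x y z = Cut (Suc (Suc 0)) 0 x y z"
| "opb True False True True x y z = Cut (Suc (Suc 0)) (Suc 0) x y z"
| "opb False True True True x y z = Cut (Suc (Suc 0)) (Suc (Suc 0)) x y z"
| "opb False False True True x y z = op12 x y z"
| "opb True True True True x y z = op15 x y z"
| "opb a False False False x y z = Nop"
| "opb a True False False x y z = Nop"
| "opb False False True False x y z = Nop"

fun opc :: "char => cmd" where
 "opc (Char b0 b1 b2 b3 b4 b5 b6 b7) = opb b3 b4 b5 b6 b0 b1 b2"

fun arity :: "cmd => nat" where
 "arity (Cut r v x y z) = Suc 0"
| "arity Reg = Suc 0"
| "arity Hull = Suc 0"
| "arity Branch = Suc (Suc 0)"
| "arity Merge = Suc (Suc (Suc 0))"
| "arity Chain = Suc (Suc (Suc (Suc 0)))"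
| "arity Ear = Suc (Suc 0)"
| "arity Bisect = Suc (Suc (Suc 0))"
| "arity Opt = Suc 0"
| "arity Half = Suc 0"
| "arity Nop = Suc 0"

fun bitn :: "bool => num => num" where
 "bitn True n = num.Bit1 n"
| "bitn False n = num.Bit0 n"

fun exp4 :: "bool => bool => bool => bool => num => num" where
 "exp4 True False True False n = n"
| "exp4 False True True False n = num.Bit0 n"
| "exp4 True True True False n = num.Bit0 (num.Bit0 n)"
| "exp4 False False False True n = num.Bit0 (num.Bit0 (num.Bit0 n))"
| "exp4 True False False True n = num.Bit0 (num.Bit0 (num.Bit0 (num.Bit0 n)))"
| "exp4 False True False True n = num.Bit0 (num.Bit0 (num.Bit0 (num.Bit0 (num.Bit0 n))))"
| "exp4 True True False True n = num.Bit0 (num.Bit0 (num.Bit0 (num.Bit0 (num.Bit0 (num.Bit0 n)))))"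
| "exp4 False False True True n = num.Bit0 (num.Bit0 (num.Bit0 (num.Bit0 (num.Bit0 (num.Bit0 (num.Bit0 n))))))"
| "exp4 True False True True n = num.Bit0 (num.Bit0 (num.Bit0 (num.Bit0 (num.Bit0 (num.Bit0 (num.Bit0 (num.Bit0 n)))))))"
| "exp4 False True True True n = num.Bit0 (num.Bit0 (num.Bit0 (num.Bit0 (num.Bit0 (num.Bit0 (num.Bit0 (num.Bit0 (num.Bit0 n))))))))"
| "exp4 True True True True n = num.Bit0 (num.Bit0 (num.Bit0 (num.Bit0 (num.Bit0 (num.Bit0 (num.Bit0 (num.Bit0 (num.Bit0 (num.Bit0 n)))))))))"
| "exp4 a False False False n = num.One"
| "exp4 a True False False n = num.One"
| "exp4 False False True False n = num.One"

text \<open>A step width in floating-point form: the three low bits give a mantissa from 8 to 15,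
  the next four a power of two up to 1024.\<close>

fun delta :: "char => int" where
 "delta (Char b0 b1 b2 b3 b4 b5 b6 b7) = Int.Pos (exp4 b3 b4 b5 b6 (bitn b0 (bitn b1 (bitn b2 num.One))))"

fun dig4 :: "bool => nat => nat" where
 "dig4 True n = Suc (n + n)"
| "dig4 False n = n + n"

fun dig :: "char => nat" where
 "dig (Char b0 b1 b2 b3 b4 b5 b6 b7) = dig4 b0 (dig4 b1 (dig4 b2 (dig4 b3 0)))"

fun bit0 :: "char => bool" where
 "bit0 (Char b0 b1 b2 b3 b4 b5 b6 b7) = b0"

fun cmd_step :: "cmd => char list => st => st list" where
 "cmd_step (Cut r v x y z) [c] s = cut r v x y z (delta c) s"
| "cmd_step Reg [c] s = [set_reg (dig c) s]"
| "cmd_step Hull [c] s = squeeze (set_reg (dig c) s)"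
| "cmd_step Branch [d, c] s = branch (dig c) (dig d) s"
| "cmd_step Merge [d, c, b] s = merge (dig b) (dig c) (dig d) s"
| "cmd_step Chain [e, d, c, b] s = chain (dig b) (dig c) (dig d) (dig e) s"
| "cmd_step Ear [d, c] s = ear (dig c) (dig d) s"
| "cmd_step Bisect [d, k, c] s = bisect (dig c) (bit0 k) (delta d) s"
| "cmd_step Opt [c] s = opt (dig c) s"
| "cmd_step Half [c] s = half (dig c) s"
| "cmd_step _ _ s = [s]"

text \<open>A stack of states still to be refuted, and the reader: the number of missing arguments,
  the command, and the arguments read so far, latest first.\<close>

datatype conf = Conf "st list" nat cmd "char list"

fun exec_top :: "cmd => char list => st list => st list" where
 "exec_top c l [] = []"
| "exec_top c l (s # st) = cmd_step c l s @ st"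

fun run1 :: "st list => nat => cmd => char list => char list => conf" where
 "run1 st n c acc [] = Conf st n c acc"
| "run1 st 0 c acc (x # xs) = run1 st (arity (opc x)) (opc x) [] xs"
| "run1 st (Suc 0) c acc (x # xs) = run1 (exec_top c (x # acc) st) 0 c [] xs"
| "run1 st (Suc (Suc n)) c acc (x # xs) = run1 st (Suc n) c (x # acc) xs"

fun run :: "conf => char list => conf" where
 "run (Conf st n c acc) xs = run1 st n c acc xs"

fun finished :: "conf => bool" where
 "finished (Conf [] n c acc) = True"
| "finished (Conf (s # st) n c acc) = False"

text \<open>The reversed sides of the square count as used edges from the start.\<close>

definition corners :: "vtx list" where
 "corners = [Vx 0 [Suc (Suc (Suc 0))] (Bx 0 0 0 0), Vx 0 [0] (Bx 8192 8192 0 0),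
   Vx 0 [Suc 0] (Bx 8192 8192 8192 8192), Vx 0 [Suc (Suc 0)] (Bx 0 0 8192 8192)]"

text \<open>Seven pieces allow at most seven triangles, so \<open>euler_count\<close> leaves 7 - 2 =
  5 units for vertices. The selected triangle is a degenerate placeholder.\<close>

definition start :: "cfg => conf" where
 "start cf = Conf [St corners [] [] n7 n5 (Tr 0 0 0 0) cf] 0 Nop []"

fun ear_roots :: "(nat \<times> nat \<times> nat) list => st => st list" where
 "ear_roots [] s = []"
| "ear_roots ((w, W', e') # l) s =
   put_flat (Suc (Suc 0)) n4 (Suc 0)
    (put_real 0 (Suc 0) n4 w W' e' s) @ ear_roots l s"

text \<open>The root for ears: vertex 4 is a T-vertex with abscissa 1, which costs one unit of
  budget. The ear is placed with each possible weight, together with the flat triangle on the right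
  side.\<close>

definition start_ear :: "conf" where
 "start_ear = Conf (ear_roots (wcand n7 n4)
   (St (corners @ [Vx (Suc (Suc 0)) [] (Bx 8192 8192 0 8192)]) [] [] n7
    n4 (Tr 0 0 0 0) (Cfg [] False False))) 0 Nop []"

subsection \<open>Soundness of the checker\<close>

lemma eqn_iff [simp]: "eqn m n \<longleftrightarrow> m = n"
 by (induction m n rule: eqn.induct) auto

lemma orf_iff [simp]: "orf a b \<longleftrightarrow> a | b"
 by (cases a) auto

lemma andf_iff [simp]: "andf a b \<longleftrightarrow> a & b"
 by (cases a) auto

lemma ite_if [simp]: "ite c a b = (if c then a else b)"
 by (cases c) auto

lemma mem_iff [simp]: "mem x xs \<longleftrightarrow> x : set xs"
 by (induction xs) auto

lemma guard_if [simp]: "guard c l = (if c then l else [])"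
 by (cases c) auto

lemma vget_nth: "i < length vs ==> vget vs i = vs ! i"
 by (induction vs i rule: vget.induct) auto

lemma vget_out: "length vs <= i ==> vget vs i = Vx 0 [] (Bx 0 0 0 0)"
 by (induction vs i rule: vget.induct) auto

lemma length_set_box [simp]: "length (set_box vs i b) = length vs"
 by (induction vs i b rule: set_box.induct) auto

lemma set_box_nth: "i < length vs ==> j < length vs ==>
  set_box vs i b ! j = (if j = i then Vx (vkind (vs ! i)) (vouts (vs ! i)) b else vs ! j)"
 by (induction vs i b arbitrary: j rule: set_box.induct) (auto simp: nth_Cons' split: if_splits)

lemma length_set_mid [simp]: "length (set_mid vs i b) = length vs"
 by (induction vs i b rule: set_mid.induct) auto

lemma set_mid_nth: "i < length vs ==> j < length vs ==>
  set_mid vs i b ! j = (if j = i then Vx n3 (vouts (vs ! i)) b else vs ! j)"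
 by (induction vs i b arbitrary: j rule: set_mid.induct) (auto simp: nth_Cons' split: if_splits)

lemma length_add_out [simp]: "length (add_out k vs i) = length vs"
 by (induction k vs i rule: add_out.induct) auto

lemma add_out_nth: "i < length vs ==> j < length vs ==>
  add_out k vs i ! j = (if j = i then Vx (vkind (vs ! i)) (k # vouts (vs ! i)) (vbox (vs ! i)) else vs ! j)"
 by (induction k vs i arbitrary: j rule: add_out.induct) (auto simp: nth_Cons' split: if_splits)

lemma length_add_edges [simp]: "length (add_edges vs a b c) = length vs"
 by (simp add: add_edges_def)

lemma add_edges_nth:
 assumes "a < length vs" "b < length vs" "c < length vs" "j < length vs"
 shows "vkind (add_edges vs a b c ! j) = vkind (vs ! j)" "vbox (add_edges vs a b c ! j) = vbox (vs ! j)"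
  "k : set (vouts (add_edges vs a b c ! j)) \<longleftrightarrow> k : set (vouts (vs ! j)) | (j, k) : {(a, b), (b, c), (c, a)}"
 using assms by (auto simp: add_edges_def add_out_nth)

section \<open>Soundness of the interval bounds\<close>

fun inbox :: "box => real^2 => bool" where
 "inbox (Bx xl xh yl yh) p \<longleftrightarrow> real_of_int xl <= 8192 * p$1 & 8192 * p$1 <= real_of_int xh &
   real_of_int yl <= 8192 * p$2 & 8192 * p$2 <= real_of_int yh"

lemma prod_low_sound:
 assumes "real_of_int a <= u" "u <= real_of_int b" "real_of_int c <= v" "v <= real_of_int d"
 shows "real_of_int (prod_low a b c d) <= u * v"
proof -
 have "real_of_int (prod_low a b c d) =
   (if 0 <= a then if 0 <= c then real_of_int a * c else real_of_int b * c
    else if b <= 0 then if d <= 0 then real_of_int b * d else real_of_int a * d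
    else if 0 <= c then real_of_int a * d else if d <= 0 then real_of_int b * c
    else min (real_of_int a * d) (real_of_int b * c))"
  unfolding prod_low_def
  by (cases "0 <= a"; cases "b <= 0"; cases "0 <= c"; cases "d <= 0") (auto simp: min_def simp flip: of_int_mult)
 moreover have "real_of_int a * c <= u * v" if "0 <= a" "0 <= c"
  using that assms by (intro mult_mono) auto
 moreover have "real_of_int b * c <= u * v" if "0 <= a" "~ 0 <= c"
 proof -
  have "real_of_int b * c <= u * c" using that assms by (intro mult_right_mono_neg) auto
  also have "... <= u * v" using that assms by (intro mult_left_mono) auto
  finally show ?thesis .
 qed
 moreover have "real_of_int b * d <= u * v" if "b <= 0" "d <= 0"
  using that assms mult_mono[of "- real_of_int b" "- u" "- real_of_int d" "- v"] by auto
 moreover have "real_of_int a * d <= u * v" if "b <= 0" "~ d <= 0"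
 proof -
  have "real_of_int a * d <= u * d" using that assms by (intro mult_right_mono) auto
  also have "... <= u * v" using that assms by (intro mult_left_mono_neg) auto
  finally show ?thesis .
 qed
 moreover have "real_of_int a * d <= u * v" if "~ 0 <= a" "0 <= c"
 proof -
  have "real_of_int a * d <= real_of_int a * v" using that assms by (intro mult_left_mono_neg) auto
  also have "... <= u * v" using that assms by (intro mult_right_mono) auto
  finally show ?thesis .
 qed
 moreover have "real_of_int b * c <= u * v" if "~ b <= 0" "d <= 0"
 proof -
  have "real_of_int b * c <= real_of_int b * v" using that assms by (intro mult_left_mono) auto
  also have "... <= u * v" using that assms by (intro mult_right_mono_neg) auto
  finally show ?thesis .
 qed
 moreover have "min (real_of_int a * d) (real_of_int b * c) <= u * v" if "~ 0 <= a" "~ b <= 0" "~ 0 <= c" "~ d <= 0"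
 proof (cases "0 <= u")
  case True
  have "real_of_int b * c <= u * c" using that assms by (intro mult_right_mono_neg) auto
  also have "... <= u * v" using True assms by (intro mult_left_mono) auto
  finally show ?thesis by simp
 next
  case False
  have "real_of_int a * d <= u * d" using that assms by (intro mult_right_mono) auto
  also have "... <= u * v" using False assms by (intro mult_left_mono_neg) auto
  finally show ?thesis by simp
 qed
 ultimately show ?thesis by (auto split: if_splits)
qed

lemma orient_low_sound:
 assumes "inbox A a" "inbox B b" "inbox C c"
 shows "real_of_int (orient_low A B C) <= 67108864 * orient a b c"
proof -
 obtain axl axh ayl ayh where A: "A = Bx axl axh ayl ayh" by (cases A)
 obtain bxl bxh byl byh where B: "B = Bx bxl bxh byl byh" by (cases B)
 obtain cxl cxh cyl cyh where C: "C = Bx cxl cxh cyl cyh" by (cases C)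
 have "real_of_int (prod_low (bxl - axh) (bxh - axl) (cyl - ayh) (cyh - ayl))
   <= (8192 * b$1 - 8192 * a$1) * (8192 * c$2 - 8192 * a$2)"
  using assms unfolding A B C by (intro prod_low_sound) auto
 moreover have "real_of_int (prod_low (axl - cxh) (axh - cxl) (byl - ayh) (byh - ayl))
   <= (8192 * a$1 - 8192 * c$1) * (8192 * b$2 - 8192 * a$2)"
  using assms unfolding A B C by (intro prod_low_sound) auto
 ultimately show ?thesis unfolding A B C orient_def by (simp add: algebra_simps)
qed

lemma orient_neg_sound:
 assumes "inbox A a" "inbox B b" "inbox C c"
 shows "real_of_int (orient_neg A B C) <= - (67108864 * orient a b c)"
proof -
 obtain axl axh ayl ayh where A: "A = Bx axl axh ayl ayh" by (cases A)
 obtain bxl bxh byl byh where B: "B = Bx bxl bxh byl byh" by (cases B)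
 obtain cxl cxh cyl cyh where C: "C = Bx cxl cxh cyl cyh" by (cases C)
 have "real_of_int (prod_low (axl - bxh) (axh - bxl) (cyl - ayh) (cyh - ayl))
   <= (8192 * a$1 - 8192 * b$1) * (8192 * c$2 - 8192 * a$2)"
  using assms unfolding A B C by (intro prod_low_sound) auto
 moreover have "real_of_int (prod_low (cxl - axh) (cxh - axl) (byl - ayh) (byh - ayl))
   <= (8192 * c$1 - 8192 * a$1) * (8192 * b$2 - 8192 * a$2)"
  using assms unfolding A B C by (intro prod_low_sound) auto
 ultimately show ?thesis unfolding A B C orient_def by (simp add: algebra_simps)
qed

lemma deadb_sound:
 assumes "inbox A a" "inbox B b" "inbox C c"
  "real_of_int (tlo w) <= 67108864 * orient a b c" "67108864 * orient a b c <= real_of_int (thi w)"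
 shows "~ deadb dir w A B C"
 using orient_low_sound[OF assms(1-3)] orient_neg_sound[OF assms(1-3)] assms(4,5) by (cases dir) auto

lemma dead3_sound:
 assumes "inbox A a" "inbox B b" "inbox C c"
  "real_of_int (tlo w) <= 67108864 * orient a b c" "67108864 * orient a b c <= real_of_int (thi w)"
 shows "~ dead3 r dir w A B C"
proof -
 consider "r = 0" | "r = 1" | n where "r = Suc (Suc n)" by (metis One_nat_def not0_implies_Suc)
 then show ?thesis
  using deadb_sound[of A a B b C c w dir] deadb_sound[of B b C c A a w dir] deadb_sound[of C c A a B b w dir] assms
  by cases (simp_all add: orient_rot)
qed

lemma split_box_sound:
 assumes "inbox b p" "split_box k sd d b = (x, bs)"
 shows "inbox x p | (EX y. bs = [y] & inbox y p)"
proof -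
 obtain xl xh yl yh where b: "b = Bx xl xh yl yh" by (cases b)
 show ?thesis using assms unfolding b
  by (cases k; cases sd; cases "xl + d < xh"; cases "xl < xh - d"; cases "yl + d < yh"; cases "yl < yh - d") auto
qed

lemma between_coord:
 assumes "m : open_segment a (c::real^2) | a = m & m = c"
 obtains u where "0 < u" "u < 1" "!!i. m$i = (1 - u) * a$i + u * c$i"
proof -
 have "EX u. 0 < u & u < 1 & m = (1 - u) *\<^sub>R a + u *\<^sub>R c"
 proof (cases "a = m & m = c")
  case True
  then show ?thesis by (intro exI[of _ "1/2"]) (simp flip: scaleR_left_distrib)
 next
  case False
  then show ?thesis using assms by (auto simp: in_segment)
 qed
 then show ?thesis using that by auto
qed

lemma mid_lo_sound:
 assumes "0 < u" "u < 1" "real_of_int al <= a" "real_of_int cl <= c" "real_of_int ml <= (1 - u) * a + u * c"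
 shows "real_of_int (mid_lo al cl ml) <= (1 - u) * a + u * c"
proof -
 have "(1 - u) * min al cl + u * min al cl <= (1 - u) * a + u * c"
  using assms by (intro add_mono mult_left_mono) auto
 then show ?thesis using assms(5) by (simp add: algebra_simps min_def split: if_splits)
qed

lemma mid_hi_sound:
 assumes "0 < u" "u < 1" "a <= real_of_int ah" "c <= real_of_int ch" "(1 - u) * a + u * c <= real_of_int mh"
 shows "(1 - u) * a + u * c <= real_of_int (mid_hi ah ch mh)"
proof -
 have "(1 - u) * a + u * c <= (1 - u) * max ah ch + u * max ah ch"
  using assms by (intro add_mono mult_left_mono) auto
 then show ?thesis using assms(5) by (simp add: algebra_simps max_def split: if_splits)
qed

lemma end_lo_sound:
 assumes "0 < u" "u < 1" "a <= real_of_int ah" "real_of_int ml <= (1 - u) * a + u * c" "real_of_int cl <= c"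
 shows "real_of_int (end_lo ah ml cl) <= c"
proof (cases "ah <= ml")
 case True
 have "real_of_int ml <= c"
 proof (rule ccontr)
  assume "~ ?thesis"
  then have "u * c < u * ml" using assms(1) by simp
  moreover have "(1 - u) * a <= (1 - u) * ml" using assms True by (intro mult_left_mono) linarith+
  ultimately show False using assms(4) by (simp add: algebra_simps)
 qed
 then show ?thesis using assms True by auto
qed (use assms in auto)

lemma end_hi_sound:
 assumes "0 < u" "u < 1" "real_of_int al <= a" "(1 - u) * a + u * c <= real_of_int mh" "c <= real_of_int ch"
 shows "c <= real_of_int (end_hi al mh ch)"
proof (cases "mh <= al")
 case True
 have "c <= real_of_int mh"
 proof (rule ccontr)
  assume "~ ?thesis"
  then have "u * mh < u * c" using assms(1) by simp
  moreover have "(1 - u) * mh <= (1 - u) * a" using assms True by (intro mult_left_mono) linarith+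
  ultimately show False using assms(4) by (simp add: algebra_simps)
 qed
 then show ?thesis using assms True by auto
qed (use assms in auto)

lemma mid_box_sound:
 assumes "m : open_segment a c | a = m & m = c" "inbox A a" "inbox M m" "inbox C c"
 shows "inbox (mid_box A M C) m"
proof -
 obtain u where u: "0 < u" "u < 1" "!!i. m$i = (1 - u) * a$i + u * c$i" using between_coord[OF assms(1)] by blast
 have e: "(1 - u) * (8192 * a$i) + u * (8192 * c$i) = 8192 * m$i" for i unfolding u(3) by (simp add: algebra_simps)
 obtain axl axh ayl ayh where A: "A = Bx axl axh ayl ayh" by (cases A)
 obtain mxl mxh myl myh where M: "M = Bx mxl mxh myl myh" by (cases M)
 obtain cxl cxh cyl cyh where C: "C = Bx cxl cxh cyl cyh" by (cases C)
 have a: "real_of_int axl <= 8192 * a$1" "8192 * a$1 <= real_of_int axh" "real_of_int ayl <= 8192 * a$2" "8192 * a$2 <= real_of_int ayh"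
  using assms(2) A by auto
 have m: "real_of_int mxl <= 8192 * m$1" "8192 * m$1 <= real_of_int mxh" "real_of_int myl <= 8192 * m$2" "8192 * m$2 <= real_of_int myh"
  using assms(3) M by auto
 have c: "real_of_int cxl <= 8192 * c$1" "8192 * c$1 <= real_of_int cxh" "real_of_int cyl <= 8192 * c$2" "8192 * c$2 <= real_of_int cyh"
  using assms(4) C by auto
 show ?thesis
  unfolding A M C mid_box.simps inbox.simps
  using mid_lo_sound[OF u(1,2) a(1) c(1), unfolded e, OF m(1)] mid_hi_sound[OF u(1,2) a(2) c(2), unfolded e, OF m(2)]
   mid_lo_sound[OF u(1,2) a(3) c(3), unfolded e, OF m(3)] mid_hi_sound[OF u(1,2) a(4) c(4), unfolded e, OF m(4)] by blast
qed

lemma end_box_sound: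
 assumes "m : open_segment a c | a = m & m = c" "inbox A a" "inbox M m" "inbox C c"
 shows "inbox (end_box A M C) c"
proof -
 obtain u where u: "0 < u" "u < 1" "!!i. m$i = (1 - u) * a$i + u * c$i" using between_coord[OF assms(1)] by blast
 have e: "(1 - u) * (8192 * a$i) + u * (8192 * c$i) = 8192 * m$i" for i unfolding u(3) by (simp add: algebra_simps)
 obtain axl axh ayl ayh where A: "A = Bx axl axh ayl ayh" by (cases A)
 obtain mxl mxh myl myh where M: "M = Bx mxl mxh myl myh" by (cases M)
 obtain cxl cxh cyl cyh where C: "C = Bx cxl cxh cyl cyh" by (cases C)
 have a: "real_of_int axl <= 8192 * a$1" "8192 * a$1 <= real_of_int axh" "real_of_int ayl <= 8192 * a$2" "8192 * a$2 <= real_of_int ayh"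
  using assms(2) A by auto
 have m: "real_of_int mxl <= 8192 * m$1" "8192 * m$1 <= real_of_int mxh" "real_of_int myl <= 8192 * m$2" "8192 * m$2 <= real_of_int myh"
  using assms(3) M by auto
 have c: "real_of_int cxl <= 8192 * c$1" "8192 * c$1 <= real_of_int cxh" "real_of_int cyl <= 8192 * c$2" "8192 * c$2 <= real_of_int cyh"
  using assms(4) C by auto
 show ?thesis
  unfolding A M C end_box.simps inbox.simps
  using end_lo_sound[OF u(1,2) a(2) m(1)[folded e] c(1)] end_hi_sound[OF u(1,2) a(1) m(2)[folded e] c(2)]
   end_lo_sound[OF u(1,2) a(4) m(3)[folded e] c(3)] end_hi_sound[OF u(1,2) a(3) m(4)[folded e] c(4)] by blast
qed

lemma nonempty_inbox: "inbox b p ==> nonempty b"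
proof -
 assume h: "inbox b p"
 obtain xl xh yl yh where b: "b = Bx xl xh yl yh" by (cases b)
 have "real_of_int xl <= real_of_int xh" "real_of_int yl <= real_of_int yh" using h b by auto
 then show ?thesis using b by simp
qed

lemma wcand_mem:
 assumes "1 <= w" "w <= 3" "w <= W" "w <= e + 1"
 shows "(w, W - w, e + 1 - w) : set (wcand W e)"
proof -
 have "w = 1 | w = 2 | w = 3" using assms by auto
 then show ?thesis using assms(3,4)
  by (induction W e rule: wcand.induct) auto
qed

section \<open>Nets, and states satisfied by a net\<close>

lemma tedges_rots: "t : rots s ==> tedges t = tedges s"
 by (cases s) auto

lemma tverts_rots: "t : rots s ==> tverts t = tverts s"
 by (cases s) auto

lemma tor_rots: "t : rots s ==> tor t = tor s"
 by (cases s) (auto simp: orient_rot)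

fun idx_edges :: "tri => (nat \<times> nat) set" where
 "idx_edges (Tr a b c w) = {(a, b), (b, c), (c, a)}"

fun idx_ok :: "nat => tri => bool" where
 "idx_ok n (Tr a b c w) \<longleftrightarrow> a < n & b < n & c < n"

definition oidx :: "(nat \<times> nat) set" where
 "oidx = {(1, 0), (2, 1), (3, 2), (0, 3)}"

text \<open>\<open>K\<close> consists of the triangles of a tiling, with their weights, and of flat triangles with
 weight 0, whose second vertex is the middle one.\<close>

locale net =
 fixes Vs :: "(real^2) set" and K :: "(triple \<times> nat) set" and tv :: "real^2 => bool"
  and cl :: "real^2 => real^2 => bool" and cf :: cfg
 assumes finK: "finite K"
  and K_uniq: "k : K ==> k' : K ==> e : tedges (fst k) ==> e : tedges (fst k') ==> k = k'"
  and K_outer: "k : K ==> tedges (fst k) Int oedges = {}"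
  and K_match: "(p, q) : oedges Un (\<Union>k\<in>K. tedges (fst k)) ==> (q, p) : oedges Un (\<Union>k\<in>K. tedges (fst k))"
  and K_verts: "k : K ==> tverts (fst k) <= Vs"
  and Vs_sq: "Vs <= unit_square" and corner_Vs: "corner_set <= Vs"
  and K_real: "k : K ==> snd k ~= 0 ==> snd k <= 3 &
    real_of_int (tlo (snd k)) <= 67108864 * tor (fst k) & 67108864 * tor (fst k) <= real_of_int (thi (snd k))"
  and K_flat: "k : K ==> snd k = 0 ==> flat (fst k) & tv (tmid (fst k))"
  and K_mid: "k : K ==> k' : K ==> snd k = 0 ==> snd k' = 0 ==> tmid (fst k) = tmid (fst k') ==> k = k'"
  and corner_tv: "c : corner_set ==> ~ tv c"
  and K_cl: "k : K ==> (p, q) : tedges (fst k) ==> cl p q"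
  and outer_cl: "(p, q) : oedges ==> cl p q"
  and cl_sym: "cl p q ==> cl q p"
  and cl_join: "m : Vs ==> m : open_segment p q ==> cl p m ==> cl m q ==> cl p q"
  and K_merge: "a : Vs ==> b : Vs ==> c : Vs ==> cl a b ==> cl b c ==> cl c a ==> 0 < orient a b c ==>
    EX k:K. snd k ~= 0 & fst k : rots (a, b, c)"
  and K_sum: "S <= {k : K. snd k ~= 0} ==> sum snd S <= 7"
  and K_count: "S <= {k : K. snd k ~= 0} ==> A <= Vs - corner_set ==> B <= Vs ==> finite A ==> finite B ==>
    (!!v. v : A ==> ~ tv v) ==> (!!v. v : B ==> tv v) ==> 2 * card A + card B + 2 + sum snd S <= card S + 7"
  and cf_mask: "k : K ==> i < 4 ==> (corner i, corner (next_side i)) : tedges (fst k) ==>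
    cf = Cfg l nf hf ==> (nget l i = 1 --> snd k ~= 0) & (nget l i = 2 --> snd k = 0)"
  and cf_ear: "cf = Cfg l True hf ==> k : K ==> snd k ~= 0 ==> i < 4 ==>
    fst k : rots (corner i, corner (next_side i), z) ==> j = next_side i | next_side j = i ==> j < 4 ==>
    ~ (j = 0 & z$2 = 0 | j = 1 & z$1 = 1 | j = 2 & z$2 = 1 | j = 3 & z$1 = 0)"
  and cf_half: "cf = Cfg l nf True ==> k : K ==> snd k ~= 0 ==> fst k : rots (corner 0, corner 1, z) ==> z$1 <= 1 / 2"
begin

text \<open>Under the naming \<open>f\<close> of vertices, \<open>t\<close> describes
  \<open>k\<close>. Proper triangles agree up to rotation, flat ones exactly, since there the second
  place marks the middle.\<close>

fun rz :: "(nat => real^2) => tri => triple \<times> nat => bool" where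
 "rz f (Tr a b c w) k \<longleftrightarrow> k : K & snd k = w & (if w = 0 then fst k = (f a, f b, f c) else fst k : rots (f a, f b, f c))"

lemma rz_edges: "rz f t k ==> tedges (fst k) = (%(i, j). (f i, f j)) ` idx_edges t"
 by (cases t) (auto dest: tedges_rots split: if_splits)

lemma rz_K: "rz f t k ==> k : K"
 by (cases t) auto

lemma rz_uniq: "rz f t k ==> rz f t k' ==> k = k'"
 using K_uniq[of k k'] rz_edges[of f t k] rz_edges[of f t k'] rz_K by (cases t) auto

definition placed :: "(nat => real^2) => tri list => (triple \<times> nat) set" where
 "placed f ts = {k : K. snd k ~= 0 & (EX t:set ts. rz f t k)}"

text \<open>The last conjunct makes the stored lists exact, so that an edge missing from them is
  known to be free.\<close>

definition vok :: "(nat => real^2) => tri list => nat => vtx => bool" where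
 "vok f ts i v \<longleftrightarrow> f i : Vs & inbox (vbox v) (f i) & (vkind v = 0 --> i < 4)
   & (vkind v = 1 --> ~ tv (f i) & f i ~: corner_set) & (2 <= vkind v --> tv (f i))
   & (3 <= vkind v --> (EX a c. Tr a i c 0 : set ts))
   & (ALL j. j : set (vouts v) \<longleftrightarrow> (i, j) : oidx | (EX t:set ts. (i, j) : idx_edges t))"

fun regok :: "(nat => real^2) => nat => tri => bool" where
 "regok f n (Tr a b c w) \<longleftrightarrow> a < n & b < n & c < n &
   real_of_int (tlo w) <= 67108864 * orient (f a) (f b) (f c) & 67108864 * orient (f a) (f b) (f c) <= real_of_int (thi w) &
   (w = 0 --> f b : open_segment (f a) (f c) | f a = f b & f b = f c)"

definition factok :: "(nat => real^2) => nat => nat \<times> nat \<times> nat => bool" where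
 "factok f n = (%(a, m, c). a < n & m < n & c < n & f m : open_segment (f a) (f c) & cl (f a) (f m) & cl (f m) (f c))"

definition kinds1 :: "vtx list => nat" where "kinds1 vs = length (filter (%x. x = 1) (map vkind vs))"
definition kinds2 :: "vtx list => nat" where "kinds2 vs = length (filter (%x. 2 <= x) (map vkind vs))"

text \<open>The two equations keep the accounts. The triangles placed and the weight left bound the
  total number of triangles, so by \<open>K_count\<close> the budget \<open>e\<close> is what
  vertices still to be named may cost.\<close>

fun sat :: "(nat => real^2) => st => bool" where
 "sat f (St vs ts fs W e t c) \<longleftrightarrow> c = cf & 4 <= length vs & (ALL i<4. f i = corner i) & inj_on f {..<length vs}
   & (ALL i<length vs. vok f ts i (vs ! i))
   & (ALL t:set ts. idx_ok (length vs) t & (EX k. rz f t k))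
   & (ALL x:set fs. factok f (length vs) x)
   & sum snd (placed f ts) + W = 7
   & e + 2 + 2 * kinds1 vs + kinds2 vs = card (placed f ts) + W
   & regok f (length vs) t"

declare sat.simps [simp del]

lemma satD:
 assumes "sat f (St vs ts fs W e t c)"
 shows "c = cf" "4 <= length vs" "!!i. i < 4 ==> f i = corner i" "inj_on f {..<length vs}"
  "!!i. i < length vs ==> vok f ts i (vs ! i)" "!!t. t : set ts ==> idx_ok (length vs) t"
  "!!t. t : set ts ==> EX k. rz f t k" "!!x. x : set fs ==> factok f (length vs) x"
  "sum snd (placed f ts) + W = 7" "e + 2 + 2 * kinds1 vs + kinds2 vs = card (placed f ts) + W"
  "regok f (length vs) t"
 using assms by (auto simp: sat.simps)

lemma sat_box:
 assumes s: "sat f (St vs ts fs W e t c)" and i: "i < length vs" and b: "inbox b (f i)"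
 shows "sat f (St (set_box vs i b) ts fs W e t c)"
proof -
 have k: "map vkind (set_box vs i b) = map vkind vs"
  using i by (intro nth_equalityI) (auto simp: set_box_nth)
 then have kk: "kinds1 (set_box vs i b) = kinds1 vs" "kinds2 (set_box vs i b) = kinds2 vs"
  unfolding kinds1_def kinds2_def by simp_all
 have "vok f ts j (set_box vs i b ! j)" if j: "j < length vs" for j
  using satD(5)[OF s j] i j b by (auto simp: set_box_nth vok_def)
 then show ?thesis using satD[OF s] kk by (simp add: sat.simps)
qed

lemma sat_reg:
 assumes "sat f (St vs ts fs W e t c)" "regok f (length vs) t'" shows "sat f (St vs ts fs W e t' c)"
 using assms by (simp add: sat.simps)

lemma rz_regok:
 assumes "rz f t k" "idx_ok n t" shows "regok f n t"
proof (cases t)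
 case (Tr a b c w)
 show ?thesis
 proof (cases "w = 0")
  case True
  then have "f b : open_segment (f a) (f c)" using K_flat[of k] assms Tr by auto
  then obtain u where "f b = (1 - u) *\<^sub>R f a + u *\<^sub>R f c" by (auto elim: in_open_segmentE)
  moreover have "orient (f a) ((1 - u) *\<^sub>R f a + u *\<^sub>R f c) (f c) = 0" by (simp add: orient_def algebra_simps)
  ultimately have "orient (f a) (f b) (f c) = 0" by metis
  then show ?thesis using assms Tr True \<open>f b : _\<close> by simp
 next
  case False
  then have "tor (fst k) = orient (f a) (f b) (f c)" using assms Tr tor_rots[of "fst k" "(f a, f b, f c)"] by simp
  then show ?thesis using K_real[of k] assms Tr False by simp
 qed
qed

lemma vbox_in: "sat f (St vs ts fs W e t c) ==> i < length vs ==> inbox (vbox (vget vs i)) (f i)"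
 using satD(5) by (simp add: vget_nth vok_def)

text \<open>The invariant of a run, for a fixed net: some state of the stack describes it.\<close>

definition ok :: "st list => bool" where "ok l \<longleftrightarrow> (EX s:set l. EX f. sat f s)"

lemma ok_append: "ok (a @ b) \<longleftrightarrow> ok a | ok b"
 by (auto simp: ok_def)

lemma okI: "sat f s ==> s : set l ==> ok l"
 by (auto simp: ok_def)

lemma tget_cases: "tget ts i t : set ts | tget ts i t = t"
 by (induction ts i t rule: tget.induct) auto

lemma set_reg_sat: "sat f s ==> sat f (set_reg i s)"
proof -
 assume s: "sat f s"
 obtain vs ts fs W e t c where S: "s = St vs ts fs W e t c" by (cases s)
 have "regok f (length vs) (tget ts i t)"
  using tget_cases[of ts i t] satD(6,7,11)[OF s[unfolded S]] rz_regok by metis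
 then show ?thesis using sat_reg[OF s[unfolded S]] S by simp
qed

lemma rest_states_ok:
 assumes s: "sat f (St vs ts fs W e t c)" and i: "i < length vs" and b: "inbox y (f i)"
 shows "ok (rest_states [y] i (St vs ts fs W e t c))"
 using sat_box[OF assms] by (auto simp: ok_def)

section \<open>Commands that shrink boxes, use symmetry or record collinearity\<close>

lemma cut_ok:
 assumes sat: "sat f s" shows "ok (cut r v k sd dir d s)"
proof -
 obtain vs ts fs W e t c where S: "s = St vs ts fs W e t c" by (cases s)
 obtain a b c' w where t: "t = Tr a b c' w" by (cases t)
 note s = sat[unfolded S t]
 have ix: "a < length vs" "b < length vs" "c' < length vs" and
  o: "real_of_int (tlo w) <= 67108864 * orient (f a) (f b) (f c')" "67108864 * orient (f a) (f b) (f c') <= real_of_int (thi w)"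
  using satD(11)[OF s] by auto
 define u where "u = sel v a b c'"
 have v: "v = 0 | v = Suc 0 | (EX n. v = Suc (Suc n))" by (metis not0_implies_Suc)
 then have u: "u < length vs" using ix by (auto simp: u_def)
 note bx = vbox_in[OF s ix(1)] vbox_in[OF s ix(2)] vbox_in[OF s ix(3)]
 obtain x bs where sp: "split_box k sd d (vbox (vget vs u)) = (x, bs)" by fastforce
 have cs: "cut r v k sd dir d s = cut2 (dead_sub r v dir w x (vbox (vget vs a)) (vbox (vget vs b)) (vbox (vget vs c'))) bs u s"
  using sp by (simp add: S t u_def)
 show ?thesis
 proof (cases "dead_sub r v dir w x (vbox (vget vs a)) (vbox (vget vs b)) (vbox (vget vs c'))")
  case True
  have "~ inbox x (f u)"
  proof
   assume "inbox x (f u)"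
   then show False using True v dead3_sound[of _ "f a" _ "f b" _ "f c'" w r dir] o bx by (auto simp: u_def)
  qed
  then obtain y where "bs = [y]" "inbox y (f u)" using split_box_sound[OF vbox_in[OF s u] sp] by blast
  then show ?thesis using rest_states_ok[OF s u] True cs by (simp add: S t)
 next
  case False
  then show ?thesis using cs sat by (simp add: ok_def) blast
 qed
qed

lemma squeeze_ok:
 assumes sat: "sat f s" shows "ok (squeeze s)"
proof -
 obtain vs ts fs W e t c where S: "s = St vs ts fs W e t c" by (cases s)
 obtain a b c' w where t: "t = Tr a b c' w" by (cases t)
 note s = sat[unfolded S t]
 show ?thesis
 proof (cases w)
  case 0
  have ix: "a < length vs" "b < length vs" "c' < length vs" and
   m: "f b : open_segment (f a) (f c') | f a = f b & f b = f c'"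
   using satD(11)[OF s] 0 by auto
  have m': "f b : open_segment (f c') (f a) | f c' = f b & f b = f a" using m by (metis open_segment_commute)
  define A where "A = vbox (vget vs a)"
  define C where "C = vbox (vget vs c')"
  define M' where "M' = mid_box A (vbox (vget vs b)) C"
  define C' where "C' = end_box A M' C"
  define A' where "A' = end_box C' M' A"
  have in1: "inbox A (f a)" "inbox C (f c')" using vbox_in[OF s] ix by (simp_all add: A_def C_def)
  have inM: "inbox M' (f b)" unfolding M'_def using mid_box_sound[OF m in1(1) vbox_in[OF s ix(2)] in1(2)] .
  have inC: "inbox C' (f c')" unfolding C'_def by (rule end_box_sound[OF m in1(1) inM in1(2)])
  have inA: "inbox A' (f a)" unfolding A'_def by (rule end_box_sound[OF m' inC inM in1(1)])
  have "sat f (St (set_box (set_box (set_box vs a A') b M') c' C') ts fs W e t c)"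
   using sat_box[OF sat_box[OF sat_box[OF s ix(1) inA] _ inM] _ inC] ix t by simp
  then show ?thesis using nonempty_inbox inA inC inM 0
   by (auto simp: S t A'_def C'_def M'_def A_def C_def ok_def)
 next
  case (Suc n)
  then show ?thesis using sat by (auto simp: S t ok_def)
 qed
qed

lemma bisect_ok:
 assumes sat: "sat f s" shows "ok (bisect v k d s)" 
proof -
 obtain vs ts fs W e t c where S: "s = St vs ts fs W e t c" by (cases s)
 note s = sat[unfolded S]
 obtain x bs where sp: "split_box k False d (vbox (vget vs v)) = (x, bs)" by fastforce
 have e: "bisect v k d s = rest_states [x] v (St vs ts fs W e t c) @ rest_states bs v (St vs ts fs W e t c)"
  unfolding S bisect.simps sp bisect2.simps ..
 show ?thesis
 proof (cases "v < length vs")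
  case True
  consider "inbox x (f v)" | y where "bs = [y]" "inbox y (f v)"
   using split_box_sound[OF vbox_in[OF s True] sp] by blast
  then show ?thesis unfolding e ok_append using rest_states_ok[OF s True] by cases metis+
 next
  case False
  have "set_box vs v y = vs" for y using False by (induction vs v y rule: set_box.induct) auto
  then show ?thesis using sat by (simp add: e ok_append) (auto simp: ok_def S)
 qed
qed

lemma finite_placed: "finite (placed f ts)"
 using finK by (simp add: placed_def)

lemma placed_sub: "placed f ts <= {k : K. snd k ~= 0}"
 by (auto simp: placed_def)

lemma has_real_D:
 assumes "has_real a b c ts"
 obtains x y z w where "Tr x y z (Suc w) : set ts" "(a, b, c) = (x, y, z) | (a, b, c) = (y, z, x) | (a, b, c) = (z, x, y)"
proof -
 have "EX x y z w. Tr x y z (Suc w) : set ts & ((a, b, c) = (x, y, z) | (a, b, c) = (y, z, x) | (a, b, c) = (z, x, y))"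
  using assms
 proof (induction ts)
  case (Cons t ts)
  show ?case
  proof (cases "has_real a b c ts")
   case True
   then show ?thesis using Cons.IH by (meson list.set_intros(2))
  next
   case False
   then have r: "same_real a b c t" using Cons.prems by simp
   obtain x y z u where t: "t = Tr x y z u" by (cases t)
   obtain w where "u = Suc w" using r t by (cases u) auto
   then show ?thesis using r t by (intro exI[of _ x] exI[of _ y] exI[of _ z] exI[of _ w]) auto
  qed
 qed simp
 then show ?thesis using that by blast
qed

lemma has_real_I:
 assumes "Tr x y z (Suc w) : set ts" "(a, b, c) = (x, y, z) | (a, b, c) = (y, z, x) | (a, b, c) = (z, x, y)"
 shows "has_real a b c ts"
 using assms by (induction ts) auto

lemma has_real_real:
 assumes s: "sat f (St vs ts fs W e t c)" and h: "has_real x y z ts"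
 obtains k where "k : K" "snd k ~= 0" "fst k : rots (f x, f y, f z)" "x < length vs" "y < length vs" "z < length vs"
proof -
 obtain a b d w where t: "Tr a b d (Suc w) : set ts"
  and p: "(x, y, z) = (a, b, d) | (x, y, z) = (b, d, a) | (x, y, z) = (d, a, b)" using has_real_D[OF h] by blast
 obtain k where "rz f (Tr a b d (Suc w)) k" using satD(7)[OF s t] by blast
 then have "k : K" "snd k ~= 0" "fst k : rots (f x, f y, f z)" using p by auto
 moreover have "x < length vs" "y < length vs" "z < length vs" using satD(6)[OF s t] p by auto
 ultimately show ?thesis using that by blast
qed

lemma half_ok:
 assumes sat: "sat f s" shows "ok (half g s)"
proof -
 obtain vs ts fs W e t c where S: "s = St vs ts fs W e t c" by (cases s)
 obtain l nf hf where C: "c = Cfg l nf hf" by (cases c)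
 note s = sat[unfolded S]
 show ?thesis
 proof (cases "hf & has_real 0 (Suc 0) g ts")
  case True
  then obtain k where k: "k : K" "snd k ~= 0" "fst k : rots (f 0, f (Suc 0), f g)" "g < length vs"
   using has_real_real[OF s] by blast
  have "cf = Cfg l nf True" using satD(1)[OF s] C True by simp
  then have h: "f g$1 <= 1 / 2" using cf_half[OF _ k(1,2)] k(3) satD(3)[OF s, of 0] satD(3)[OF s, of 1] by simp
  have "inbox (half2 (vbox (vget vs g))) (f g)"
   using vbox_in[OF s k(4)] h by (cases "vbox (vget vs g)") auto
  from sat_box[OF s k(4) this] show ?thesis using True by (intro okI) (simp_all add: S C)
 next
  case False
  then have "half g s = [s]" by (auto simp: S C)
  then show ?thesis using sat by (auto simp: ok_def)
 qed
qed

lemma pinned_sound: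
 assumes "pinned j b" "inbox b z" "z : unit_square" "j < 4"
 shows "j = 0 & z$2 = 0 | j = 1 & z$1 = 1 | j = 2 & z$2 = 1 | j = 3 & z$1 = 0"
proof -
 obtain xl xh yl yh where b: "b = Bx xl xh yl yh" by (cases b)
 have q: "0 <= z$1" "z$1 <= 1" "0 <= z$2" "z$2 <= 1" using assms(3) by (auto simp: usq_iff)
 consider "j = 0" | "j = 1" | "j = 2" | "j = 3" using assms(4) by linarith
 then show ?thesis
 proof cases
  case 1
  then have "yh <= 0" using assms(1) b by simp
  then have "real_of_int yh <= 0" by simp
  then show ?thesis using 1 assms(2) b q by simp
 next
  case 2
  then have "8192 <= xl" using assms(1) b by simp
  then have "8192 <= real_of_int xl" by linarith
  then show ?thesis using 2 assms(2) b q by simp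
 next
  case 3
  then have "8192 <= yl" using assms(1) b by (simp add: numeral_2_eq_2)
  then have "8192 <= real_of_int yl" by linarith
  then show ?thesis using 3 assms(2) b q by simp
 next
  case 4
  then have "xh <= 0" using assms(1) b by (simp add: numeral_3_eq_3)
  then have "real_of_int xh <= 0" by simp
  then show ?thesis using 4 assms(2) b q by simp
 qed
qed

lemma is_side_iff: "is_side p q \<longleftrightarrow> p < 4 & q = next_side p"
 by (cases "(p, q)" rule: is_side.cases) auto

lemma ear_ok:
 assumes sat: "sat f s" shows "ok (ear p g s)"
proof -
 obtain vs ts fs W e t c where S: "s = St vs ts fs W e t c" by (cases s)
 obtain l nf hf where C: "c = Cfg l nf hf" by (cases c)
 note s = sat[unfolded S]
 define j1 j2 where "j1 = next_side p" and "j2 = next_side (next_side (next_side p))"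
 show ?thesis
 proof (cases "nf & is_side p (next_side p) & has_real p (next_side p) g ts &
   (pinned j1 (vbox (vget vs g)) | pinned j2 (vbox (vget vs g)))")
  case True
  then have p: "p < 4" by (simp add: is_side_iff)
  then have j: "j1 < 4" "j2 < 4" "next_side j2 = p" unfolding j1_def j2_def
   by (cases p rule: next_side.cases; simp)+
  obtain k where k: "k : K" "snd k ~= 0" "fst k : rots (f p, f j1, f g)" "g < length vs"
   using has_real_real[OF s] True unfolding j1_def by blast
  have c: "cf = Cfg l True hf" using satD(1)[OF s] C True by simp
  have "f p = corner p" "f j1 = corner j1" using satD(3)[OF s] p j by blast+
  then have k3: "fst k : rots (corner p, corner (next_side p), f g)" using k(3) j1_def by simp
  have sq: "f g : unit_square" using satD(5)[OF s k(4)] Vs_sq by (auto simp: vok_def)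
  have False
   using True pinned_sound[OF _ vbox_in[OF s k(4)] sq j(1)] pinned_sound[OF _ vbox_in[OF s k(4)] sq j(2)]
    cf_ear[OF c k(1,2) p k3, of j1] cf_ear[OF c k(1,2) p k3, of j2] j j1_def by blast
  then show ?thesis ..
 next
  case False
  then have "ear p g s = [s]" by (auto simp: S C j1_def j2_def)
  then show ?thesis using sat by (auto simp: ok_def)
 qed
qed

lemma line_chain:
 assumes d: "d ~= (0::real^2)" and s: "0 < x" "x < y" "y < z" and p: "m = a + x *\<^sub>R d" "q = a + y *\<^sub>R d" "c = a + z *\<^sub>R d"
 shows "m : open_segment a q" "q : open_segment m c" "q : open_segment a c" "m : open_segment a c"
 using seg_param[of 0 y d a] seg_param[of x z d a] seg_param[of 0 z d a] d s by (simp_all add: p)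

text \<open>In each case the four points are written with increasing parameters on one line; the
  cases differ in the two points that span it.\<close>

lemma chain_between:
 assumes "m : open_segment a c & q : open_segment m c | m : open_segment a q & q : open_segment m c
  | q : open_segment a c & m : open_segment a (q::real^2)"
 shows "m : open_segment a q & q : open_segment m c & q : open_segment a c & m : open_segment a c"
 using assms
proof (elim disjE conjE)
 assume "m : open_segment a c" "q : open_segment m c"
 then obtain u v where u: "0 < u" "u < 1" "m = (1 - u) *\<^sub>R a + u *\<^sub>R c" "a ~= c"
  and v: "0 < v" "v < 1" "q = (1 - v) *\<^sub>R m + v *\<^sub>R c" by (elim in_open_segmentE) blast
 have "m = a + u *\<^sub>R (c - a)" "q = a + (u + v * (1 - u)) *\<^sub>R (c - a)" "c = a + 1 *\<^sub>R (c - a)"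
  by (simp_all add: u(3) v(3) algebra_simps)
 note e = this
 have "0 < v * (1 - u)" "0 < (1 - u) * (1 - v)" using u v by simp_all
 then have l: "u < u + v * (1 - u)" "u + v * (1 - u) < 1" by (simp_all add: algebra_simps)
 have "c - a ~= 0" using u by simp
 from line_chain[OF this u(1) l e] show ?thesis by blast
next
 assume "m : open_segment a q" "q : open_segment m c"
 then obtain u v where u: "0 < u" "u < 1" "m = (1 - u) *\<^sub>R a + u *\<^sub>R q" "a ~= q"
  and v: "0 < v" "v < 1" "q = (1 - v) *\<^sub>R m + v *\<^sub>R c" by (elim in_open_segmentE) blast
 have m: "m = a + u *\<^sub>R (q - a)" by (simp add: u(3) algebra_simps)
 have "v *\<^sub>R c = q - (1 - v) *\<^sub>R m" using v(3) by (simp add: algebra_simps)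
 also have "... = v *\<^sub>R a + (1 - u + u * v) *\<^sub>R (q - a)" by (simp add: m algebra_simps)
 finally have "(1 / v) *\<^sub>R (v *\<^sub>R c) = (1 / v) *\<^sub>R (v *\<^sub>R a + (1 - u + u * v) *\<^sub>R (q - a))" by simp
 then have c: "c = a + ((1 - u + u * v) / v) *\<^sub>R (q - a)" using v by (simp add: scaleR_right_distrib)
 have "0 < (1 - u) * (1 - v)" using u v by simp
 then have l: "1 < (1 - u + u * v) / v" using v by (simp add: algebra_simps)
 have "q - a ~= 0" "q = a + 1 *\<^sub>R (q - a)" using u by simp_all
 from line_chain[OF this(1) u(1,2) l m this(2) c] show ?thesis by blast
next
 assume "q : open_segment a c" "m : open_segment a q"
 then obtain u v where u: "0 < u" "u < 1" "q = (1 - u) *\<^sub>R a + u *\<^sub>R c" "a ~= c"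
  and v: "0 < v" "v < 1" "m = (1 - v) *\<^sub>R a + v *\<^sub>R q" by (elim in_open_segmentE) blast
 have "q = a + u *\<^sub>R (c - a)" "m = a + (v * u) *\<^sub>R (c - a)" "c = a + 1 *\<^sub>R (c - a)"
  by (simp_all add: u(3) v(3) algebra_simps)
 note e = this
 have l: "0 < v * u" "v * u < u" using u v by auto
 have "c - a ~= 0" using u by simp
 from line_chain[OF this l u(2) e(2,1,3)] show ?thesis by blast
qed

lemma factok_sym: "factok f n (a, m, c) ==> factok f n (c, m, a)"
 using cl_sym by (auto simp: factok_def open_segment_commute)

lemma is_fact_ok:
 assumes "!!x. x : set fs ==> factok f n x" "is_fact a m c fs" shows "factok f n (a, m, c)"
 using assms
proof (induction fs)
 case (Cons h fs)
 obtain x y z where h: "h = (x, y, z)" by (cases h)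
 have "factok f n (x, y, z)" using Cons.prems(1) h by auto
 then show ?case using Cons h factok_sym[of f n x y z] by auto
qed simp

lemma chain_ok:
 assumes sat: "sat f s" shows "ok (chain a m x d s)"
proof -
 obtain vs ts fs W e t c where S: "s = St vs ts fs W e t c" by (cases s)
 note s = sat[unfolded S]
 define b where "b \<longleftrightarrow> (is_fact a m d fs & is_fact m x d fs | is_fact a m x fs & is_fact m x d fs | is_fact a x d fs & is_fact a m x fs)"
 have cb: "chain a m x d s = chain1 b a m x d (St vs ts fs W e t c)"
  by (simp only: S chain.simps b_def orf_iff andf_iff)
 show ?thesis
 proof (cases b)
  case True
  note F = is_fact_ok[of fs f "length vs", OF satD(8)[OF s]]
  have fo: "factok f (length vs) (a, m, d) & factok f (length vs) (m, x, d) |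
    factok f (length vs) (a, m, x) & factok f (length vs) (m, x, d) |
    factok f (length vs) (a, x, d) & factok f (length vs) (a, m, x)"
   using True F unfolding b_def by blast
  then have bt: "f m : open_segment (f a) (f x) & f x : open_segment (f m) (f d) & f x : open_segment (f a) (f d) & f m : open_segment (f a) (f d)"
   by (intro chain_between) (auto simp: factok_def)
  have ix: "a < length vs" "m < length vs" "x < length vs" "d < length vs" using fo by (auto simp: factok_def)
  have c1: "cl (f a) (f m)" "cl (f m) (f x)" "cl (f x) (f d)" using fo by (auto simp: factok_def)
  have V: "f m : Vs" "f x : Vs" using satD(5)[OF s] ix by (auto simp: vok_def)
  have c2: "cl (f a) (f x)" "cl (f m) (f d)" using cl_join V bt c1 by blast+
  have "sat f (St vs ts ((a, m, x) # (m, x, d) # (a, x, d) # (a, m, d) # fs) W e t c)"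
   using s bt ix c1 c2 by (simp add: sat.simps factok_def)
  then show ?thesis unfolding cb using True by (intro okI) simp_all
 next
  case False
  then show ?thesis unfolding cb using s by (intro okI) simp_all
 qed
qed

end

context net
begin

section \<open>Commands that attach triangles\<close>

lemma satI:
 assumes "c = cf" "4 <= length vs" "!!i. i < 4 ==> f i = corner i" "inj_on f {..<length vs}"
  "!!i. i < length vs ==> vok f ts i (vs ! i)" "!!t. t : set ts ==> idx_ok (length vs) t"
  "!!t. t : set ts ==> EX k. rz f t k" "!!x. x : set fs ==> factok f (length vs) x"
  "sum snd (placed f ts) + W = 7" "e + 2 + 2 * kinds1 vs + kinds2 vs = card (placed f ts) + W"
  "regok f (length vs) t"
 shows "sat f (St vs ts fs W e t c)"
 unfolding sat.simps using assms by blast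

lemma kids3_eq: "kids3 m lo ng p q g (St vs ts fs W e t c) =
  (if m = 2 then [] else real_kids lo ng p q g (St vs ts fs W e t c) (wcand W e))
  @ (if m = 1 then [] else flat_kids (andf (lo <= 0) (ng <= 0)) p q g (St vs ts fs W e t c))"
proof -
 consider "m = 0" | "m = Suc 0" | "m = Suc (Suc 0)" | n where "m = Suc (Suc (Suc n))" by (metis not0_implies_Suc)
 then show ?thesis by cases (simp_all del: flat_kids.simps andf_iff)
qed

lemma corner_mem: "i < 4 ==> corner i : corner_set"
 by (cases i rule: corner.cases) (auto simp: corner_set_def)

lemma oidx_oedges: "(i, j) : oidx \<longleftrightarrow> i < 4 & j < 4 & (corner i, corner j) : oedges"
proof
 show "(i, j) : oidx ==> i < 4 & j < 4 & (corner i, corner j) : oedges"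
  by (auto simp: oidx_def oedges_def numeral_2_eq_2 numeral_3_eq_3)
 assume h: "i < 4 & j < 4 & (corner i, corner j) : oedges"
 then have "i = 0 | i = 1 | i = 2 | i = 3" "j = 0 | j = 1 | j = 2 | j = 3" by linarith+
 then show "(i, j) : oidx" using h
  by (elim disjE) (simp_all add: oidx_def oedges_def numeral_2_eq_2 numeral_3_eq_3)
qed

lemma idx_edges_lt: "idx_ok n t ==> (i, j) : idx_edges t ==> i < n & j < n"
 by (cases t) auto

lemma used_iff:
 assumes s: "sat f (St vs ts fs W e t c)"
 shows "used vs i j \<longleftrightarrow> (i, j) : oidx | (EX t:set ts. (i, j) : idx_edges t)"
proof (cases "i < length vs")
 case True
 then show ?thesis using satD(5)[OF s True] by (simp add: used_def vok_def vget_nth)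
next
 case False
 then show ?thesis using idx_edges_lt satD(2,6)[OF s] oidx_oedges[of i j]
  by (fastforce simp: used_def vget_out)
qed

lemma used_lt:
 assumes s: "sat f (St vs ts fs W e t c)" and u: "used vs i j"
 shows "i < length vs & j < length vs"
 using u used_iff[OF s] idx_edges_lt satD(2,6)[OF s] oidx_oedges[of i j] by fastforce

lemma used_edge:
 assumes s: "sat f (St vs ts fs W e t c)" and u: "used vs i j"
 shows "(f i, f j) : oedges Un (\<Union>k\<in>K. tedges (fst k))"
proof -
 consider "(i, j) : oidx" | t where "t : set ts" "(i, j) : idx_edges t" using u used_iff[OF s] by blast
 then show ?thesis
 proof cases
  case 1
  then show ?thesis using oidx_oedges[of i j] satD(3)[OF s] by auto
 next
  case (2 t')
  then obtain k where "rz f t' k" using satD(7)[OF s] by blast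
  then show ?thesis using rz_edges[of f t' k] rz_K[of f t' k] 2 by force
 qed
qed

text \<open>A directed side has a single owner in the net, so it is used exactly when this owner has
  been placed.\<close>

lemma used_placed:
 assumes s: "sat f (St vs ts fs W e t c)" and k: "k : K" and ij: "i < length vs" "j < length vs"
  and ed: "(f i, f j) : tedges (fst k)"
 shows "used vs i j \<longleftrightarrow> (EX t:set ts. rz f t k)"
proof
 assume "used vs i j"
 then consider "(i, j) : oidx" | t where "t : set ts" "(i, j) : idx_edges t" using used_iff[OF s] by blast
 then show "EX t:set ts. rz f t k"
 proof cases
  case 1
  then have "(f i, f j) : oedges" using oidx_oedges[of i j] satD(3)[OF s] by auto
  then show ?thesis using K_outer[OF k] ed by blast
 next
  case (2 t')
  then obtain k' where k': "rz f t' k'" using satD(7)[OF s] by blast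
  then have "(f i, f j) : tedges (fst k')" using rz_edges[OF k'] 2 by force
  then have "k' = k" using K_uniq[OF rz_K[OF k'] k] ed by blast
  then show ?thesis using k' 2 by blast
 qed
next
 assume "EX t:set ts. rz f t k"
 then obtain t' where t': "t' : set ts" "rz f t' k" by blast
 then obtain x y where xy: "(x, y) : idx_edges t'" "f x = f i" "f y = f j" using rz_edges[OF t'(2)] ed by force
 have "x < length vs" "y < length vs" using idx_edges_lt[OF satD(6)[OF s t'(1)] xy(1)] by auto
 then have "x = i" "y = j" using satD(4)[OF s] xy ij unfolding inj_on_def by auto
 then show "used vs i j" using used_iff[OF s] xy(1) t'(1) by blast
qed

lemma kinds_card:
 assumes s: "sat f (St vs ts fs W e t c)"
 shows "kinds1 vs = card (f ` {i. i < length vs & vkind (vs ! i) = 1})"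
  "kinds2 vs = card (f ` {i. i < length vs & 2 <= vkind (vs ! i)})"
proof -
 have inj: "inj_on f {i. i < length vs & Q i}" for Q using satD(4)[OF s] by (auto simp: inj_on_def)
 show "kinds1 vs = card (f ` {i. i < length vs & vkind (vs ! i) = 1})"
  unfolding kinds1_def length_filter_conv_card card_image[OF inj] by (auto intro: arg_cong[of _ _ card])
 show "kinds2 vs = card (f ` {i. i < length vs & 2 <= vkind (vs ! i)})"
  unfolding kinds2_def length_filter_conv_card card_image[OF inj] by (auto intro: arg_cong[of _ _ card])
qed

text \<open>The count for the vertices named so far, and for these together with one further vertex
  \<open>z\<close> of either sort. The latter forms show that the budget suffices for naming
  \<open>z\<close>.\<close>

lemma count_vs:
 assumes s: "sat f (St vs ts fs W e t c)" and S: "S <= {k : K. snd k ~= 0}"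
 shows "2 * kinds1 vs + kinds2 vs + 2 + sum snd S <= card S + 7"
  and "z : Vs ==> z ~: f ` {..<length vs} ==> ~ tv z ==> 2 * kinds1 vs + 2 + kinds2 vs + 2 + sum snd S <= card S + 7"
  and "z : Vs ==> z ~: f ` {..<length vs} ==> tv z ==> 2 * kinds1 vs + kinds2 vs + 1 + 2 + sum snd S <= card S + 7"
proof -
 let ?A = "f ` {i. i < length vs & vkind (vs ! i) = 1}" and ?B = "f ` {i. i < length vs & 2 <= vkind (vs ! i)}"
 have A: "?A <= Vs - corner_set" "finite ?A" "!!v. v : ?A ==> ~ tv v"
  using satD(5)[OF s] by (auto simp: vok_def)
 have B: "?B <= Vs" "finite ?B" "!!v. v : ?B ==> tv v"
  using satD(5)[OF s] by (auto simp: vok_def)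
 show "2 * kinds1 vs + kinds2 vs + 2 + sum snd S <= card S + 7"
  unfolding kinds_card[OF s] by (rule K_count[OF S A(1) B(1) A(2) B(2) A(3) B(3)])
 assume z: "z : Vs" "z ~: f ` {..<length vs}"
 then have zA: "z ~: ?A" "z ~: ?B" by auto
 have zc: "z ~: corner_set"
 proof
  assume "z : corner_set"
  then have "EX i<4. z = corner i"
   by (auto simp: corner_set_def intro: exI[of _ "0::nat"] exI[of _ "1::nat"] exI[of _ "2::nat"] exI[of _ "3::nat"] simp: numeral_2_eq_2 numeral_3_eq_3)
  then obtain i where i: "i < 4" "z = f i" using satD(3)[OF s] by metis
  then have "i < length vs" using satD(2)[OF s] by linarith
  then show False using z(2) i by blast
 qed
 show "2 * kinds1 vs + 2 + kinds2 vs + 2 + sum snd S <= card S + 7" if t: "~ tv z"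
 proof -
  have "insert z ?A <= Vs - corner_set" "finite (insert z ?A)" "!!v. v : insert z ?A ==> ~ tv v"
   using A z(1) zc t by auto
  from K_count[OF S this(1) B(1) this(2) B(2) this(3) B(3)] show ?thesis
   unfolding kinds_card[OF s] using zA A(2) by simp
 qed
 show "2 * kinds1 vs + kinds2 vs + 1 + 2 + sum snd S <= card S + 7" if t: "tv z"
 proof -
  have "insert z ?B <= Vs" "finite (insert z ?B)" "!!v. v : insert z ?B ==> tv v"
   using B z(1) t by auto
  from K_count[OF S A(1) this(1) A(2) this(2) A(3) this(3)] show ?thesis
   unfolding kinds_card[OF s] using zA B(2) by simp
 qed
qed

lemma add_edges_vok:
 assumes v: "vok f ts j (vs ! j)" and ix: "p < length vs" "q < length vs" "g < length vs" "j < length vs"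
 shows "vok f (Tr p q g w # ts) j (add_edges vs p q g ! j)"
proof -
 have "(j, i) : idx_edges (Tr p q g w) \<longleftrightarrow> (j, i) : {(p, q), (q, g), (g, p)}" for i by auto
 then show ?thesis
  using v unfolding vok_def add_edges_nth(1,2)[OF ix] add_edges_nth(3)[OF ix] by (auto simp del: idx_edges.simps)
qed

lemma kinds_eqI: "length vs = length vs' ==> (!!i. i < length vs ==> vkind (vs' ! i) = vkind (vs ! i)) ==>
  kinds1 vs' = kinds1 vs & kinds2 vs' = kinds2 vs"
proof -
 assume "length vs = length vs'" "!!i. i < length vs ==> vkind (vs' ! i) = vkind (vs ! i)"
 then have "map vkind vs' = map vkind vs" by (intro nth_equalityI) auto
 then show ?thesis by (simp add: kinds1_def kinds2_def)
qed

text \<open>The count for the placed triangles together with \<open>k\<close> gives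
  \<open>w <= e + 1\<close>, so the subtraction in the new budget does not truncate.\<close>

lemma put_real_sat:
 assumes s: "sat f (St vs ts fs W e t c)" and ix: "p < length vs" "q < length vs" "g < length vs"
  and k: "k : K" "fst k : rots (f p, f q, f g)" "snd k = w" "w ~= 0" and new: "!!t. t : set ts ==> ~ rz f t k"
 shows "(w, W - w, e + 1 - w) : set (wcand W e)" "sat f (put_real p q g w (W - w) (e + 1 - w) (St vs ts fs W e t c))"
proof -
 have rk: "rz f (Tr p q g w) k" using k by simp
 have knew: "k ~: placed f ts" using new by (auto simp: placed_def)
 have S: "insert k (placed f ts) <= {k : K. snd k ~= 0}" using placed_sub k by auto
 have w7: "sum snd (placed f ts) + w <= 7" using K_sum[OF S] knew finite_placed[of f ts] k(3) by simp
 have ct: "2 * kinds1 vs + kinds2 vs + 2 + (sum snd (placed f ts) + w) <= card (placed f ts) + 1 + 7"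
  using count_vs(1)[OF s S] knew finite_placed[of f ts] k(3) by simp
 have eq: "sum snd (placed f ts) + W = 7" "e + 2 + 2 * kinds1 vs + kinds2 vs = card (placed f ts) + W" using satD(9,10)[OF s] .
 have wW: "w <= W" "w <= e + 1" using w7 ct eq by linarith+
 have w3: "1 <= w" "w <= 3" using K_real[OF k(1)] k by auto
 show "(w, W - w, e + 1 - w) : set (wcand W e)" using wcand_mem[OF w3 wW] .
 have pl: "placed f (Tr p q g w # ts) = insert k (placed f ts)"
 proof -
  have iff: "rz f (Tr p q g w) k' \<longleftrightarrow> k' = k" for k' using rz_uniq[OF _ rk] rk by blast
  show ?thesis
   by (intro set_eqI) (unfold placed_def mem_Collect_eq insert_iff list.set bex_simps iff, use k in blast)
 qed
 have kd: "kinds1 (add_edges vs p q g) = kinds1 vs & kinds2 (add_edges vs p q g) = kinds2 vs"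
  by (intro kinds_eqI) (auto simp: add_edges_nth(1)[OF ix])
 have rg: "regok f (length vs) (Tr p q g w)" using rz_regok[OF rk] ix by simp
 have "!!j. j < length vs ==> vok f (Tr p q g w # ts) j (add_edges vs p q g ! j)"
  using add_edges_vok satD(5)[OF s] ix by blast
 note v = this
 have sm: "sum snd (insert k (placed f ts)) = sum snd (placed f ts) + w" "card (insert k (placed f ts)) = Suc (card (placed f ts))"
  using knew finite_placed[of f ts] k(3) by simp_all
 show "sat f (put_real p q g w (W - w) (e + 1 - w) (St vs ts fs W e t c))"
  unfolding put_real.simps
 proof (rule satI, unfold length_add_edges pl sm)
  show "EX k. rz f t' k" if "t' : set (Tr p q g w # ts)" for t'
   using that rk satD(7)[OF s, of t'] by (metis set_ConsD)
  show "idx_ok (length vs) t'" if "t' : set (Tr p q g w # ts)" for t'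
   using that satD(6)[OF s, of t'] ix by auto
  show "sum snd (placed f ts) + w + (W - w) = 7" using eq wW by linarith
  show "e + 1 - w + 2 + 2 * kinds1 (add_edges vs p q g) + kinds2 (add_edges vs p q g) = Suc (card (placed f ts)) + (W - w)"
   using eq wW kd by linarith
 qed (use satD(1-4,8)[OF s] v rg in blast)+
qed

text \<open>The middle vertex is a T-vertex, so its kind is 2 or more. Kind 3 would mean that its
  flat triangle is placed; as a middle vertex belongs to only one, that would be
  \<open>k\<close>.\<close>

lemma put_flat_ok:
 assumes s: "sat f (St vs ts fs W e t c)" and ix: "a < length vs" "m < length vs" "d < length vs"
  and k: "k : K" "fst k = (f a, f m, f d)" "snd k = 0" and new: "!!t. t : set ts ==> ~ rz f t k"
 shows "ok (flat_if (vkind (vget vs m)) a m d (St vs ts fs W e t c))"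
proof -
 have rk: "rz f (Tr a m d 0) k" using k by simp
 have kf: "f m : open_segment (f a) (f d)" "tv (f m)" using K_flat[OF k(1,3)] k(2) by auto
 note vm = satD(5)[OF s ix(2)]
 have kind: "vkind (vs ! m) = 2"
 proof -
  have "vkind (vs ! m) ~= 1" using vm kf(2) by (auto simp: vok_def)
  moreover have "vkind (vs ! m) ~= 0"
   using vm kf(2) corner_tv corner_mem satD(3)[OF s] by (metis vok_def)
  moreover have "~ 3 <= vkind (vs ! m)"
  proof
   assume "3 <= vkind (vs ! m)"
   then obtain x y where t': "Tr x m y 0 : set ts" using vm by (auto simp: vok_def)
   then obtain k' where k': "rz f (Tr x m y 0) k'" using satD(7)[OF s] by blast
   then have "k' = k" using K_mid[of k' k] k by auto
   then show False using new t' k' by blast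
  qed
  ultimately show ?thesis by linarith
 qed
 define x where "x = mid_box (vbox (vget vs a)) (vbox (vget vs m)) (vbox (vget vs d))"
 have inx: "inbox x (f m)"
  unfolding x_def by (rule mid_box_sound[OF _ vbox_in[OF s ix(1)] vbox_in[OF s ix(2)] vbox_in[OF s ix(3)]]) (use kf in blast)
 define vs1 where "vs1 = set_mid vs m x"
 have l1: "length vs1 = length vs" by (simp add: vs1_def)
 have n1: "vs1 ! j = (if j = m then Vx n3 (vouts (vs ! m)) x else vs ! j)" if "j < length vs" for j
  using set_mid_nth[OF ix(2) that] by (simp add: vs1_def)
 have pl: "placed f (Tr a m d 0 # ts) = placed f ts" by (auto simp: placed_def)
 have ad: "vkind (add_edges vs1 a m d ! i) = vkind (vs1 ! i)" if "i < length vs" for i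
  using add_edges_nth(1)[of a vs1 m d i] ix l1 that by simp
 have kd: "kinds1 (add_edges vs1 a m d) = kinds1 vs & kinds2 (add_edges vs1 a m d) = kinds2 vs"
 proof -
  have "length vs1 = length vs" by fact
  have m1: "map (%x. x = 1) (map vkind (add_edges vs1 a m d)) = map (%x. x = 1) (map vkind vs)"
   by (intro nth_equalityI) (use ad n1 l1 kind in auto)
  have m2: "map (%x. 2 <= x) (map vkind (add_edges vs1 a m d)) = map (%x. 2 <= x) (map vkind vs)"
   by (intro nth_equalityI) (use ad n1 l1 kind in auto)
  have "length (filter P xs) = length (filter id (map P xs))" for P :: "nat => bool" and xs
   by (induction xs) auto
  then show ?thesis unfolding kinds1_def kinds2_def using m1 m2 by metis
 qed
 have v1: "vok f (Tr a m d 0 # ts) j (add_edges vs1 a m d ! j)" if j: "j < length vs" for j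
 proof -
  note ixx = ix[folded l1] j[folded l1]
  have e: "(j, i) : idx_edges (Tr a m d 0) \<longleftrightarrow> (j, i) : {(a, m), (m, d), (d, a)}" for i by auto
  show ?thesis
   using satD(5)[OF s j] n1[OF j] inx kf(2) e
   unfolding vok_def add_edges_nth(1,2)[OF ixx] add_edges_nth(3)[OF ixx]
   by (auto simp del: idx_edges.simps)
 qed
 have rg: "regok f (length vs) (Tr a m d 0)" using rz_regok[OF rk] ix by simp
 have fo: "factok f (length vs) (a, m, d)"
  using kf ix K_cl[OF k(1)] k(2) by (simp add: factok_def)
 have "sat f (St (add_edges vs1 a m d) (Tr a m d 0 # ts) ((a, m, d) # fs) W e (Tr a m d 0) c)"
 proof (rule satI, unfold length_add_edges pl l1)
  show "EX k. rz f t' k" if "t' : set (Tr a m d 0 # ts)" for t'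
   using that rk satD(7)[OF s, of t'] by (metis set_ConsD)
  show "idx_ok (length vs) t'" if "t' : set (Tr a m d 0 # ts)" for t'
   using that satD(6)[OF s, of t'] ix by auto
  show "factok f (length vs) x" if "x : set ((a, m, d) # fs)" for x using that fo satD(8)[OF s, of x] by auto
  show "e + 2 + 2 * kinds1 (add_edges vs1 a m d) + kinds2 (add_edges vs1 a m d) = card (placed f ts) + W"
   using satD(10)[OF s] kd by simp
 qed (use satD(1-4,9)[OF s] v1 rg in blast)+
 moreover have "flat_if (vkind (vget vs m)) a m d (St vs ts fs W e t c) =
   [St (add_edges vs1 a m d) (Tr a m d 0 # ts) ((a, m, d) # fs) W e (Tr a m d 0) c]"
  using kind nonempty_inbox[OF inx, unfolded x_def] ix by (simp add: vget_nth numeral_2_eq_2 vs1_def x_def)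
 ultimately show ?thesis by (intro okI) simp_all
qed

lemma real_kids_mem:
 assumes "(w, W', e') : set l" "lo <= thi w" "ng <= - tlo w"
 shows "put_real p q g w W' e' s : set (real_kids lo ng p q g s l)"
 using assms by (induction l) auto

text \<open>As the edge from \<open>p\<close> to \<open>q\<close> is free, its owner
  \<open>k\<close> has not been placed; so the two other sides of \<open>k\<close> are free as well,
  and \<open>kids\<close> does not discard it.\<close>

lemma kids_ok:
 assumes s: "sat f (St vs ts fs W e t c)" and ix: "p < length vs" "q < length vs" "g < length vs"
  and k: "k : K" "fst k : rots (f p, f q, f g)" and nu: "~ used vs p q"
  and m: "m = 1 --> snd k ~= 0" "m = 2 --> snd k = 0"
 shows "ok (kids m p q g (St vs ts fs W e t c))"
proof -
 have ed: "tedges (fst k) = {(f p, f q), (f q, f g), (f g, f p)}" using tedges_rots[OF k(2)] by simp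
 have new: "~ rz f t' k" if "t' : set ts" for t'
  using used_placed[OF s k(1) ix(1,2)] ed nu that by blast
 have nu2: "~ used vs q g" "~ used vs g p"
  using used_placed[OF s k(1) ix(2,3)] used_placed[OF s k(1) ix(3,1)] ed new by blast+
 let ?s = "St vs ts fs W e t c"
 define lo ng where "lo = orient_low (vbox (vget vs p)) (vbox (vget vs q)) (vbox (vget vs g))"
  and "ng = orient_neg (vbox (vget vs p)) (vbox (vget vs q)) (vbox (vget vs g))"
 have kk: "kids m p q g ?s = kids3 m lo ng p q g ?s" using nu2 by (simp add: lo_def ng_def)
 have o: "real_of_int lo <= 67108864 * orient (f p) (f q) (f g)" "real_of_int ng <= - (67108864 * orient (f p) (f q) (f g))"
  unfolding lo_def ng_def
  by (rule orient_low_sound orient_neg_sound; rule vbox_in[OF s]; rule ix)+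
 have tor: "tor (fst k) = orient (f p) (f q) (f g)" using tor_rots[OF k(2)] by simp
 show ?thesis
 proof (cases "snd k = 0")
  case False
  define w where "w = snd k"
  have ps: "(w, W - w, e + 1 - w) : set (wcand W e)" "sat f (put_real p q g w (W - w) (e + 1 - w) ?s)"
   using put_real_sat[OF s ix k w_def[symmetric] _ new] False by (auto simp: w_def)
  have "real_of_int lo <= real_of_int (thi w)" "real_of_int ng <= real_of_int (- tlo w)"
   using K_real[OF k(1) False] o tor by (auto simp: w_def)
  then have "lo <= thi w" "ng <= - tlo w" by simp_all
  from real_kids_mem[OF ps(1) this, of p q g ?s] okI[OF ps(2)]
  have "ok (real_kids lo ng p q g ?s (wcand W e))" by blast
  moreover have "m ~= 2" using m False by blast
  ultimately show ?thesis unfolding kk kids3_eq ok_append by simp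
 next
  case True
  have "tor (fst k) = 0"
  proof -
   obtain a b d where abd: "fst k = (a, b, d)" by (cases "fst k")
   then have "b : open_segment a d" using K_flat[OF k(1) True] by simp
   then obtain u where u: "b = (1 - u) *\<^sub>R a + u *\<^sub>R d" by (auto elim: in_open_segmentE)
   have "orient a ((1 - u) *\<^sub>R a + u *\<^sub>R d) d = 0" by (simp add: orient_def algebra_simps)
   then show ?thesis unfolding abd u by simp
  qed
  then have "real_of_int lo <= 0" "real_of_int ng <= 0" using o tor by simp_all
  then have z: "andf (lo <= 0) (ng <= 0) = True" by simp
  consider "fst k = (f q, f g, f p)" | "fst k = (f g, f p, f q)" | "fst k = (f p, f q, f g)" using k(2) by auto
  then have "ok (flat_kids True p q g ?s)"
  proof cases
   case 1 then show ?thesis using put_flat_ok[OF s ix(2,3,1) k(1) _ True new] by (simp add: ok_append)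
  next
   case 2 then show ?thesis using put_flat_ok[OF s ix(3,1,2) k(1) _ True new] by (simp add: ok_append)
  next
   case 3 then show ?thesis using put_flat_ok[OF s ix(1,2,3) k(1) _ True new] by (simp add: ok_append)
  qed
  moreover have "m ~= 1" using m True by blast
  ultimately show ?thesis unfolding kk kids3_eq ok_append z by simp
 qed
qed

lemma named_kids_ok:
 assumes "j < length us" "ok (kids m p q (g + j) s)" shows "ok (named_kids us m p q g s)"
 using assms
proof (induction us arbitrary: g j)
 case (Cons u us)
 show ?case
 proof (cases j)
  case 0 then show ?thesis using Cons.prems by (simp add: ok_append)
 next
  case (Suc i) then show ?thesis using Cons.prems Cons.IH[of i "Suc g"] by (simp add: ok_append)
 qed
qed simp

lemma add_vtx_sat:
 assumes s: "sat f (St vs ts fs W e t c)" and z: "z : Vs" "z ~: f ` {..<length vs}"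
  and kd: "kd = 1 & ~ tv z & e' + 2 = e | kd = 2 & tv z & e' + 1 = e"
 shows "sat (f(length vs := z)) (add_vtx kd e' (St vs ts fs W e t c))"
proof -
 let ?n = "length vs" and ?f = "f(length vs := z)"
 have n4: "4 <= ?n" using satD(2)[OF s] .
 have fx: "?f i = f i" if "i < ?n" for i using that by simp
 have rz_f: "rz ?f t' k = rz f t' k" if "idx_ok ?n t'" for t' k using that by (cases t') auto
 have pl: "placed ?f ts = placed f ts" using rz_f satD(6)[OF s] unfolding placed_def by blast
 have sq: "z : unit_square" using z(1) Vs_sq by blast
 have zc: "z ~: corner_set"
 proof
  assume "z : corner_set"
  then have "EX i<4. z = corner i"
   by (auto simp: corner_set_def intro: exI[of _ "0::nat"] exI[of _ "1::nat"] exI[of _ "2::nat"] exI[of _ "3::nat"] simp: numeral_2_eq_2 numeral_3_eq_3)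
  then obtain i where "i < 4" "z = f i" using satD(3)[OF s] by metis
  then show False using z(2) n4 by auto
 qed
 have kk: "kinds1 (vs @ [v]) = kinds1 vs + (if vkind v = 1 then 1 else 0)"
  "kinds2 (vs @ [v]) = kinds2 vs + (if 2 <= vkind v then 1 else 0)" for v
  by (auto simp: kinds1_def kinds2_def)
 show ?thesis
  unfolding add_vtx.simps
 proof (rule satI, unfold pl kk)
  show "c = cf" "4 <= length (vs @ [Vx kd [] (Bx 0 8192 0 8192)])" using satD(1,2)[OF s] by simp_all
  show "?f i = corner i" if "i < 4" for i using satD(2,3)[OF s] that by simp
  show "inj_on ?f {..<length (vs @ [Vx kd [] (Bx 0 8192 0 8192)])}"
   using satD(4)[OF s] z(2) by (auto simp: inj_on_def less_Suc_eq)
  show "vok ?f ts i ((vs @ [Vx kd [] (Bx 0 8192 0 8192)]) ! i)" if i: "i < length (vs @ [Vx kd [] (Bx 0 8192 0 8192)])" for i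
  proof (cases "i < ?n")
   case True
   then show ?thesis using satD(5)[OF s True] by (simp add: nth_append vok_def)
  next
   case False
   then have i: "i = ?n" using i by simp
   have "(i, j) ~: oidx" for j using oidx_oedges[of i j] i n4 by simp
   moreover have "~ (EX t:set ts. (i, j) : idx_edges t)" for j
    using idx_edges_lt[OF satD(6)[OF s]] i by blast
   ultimately show ?thesis using kd z sq zc unfolding vok_def i by (auto simp: usq_iff)
  qed
  show "idx_ok (length (vs @ [Vx kd [] (Bx 0 8192 0 8192)])) t'" if "t' : set ts" for t'
   using satD(6)[OF s that] by (cases t') auto
  show "EX k. rz ?f t' k" if "t' : set ts" for t'
   using satD(7)[OF s that] rz_f[OF satD(6)[OF s that]] by blast
  show "factok ?f (length (vs @ [Vx kd [] (Bx 0 8192 0 8192)])) x" if "x : set fs" for x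
   using satD(8)[OF s that] by (cases x) (auto simp: factok_def)
  show "sum snd (placed f ts) + W = 7" using satD(9)[OF s] .
  show "e' + 2 + 2 * (kinds1 vs + (if vkind (Vx kd [] (Bx 0 8192 0 8192)) = 1 then 1 else 0)) +
    (kinds2 vs + (if 2 <= vkind (Vx kd [] (Bx 0 8192 0 8192)) then 1 else 0)) = card (placed f ts) + W"
   using satD(10)[OF s] kd by auto
  show "regok ?f (length (vs @ [Vx kd [] (Bx 0 8192 0 8192)])) t" using satD(11)[OF s] by (cases t) auto
 qed
qed

lemma edge_third: "(p, q) : tedges t ==> EX z. t : rots (p, q, z) & z : tverts t"
 by (cases t) auto

text \<open>The edge has an owner, because its reverse is present. The third vertex of the owner is
  either named already, or new and then affordable by the count.\<close>

lemma branch_ok: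
 assumes sat: "sat f s" shows "ok (branch p q s)"
proof -
 obtain vs ts fs W e t c where S: "s = St vs ts fs W e t c" by (cases s)
 note s = sat[unfolded S]
 let ?s = "St vs ts fs W e t c"
 show ?thesis
 proof (cases "used vs q p & ~ used vs p q")
  case False
  then have "branch p q s = [s]" by (auto simp: S)
  then show ?thesis using sat by (auto simp: ok_def)
 next
  case True
  then have ix: "p < length vs" "q < length vs" using used_lt[OF s] by blast+
  have "(f q, f p) : oedges Un (\<Union>k\<in>K. tedges (fst k))" using used_edge[OF s] True by blast
  then have "(f p, f q) : oedges Un (\<Union>k\<in>K. tedges (fst k))" by (rule K_match)
  \<comment> \<open>The reversed sides of the square are used from the start, so a free edge must
    belong to a triangle.\<close>
  moreover have "(f p, f q) ~: oedges"
  proof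
   assume o: "(f p, f q) : oedges"
   have "EX i<4. v = corner i" if "v : corner_set" for v
    using that by (auto simp: corner_set_def intro: exI[of _ "0::nat"] exI[of _ "1::nat"] exI[of _ "2::nat"] exI[of _ "3::nat"] simp: numeral_2_eq_2 numeral_3_eq_3)
   moreover have "f p : corner_set" "f q : corner_set" using o by (auto simp: oedges_def corner_set_def)
   ultimately obtain i j where ij: "i < 4" "j < 4" "f p = f i" "f q = f j" using satD(3)[OF s] by metis
   then have "p = i" "q = j" using satD(2,4)[OF s] ix unfolding inj_on_def by auto
   then have "(p, q) : oidx" using o ij oidx_oedges[of p q] satD(3)[OF s] by simp
   then show False using True used_iff[OF s] by blast
  qed
  ultimately obtain k where k: "k : K" "(f p, f q) : tedges (fst k)" by blast
  obtain z where z: "fst k : rots (f p, f q, z)" "z : tverts (fst k)" using edge_third[OF k(2)] by blast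
  obtain l nf hf where C: "c = Cfg l nf hf" by (cases c)
  define m where "m = mask c p q"
  have m: "m = 1 --> snd k ~= 0" "m = 2 --> snd k = 0"
  proof -
   have "(m = 1 --> snd k ~= 0) & (m = 2 --> snd k = 0)"
   proof (cases "is_side p q")
    case True
    then have pq: "p < 4" "q = next_side p" by (simp_all add: is_side_iff)
    then have "next_side p < 4" by (cases p rule: next_side.cases) auto
    then have "(corner p, corner (next_side p)) : tedges (fst k)" using k(2) satD(3)[OF s] pq by simp
    from cf_mask[OF k(1) pq(1) this satD(1)[OF s, unfolded C, symmetric]]
    show ?thesis using True by (simp add: m_def C)
   next
    case False then show ?thesis by (simp add: m_def C)
   qed
   then show "m = 1 --> snd k ~= 0" "m = 2 --> snd k = 0" by blast+
  qed
  have br: "branch p q s = named_kids vs m p q 0 ?s @ new_kids e m p q (length vs) ?s"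
   using True by (simp add: S m_def)
  have zV: "z : Vs" using z(2) K_verts[OF k(1)] by blast
  show ?thesis
  proof (cases "z : f ` {..<length vs}")
   case True
   then obtain g where g: "g < length vs" "z = f g" by blast
   have "ok (kids m p q g ?s)" using kids_ok[OF s ix g(1) k(1) _ _ m] z(1) g(2) \<open>used vs q p & ~ used vs p q\<close> by blast
   then show ?thesis unfolding br ok_append using named_kids_ok[of g vs m p q 0 ?s] g(1) by simp
  next
   case False
   let ?f = "f(length vs := z)"
   have cnt: "sum snd (placed f ts) + W = 7" "e + 2 + 2 * kinds1 vs + kinds2 vs = card (placed f ts) + W"
    using satD(9,10)[OF s] .
   have main: "ok (kids m p q (length vs) (add_vtx kd e' ?s))"
    if kd: "kd = 1 & ~ tv z & e' + 2 = e | kd = 2 & tv z & e' + 1 = e" for kd e'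
   proof -
    let ?vs = "vs @ [Vx kd [] (Bx 0 8192 0 8192)]"
    have s': "sat ?f (St ?vs ts fs W e' t c)" using add_vtx_sat[OF s zV False kd] by simp
    have us: "used ?vs p q = used vs p q" using ix by (simp add: used_def vget_nth nth_append)
    show ?thesis unfolding add_vtx.simps
     by (rule kids_ok[OF s' _ _ _ k(1) _ _ m]) (use ix z(1) us \<open>used vs q p & ~ used vs p q\<close> in auto)
   qed
   show ?thesis
   proof (cases "tv z")
    case True
    then have "1 <= e" using count_vs(3)[OF s placed_sub[of f ts] zV False True] cnt by linarith
    then obtain e' where e': "e = Suc e'" by (cases e) auto
    then have "ok (kids m p q (length vs) (add_vtx 2 e' ?s))" using main True by simp
    then show ?thesis unfolding br ok_append e' by (cases e') (auto simp: ok_append numeral_2_eq_2)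
   next
    case F: False
    then have "2 <= e" using count_vs(2)[OF s placed_sub[of f ts] zV False F] cnt by linarith
    then obtain e' where e': "e = Suc (Suc e')" by (metis One_nat_def Suc_1 Suc_le_D Suc_le_mono)
    then have "ok (kids m p q (length vs) (add_vtx 1 e' ?s))" using main F by simp
    then show ?thesis unfolding br ok_append e' by (simp add: ok_append)
   qed
  qed
 qed
qed

lemma is_span_cl:
 assumes "!!x. x : set fs ==> factok f n x" "!!i. i < n ==> f i : Vs" "is_span a c fs"
 shows "cl (f a) (f c) & a < n & c < n"
 using assms
proof (induction fs)
 case (Cons h fs)
 obtain x y z where h: "h = (x, y, z)" by (cases h)
 have "factok f n (x, y, z)" using Cons.prems(1) h by auto
 then have "cl (f x) (f z)" "x < n" "z < n" using cl_join[of "f y" "f x" "f z"] Cons.prems(2) by (auto simp: factok_def)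
 then show ?case using Cons h cl_sym by auto
qed simp

lemma is_clean_cl:
 assumes s: "sat f (St vs ts fs W e t c)" and i: "is_clean a b (St vs ts fs W e t c)"
 shows "cl (f a) (f b) & a < length vs & b < length vs"
proof -
 have ed: "cl p q" if "(p, q) : oedges Un (\<Union>k\<in>K. tedges (fst k))" for p q
  using that K_cl outer_cl by blast
 consider "used vs a b" | "used vs b a" | "is_span a b fs" using i by auto
 then show ?thesis
 proof cases
  case 1 then show ?thesis using ed[OF used_edge[OF s 1]] used_lt[OF s 1] by blast
 next
  case 2 then show ?thesis using ed[OF used_edge[OF s 2]] used_lt[OF s 2] cl_sym by blast
 next
  case 3 then show ?thesis using is_span_cl[of fs f "length vs" a b] satD(5,8)[OF s] by (auto simp: vok_def)
 qed
qed

text \<open>The boxes certify a positive orientation, so \<open>K_merge\<close> yields the triangle.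
  It is not among those placed, hence its three sides are free.\<close>

lemma merge_ok:
 assumes sat: "sat f s" shows "ok (merge a b d s)"
proof -
 obtain vs ts fs W e t c where S: "s = St vs ts fs W e t c" by (cases s)
 note s = sat[unfolded S]
 let ?s = "St vs ts fs W e t c"
 define lo ng where "lo = orient_low (vbox (vget vs a)) (vbox (vget vs b)) (vbox (vget vs d))"
  and "ng = orient_neg (vbox (vget vs a)) (vbox (vget vs b)) (vbox (vget vs d))"
 define g where "g \<longleftrightarrow> is_clean a b ?s & is_clean b d ?s & is_clean d a ?s"
 have mg: "merge a b d s = merge1 g lo ng a b d ?s"
  by (simp only: S merge.simps lo_def ng_def g_def andf_iff)
 show ?thesis
 proof (cases "g & 0 < lo & ~ has_real a b d ts")
  case False
  then have "merge a b d s = [s]" unfolding mg by (cases g) (auto simp: S)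
  then show ?thesis using sat by (auto simp: ok_def)
 next
  case True
  then have cl3: "is_clean a b ?s" "is_clean b d ?s" "is_clean d a ?s" by (simp_all only: g_def)
  note c1 = is_clean_cl[OF s cl3(1)] and c2 = is_clean_cl[OF s cl3(2)] and c3 = is_clean_cl[OF s cl3(3)]
  then have ix: "a < length vs" "b < length vs" "d < length vs" by blast+
  have V: "f a : Vs" "f b : Vs" "f d : Vs" using satD(5)[OF s] ix by (auto simp: vok_def)
  have o: "real_of_int lo <= 67108864 * orient (f a) (f b) (f d)" "real_of_int ng <= - (67108864 * orient (f a) (f b) (f d))"
   unfolding lo_def ng_def
   by (rule orient_low_sound orient_neg_sound; rule vbox_in[OF s]; rule ix)+
  then have "0 < orient (f a) (f b) (f d)" using True by (smt (verit) of_int_0_less_iff)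
  then obtain k where k: "k : K" "snd k ~= 0" "fst k : rots (f a, f b, f d)" using K_merge V c1 c2 c3 by blast
  have new: "~ rz f t' k" if t': "t' : set ts" for t'
  proof
   assume r: "rz f t' k"
   obtain x y z w where xyz: "t' = Tr x y z w" by (cases t')
   then obtain w' where w: "w = Suc w'" using r k(2) by (cases w) auto
   have xi: "x < length vs" "y < length vs" "z < length vs" using satD(6)[OF s t'] xyz by auto
   have inj: "f i = f j \<longleftrightarrow> i = j" if "i < length vs" "j < length vs" for i j
    using satD(4)[OF s] that unfolding inj_on_def by auto
   have "fst k : rots (f x, f y, f z)" using r xyz w by simp
   then have "(a, b, d) = (x, y, z) | (a, b, d) = (y, z, x) | (a, b, d) = (z, x, y)"
    using k(3) ix xi by (auto simp: inj)
   then have "has_real a b d ts" using has_real_I[of x y z w' ts] t' xyz w by blast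
   then show False using True by blast
  qed
  have ed: "tedges (fst k) = {(f a, f b), (f b, f d), (f d, f a)}" using tedges_rots[OF k(3)] by simp
  have "~ used vs a b" "~ used vs b d" "~ used vs d a"
   using used_placed[OF s k(1) ix(1,2)] used_placed[OF s k(1) ix(2,3)] used_placed[OF s k(1) ix(3,1)] ed new by blast+
  then have m: "merge a b d s = real_kids lo ng a b d ?s (wcand W e)" unfolding mg using True by simp
  define w where "w = snd k"
  have ps: "(w, W - w, e + 1 - w) : set (wcand W e)" "sat f (put_real a b d w (W - w) (e + 1 - w) ?s)"
   using put_real_sat[OF s ix k(1,3) w_def[symmetric] _ new] k(2) by (auto simp: w_def)
  have "real_of_int lo <= real_of_int (thi w)" "real_of_int ng <= real_of_int (- tlo w)"
   using K_real[OF k(1,2)] o tor_rots[OF k(3)] by (auto simp: w_def)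
  then have "lo <= thi w" "ng <= - tlo w" by simp_all
  from real_kids_mem[OF ps(1) this, of a b d ?s] okI[OF ps(2)] show ?thesis unfolding m by blast
 qed
qed

text \<open>\<open>Opt\<close> also discards satisfiable states, those of the surviving
  configurations; therefore soundness from here on offers this as an alternative.\<close>

definition goal :: bool where
 "goal \<longleftrightarrow> (EX f i. (ALL j<4. f j = corner j) & (ALL t:set (opt_list i). EX k. rz f t k))"

lemma eqt_iff: "eqt s t \<longleftrightarrow> s = t"
 by (cases s; cases t) auto

lemma tsub_iff: "tsub xs ts \<longleftrightarrow> set xs <= set ts"
proof -
 have "tmem x ts \<longleftrightarrow> x : set ts" for x by (induction ts) (auto simp: eqt_iff)
 then show ?thesis by (induction xs) auto
qed

lemma opt_ok:
 assumes sat: "sat f s" shows "ok (opt i s) | goal"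
proof -
 obtain vs ts fs W e t c where S: "s = St vs ts fs W e t c" by (cases s)
 note s = sat[unfolded S]
 show ?thesis
 proof (cases "tsub (opt_list i) ts")
  case True
  then have "ALL t:set (opt_list i). EX k. rz f t k" using satD(7)[OF s] unfolding tsub_iff by blast
  then show ?thesis unfolding goal_def using satD(3)[OF s] by blast
 next
  case False
  then have "opt i s = [s]" by (simp add: S)
  then show ?thesis using sat by (auto simp: ok_def)
 qed
qed

lemma cmd_step_ok:
 assumes "sat f s" shows "ok (cmd_step c l s) | goal"
proof -
 have "ok [s]" "ok [set_reg i s]" for i using assms set_reg_sat[OF assms, of i] by (auto simp: ok_def)
 then show ?thesis
  using cut_ok[OF assms] squeeze_ok[OF set_reg_sat[OF assms]] branch_ok[OF assms] merge_ok[OF assms] chain_ok[OF assms]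
   ear_ok[OF assms] bisect_ok[OF assms] opt_ok[OF assms] half_ok[OF assms]
  by (cases "(c, l, s)" rule: cmd_step.cases) (simp_all del: set_reg.simps branch.simps merge.simps chain.simps
   ear.simps bisect.simps opt.simps half.simps cut.simps)
qed

lemma exec_top_ok: "ok st ==> ok (exec_top c l st) | goal"
proof (cases st)
 case (Cons s st')
 moreover assume "ok st"
 ultimately consider f where "sat f s" | "ok st'" by (auto simp: ok_def)
 then show ?thesis using cmd_step_ok[of _ s c l] Cons by cases (auto simp: ok_append)
qed (simp add: ok_def)

lemma run1_ok: "ok st ==> run1 st n c acc xs = Conf st' n' c' acc' ==> ok st' | goal"
proof (induction st n c acc xs rule: run1.induct)
 case (3 st c acc x xs)
 then show ?case using exec_top_ok[of st c "x # acc"] by auto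
qed auto

fun conf_ok :: "conf => bool" where
 "conf_ok (Conf st n c acc) \<longleftrightarrow> ok st | goal"

lemma run_ok: "conf_ok x ==> conf_ok (run x xs)"
proof -
 assume x: "conf_ok x"
 obtain st n c acc where X: "x = Conf st n c acc" by (cases x)
 obtain st' n' c' acc' where Y: "run1 st n c acc xs = Conf st' n' c' acc'" by (cases "run1 st n c acc xs")
 show ?thesis using x run1_ok[OF _ Y] by (auto simp: X Y)
qed

text \<open>No state of an empty stack is satisfied, so only the alternative remains.\<close>

lemma finished_goal: "conf_ok x ==> finished x ==> goal"
 by (cases x rule: finished.cases) (auto simp: ok_def)

end

section \<open>From coarse tilings to nets\<close>

lemma pos_parts_le_1:
 fixes x y z :: real
 assumes "x + y + z = 0" "\<bar>x\<bar> <= 1" "\<bar>y\<bar> <= 1" "\<bar>z\<bar> <= 1" shows "max x 0 + max y 0 + max z 0 <= 1"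
 using assms by (auto simp: max_def)

text \<open>As a linear form in the abscissas, the orientation is at most the sum of the positive
  parts of its coefficients. These are differences of ordinates: they add up to 0 and have modulus
  at most 1.\<close>

lemma orient_usq:
 assumes "a : unit_square" "b : unit_square" "c : unit_square" shows "orient a b c <= 1"
proof -
 have q: "0 <= p$1 & p$1 <= 1 & 0 <= p$2 & p$2 <= 1" if "p : {a, b, c}" for p using that assms by (auto simp: usq_iff)
 have le: "x * s <= max s 0" if "0 <= x" "x <= 1" for x s :: real
  using that mult_right_mono[of x 1 s] mult_nonneg_nonpos[of x s] by (cases "0 <= s") auto
 have "orient a b c = a$1 * (b$2 - c$2) + b$1 * (c$2 - a$2) + c$1 * (a$2 - b$2)"
  by (simp add: orient_def algebra_simps)
 also have "... <= max (b$2 - c$2) 0 + max (c$2 - a$2) 0 + max (a$2 - b$2) 0"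
  using q[of a] q[of b] q[of c] by (intro add_mono le) auto
 also have "... <= 1" using q[of a] q[of b] q[of c] by (intro pos_parts_le_1) auto
 finally show ?thesis .
qed

context wtiling
begin

definition "KK G = (%t. (t, wt t)) ` P Un (%k. (k, 0)) ` G"

lemma wt_le_3: assumes "t : P" shows "wt t <= 3"
proof -
 obtain a b c where t: "t = (a, b, c)" by (cases t)
 have "tor t <= 1" using tverts_usq[OF assms] orient_usq[of a b c] t by auto
 then have "19145775 * real (wt t) <= 67108864" using tor_lo[OF assms] by linarith
 then show ?thesis by (simp add: not_less_eq_eq[symmetric])
qed

lemma tverts_fst: "v : tverts k ==> EX e:tedges k. fst e = v"
 by (cases k) auto

lemma real_P: "k : KK G ==> snd k ~= 0 ==> fst k : P & snd k = wt (fst k)"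
 by (auto simp: KK_def)

lemma P_real: "t : P ==> (t, wt t) : KK G & wt t ~= 0"
 using wt_pos by (fastforce simp: KK_def)

lemma flat_G: "k : KK G ==> snd k = 0 ==> fst k : G"
 using wt_pos by (fastforce simp: KK_def)

text \<open>Only the three conditions on the configuration are left to the caller; everything else
  holds for each coarse tiling with its flat triangles.\<close>

lemma net_intro:
 assumes cl: "closes F X G"
  and mask: "!!k i l nf hf. k : KK G ==> i < 4 ==> (corner i, corner (next_side i)) : tedges (fst k) ==>
    cf = Cfg l nf hf ==> (nget l i = 1 --> snd k ~= 0) & (nget l i = 2 --> snd k = 0)"
  and ear: "!!k i j z l hf. cf = Cfg l True hf ==> k : KK G ==> snd k ~= 0 ==> i < 4 ==>
    fst k : rots (corner i, corner (next_side i), z) ==> j = next_side i | next_side j = i ==> j < 4 ==>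
    ~ (j = 0 & z$2 = 0 | j = 1 & z$1 = 1 | j = 2 & z$2 = 1 | j = 3 & z$1 = 0)"
  and half: "!!k z l nf. cf = Cfg l nf True ==> k : KK G ==> snd k ~= 0 ==> fst k : rots (corner 0, corner 1, z) ==> z$1 <= 1 / 2"
 shows "net Vs (KK G) tv clean cf"
proof
 note cD = closesD[OF cl]
 have X_un: "oedges Un (\<Union>k\<in>KK G. tedges (fst k)) = X Un \<Union>(tedges ` G)"
  by (auto simp: KK_def X_def)
 have PX: "tedges t <= X" if "t : P" for t using that by (auto simp: X_def)
 have kc: "fst k : P & snd k = wt (fst k) | fst k : G & snd k = 0" if "k : KK G" for k using that by (auto simp: KK_def)
 show "finite (KK G)" using fin cD(1) by (simp add: KK_def)
 show "k = k'" if "k : KK G" "k' : KK G" "e : tedges (fst k)" "e : tedges (fst k')" for k k' e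
 proof -
  have "fst k = fst k' & snd k = snd k'"
   using kc[OF that(1)] kc[OF that(2)]
  proof (elim disjE conjE)
   assume a: "fst k : P" "snd k = wt (fst k)" "fst k' : P" "snd k' = wt (fst k')"
   then have "fst k = fst k'" using edge_owner that(3,4) by blast
   then show ?thesis using a by simp
  next
   assume "fst k : P" "fst k' : G"
   then show ?thesis using cD(6)[of "fst k'"] PX that(3,4) by blast
  next
   assume "fst k : G" "fst k' : P"
   then show ?thesis using cD(6)[of "fst k"] PX that(3,4) by blast
  next
   assume a: "fst k : G" "snd k = 0" "fst k' : G" "snd k' = 0"
   then show ?thesis using cD(5)[OF a(1,3) that(3,4)] by simp
  qed
  then show ?thesis by (simp add: prod_eq_iff)
 qed
 show "tedges (fst k) Int oedges = {}" if k: "k : KK G" for k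
  using kc[OF k]
 proof (elim disjE conjE)
  assume p: "fst k : P"
  show ?thesis
  proof (rule ccontr)
   assume "tedges (fst k) Int oedges ~= {}"
   then obtain e s where e: "e : tedges (fst k)" "s : outer" "e : tedges s" using oedges_outer by blast
   then have "fst k = s" using PP.edge_owner[of "fst k" e s] p by (simp add: PP_def)
   then show False using p e P_outer by blast
  qed
 next
  assume "fst k : G" then show ?thesis using cD(6) unfolding X_def by blast
 qed
 show "(q, p) : oedges Un (\<Union>k\<in>KK G. tedges (fst k))" if "(p, q) : oedges Un (\<Union>k\<in>KK G. tedges (fst k))" for p q
  using cD(7)[of p q] that unfolding X_un .
 show "tverts (fst k) <= Vs" if k: "k : KK G" for k
  using kc[OF k]
 proof (elim disjE conjE)
  assume "fst k : P" then show ?thesis by (auto simp: Vs_def)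
 next
  assume g: "fst k : G"
  show ?thesis
  proof
   fix v assume "v : tverts (fst k)"
   then obtain e where "e : tedges (fst k)" "fst e = v" using tverts_fst by blast
   then show "v : Vs" using cD(9)[OF g] ends_X_Vs by blast
  qed
 qed
 show "Vs <= unit_square" "corner_set <= Vs" using Vs_usq corner_vertex by blast+
 show "snd k <= 3 & real_of_int (tlo (snd k)) <= 67108864 * tor (fst k) & 67108864 * tor (fst k) <= real_of_int (thi (snd k))"
  if k: "k : KK G" "snd k ~= 0" for k
 proof -
  have p: "fst k : P" "snd k = wt (fst k)" using real_P[OF k] by auto
  then have "snd k = 1 | snd k = 2 | snd k = 3" using wt_le_3[OF p(1)] k(2) by linarith
  then have "real_of_int (tlo (snd k)) = 19145775 * real (snd k)" "real_of_int (thi (snd k)) = 19202147 * real (snd k)"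
   by (auto simp: numeral_2_eq_2 numeral_3_eq_3)
  then show ?thesis using tor_lo[OF p(1)] tor_hi[OF p(1)] wt_le_3[OF p(1)] p(2) by simp
 qed
 show "flat (fst k) & tv (tmid (fst k))" if "k : KK G" "snd k = 0" for k
  using cD(3,4)[OF flat_G[OF that]] by (simp add: tv_def)
 show "k = k'" if "k : KK G" "k' : KK G" "snd k = 0" "snd k' = 0" "tmid (fst k) = tmid (fst k')" for k k'
  using cD(8)[OF flat_G[OF that(1,3)] flat_G[OF that(2,4)] that(5)] that(3,4) by (simp add: prod_eq_iff)
 show "~ tv c" if "c : corner_set" for c using corner_not_tv that .
 have Xc: "clean p q" if "(p, q) : X" for p q
  using X_clean[OF that] by (auto simp: clean_def oseg_def)
 show "clean p q" if k: "k : KK G" "(p, q) : tedges (fst k)" for k p q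
  using kc[OF k(1)]
 proof (elim disjE conjE)
  assume "fst k : P" then show ?thesis using PX k(2) Xc by blast
 next
  assume g: "fst k : G"
  show ?thesis
   by (rule cover_clean[OF cD(2)]) (use cD(11)[OF g k(2)] in \<open>auto simp: oseg_def\<close>)
 qed
 show "clean p q" if "(p, q) : oedges" for p q using Xc that by (auto simp: X_def)
 show "clean q p" if "clean p q" for p q using clean_sym that .
 show "clean p q" if "m : Vs" "m : open_segment p q" "clean p m" "clean m q" for m p q using clean_join that by blast
 show "EX k:KK G. snd k ~= 0 & fst k : rots (a, b, c)"
  if h: "a : Vs" "b : Vs" "c : Vs" "clean a b" "clean b c" "clean c a" "0 < orient a b c" for a b c
 proof -
  obtain t where t: "t : rots (a, b, c)" "t : P" using merge[OF h] by blast
  then show ?thesis using P_real[OF t(2), of G] by (intro bexI[of _ "(t, wt t)"]) auto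
 qed
 have inj: "inj_on fst {k : KK G. snd k ~= 0}" 
 proof (rule inj_onI)
  fix k k' assume h: "k : {k : KK G. snd k ~= 0}" "k' : {k : KK G. snd k ~= 0}" "fst k = fst k'"
  have "snd k = wt (fst k)" "snd k' = wt (fst k')" using real_P[of k G] real_P[of k' G] h(1,2) by simp_all
  then show "k = k'" using h(3) by (simp add: prod_eq_iff)
 qed
 have SP: "sum snd S = sum wt (fst ` S)" "fst ` S <= P" "card (fst ` S) = card S" if S: "S <= {k : KK G. snd k ~= 0}" for S
 proof -
  have i: "inj_on fst S" using inj S inj_on_subset by blast
  show "fst ` S <= P" using S real_P by blast
  show "card (fst ` S) = card S" by (rule card_image[OF i])
  have "sum wt (fst ` S) = sum (wt \<circ> fst) S" by (rule sum.reindex[OF i])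
  also have "... = sum snd S" by (intro sum.cong) (use S real_P in auto)
  finally show "sum snd S = sum wt (fst ` S)" ..
 qed
 show "sum snd S <= 7" if S: "S <= {k : KK G. snd k ~= 0}" for S
  unfolding SP(1)[OF S] wt_sum[symmetric] by (rule sum_mono2[OF fin SP(2)[OF S]]) simp
 show "2 * card A + card B + 2 + sum snd S <= card S + 7"
  if S: "S <= {k : KK G. snd k ~= 0}" and A: "A <= Vs - corner_set" "B <= Vs" "finite A" "finite B"
   "!!v. v : A ==> ~ tv v" "!!v. v : B ==> tv v" for S A B
 proof -
  have "2 * card A + card B + 2 <= card P" using A by (intro euler_count) blast+
  \<comment> \<open>Each triangle outside \<open>S\<close> has weight at least 1, so there are no
    more of them than there is weight left.\<close>
  moreover have "card P + sum wt (fst ` S) <= card (fst ` S) + 7"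
  proof -
   have "card (P - fst ` S) <= sum wt (P - fst ` S)"
    using sum_mono[of "P - fst ` S" "%_. 1" wt] wt_pos by simp
   moreover have "sum wt (P - fst ` S) + sum wt (fst ` S) = 7" using sum.subset_diff[OF SP(2)[OF S] fin, of wt] wt_sum by simp
   moreover have "card (P - fst ` S) + card (fst ` S) = card P"
    using SP(2)[OF S] fin by (metis card_Diff_subset card_mono finite_subset le_add_diff_inverse2)
   ultimately show ?thesis by linarith
  qed
  ultimately show ?thesis using SP[OF S] by linarith
 qed
qed (use mask ear half in blast)+

end

context net
begin

lemma corners_sat: "sat corner (St corners [] [] n7 n5 (Tr 0 0 0 0) cf)"
proof (rule satI)
 have l: "length corners = 4" by (simp add: corners_def)
 show "4 <= length corners" by (simp add: l)
 have c4: "i = 0 | i = 1 | i = 2 | i = 3" if "i < 4" for i :: nat using that by linarith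
 show "inj_on corner {..<length corners}" unfolding l
  by (intro inj_onI) (auto dest!: c4 simp: numeral_2_eq_2 numeral_3_eq_3)
 show "vok corner [] i (corners ! i)" if "i < length corners" for i
 proof -
  have "corner i : Vs" using corner_mem corner_Vs that l by auto
  then show ?thesis using c4[of i] that unfolding l
   by (auto simp: vok_def corners_def oidx_def numeral_2_eq_2 numeral_3_eq_3)
 qed
 have "placed corner [] = {}" by (auto simp: placed_def)
 then show "sum snd (placed corner []) + n7 = 7" "n5 + 2 + 2 * kinds1 corners + kinds2 corners = card (placed corner []) + n7"
  by (simp_all add: kinds1_def kinds2_def corners_def)
 show "regok corner (length corners) (Tr 0 0 0 0)" by (simp add: l)
qed simp_all

lemma start_ok: "conf_ok (start cf)"
 using corners_sat by (auto simp: start_def ok_def)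

lemma ear_roots_mem:
 "(w, W', e') : set l ==> ok (put_flat n2 n4 n1 (put_real 0 n1 n4 w W' e' s)) ==> ok (ear_roots l s)"
 by (induction l) (auto simp: ok_append)

text \<open>Follows the construction of \<open>start_ear\<close>: the apex is named as vertex 4, its
  box is narrowed to abscissa 1, and then the ear and the flat triangle are placed.\<close>

lemma ear_ok_start:
 assumes c: "cf = Cfg [] False False" and k: "k : K" "snd k ~= 0" "fst k : rots (pt 0 0, pt 1 0, z)" and fl: "((pt 1 1, z, pt 1 0), 0) : K" and z1: "z$1 = 1"
 shows "conf_ok start_ear"
proof -
 have zV: "z : Vs" using K_verts[OF fl] by simp
 have tvz: "tv z" using K_flat[OF fl] by simp
 let ?f = "corner(4 := z)"
 have l: "length corners = 4" by (simp add: corners_def)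
 have zn: "z ~: corner ` {..<length corners}" using corner_tv corner_mem tvz by (auto simp: l)
 from add_vtx_sat[OF corners_sat zV zn, of 2 n4] tvz
 have s1: "sat ?f (St (corners @ [Vx 2 [] (Bx 0 8192 0 8192)]) [] [] n7 n4 (Tr 0 0 0 0) cf)" by (simp add: l del: fun_upd_apply)
 have zsq: "z : unit_square" using zV Vs_sq by blast
 have "inbox (Bx 8192 8192 0 8192) (?f 4)" using zsq z1 by (simp add: usq_iff)
 from sat_box[OF s1 _ this] have "sat ?f (St (set_box (corners @ [Vx 2 [] (Bx 0 8192 0 8192)]) 4 (Bx 8192 8192 0 8192)) [] [] n7 n4 (Tr 0 0 0 0) cf)"
  by (simp add: l del: fun_upd_apply)
 moreover have "set_box (corners @ [Vx 2 [] (Bx 0 8192 0 8192)]) 4 (Bx 8192 8192 0 8192) = corners @ [Vx n2 [] (Bx 8192 8192 0 8192)]"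
  by (simp add: corners_def eval_nat_numeral)
 ultimately have s2: "sat ?f (St (corners @ [Vx n2 [] (Bx 8192 8192 0 8192)]) [] [] n7 n4 (Tr 0 0 0 0) cf)" by simp
 define vs where "vs = corners @ [Vx n2 [] (Bx 8192 8192 0 8192)]"
 have lv: "length vs = 5" by (simp add: vs_def l)
 note s2 = s2[folded vs_def]
 define w where "w = snd k"
 have kr: "fst k : rots (?f 0, ?f n1, ?f n4)" using k(3) by (simp add: eval_nat_numeral)
 note pr = put_real_sat[OF s2 _ _ _ k(1) kr w_def[symmetric], unfolded lv]
 have w0: "w ~= 0" using k(2) w_def by simp
 have m: "(w, n7 - w, n4 + 1 - w) : set (wcand n7 n4)" "sat ?f (put_real 0 n1 n4 w (n7 - w) (n4 + 1 - w) (St vs [] [] n7 n4 (Tr 0 0 0 0) cf))"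
  using pr w0 by (simp_all del: fun_upd_apply)
 define vs' where "vs' = add_edges vs 0 n1 n4"
 have lv': "length vs' = 5" by (simp add: vs'_def lv)
 have s3: "sat ?f (St vs' [Tr 0 n1 n4 w] [] (n7 - w) (n4 + 1 - w) (Tr 0 n1 n4 w) cf)" using m(2) by (simp add: vs'_def)
 have "ok (flat_if (vkind (vget vs' n4)) n2 n4 n1 (St vs' [Tr 0 n1 n4 w] [] (n7 - w) (n4 + 1 - w) (Tr 0 n1 n4 w) cf))"
  by (rule put_flat_ok[OF s3 _ _ _ fl]) (use w0 lv' in \<open>auto simp: eval_nat_numeral\<close>)
 moreover have "vkind (vget vs' n4) = n2"
  using add_edges_nth(1)[of 0 vs n1 n4 n4] lv by (simp add: vs'_def vget_nth) (simp add: vs_def corners_def)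
 ultimately have "ok (put_flat n2 n4 n1 (put_real 0 n1 n4 w (n7 - w) (n4 + 1 - w) (St vs [] [] n7 n4 (Tr 0 0 0 0) cf)))"
  by (simp add: vs'_def del: put_flat.simps)
 note r = ear_roots_mem[OF m(1) this]
 have e: "start_ear = Conf (ear_roots (wcand n7 n4) (St vs [] [] n7 n4 (Tr 0 0 0 0) cf)) 0 Nop []"
  by (simp only: start_ear_def vs_def c)
 show ?thesis unfolding e conf_ok.simps by (rule disjI1) (rule r)
qed

end

subsection \<open>Symmetries of the square and optimal configurations\<close>

lemma tedges_rots_iff: "(p, q) : tedges t \<longleftrightarrow> (EX z. t : rots (p, q, z))"
 by (cases t) auto

text \<open>A symmetry \<open>g\<close> of the square with inverse \<open>h\<close>; the sign
  \<open>s\<close> is its determinant.\<close>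

locale motion =
 fixes g h :: "real^2 => real^2" and s :: real
 assumes hg: "h (g x) = x" and gh: "g (h x) = x" and sq: "x : unit_square ==> g x : unit_square"
  and sq': "x : unit_square ==> h x : unit_square"
  and s: "s = 1 | s = - 1" and orient: "orient (g a) (g b) (g c) = s * orient a b c"
  and aff: "g ((1 - u) *\<^sub>R a + u *\<^sub>R b) = (1 - u) *\<^sub>R g a + u *\<^sub>R g b"
begin

text \<open>A reflection reverses orientation, so two vertices are exchanged to keep the triple
  counterclockwise.\<close>

fun T :: "triple => triple" where
 "T (a, b, c) = (if s = 1 then (g a, g b, g c) else (g a, g c, g b))"
fun T' :: "triple => triple" where
 "T' (a, b, c) = (if s = 1 then (h a, h b, h c) else (h a, h c, h b))"

lemma T_pos: "T (a, b, c) = (g a, g b, g c)" "T' (a, b, c) = (h a, h b, h c)" if "s = 1"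
 unfolding T.simps T'.simps using that by simp_all

lemma T_neg: "T (a, b, c) = (g a, g c, g b)" "T' (a, b, c) = (h a, h c, h b)" if "s ~= 1"
 unfolding T.simps T'.simps using that by simp_all

lemma T_cases:
 obtains "!!a b c. T (a, b, c) = (g a, g b, g c)" "!!a b c. T' (a, b, c) = (h a, h b, h c)"
   "!!a b c. orient (g a) (g b) (g c) = orient a b c"
 | "!!a b c. T (a, b, c) = (g a, g c, g b)" "!!a b c. T' (a, b, c) = (h a, h c, h b)"
   "!!a b c. orient (g a) (g b) (g c) = orient b a c"
proof (cases "s = 1")
 case True
 show ?thesis by (rule that(1)[OF T_pos[OF True]]) (simp add: orient True)
next
 case False
 have s1: "s = - 1" using s False by blast
 have "orient (g a) (g b) (g c) = orient b a c" for a b c unfolding orient s1 orient_swap[of b a] by simp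
 then show ?thesis by (rule that(2)[OF T_neg[OF False]])
qed

lemmas [simp del] = T.simps T'.simps

lemma T_T' [simp]: "T' (T t) = t" "T (T' t) = t"
 by (cases t; rule T_cases; simp add: hg gh)+

lemma tor_T [simp]: "tor (T t) = tor t"
proof -
 obtain a b c where t: "t = (a, b, c)" by (cases t)
 show ?thesis unfolding t by (rule T_cases) (simp_all add: orient_rot)
qed

lemma g_eq [simp]: "g x = g y \<longleftrightarrow> x = y" using hg by metis

lemma ctri_T: "g x : ctri (T t) \<longleftrightarrow> x : ctri t" and otri_T: "g x : otri (T t) \<longleftrightarrow> x : otri t"
proof -
 obtain a b c where t: "t = (a, b, c)" by (cases t)
 show "g x : ctri (T t) \<longleftrightarrow> x : ctri t" unfolding t by (rule T_cases) auto
 show "g x : otri (T t) \<longleftrightarrow> x : otri t" unfolding t by (rule T_cases) auto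
qed

lemma tverts_T: "tverts (T t) = g ` tverts t"
proof -
 obtain a b c where t: "t = (a, b, c)" by (cases t)
 show ?thesis unfolding t by (rule T_cases) auto
qed

lemma segment_g: "open_segment (g p) (g q) = g ` open_segment p q"
proof (cases "p = q")
 case False
 then have "g p ~= g q" by simp
 with False show ?thesis
  by (simp only: open_segment_image_interval if_False image_image aff)
qed simp

lemma surj: "EX x. y = g x" using gh by metis

lemma inj_g: "inj g" using hg by (metis injI)

lemma ctri_T_image: "ctri (T t) = g ` ctri t" and otri_T_image: "otri (T t) = g ` otri t"
proof -
 have "y : ctri (T t) \<longleftrightarrow> y : g ` ctri t" "y : otri (T t) \<longleftrightarrow> y : g ` otri t" for y
 proof -
  obtain x where x: "y = g x" using surj by blast
  show "y : ctri (T t) \<longleftrightarrow> y : g ` ctri t" "y : otri (T t) \<longleftrightarrow> y : g ` otri t"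
   unfolding x ctri_T otri_T inj_image_mem_iff[OF inj_g] by (rule refl)+
 qed
 then show "ctri (T t) = g ` ctri t" "otri (T t) = g ` otri t" by blast+
qed

lemma usq_g: "g ` unit_square = unit_square"
 using sq sq' gh by (metis image_subsetI image_eqI subsetI subset_antisym)

lemma inj_T: "inj T" using T_T'(1) by (metis injI)

lemma T_rots: "T t : rots (T (a, b, c)) \<longleftrightarrow> t : rots (a, b, c)"
proof -
 obtain x y z where t: "t = (x, y, z)" by (cases t)
 show ?thesis unfolding t by (rule T_cases) auto
qed

lemma wtiling_T:
 assumes "wtiling P wt" shows "wtiling (T ` P) (wt \<circ> T')"
proof -
 interpret wtiling P wt by fact
 interpret t: tiling "T ` P"
 proof
  show "finite (T ` P)" using fin by simp
  show "0 < tor t" if "t : T ` P" for t using that pos by (metis imageE tor_T)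
  show "otri x Int otri y = {}" if xy: "x : T ` P" "y : T ` P" "x ~= y" for x y
  proof -
   obtain a b where ab: "x = T a" "y = T b" "a : P" "b : P" using xy by blast
   then have "otri a Int otri b = {}" using disj xy(3) by blast
   then show ?thesis unfolding ab otri_T_image image_Int[OF inj_g, symmetric] by simp
  qed
  have "\<Union>(ctri ` T ` P) = g ` \<Union>(ctri ` P)" unfolding image_image ctri_T_image by blast
  then show "\<Union>(ctri ` T ` P) = unit_square" using cover usq_g by simp
 qed
 show ?thesis
 proof
  fix t assume "t : T ` P"
  then obtain a where a: "t = T a" "a : P" by blast
  show "1 <= (wt \<circ> T') t" using wt_pos[OF a(2)] a(1) by simp
  show "19145775 * real ((wt \<circ> T') t) <= 67108864 * tor t" using tor_lo[OF a(2)] a(1) by simp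
  show "67108864 * tor t <= 19202147 * real ((wt \<circ> T') t)" using tor_hi[OF a(2)] a(1) by simp
 next
  have "sum (wt \<circ> T') (T ` P) = sum wt P"
   by (subst sum.reindex) (auto intro: inj_on_subset[OF inj_T])
  then show "sum (wt \<circ> T') (T ` P) = 7" using wt_sum by simp
 next
  fix a b c assume V: "a : t.Vs" "b : t.Vs" "c : t.Vs" and cl: "t.clean a b" "t.clean b c" "t.clean c a"
   and o: "0 < orient a b c"
  have Vs: "t.Vs = g ` Vs" unfolding t.Vs_def Vs_def image_image tverts_T by blast
  obtain a' b' c' where e: "a = g a'" "b = g b'" "c = g c'" and V': "a' : Vs" "b' : Vs" "c' : Vs" using V unfolding Vs by blast
  have cln: "clean p q" if "t.clean (g p) (g q)" for p q
   using that unfolding t.clean_def clean_def segment_g otri_T_image by (force simp: otri_T_image)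
  have cl': "clean a' b'" "clean b' c'" "clean c' a'" using cl unfolding e by (auto intro: cln)
  show "rots (a, b, c) Int T ` P ~= {}"
  proof (rule T_cases)
   assume T: "!!a b c. T (a, b, c) = (g a, g b, g c)" and g: "!!a b c. orient (g a) (g b) (g c) = orient a b c"
   have "0 < orient a' b' c'" using o unfolding e g .
   then obtain t where t: "t : rots (a', b', c')" "t : P" using merge[OF V' cl'] by blast
   have "T t : rots (a, b, c)" using t T_rots[of t a' b' c'] unfolding T e by blast
   then show ?thesis using t by blast
  next
   assume T: "!!a b c. T (a, b, c) = (g a, g c, g b)" and g: "!!a b c. orient (g a) (g b) (g c) = orient b a c"
   have "0 < orient a' c' b'" using o unfolding e g by (simp add: orient_rot)
   then obtain t where t: "t : rots (a', c', b')" "t : P"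
    using merge[OF V'(1,3,2) clean_sym[OF cl'(3)] clean_sym[OF cl'(2)] clean_sym[OF cl'(1)]] by blast
   have "T t : rots (a, b, c)" using t T_rots[of t a' c' b'] unfolding T e by blast
   then show ?thesis using t by blast
  qed
 qed
qed

end

text \<open>In the surviving configurations five areas are functions of four coordinates, as in
  \<open>area_rel_a\<close> and \<open>area_rel_b\<close>. Eliminating the coordinates and clearing
  denominators gives this relation.\<close>

definition area_rel :: "real => real => real => real => real => bool" where
 "area_rel a1 a2 a3 a4 a5 \<longleftrightarrow>
   (1 - 2 * a1) * (1 - 2 * a2) * (1 - 4 * a1 * a2 - 4 * a2 * a3) =
   2 * a4 * (1 - 4 * a1 * a2 - 4 * a2 * a3) + 2 * a5 * (1 - 4 * a1 * a2) * (1 - 2 * a2)"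

text \<open>Weight 1 is required so that the five triangles have the areas of pieces of the
  dissection.\<close>

definition opt_tiling :: "triple set => (triple => nat) => bool" where
 "opt_tiling P wt \<longleftrightarrow> (EX t1 t2 t3 t4 t5. distinct [t1, t2, t3, t4, t5] & {t1, t2, t3, t4, t5} <= {t : P. wt t = 1} &
   area_rel (tor t1 / 2) (tor t2 / 2) (tor t3 / 2) (tor t4 / 2) (tor t5 / 2))"

lemma (in motion) opt_tiling_T:
 assumes "opt_tiling (T ` P) (wt \<circ> T')" shows "opt_tiling P wt"
proof -
 obtain t1 t2 t3 t4 t5 where t: "distinct [t1, t2, t3, t4, t5]" "{t1, t2, t3, t4, t5} <= {t : T ` P. (wt \<circ> T') t = 1}"
  "area_rel (tor t1 / 2) (tor t2 / 2) (tor t3 / 2) (tor t4 / 2) (tor t5 / 2)"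
  using assms unfolding opt_tiling_def by blast
 have tr: "tor (T' x) = tor x" for x using tor_T[of "T' x"] by simp
 have ne: "T' x = T' y \<longleftrightarrow> x = y" for x y using T_T'(2) by metis
 have "distinct [T' t1, T' t2, T' t3, T' t4, T' t5]" using t(1) by (simp add: ne)
 moreover have "T' x : P & wt (T' x) = 1" if "x : {t1, t2, t3, t4, t5}" for x
 proof -
  have "x : T ` P" "wt (T' x) = 1" using t(2) that by auto
  then show ?thesis by (metis T_T'(1) imageE)
 qed
 ultimately show ?thesis unfolding opt_tiling_def using t(3)
  by (intro exI[of _ "T' t1"] exI[of _ "T' t2"] exI[of _ "T' t3"] exI[of _ "T' t4"] exI[of _ "T' t5"]) (auto simp: tr)
qed

definition "rotg z = pt (1 - z$2) (z$1)" for z :: "real^2"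
definition "roth z = pt (z$2) (1 - z$1)" for z :: "real^2"
definition "reflg z = pt (1 - z$1) (z$2)" for z :: "real^2"

interpretation rot: motion rotg roth 1
proof
 show "rotg ((1 - u) *\<^sub>R a + u *\<^sub>R b) = (1 - u) *\<^sub>R rotg a + u *\<^sub>R rotg b" for u a b
  by (simp add: rotg_def vec2_eq_iff) (simp add: algebra_simps)
qed (simp_all add: rotg_def roth_def usq_iff orient_def vec2_eq_iff, simp_all add: algebra_simps)

interpretation ref: motion reflg reflg "- 1"
proof
 show "reflg ((1 - u) *\<^sub>R a + u *\<^sub>R b) = (1 - u) *\<^sub>R reflg a + u *\<^sub>R reflg b" for u a b
  by (simp add: reflg_def vec2_eq_iff) (simp add: algebra_simps)
qed (simp_all add: reflg_def usq_iff orient_def vec2_eq_iff, simp_all add: algebra_simps)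

section \<open>Triangles over the sides of the square, and how motions move them\<close>

definition apex :: "triple set => nat => real^2 => bool" where
 "apex P i z \<longleftrightarrow> rots (corner i, corner (next_side i), z) Int P ~= {}"

lemma corner_rot:
 assumes "i < 4" shows "rotg (corner i) = corner (next_side i)"
proof -
 have "i = 0 | i = Suc 0 | i = Suc (Suc 0) | i = Suc (Suc (Suc 0))" using assms by linarith
 then show ?thesis by (elim disjE) (simp_all add: rotg_def)
qed

fun mirror :: "nat => nat" where
 "mirror 0 = 0"
| "mirror (Suc 0) = Suc (Suc (Suc 0))"
| "mirror (Suc (Suc 0)) = Suc (Suc 0)"
| "mirror (Suc (Suc (Suc n))) = Suc 0"

lemma corner_refl:
 assumes "i < 4" shows "reflg (corner i) = corner (next_side (mirror i))" "reflg (corner (next_side i)) = corner (mirror i)"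
proof -
 have "i = 0 | i = Suc 0 | i = Suc (Suc 0) | i = Suc (Suc (Suc 0))" using assms by linarith
 then show "reflg (corner i) = corner (next_side (mirror i))" "reflg (corner (next_side i)) = corner (mirror i)"
  by (elim disjE; simp add: reflg_def)+
qed

lemma next_less: "i < 4 ==> next_side i < 4"
proof -
 assume "i < 4"
 then have "i = 0 | i = Suc 0 | i = Suc (Suc 0) | i = Suc (Suc (Suc 0))" by linarith
 then show ?thesis by (elim disjE) simp_all
qed

lemma apex_rot:
 assumes "i < 4" shows "apex (rot.T ` P) (next_side i) (rotg z) \<longleftrightarrow> apex P i z"
proof -
 have "rot.T (corner i, corner (next_side i), z) = (corner (next_side i), corner (next_side (next_side i)), rotg z)"
  unfolding rot.T_pos[OF refl] using corner_rot[OF assms] corner_rot[OF next_less[OF assms]] by simp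
 then have e: "rots (corner (next_side i), corner (next_side (next_side i)), rotg z) = rots (rot.T (corner i, corner (next_side i), z))"
  by (simp only:)
 have "apex (rot.T ` P) (next_side i) (rotg z) \<longleftrightarrow> (EX t:P. rot.T t : rots (rot.T (corner i, corner (next_side i), z)))"
  unfolding apex_def e by blast
 then show ?thesis unfolding apex_def rot.T_rots by blast
qed

lemma apex_refl:
 assumes "i < 4" shows "apex (ref.T ` P) (mirror i) (reflg z) \<longleftrightarrow> apex P i z"
proof -
 have e: "rots (ref.T (corner i, corner (next_side i), z)) = rots (corner (mirror i), corner (next_side (mirror i)), reflg z)"
  unfolding ref.T_neg[of "corner i", simplified] using corner_refl[OF assms] by auto
 have "apex (ref.T ` P) (mirror i) (reflg z) \<longleftrightarrow> (EX t:P. ref.T t : rots (ref.T (corner i, corner (next_side i), z)))"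
  unfolding apex_def e by blast
 then show ?thesis unfolding apex_def ref.T_rots by blast
qed


section \<open>The relation between five areas\<close>

lemma segment_line:
 fixes a c m :: "real^2"
 assumes "m : open_segment a c" "\<alpha> * a$1 + \<beta> * a$2 = \<gamma>" "\<alpha> * c$1 + \<beta> * c$2 = \<gamma>"
 shows "\<alpha> * m$1 + \<beta> * m$2 = \<gamma>"
proof -
 obtain u where m: "m = (1 - u) *\<^sub>R a + u *\<^sub>R c" using assms(1) by (auto elim: in_open_segmentE)
 have "\<alpha> * m$1 + \<beta> * m$2 = (1 - u) * (\<alpha> * a$1 + \<beta> * a$2) + u * (\<alpha> * c$1 + \<beta> * c$2)"
  by (simp add: m algebra_simps)
 then show ?thesis by (simp add: assms(2,3) algebra_simps)
qed

text \<open>For lists 0 to 3 of \<open>opt_list\<close>: \<open>y\<close> is the height of the apex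
  of the ear, \<open>u\<close>, \<open>v\<close> and \<open>s\<close> are abscissas of the vertices
  6, 7 and 5, and the \<open>b\<close> are doubled areas.\<close>

lemma area_rel_a:
 assumes "b1 = u" "b2 = y" "b3 = v * (1 - u * y)" "b4 = (1 - y) * (1 - s)" "b5 = (s - u) * (1 - y * v)"
 shows "area_rel (b1 / 2) (b2 / 2) (b3 / 2) (b4 / 2) (b5 / 2)"
proof -
 have e: "1 - b1 * b2 - b2 * b3 = (1 - y * v) * (1 - u * y)" unfolding assms(1,2,3) by (simp add: algebra_simps)
 have "(1 - b1) * (1 - b2) * (1 - b1 * b2 - b2 * b3) = b4 * (1 - b1 * b2 - b2 * b3) + b5 * (1 - b1 * b2) * (1 - b2)"
  unfolding e unfolding assms(1,2,4,5) by (simp add: algebra_simps)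
 then show ?thesis by (simp add: area_rel_def)
qed

text \<open>For the last two lists: \<open>y\<close> is again the height of the apex,
  \<open>u\<close> and \<open>v\<close> are abscissas of the vertices 6 and 7, and \<open>s\<close>
  divides the part of the right side above the apex.\<close>

lemma area_rel_b:
 assumes "b1 = y" "b2 = u" "u * b3 = v * (1 - u * y)" "b4 = (1 - u) * (1 - s)" "b5 = (s - y) * (1 - v)"
 shows "area_rel (b1 / 2) (b2 / 2) (b3 / 2) (b4 / 2) (b5 / 2)"
proof -
 have e: "1 - b1 * b2 - b2 * b3 = (1 - v) * (1 - u * y)" using assms(1,2,3) by (simp add: algebra_simps)
 have "(1 - b1) * (1 - b2) * (1 - b1 * b2 - b2 * b3) = b4 * (1 - b1 * b2 - b2 * b3) + b5 * (1 - b1 * b2) * (1 - b2)"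
  unfolding e unfolding assms(1,2,4,5) by (simp add: algebra_simps)
 then show ?thesis by (simp add: area_rel_def)
qed

context net
begin

lemma rz_real:
 assumes "rz f (Tr a b c (Suc 0)) k"
 shows "k : K" "snd k = 1" "tor (fst k) = orient (f a) (f b) (f c)" "tverts (fst k) = {f a, f b, f c}"
 using assms tor_rots[of "fst k" "(f a, f b, f c)"] tverts_rots[of "fst k" "(f a, f b, f c)"] by simp_all

lemma rz_flat:
 assumes "rz f (Tr a b c 0) k"
 shows "f b : open_segment (f a) (f c)" "f b ~: corner_set"
 using assms K_flat[of k] corner_tv[of "f b"] by (cases k; force)+

lemma corners_in: "pt 0 0 : corner_set" "pt 1 0 : corner_set" "pt 1 1 : corner_set" "pt 0 1 : corner_set"
 by (simp_all add: corner_set_def)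

definition "opt_net \<longleftrightarrow> (EX k1 k2 k3 k4 k5. distinct [k1, k2, k3, k4, k5] & {k1, k2, k3, k4, k5} <= {k : K. snd k = 1} &
   area_rel (tor (fst k1) / 2) (tor (fst k2) / 2) (tor (fst k3) / 2) (tor (fst k4) / 2) (tor (fst k5) / 2))"

text \<open>Tells the five triangles apart: no two of them have the same corners of the square among
  their vertices.\<close>

definition "corners_of k = map (%c. c : tverts (fst k)) [pt 0 0, pt 1 0, pt 1 1, pt 0 1]"

lemma opt_netI:
 assumes "distinct [corners_of k1, corners_of k2, corners_of k3, corners_of k4, corners_of k5]"
  "{k1, k2, k3, k4, k5} <= {k : K. snd k = 1}"
  "area_rel (tor (fst k1) / 2) (tor (fst k2) / 2) (tor (fst k3) / 2) (tor (fst k4) / 2) (tor (fst k5) / 2)"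
 shows opt_net
proof -
 have "distinct [k1, k2, k3, k4, k5]" using assms(1) by auto
 then show ?thesis using assms(2,3) unfolding opt_net_def by blast
qed

text \<open>The flat triangles put the named vertices on known lines. This leaves four free
  coordinates, in which the doubled areas take the form of \<open>area_rel_a\<close> or
  \<open>area_rel_b\<close>.\<close>

lemma goal_opt:
 assumes goal shows opt_net
proof -
 obtain f i where f4: "!!j. j < 4 ==> f j = corner j" and fi: "!!t. t : set (opt_list i) ==> EX k. rz f t k"
  using assms unfolding goal_def by blast
 have f: "f 0 = pt 0 0" "f (Suc 0) = pt 1 0" "f (Suc (Suc 0)) = pt 1 1" "f (Suc (Suc (Suc 0))) = pt 0 1"
  using f4[of 0] f4[of "Suc 0"] f4[of "Suc (Suc 0)"] f4[of "Suc (Suc (Suc 0))"] by simp_all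
 define p4 p5 p6 p7 where p: "p4 = f n4" "p5 = f n5" "p6 = f n6" "p7 = f n7"
 note fp = f p[symmetric]
 have R: "EX k. k : K & snd k = 1 & tor (fst k) = orient (f a) (f b) (f c) & tverts (fst k) = {f a, f b, f c}"
  if h: "Tr a b c (Suc 0) : set (opt_list i)" for a b c
 proof -
  obtain k where k: "rz f (Tr a b c (Suc 0)) k" using fi[OF h] by blast
  show ?thesis using rz_real[OF k] by (intro exI[of _ k]) (simp only:)
 qed
 have F: "f b : open_segment (f a) (f c) & f b ~: corner_set"
  if "Tr a b c 0 : set (opt_list i)" for a b c
  using fi[OF that] rz_flat by blast
 have nc: "x ~= pt 0 0 & x ~= pt 1 0 & x ~= pt 1 1 & x ~= pt 0 1" if "x ~: corner_set" for x
  using that corners_in by blast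
 have dist: "distinct [corners_of k1, corners_of k2, corners_of k3, corners_of k4, corners_of k5]"
  if "tverts (fst k1) = A1" "tverts (fst k2) = A2" "tverts (fst k3) = A3" "tverts (fst k4) = A4" "tverts (fst k5) = A5"
   "distinct (map (%A. map (%c. c : A) [pt 0 0, pt 1 0, pt 1 1, pt 0 1]) [A1, A2, A3, A4, A5])"
  for k1 k2 k3 k4 k5 A1 A2 A3 A4 A5
  using that unfolding corners_of_def by simp
 have "p4 : open_segment (pt 1 1) (pt 1 0) & p4 ~: corner_set"
  using F[of n2 n4 n1] unfolding fp by (cases i rule: opt_list.cases) auto
 then have p41: "p4$1 = 1" "p4 ~: corner_set" using segment_line[of p4 "pt 1 1" "pt 1 0" 1 0 1] by auto
 obtain k1 where k1: "k1 : K" "snd k1 = 1" "tor (fst k1) = orient (pt 0 0) (pt 1 0) p4" "tverts (fst k1) = {pt 0 0, pt 1 0, p4}"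
  using R[of 0 n1 n4] unfolding fp by (cases i rule: opt_list.cases) auto
 obtain k3 where k3: "k3 : K" "snd k3 = 1" "tor (fst k3) = orient (pt 0 1) (pt 0 0) p6" "tverts (fst k3) = {pt 0 1, pt 0 0, p6}"
  using R[of n3 0 n6] unfolding fp by (cases i rule: opt_list.cases) auto
 consider "i = n0 | i = n1" | "i = n2 | i = n3" | "i = n4" | "opt_list i = opt_list n5"
  by (cases i rule: opt_list.cases) auto
 then show ?thesis
 proof cases
  case 1
  obtain k2 where k2: "k2 : K" "snd k2 = 1" "tor (fst k2) = orient p4 (pt 1 1) p5" "tverts (fst k2) = {p4, pt 1 1, p5}"
   using R[of n4 n2 n5] 1 unfolding fp by auto
  obtain k4 where k4: "k4 : K" "snd k4 = 1" "tor (fst k4) = orient p6 p5 p7" "tverts (fst k4) = {p6, p5, p7}"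
   using R[of n6 n5 n7] 1 unfolding fp by auto
  obtain k5 where k5: "k5 : K" "snd k5 = 1" "tor (fst k5) = orient (pt 0 1) p6 p7" "tverts (fst k5) = {pt 0 1, p6, p7}"
   using R[of n3 n6 n7] 1 unfolding fp by auto
  have f7: "p7 : open_segment (pt 0 1) (pt 1 1) & p7 ~: corner_set" using F[of n3 n7 n2] 1 unfolding fp by auto
  \<comment> \<open>Whichever way the flat triangles subdivide it, both vertices lie on the line
    from the corner (0, 0) to the apex.\<close>
  have nc56: "p5 ~: corner_set & p6 ~: corner_set & p5$2 = p4$2 * p5$1 & p6$2 = p4$2 * p6$1"
   using 1
  proof
   assume "i = n0"
   then have "p5 : open_segment p4 (pt 0 0) & p5 ~: corner_set" "p6 : open_segment p5 (pt 0 0) & p6 ~: corner_set"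
    using F[of n4 n5 n0] F[of n5 n6 n0] unfolding fp by auto
   then show ?thesis using segment_line[of p5 p4 "pt 0 0" "- p4$2" 1 0] segment_line[of p6 p5 "pt 0 0" "- p4$2" 1 0] p41 by auto
  next
   assume "i = n1"
   then have "p5 : open_segment p4 p6 & p5 ~: corner_set" "p6 : open_segment p4 (pt 0 0) & p6 ~: corner_set"
    using F[of n4 n5 n6] F[of n4 n6 n0] unfolding fp by auto
   then show ?thesis using segment_line[of p6 p4 "pt 0 0" "- p4$2" 1 0] segment_line[of p5 p4 p6 "- p4$2" 1 0] p41 by auto
  qed
  have p7: "p7$2 = 1" using f7 segment_line[of p7 "pt 0 1" "pt 1 1" 0 1 1] by auto
  have c: "p5$2 = p4$2 * p5$1" "p6$2 = p4$2 * p6$1" using nc56 by auto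
  show ?thesis
  proof (rule opt_netI[of k3 k1 k5 k2 k4])
   show "distinct [corners_of k3, corners_of k1, corners_of k5, corners_of k2, corners_of k4]"
    by (rule dist[OF k3(4) k1(4) k5(4) k2(4) k4(4)]) (use nc[OF p41(2)] nc[of p5] nc[of p6] nc[of p7] nc56 f7 in auto)
   show "{k3, k1, k5, k2, k4} <= {k : K. snd k = 1}" using k1 k2 k3 k4 k5 by simp
   show "area_rel (tor (fst k3) / 2) (tor (fst k1) / 2) (tor (fst k5) / 2) (tor (fst k2) / 2) (tor (fst k4) / 2)"
    by (rule area_rel_a[of _ "p6$1" _ "p4$2" _ "p7$1" _ "p5$1"])
     (simp_all add: k1 k2 k3 k4 k5 orient_def p41 p7 c algebra_simps)
  qed
 next
  case 2
  obtain k2 where k2: "k2 : K" "snd k2 = 1" "tor (fst k2) = orient p4 (pt 1 1) p5" "tverts (fst k2) = {p4, pt 1 1, p5}"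
   using R[of n4 n2 n5] 2 unfolding fp by auto
  obtain k4 where k4: "k4 : K" "snd k4 = 1" "tor (fst k4) = orient (pt 0 0) p7 p6" "tverts (fst k4) = {pt 0 0, p7, p6}"
   using R[of 0 n7 n6] 2 unfolding fp by auto
  obtain k5 where k5: "k5 : K" "snd k5 = 1" "tor (fst k5) = orient p6 p7 p5" "tverts (fst k5) = {p6, p7, p5}"
   using R[of n6 n7 n5] 2 unfolding fp by auto
  have f7: "p7 : open_segment p4 (pt 0 0) & p7 ~: corner_set" using F[of n4 n7 0] 2 unfolding fp by auto
  have nc56: "p5 ~: corner_set & p6 ~: corner_set & p5$2 = 1 & p6$2 = 1"
   using 2
  proof
   assume "i = n2"
   then have "p5 : open_segment (pt 0 1) (pt 1 1) & p5 ~: corner_set" "p6 : open_segment (pt 0 1) p5 & p6 ~: corner_set"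
    using F[of n3 n5 n2] F[of n3 n6 n5] unfolding fp by auto
   then show ?thesis using segment_line[of p5 "pt 0 1" "pt 1 1" 0 1 1] segment_line[of p6 "pt 0 1" p5 0 1 1] by auto
  next
   assume "i = n3"
   then have "p6 : open_segment (pt 0 1) (pt 1 1) & p6 ~: corner_set" "p5 : open_segment p6 (pt 1 1) & p5 ~: corner_set"
    using F[of n3 n6 n2] F[of n6 n5 n2] unfolding fp by auto
   then show ?thesis using segment_line[of p6 "pt 0 1" "pt 1 1" 0 1 1] segment_line[of p5 p6 "pt 1 1" 0 1 1] by auto
  qed
  have c: "p5$2 = 1" "p6$2 = 1" "p7$2 = p4$2 * p7$1"
   using nc56 f7 segment_line[of p7 p4 "pt 0 0" "- p4$2" 1 0] p41 by auto
  show ?thesis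
  proof (rule opt_netI[of k3 k1 k4 k2 k5])
   show "distinct [corners_of k3, corners_of k1, corners_of k4, corners_of k2, corners_of k5]"
    by (rule dist[OF k3(4) k1(4) k4(4) k2(4) k5(4)]) (use nc[OF p41(2)] nc[of p5] nc[of p6] nc[of p7] nc56 f7 in auto)
   show "{k3, k1, k4, k2, k5} <= {k : K. snd k = 1}" using k1 k2 k3 k4 k5 by simp
   show "area_rel (tor (fst k3) / 2) (tor (fst k1) / 2) (tor (fst k4) / 2) (tor (fst k2) / 2) (tor (fst k5) / 2)"
    by (rule area_rel_a[of _ "p6$1" _ "p4$2" _ "p7$1" _ "p5$1"])
     (simp_all add: k1 k2 k3 k4 k5 orient_def p41 c algebra_simps)
  qed
 next
  case 3
  obtain k2 where k2: "k2 : K" "snd k2 = 1" "tor (fst k2) = orient p4 p5 p6" "tverts (fst k2) = {p4, p5, p6}"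
   using R[of n4 n5 n6] 3 unfolding fp by auto
  obtain k4 where k4: "k4 : K" "snd k4 = 1" "tor (fst k4) = orient (pt 1 1) (pt 0 1) p7" "tverts (fst k4) = {pt 1 1, pt 0 1, p7}"
   using R[of n2 n3 n7] 3 unfolding fp by auto
  obtain k5 where k5: "k5 : K" "snd k5 = 1" "tor (fst k5) = orient p5 (pt 1 1) p7" "tverts (fst k5) = {p5, pt 1 1, p7}"
   using R[of n5 n2 n7] 3 unfolding fp by auto
  have fl: "p5 : open_segment (pt 1 1) p4 & p5 ~: corner_set" "p6 : open_segment p4 (pt 0 0) & p6 ~: corner_set"
   "p7 : open_segment p6 (pt 0 1) & p7 ~: corner_set"
   using F[of n2 n5 n4] F[of n4 n6 0] F[of n6 n7 n3] 3 unfolding fp by auto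
  have c: "p5$1 = 1" "p6$2 = p4$2 * p6$1"
   using fl segment_line[of p5 "pt 1 1" p4 1 0 1] segment_line[of p6 p4 "pt 0 0" "- p4$2" 1 0] p41 by auto
  have "p6$1 * (1 - p7$2) = p7$1 * (1 - p6$1 * p4$2)"
   using orient_on_segment[of p7 p6 "pt 0 1"] fl(3) c(2) by (simp add: orient_def algebra_simps)
  note c = c this
  show ?thesis
  proof (rule opt_netI[of k1 k3 k4 k2 k5])
   show "distinct [corners_of k1, corners_of k3, corners_of k4, corners_of k2, corners_of k5]"
    by (rule dist[OF k1(4) k3(4) k4(4) k2(4) k5(4)]) (use nc[OF p41(2)] nc[of p5] nc[of p6] nc[of p7] fl in auto)
   show "{k1, k3, k4, k2, k5} <= {k : K. snd k = 1}" using k1 k2 k3 k4 k5 by simp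
   show "area_rel (tor (fst k1) / 2) (tor (fst k3) / 2) (tor (fst k4) / 2) (tor (fst k2) / 2) (tor (fst k5) / 2)"
    \<comment> \<open>The two segments of the right side above the apex have exchanged their roles,
      so \<open>s\<close> is the height of \<open>p5\<close> reflected within [y, 1].\<close>
    by (rule area_rel_b[of _ "p4$2" _ "p6$1" _ "p7$1" _ "1 - p5$2 + p4$2"])
     (use c(3) in \<open>simp_all add: k1 k2 k3 k4 k5 orient_def p41 c(1,2) algebra_simps\<close>)
  qed
 next
  case 4
  obtain k2 where k2: "k2 : K" "snd k2 = 1" "tor (fst k2) = orient p4 p5 p7" "tverts (fst k2) = {p4, p5, p7}"
   using R[of n4 n5 n7] 4 unfolding fp by auto
  obtain k4 where k4: "k4 : K" "snd k4 = 1" "tor (fst k4) = orient p5 (pt 1 1) p6" "tverts (fst k4) = {p5, pt 1 1, p6}"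
   using R[of n5 n2 n6] 4 unfolding fp by auto
  obtain k5 where k5: "k5 : K" "snd k5 = 1" "tor (fst k5) = orient (pt 0 0) p4 p7" "tverts (fst k5) = {pt 0 0, p4, p7}"
   using R[of 0 n4 n7] 4 unfolding fp by auto
  have fl: "p5 : open_segment (pt 1 1) p4 & p5 ~: corner_set" "p7 : open_segment (pt 0 0) p6 & p7 ~: corner_set"
   "p6 : open_segment (pt 0 1) (pt 1 1) & p6 ~: corner_set"
   using F[of n2 n5 n4] F[of 0 n7 n6] F[of n3 n6 n2] 4 unfolding fp by auto
  have c: "p5$1 = 1" "p6$2 = 1"
   using fl segment_line[of p5 "pt 1 1" p4 1 0 1] segment_line[of p6 "pt 0 1" "pt 1 1" 0 1 1] p41 by auto
  have "p7$1 = p6$1 * p7$2"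
   using orient_on_segment[of p7 "pt 0 0" p6] fl(2) c(2) by (simp add: orient_def algebra_simps)
  note c = c this
  show ?thesis
  proof (rule opt_netI[of k1 k3 k5 k4 k2])
   show "distinct [corners_of k1, corners_of k3, corners_of k5, corners_of k4, corners_of k2]"
    by (rule dist[OF k1(4) k3(4) k5(4) k4(4) k2(4)]) (use nc[OF p41(2)] nc[of p5] nc[of p6] nc[of p7] fl in auto)
   show "{k1, k3, k5, k4, k2} <= {k : K. snd k = 1}" using k1 k2 k3 k4 k5 by simp
   show "area_rel (tor (fst k1) / 2) (tor (fst k3) / 2) (tor (fst k5) / 2) (tor (fst k4) / 2) (tor (fst k2) / 2)"
    by (rule area_rel_b[of _ "p4$2" _ "p6$1" _ "p7$1" _ "p5$2"])
     (simp_all add: k1 k2 k3 k4 k5 orient_def p41 c algebra_simps)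
  qed
 qed
qed

end

subsection \<open>Certificates\<close>

text \<open>The certificates are stored as Huffman codes, six bits to a character. The code of a character
 depends on its position in the command and on the preceding command. Any string is sound, so nothing
 has to be proved about the decoding.\<close>

datatype huff = Lf "char list" | Nd huff huff

text \<open>A leaf with several characters abbreviates a balanced subtree: each bit keeps the
  characters at even or at odd places, until one is left.\<close>

fun thin :: "bool \<Rightarrow> char list \<Rightarrow> char list" where
 "thin b [] = []"
| "thin True [x] = []"
| "thin False [x] = [x]"
| "thin True (x # y # l) = y # thin True l"
| "thin False (x # y # l) = x # thin False l"

fun descend :: "bool \<Rightarrow> huff \<Rightarrow> huff" where
 "descend False (Nd l r) = l"
| "descend True (Nd l r) = r"
| "descend b (Lf l) = Lf (thin b l)"

definition "rest_op = Nd (Nd (Lf ''f'') (Lf ''cd'')) (Nd (Nd (Lf '';='') (Nd (Lf ''a'') (Lf ''-6''))) (Nd (Lf ''8:9<'') (Nd (Lf ''?y'') (Nd (Nd (Lf ''>'') (Lf '',7'')) (Nd (Lf ''/50L'') (Nd (Lf ''Nb'') (Nd (Lf ''e'') (Nd (Nd (Lf ''ptrvqusw'') (Nd (Nd (Nd (Lf ''x'') (Lf ''()'')) (Lf ''*.+1'')) (Lf ''2A4C3B@D''))) (Lf ''EWOgI[SlGYQiK^UnFXPhJ]TmHZRkM_Vo'')))))))))"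
definition "rest_arg = Nd (Lf ''0214'') (Nd (Lf ''56'') (Nd (Lf ''37'') (Nd (Lf ''8'') (Nd (Lf ''Tb]d'') (Nd (Nd (Lf ''e'') (Lf ''BC'')) (Lf ''MXNY''))))))"

fun op_code :: "cmd \<Rightarrow> huff" where
 "op_code (Cut r v x y z) = Nd (Lf ''a'') (Nd (Nd (Lf ''c'') (Nd (Lf ''d'') (Lf ''>?''))) (Nd (Nd (Nd (Lf
   ''b'') (Lf ''89'')) (Lf '':<;='')) (Nd (Nd (Nd (Lf ''e'') (Lf ''45'')) (Nd (Nd (Lf ''7'') (Lf ''-0''))
   (Lf ''163L''))) (Nd (Nd (Nd (Lf ''MU'') (Nd (Lf ''W'') (Lf '')+''))) (Lf ''.E2G/FAI'')) (Nd (Nd (Lf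
   ''KSOT'') (Nd (Lf ''Vl'') (Lf ''*@,C''))) (Nd (Lf ''DPJRHQNh'') (Nd (Nd (Nd (Lf ''q'') (Lf ''Bg'')) (Lf
   ''krmu'')) (Nd (Nd (Lf ''vw'') (Lf ''Z^]_'')) (Nd (Lf ''fonp'') (Nd (Nd (Lf ''t'') (Lf ''(X'')) (Lf
   ''Yi[s'')))))))))))"
| "op_code Reg = Nd (Nd (Nd (Lf ''4'') (Lf ''0<'')) (Nd (Lf ''=>'') (Nd (Lf ''?'') (Lf ''35'')))) (Nd (Nd (Lf
   ''6879'') (Nd (Lf '':;'') (Lf '',1-2''))) (Nd (Nd (Lf ''HMLN'') (Nd (Nd (Lf ''U'') (Lf ''*+'')) (Lf
   ''.D/E''))) (Nd (Nd (Lf ''FKGO'') (Nd (Lf ''TV'') (Nd (Lf ''W'') (Lf ''()'')))) (Nd (Lf ''@PISAQJl'') (Nd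
   (Lf ''BhRmCkXq'') (Nd (Lf ''rvuw'') (Nd (Lf ''Y_^o'') (Nd (Lf ''pt'') (Nd (Lf '']n'') (Nd (Lf ''s'') (Nd
   (Lf ''i'') (Lf ''Z[''))))))))))))"
| "op_code Hull = Nd (Lf ''a'') (Nd (Nd (Lf ''c'') (Nd (Lf ''d'') (Lf ''498:''))) (Nd (Lf '';LAb@MCe'') (Nd
   (Lf ''6E?N7HBO'') (Nd (Lf ''0D<J5F>K'') (Nd (Nd (Lf ''RS'') (Lf ''(+*='')) (Nd (Lf ''GQPT'') (Nd (Nd (Lf
   ''U'') (Lf '')/'')) (Nd (Lf ''IV'') (Nd (Lf ''W'') (Lf ''-3''))))))))))"
| "op_code Branch = Nd (Nd (Lf ''d'') (Nd (Lf ''e'') (Lf ''=?''))) (Nd (Nd (Lf ''bc'') (Lf ''8;9<'')) (Nd (Nd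
   (Lf ''>a'') (Lf ''3:5L'')) (Nd (Nd (Nd (Lf ''f'') (Lf ''-1'')) (Lf ''274H'')) (Nd (Nd (Lf ''/60E'') (Nd
   (Nd (Lf ''l'') (Lf '',@'')) (Lf ''AFDG''))) (Nd (Nd (Lf ''MPNT'') (Nd (Lf ''UW'') (Nd (Lf ''y'') (Lf
   '')C'')))) (Nd (Lf ''IVOhK_Rr'') (Nd (Nd (Lf ''vx'') (Lf ''(.+Q'')) (Nd (Lf ''Snmp'') (Nd (Lf ''qt'') (Lf
   ''*JBu''))))))))))"
| "op_code Merge = Nd (Nd (Lf ''d'') (Nd (Lf ''e'') (Lf ''ab''))) (Nd (Nd (Nd (Lf ''c'') (Lf ''5<'')) (Nd (Lf
   ''=>'') (Nd (Lf ''?'') (Lf '',-'')))) (Nd (Lf ''/96L4:7f'') (Nd (Nd (Lf ''183;'') (Nd (Lf ''GU'') (Lf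
   ''+0.2''))) (Nd (Lf ''ATHWDVOl'') (Nd (Lf '')IEKCJFM'') (Nd (Nd (Lf ''Nu'') (Lf ''(X@_'')) (Nd (Nd (Nd
   (Lf ''y'') (Lf ''QR'')) (Lf ''S^]m'')) (Nd (Lf ''nqor'') (Nd (Lf ''tw'') (Nd (Lf ''x'') (Lf
   ''Yh'')))))))))))"
| "op_code Chain = Nd (Lf ''d'') (Lf ''e'')"
| "op_code Nop = rest_op"
| "op_code Ear = rest_op"
| "op_code Bisect = rest_op"
| "op_code Opt = rest_op"
| "op_code Half = rest_op"

fun arg_code :: "cmd \<Rightarrow> nat \<Rightarrow> huff" where
 "arg_code (Cut r v x y z) n = Nd (Nd (Nd (Lf ''x'') (Nd (Lf ''i'') (Lf ''Z[''))) (Lf ''_lbpaodq'')) (Nd (Nd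
   (Nd (Nd (Lf ''s'') (Lf ''8M'')) (Lf ''QXRY'')) (Lf ''^gejchfk'')) (Nd (Nd (Nd (Lf ''mn'') (Nd (Lf ''r'')
   (Lf ''@G''))) (Lf ''JOLSKPNT'')) (Nd (Nd (Lf ''UWV]'') (Nd (Lf ''tu'') (Nd (Lf ''v'') (Lf ''/;'')))) (Nd
   (Lf ''=DBFAECH'') (Nd (Nd (Lf ''Iw'') (Lf ''5769'')) (Nd (Lf '':><?'') (Nd (Lf ''+0.2'') (Nd (Lf ''34'')
   (Nd (Lf '',-'') (Nd (Lf ''1'') (Lf '')*'')))))))))))"
| "arg_code Reg n = Nd (Lf ''01'') (Nd (Lf ''2'') (Nd (Lf ''3'') (Nd (Lf ''4'') (Nd (Lf ''5'') (Nd (Lf ''6'')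
   (Lf ''78''))))))"
| "arg_code Hull n = Nd (Lf ''0'') (Nd (Lf ''1'') (Nd (Lf ''2'') (Nd (Lf ''3'') (Lf ''45''))))"
| "arg_code Branch 0 = Nd (Nd (Lf ''6'') (Lf ''34'')) (Nd (Lf ''57'') (Lf ''0218''))"
| "arg_code Branch (Suc n) = Nd (Lf ''1324'') (Nd (Lf ''56'') (Nd (Lf ''7'') (Lf ''08'')))"
| "arg_code Merge 0 = Nd (Lf ''35'') (Nd (Lf ''46'') (Nd (Lf ''7'') (Lf ''28'')))"
| "arg_code Merge (Suc 0) = Nd (Nd (Lf ''1'') (Lf ''23'')) (Nd (Lf ''45'') (Nd (Lf ''7'') (Lf ''68'')))"
| "arg_code Merge (Suc (Suc n)) = Nd (Lf ''0'') (Nd (Lf ''2'') (Nd (Lf ''1'') (Nd (Lf ''3'') (Nd (Lf ''4'')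
   (Nd (Lf ''5'') (Nd (Lf ''6'') (Lf ''78'')))))))"
| "arg_code Chain n = Nd (Nd (Lf ''7'') (Lf ''45'')) (Nd (Lf ''68'') (Lf ''0213''))"
| "arg_code Nop n = rest_arg"
| "arg_code Ear n = rest_arg"
| "arg_code Bisect n = rest_arg"
| "arg_code Opt n = rest_arg"
| "arg_code Half n = rest_arg"

fun code_of :: "cmd \<Rightarrow> nat \<Rightarrow> huff" where
 "code_of c 0 = op_code c"
| "code_of c (Suc n) = arg_code c n"

fun decode :: "bool list \<Rightarrow> huff \<Rightarrow> nat \<Rightarrow> cmd \<Rightarrow> char list"
 and settle :: "bool list \<Rightarrow> huff \<Rightarrow> nat \<Rightarrow> cmd \<Rightarrow> char list" where
 "decode [] h n c = []"
| "decode (b # bs) h n c = settle bs (descend b h) n c"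
| "settle bs (Nd l r) n c = decode bs (Nd l r) n c"
| "settle bs (Lf []) n c = []"
| "settle bs (Lf [x]) 0 c = x # decode bs (code_of (opc x) (arity (opc x))) (arity (opc x)) (opc x)"
| "settle bs (Lf [x]) (Suc n) c = x # decode bs (code_of c n) n c"
| "settle bs (Lf (x # y # l)) n c = decode bs (Lf (x # y # l)) n c"

text \<open>The sixth bit separates the codes 64 to 95 and 124 from the others: the backslash, code 92,
 is replaced by code 124.\<close>

fun bits :: "char list \<Rightarrow> bool list" where
 "bits [] = []"
| "bits (Char b0 b1 b2 b3 b4 b5 b6 b7 # l) =
   b0 # b1 # b2 # b3 # b4 # andf b5 (ite (andf b6 (andf b4 (andf b3 (andf b2 (ite (orf b0 b1) False True))))) False True) # bits l"

text \<open>Each string is decoded afresh, beginning with \<open>rest_op\<close>, while the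
  configuration of the run carries over from string to string.\<close>

fun feed :: "conf \<Rightarrow> char list list \<Rightarrow> conf" (infixl "|>" 60) where
 "x |> [] = x"
| "x |> (l # ls) = run x (decode (bits l) rest_op 0 Nop) |> ls"

lemma (in net) feed_ok: "conf_ok x \<Longrightarrow> conf_ok (x |> ls)"
 by (induction ls arbitrary: x) (simp_all add: run_ok)

definition "c25_0 = [''zvoyHlSkq;QQSgVjV^ZKJxJaFMEGjZhSAYXfTQnwP[D|ImQ@p<@HDyM=jeDz> TC]J^MwjMN[aZjU?tptbvli;bl][M[__mfSaFMEwbBUMtiyx^TPFfHwM;CTKaLR aV?tv@FfI]d;Utl utl@ YKHlYVtqkydVCQH=@ddXFFSgck;DpYiTF<iqLCXwnvsb^SAamfqRzvFHo?iylL[;Al<cO=el]uZ@CfVa=mfrq>BSObQPf SRfemiJ YseUDjLsTlQxrHQIxJYVDe|<DXeLC@FTvRwHFP;RwFPJwlKZRXwniIpfI@@IsmZEdpsTHMMsHLhbECx<x'',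
 ''OFEJiL@UPiC>JEX@ U;b^P]cX@qkYVuJHapTHMMfa=RHlhFZ=IRksCtLszxujhZahiZA@SVPH^wlkZRh;gGfWtgEynYQGdsmdp@KLdKXYOry=cdwAKceM[kQ^W]mAb[IJAP?zlLHuPgb|;ReM;VlinFzt||OJ^Mwj=So=xkIwxrTSjRyPBnoMrA|<AKk>Xd]RePJGF;clnXdWuGG;BSmPJyKEPrZGHABDG]XYJnxhsHSi|[OIy^wmwnIrKjsEwN?|T|zWWx[GjKMogDvgvdOfDyn[qn<VjgAL|nSUq^N>P^HWTgJ>iyin;VtjVFRo]YdUFxTJehpcz'',
 ''owII][M@rbVcLMr>YsgoFymKuTKfU]d[WjlYwbMusVVaQHiBPjJKmRD;uzDaWiNU<SsSm]mVSNhJAVmdiZvc;svO^dWv<xJLBIDzeBXsntsj^WAfmdqZzc[rvweP [Ud__YN|[bzu>_jLD>;<O?sZjnZjfBa^IEVTSyveJ[vmXS]wfmWTiv<uZ^YRnVLbMC]Rpllu=sCsKzsfoK^Mwj=So=xkqyqv;d?<<_<yjscjx<sYuTk>iaiEmYSwEY;vZv>>ZMAUMtiyx^DYSb<[Mk@ntH WwEDmqOpRhSsq=HrnE;r[[ofzsmWd_|>;_nVST?la=RlgEASy'',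
 ''?w];mmt;_xDVvUki^MTNEdmpFmDoEesVxT?>nSKcRbs<AGhAnma [KlQKq[QylENuGJgHp|hSsq=HJ;NmLxFTKJq@_GsaNMGwcbB@g@FNrDNdX ?GK;Jm^Fc_yf_Zx;Aw x?>^HsJzTkKHSQocHdgBnrPcfVjNekOGZdbIwLO yC_<jWDsPTW_ksNRZ@LH FubXK?j=n>Lvn?jO|=[IPpUFZdzTiyFI@I;FDVFuPpUBMZJnEYrnSKSLpwqVWj<IKVRnuCypJx>LCxRC?OUFppdwzx^=;CPKyAt[DapK@ kMuTO?^eGyu<sC=YqK@ _WexLdxL_pAz'',
 ''i?DuZBnbleSmM>L_I^jQRKRURd PaBziPcfb[QqK rTASTAAmxV[sNp=aJ^gFGS^vS<aw^;kq]x|uFhenZAnf?xAGAGp Chfr LTNQ Nuc|PhQ<=>wsy]<J[mKnHTB?=z?^r?FWUA>scNiniU=HSeNQRBCN]TuZRHTwaIC pphu@nU|nH;XJg|fPgdtoEI^c[rI<RR=VcCpU<ghQkjTgxB[mjR]bs<ghQkjTgYR|]?rPN[wbrqDasnDJsG| FxzWsyoytoNlnX_vz]ajFzt||OJxJaFMEwbRtXxWr>r;epRhSsq=h kLtrgVL]WNO>|Z[[Ui|Jthix'',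
 ''RSgVjb|_ZwFoMb|MjedK@a TtsedpRXcVbsY;viq <anTO<SCIjDZtT|N_e^UUd;WWD[IKoEFwMwGPFwrj|kWcFwOOD|ePcBrw|^MTuPgBnRHQ_sQXgVcwcBnrPK_Zqt]ajFzt||OJgGwfrZ;KerTsF_cii>xLCXbhTcdfb@DbfmpR|XjZQm pFQ_yCsAGmHS=]LLteZMJG|HhQqD[>hYKdsuPgfc;QQsVXcVbwbrY[JLAjUpXDXXhK>lif]OILwJIp@uJ@tMszx[ZfEwpXOID_eNIUHUJQ@BMCcRdXq]N aN_<UzdTaTiDAHLupl@DrAxFMtw@ St'',
 ''yD=ePU|ZNddxSStAGrPVdi[FI_ClJBLLteZMJG|H x[W>|H>R_ioaYdjmy@|clqh|ScX_dIIDffslzIM_pjIZ^kUW@QqdVs[lzBHJM?FSBHEMNIPuNv]I|]DxXTxHNxr>ea|vfZvxKYBC]ai[;]DXhcHa|^KlQQ@Xn_kOgCKl|^KlQKq[Qy|IkTJWWE;ikKR=goVEyZsax;qn;jcsL s]<SRxJIsaWdvyCHbn[qd > HDB=DQpEQwmXRXU_K?a?LuY[xsnLkIbGZ CAMQthaXYjYwSr<k;hTa;JiH@aRxE_b_j>zj;fekA]P?fVcpImvKmj@HU;OZ'',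
 ''cCBXhnSWUs]=win^ES]cdhVY<eUYYjNNTulaRjkdzVPnBnQC=MPoeKWi=iLkA]pa FdIbTG=ztfuaanLkQ|pa FaInaOZrX=ZIMjuHrAgBGbZDyP|QLql_YXYqvl|ndUJg=;fuCiv=sCsKzsfoKgKSUqrTsngDM[aMJL]bbNb<@|ctkdtWfzp>DYJnhYKlQIS_h[Ep_jUUKFP?Z_Wtti|^tOIsypscyreVV;CU^IOBOOFM[m[RV;wkCUMdxp>HGNVC[tR<VThPYItiyxtiww=FpqHGR]gUVUaOdYDfBMZJnEEM]ZiZyimhPUC]ZNnGEynIHCS_ |I>'']"

definition "c25_1 = [''gQBLt;CRwlhCrhbbEjfbE@lZAafYRgHwInFfP<AXIItMFOGWvI KRqLDSSXFPwNwsdni qfsXJmmAv;?z|ffu^@w>qo>eL]sZ@CFWacmFsqqBcObQPePgdJKSIJ dy<JFTYAhMBgGYhDZeDK<RN_BjRbA@CjZYwHFpve][DIRuNiIanmiIPsDA YsMZAIbLatTOcp RVL Kc[FaRZC EtzPlR A@fmSzAyFq@Rd[fuBRXLatT;FRRXl Fz=qkvhGhXVuIrkH[aiI[A@KVPHQE;lfDz>yayE=YAYLumIjRTkQVSU@BQ^SsnVPh_MHuPgb|;ReM;Vli>'',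
 ''sPgfc;QAA@ d;V;mo]>uxXWZ>=]mCqMUSy|YGUvMLDWfb^deUVDovtmd[XkiVoTS=GUuTSTcRNpqTjnWvSUFy'',
 ''?[hNUp;I<<|^?bTOWVa>SVV >=V>L^^gQXxCeeKQaYDvL;NADoLuba=RHlhjU<@n jE=@nCEI@dlCmdDrzqVfLB[OIkF[wJk@@BhffIP<n]ifzY;nYtmsPrRnG<c=w=Zfsw^KnWYgOHBQv=sCqkyRnqmH?soTS]MlQKqajFzTb|;<XBuPgBait|svDvB[tR<VTrANp=apKigE?nh TlSou^MNcK;>ol;qCYYGYZGQdnZDFdi @BrhxuzF;bkFdAYJHHKbW[]h]_N[wvwEQ=RaVMSzDUmOyRXfnB@RkpYiRlLncCEluxDa[TWJR utBJQpTsyJeuNDt'',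
 ''_] vfvZ@HePgP@];|OSzfBF[NcitvfL=iyepwvQBwc[Ji=^PgjDzdTYYJW@^qPRbcl rZnTFT@IRaBxSt<;<XM<_g@uZG<O[xYK^wl LzgDylyViuyQTOUhLEfr yYzPUC]ZNfwSoT@Kb[W<zwBrh]jINvevXNga<lFdAk>D<KLuBkdiB|K;KGHABLP D|?<@wv<LUBNe^LEfBSYpVyzj|_VWyN|IHOP_abW@e>PUC]ZNnGEG deNoCa|kpizWjPLg[j^qy|>ZqkXNISRNarCxDwIGedRp=TNciZCG@C]^w=lWrxOwYwIxoD?=C?CF@BaiXgvBk[kz'',
 ''umeZJXLwvD[spcK]zIXq|zMpi|DC]thGpPNkAYpePgfc;QR[cCPrFidu<o;]iAPHSzCVVgjZKUaS]QPVgDeizWrRz]dsZbLhmmLmltt]xWkmGWjGvc_qlGsu]R<K=? [Ojt]Ux]|MvmEZjjP]EJSciqtBjZhSapTZfqN|FVVPV=c;q>dVC]ZNnGMz@KH@R=JlKidMYRJYs>eaeE[sVnK^ATzW[SNp=a>we<lX^g=mo>]oEgevsrGf?agKiLekCEJnT=SCSKZsbfNmTEjZhSsqIrgZv THZuHiiI@a LLlkE@]_Pjaxu<k=qY[jfzZXcVbCUMtiyx <'',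
 ''c>fXZU|jfB]ItiPXJM?|_PFWCUMdhRhQSqmhPUC]ZNnGEM]ZiZyimh LLSzHwkhYAkiYApP_MIlYVtqkyV[Uz|kNfY@CsSbpZ_bfrD|RrllMUAL[nQSHQdQdfy eHL KcDe kdYQTrqS UrL@XhwolMQn]nWI]SAcMgI]STGWb|huOmMMIXXftqkyV[iVCQptYTOQ=@ddtDnxc|HrYkf AYj|gRA[MaQJefHkILRMtDYMrdnJvZ|W<JmiMguy;Ob=;SkFbAYj|gRD[MaIMRetAYMranJvZ|_vhtfv<XRY=jqezR[xY?WvEY;SjF@pdnmBn<sJfRZY'',
 ''rDb|Nvq=HQaYW|YJZcxcV@VSHgr]sHmnJci@G[D?bnbGpMOQB;fU]d;Url url@PYKHLtWKB[ve^Vu;jl]mw@Ff=q]Fa]sjNr=JYVpZYV@hlEDFzkEaM;ROkz]EJYl>xc[B@ cLSumfVa=ZSyX_AyOL]Gvs?adw< A|vX@A_jjef_XA|iaupzbhiBa^IEVTS=]SbfSItISulbEDFfjEAVtHJIsPLMygG QXpjDFppdgDb^@GtWLDr'',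
 ''z=<HLxRD^k>wJ|DL KcDe kLsbhdcg@kLs@ AK[i[DCXsTWfePQE >P?irnxz=Irms=fj =myLKi[[BxcFCX VnKeZREomDZmI|hEf|DZ^_kAXJaNiilTyUbmptbm@PEKHLLUKB[vHOK[Aaa>ZQHr=JYVpZYV@hlEDFzkEaMsbfNIXF=ywffmy^mhGH[Rd[g;MUA;[Y[BfSItIMeejb]VKB]wlfevmZXbysdOdmAsKS>i>|O=@@juYVtHJIsPLMygGppdgDb^@sf[tDRDYDiy=<HLxRDFpqbzoZAfGIJAWYfEQIGOAVYfA@CVvRwHFpEbh@|]]Yn^?'']"

definition "c25_2 = [''reipZJnZWletAhej[uCxf=QnWIsBVKsB@em pqJ^ lYQgHwNw[I]SAcMgYitvFXo?ksmtlvCxvO>uodj[VALHnBG[EsqqBqGqHLePgtTVj|w|KyZXBVNo]@VRrwMbgcK;|@lhQTRfaXZrOO aiIRHoYJlfWjLsb=S<yV|Q[fE@VvNpgu pqJzU=AjWzvt@<AKuFPhVskfDeSYTJs]zHacwDwiKrWKGI aHs]F^MsjfAIDFi<;RQMIMa_zc|vfra_zsBPmq<qK@kIdsHwLRoHS;T cMf_qWsCTLQnYWtbpfYigbJjfsBZ@LDWsljSd[DIaqBHqkM>A>'',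
 ''gJrVXZrV@pbEDFfjIanIrM;bvHltGPb_fPhWJaEun[Qs|[oFlXyLmCADljvEdq]z|n[y@FAsZ@IMFPZ^OGpPogDrK@OZ>SZFeXGcqtdW[|?uK MBCVep@>VbqBXuu]>xHcexVeXKvIY<DniD[@p JVRc ppdOM@YMozjuYUuYkvT_k_ reM[v>NCEMV|JhAP@@@dLMC=REdp_PauPOR?fxrTXJZQO@kQKJ]tZMcDArWfv;Hr]sHytNJW>WSsNHaAVtX@GKj?jEHQMSb|SS[DNvxGxd]VKB]Sm>vBETEuzGxAdLc ZblVtCxf=qeihU<@lf'',
 ''?mb|InHvZB?i|snhMB[fQZmL@@IsmZWPBOsERSsLBCjXq@NOvLnPIeAhBJ]pWyBL@|lb^UsmqUcmFmb^U_@WkOQZ]^ fI^Msv@mRpcDXXnfDzfY]d;neVZu EL_n_@|RfSoZUqz|zv<x=KE|DCA@H?IMC@XVCHiqP_>iTfSr|B@|l=UBGaaO<A@Xi]RPBC=SdpfYQGoVeTKDmTK@TrBBCsubpn]mglBrwVsXQomIzwMFp@e|URMkbKKAW[FG|aYGAgoou@HSpIIsrosR[CXtUksrZq VFCsGBZme=|xDVZOrmlo@DFbWkRjEbVjE@JYAacmzAZWZv'',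
 ''B@ uEi@ArZtzpu<@MS<nYWubpnY[ VIxQBd<Z]zuUVckV?p;f]UKBKvQhjUgfCXIlQKq[QQ@@p<geK[Uepl;F;Mo]yutIkSdnOA?BKmpJygJ em] DHp@ARxvmtyFmQiCx|MEiFTfR_K;ERzQKSBavSRjQ;VIE@P@EDCS DyfQKgCRqfs]?rPb|?|_B[aMZI^KJHE;t[mWsY;rZSDaxDHp@IDuT_HNSkgwyuMgkDkAp@AFHaveTkOHBzc PTw=;cbpqGDA=QPPnJnSWj;>=QQxxCb lZ|gnDymsZqmi>NN> ]gzkEadzvbG^JuaAS|rvTDFLYVSD'',
 ''?]hANDtDQcFpWn=CfHRgThIBFyncHzjL<hHzh>DJ>xLnpZKtRVK f=xARX @CCfxX>FeYfBSAaO;XmEGdlV CY?kGHaABP wFJwPjkdz>QOA>|[nBN @]<rPDXLjxEJm ia|paaFbAuPJ?LOXFHpPc WZATRJyEEPEoTahR@qYxFiZ;HhrQjVLBZvHUSFA aoXsg_qYuVhBkrqu<GOXDL ACXXKALDgqeQyZpDmfeVUk]eTzGb@y=DppVRHNTJQLzkm pP|^jN_>EgU[qUiUKpulGw[DL ACHsLEMhCNDvPIlacAYpkWJiNzJ [WzdbtY|YwG?H t'',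
 ''rOBnxgiT|etk>wVekicFjNUFL|FWv=GCjdWCj]u@jAuuZ@]CfxhQXpze]_<c@RuHJyC?HhQtcjA]qOSixJiZD]mFpzpDk]_N[wvwEQjZaaToUSaCnKjzCbP|]DFbs?PTn KeQfDJ=UTyOrYZ[[M^[;ckh><tcxmYO>Sj_IKxfFaAWnThUsdNK@oX_]OSzfBGYoNcitvf nfpQL?sBeupZnxYjAGuAMp<eaHBm>lLLSzl@DxE;k;YRwTxH;uYLevvDtuDNby_VhnBmEZS<Ofkt_ei|pVLO>^pCHQ|nG>s|VB_zh[GApqjbmdLLXa]K PfXK[xR_F'',
 ''?mt<CK VzC|yz[Ed@UB]RjLDsoIMSy^VsFjupZnxYjAKcoSsT^PWOKMcGwktJxWreaw=atgffqcOht?B?wyrnzZAMpGNuqc;aIUZU[EWXo;CXLefefsjKEwL?Rd^d=ncfn]ZyhSJ=xGo;YS?=tOB> @NVjlLV?MLp<eaHnQDHQi@@@@s_Vnxj;tUBsn[lcdVqsReXY|GGJXkIvO;i]CYofFZr@JSjugiISzJluHuPSduL_K]tDLhgTjWqOjAaKT]gQd[FUwYL>pxXfjqd=]cbPmVfvwmcYZEFqaQqZnX?beI]<BhXKtTUazJtbQZIOr dqCib Rgq'',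
 ''_]VZFojRTnGLniVTm>ZirzswM>nMW|IJ;ACLnIwtntCILocRotQsotMbcEUkoVjl><][Yl[bKXLEmhGPKQPm<yvuj<BamsncgFaq=OHDpqbjuO^AXC_KqXa]TxRGlky@X qB;hpeNXGSe_i]Xi@j[zxb?Kmys;MzZ;c;AP^mcHX=Y=Y=cHwM[?uw^zuD<OGsRfq@_PWRM a?frs<tU@piUxlrexYHEZQmux|DFvfQxFueb[f_IJAVSKLfehq ilTtXA]=lKeMNZ[GGPlChV_w_E^vjg=?egQ?D?KK?eGsYdvBGqex<ni]JaNiCh[GaLid^DLVv?B>'']"

definition "c25_3 = [''?MTCnaZ=YZLMnIw<=v?j @GnBkQbZkYkbFC[[mTAFybE@HoRTD|bpS>CWb;T_hni;oBO[us>?rKwM[ss<tU@xpexNe[p]^h<Rqeh<Lzgx_Yyo<TNctVxx]qMmSItI]@][]S[JaNiilLEbW@E[afjJTWaVLRKGEWp@;=JsluM_W?Xx?rS trtFkN[]@o|zTuYkCxPiTE[MNKMk=gIrMcseJFIiqi|IixvJ;<QqiN qyTqHUk]IN_^mHdhLDOMbqi;ZyuVtUqQeCxPE[MrhZM_tiTuP|eJvZJfQRKGUkOkokV_Wb|wl=iWSpoLvK=Fp;[rs<tU@piUx'',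
 ''oenDKc;xPaVivZ|NBwhnT|s<KQIpZZ_j=w>AcA|Q=qyyYtOq?rr_YVNctVxxS=oFwtNePgtAtgF=BI Kte?Mo|wlMOsSWA c k;tyH|czRqMsoDegQ?D?KK?eYyLR[acoFwtNePgtAtmuMmiDzdfrrtxRwfHwM[?uw^zuDj]RKaIUJEymY|V]s<DXMKuREAMOCfY>pD?W^t@fmT[@al@DHpKFRR|dEtD?NNV<CpZXMlfKeAEPbTh@>DM?NOVC?wIPmvDq[SP]|gPaB^TCexmjzNC<@RtH][zGDVhPGuc Ru]rZwpqbcu>jIh@RdBE<XmHNovBUdhj='',
 ''?W=VBsALtuYGYrgDw_<HKUX@whnT|s<KQisE=In|Egs|skAnOnvd[Dncqf?Uoy;][cL mN;Xi<IVCwAd@kYibHKnss_| olUDfG;F]mBYN=Iyu|GERk|t^;Jgof>tJ;xJiYu[?vY[DwHtQMAN[TPrcm_YDvDoyStJqk<Z=c=?SzXiF>wq?FMB@?;UuM?;mGKuvg@EPblPqX|[;yVcx|KSa|xSlywyv=o|N<_g@gMVPrmM;A@dHwM[_zuD<KcAvGo@>E[NkEwj^mFmxNuKTmxnqKtCjKEIpZZSMyS[NV|m>Zq=gz_=BtLcT BZqFWs?XjFqajqZ|bp'',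
 ''sKEZuTkoiQ dtXAoV|?uK kugE ZMO@kQkIV[<I=BhXKtTUazJt_YXmTisxnc_JKncpqZjuWkiWjJ<ZMrhZMEJQn[vf VSonAjVSwxEz|QBlfvT;j@NVSonyGo@MSSSyHTYm>ZM=z>@ZM=zJkqUk_voLllX[vr]yLx@Vn]Z|_qigbHUmkCQMthRMh rTth|piQq oXnRs^YPFFZ>kTiM=Z]LHT[muKPmfs?Nb[uN| BwXi@FHPfuHBLfr_uMR=DGI<NFfZslFE qTthpQ|p=NNFEbu@jQacp E_kIWAGP c^J]@X RGffRThiKQwjGupEPb<ityV]B'',
 ''?JHE;hAS|VEeTMBCndUh AFXykKrDya <fiD|?<p<b>ly;bfNmTm<tVTPFSQNPkBLc@Cm]IZLummdH_md@Ctj@pfYQghiEVRCS=dPbj]RkPnTj@DzFBIrldNGpPoOQuNiUHWJU@BsMlH@a@@dLLt@ sT[baRXJNOGZRbtF?@lNVWxuLcThA|EAFZ;RCPmNO@kyeKOF^[EsT<fQYd[FiT[@@Rlqh^SchMrlDJSgsltI]> eRtymVZATEsZ]^ceV@Uisoql@ZQgSBtlcmHAuQ cuakyAVC[TbJfRhyg;SXKlQKq[QAYtOIfVt^LN_yZ]mxRIdhs]WjSx'',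
 ''U@wuqwd JipQPDwyAdsf[udZMBCFgu LhKgMwjIuulBmNummdl@<aNjUx>RjBPx^TkauDQg;nT_YVPCzh>mmFasZ]PZIA<izpQK_P@Cu]^h?bzfULwMRjZbqWWeqT[|hnsXAHpKFNtB cE?@lFVs[w^gaCmxvnzNubcuzZ;rBPmfG uhuDkM;WFBrhOgk>Bm]]VvwEdrPtlEbSX_mBt@DNYcfNmTm<T<Z=[SBxX]duxfEJIqGsTRNgABEzRhSsq=hT=?D>Vz[b?ahtybzTqkf_JJu>uY^?PuY[OIlMue_NIDwM[g_KaY@CS]jHvrqcyAylzRq;ggp'',
 ''GwlVer xmsclp eRnDY^X_Zgxt>Z@dYMb@ci<IsSWCi^i YsbNgAWysBVFJXyByNHUdy@XXmb<YxsHp@YA H^ATFrLSQcx sFp[FMVKdSYG>OuFsq;xXdATcp v@nU|fg|LejplVhL;VEnf?HwFqmNcPaBFXAait|svD|[v|VEDwp^ILVv<J?wL<MKBqoNKf_OHESN_fGD@@BM]ZiZyimHvx>F;_zm_xuTwot=_^wSGr<Nrv]Ddleiz^RdYmhXjLEYT<ZsTl<OKKnRXSWB]WBqmUvveJ;|Uemc^bBA|Lef;n>|F|ctkj^uSgbR@GLUnt;PdoVxL='',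
 ''oT@y|[uKOGdub[YnPft|zU^@gynpQiits=LNQjvrApPowmb=mL>k]VVp_K>GG>gL@DYrZguBn[oruP]EXfkIqla;VzlS cy<[PRyHFziQO a hEGS]GNGJHNJ^ut?CqDHZztRuhUemRd@NXjoc_D?;Fcp t>n<GDYFLpXJZDG|? ^cpnRXV=CmDPVqqHLM?MwH@|LbpqsEI@|rUS]rImAAN_RJmCsyR[p<NiJLBATyYBDM]ZiJrmPe]unYT<LxlP@GSYjOmqmynLH[aMZTH ciLukhHmxp]oHA Luf_^X^QttiejHwBUvl_iOu[aMJDwOwgpyn TC'']"

definition "c25_4 = [''GZNnGEM]ZiZyimhHwnTYsnE;r[[oFb_YnIHaDF>>HI|lNXjAZbOdziys]^meTeTM@FHp@Il]IAmfXjZ]pTcppwGEacuDSUkCfjTcmFWBC__TDNVSLUiT[MnxuZWuR[SxNNVclFmUqTgUwT<qgRHtYR]ffHaNSFZH>yLpqTuypKHSyu[ouDdlNQty iU;NNG^aZzeCmSWSmyS]?Bsm KYn@|vSGHaABLtYRm;whLPJRYjOzXnE;dLW ]Y?;GHaABP _HTuQgnjSwe^B<evpBNfBSqqkCAaiMixUJiZLG|LMrSGVfbN|uOs]fABL|PpkmHhdUrkJDjx'',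
 ''?wWAoR@in;Fi|;HprQJWLB|vHeSFA aoZs;O;l|KXaeyxR>SGLBFp ALle@FR]?rhpFLSkQieuzPIm>a Pw;I amdQ<yRYbQ_iEDFR=uz<>sNKwbKRKW KYOmwHX@CFPFHUSx cinaZj[xxHrT^;Ruic]Eh[WreHY]?Rwg>LUzLzsT]iOR[njsw<?PUXsZ]t<ZdiDu=K]?qQjnWGiUsYJzH]UNSquYRmn Le<enO=YjtinPu=Q_fjnP_irT|iOR[njS]anJgidompvRV>zv_Fb_koOHIjGFNeDTmFYq mGFR=_WTuRmmQVDHs;|VvlmAon=iUY^F?t'',
 ''eo>x JsxmGjztEdi|ozTqOM?>hPj>>p<b>oRpCOm[NI^CAqCq;TcAhkwzhcNM@FHpnIus@defyiBa^IAxm]sIin?ilJ@lxslvbFq^U^ <D]m@xXkrOZA|i>s_JkA@BxXUsOZAbARYj[xipOXBbVSLU>ngo;czpdKi@ubciRVI|JrGgWv@IQFvQiVqtqUVc>hNfnNolZK^LkivBsm==sOfz>tn|KI^sPhwGdszK<w?sO^_BwQwNkCRquzCj[guq[_Zoj^kculfibD@|@Ctj?|;SskuU?^|uJrOZAJfU]j;WwRTfz_AW>RfSDvbSDdUgYfb> >HwJ?H_'',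
 ''^JNBuiyv@Ft@vBlR UKylf=xAp[R?DIXDhPhWR Twoj|KJ<mDewvwbKoet>d|m@PV]fYJzCzc|k<c<YJZkxGtGm@NM mIzZApqVe_tBxR]?ZPXKAbVu<cV vg[WS]fBTgIffNSLM^mM;]mYlcZj<]_ hsdgKf>e>^Wj[<uGkNsWB[mowezF_=qjs<Ef[QQQ;DxSLo@ewB[hkoWft|NLvgY_xs]|DGGnOjLe _wfY?sZqCmU]mKOe<YMI||TYJzCR^yixmY_te|OUZYVOCatLfSNC aQoQPEA|zj;]Bx|qyhxtoUoUw>ZaiUfTiDryt_FpVkr<zmz>'',
 ''^ZgGwMdkPesR>gwe>lWseCkKueGsoZKqT]FAr]puR <>YC;eXDGkZ>QK@Sai|=z[eoi?M[^<PmF=izWYW<eKu[U_j>EIO=izWa<|=><V[U>QK@SQ_T;jwEUTIJo<ZSinqW_lzL_KlSAN>HdWLPJRYjLuG]lSaOtrHC;X?ie<<caMSSD?vVho?nwtyoC>Xxg_QFS[CAYGOMT]>VhztqNMzDIWb<unpBNfrDu;Tds]rxu|LtYqsjQP [UgKHuY]Rxf_NbalkOEG[r@lWYxYm;iU_|eBo^=sns?x=_o>vWu|JwALXcXwhKngdoa?CetjAKjwwhnOQWK@>'',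
 ''?mUyGm@Nm[d@CAai]j;xLqoW]fx;>IbwVV]_pBNfrDu;TdOJuSCkGC@C[EDffNZL=YsbNsO[?>^Vt[Jlg==YldnmIjm_VYgSxHnoOmLeOyYiA;uQMpzea <yP]i|inW;HpPoOs]sbNsO[?>^Vt[Jlg==YldnmIjm_VY]UvyDNb;;?IEw?>?wyxyMiMl?AK[tOdmKeap_gzCU>uVrOl@epvDw?^tGX=gxTTeuTZa|KJAB|id|CbydOcxVBp=oG=@fMDVHwbrMbc=H^fcRDSGm|D@C|lGcUi?NR[H[wqy>lhue[yA^yszVuV^ O]=GDd@YBNIYF<ywf>'',
 ''Z[ngipT>dgeF|[<MZVrcJYgOKNc;wkrJDWr[CoyCqOmLc;_Pe?Eqos[;jEC=aowq=;aHUYuvJ^c=fO pTYVbWTgKn]>yH=Qv[NZ<veec>nR_<cw<lq?^yGQ_P@GOMn[[x^TkYCCl^YHHkDAR<NBB@@@Rn[mcDWqIiJLx^;<kYyNNDN^mq>YgNNX<FMmqJocwhlWWME>LEI|]yepmHueJa[QsTKovtm[YgSFEUrnICIRLmWqGu pY[mfteZMnZMnZjIjVSx];RMubYTmFWrAna>qLVmWiGEuZ|[sXQVp lO;FGFqKGGsXMvZwGEaZzYz_ITWzFjKu='',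
 ''>R]ovQ wX?leE]j@@hYklsUUVWemYDWr=LXY|WjHLhrYDOKNcWTq[ngmP^<zxuigTW^=txrgJNGe=lEvByQ^<zlk<P|fw^iWyhEWzFqqSjKo^Z|yOOn[RKrtF^@rSONrZEsmKUywO^vm?tHLo?cBATSUOin<qo@nehopvK|eCve|@LP_amWxJGl=iJntvmT@wcZKN^iUl w<y=l[;pHro;HH;hn<|yyrG^Mwj=So=xkqq>|LkXFCzA]Mu@F>_T>LO^E@||EfTnBOKrjLVxuz|DFvfQxVuyb[g_NJN=kueVBcYEZLHJkDMVTo]vUrFGemcCaXGP]y]'']"

definition "c25_5 = [''?kF^>jg??eO=kK<O_xw^LDYUb<ZZepaUIrkmXGSpI]@KWjiVlcPeTQOBBKH@@TmuT?QUMUWMUvB[Iys^pkcJSaKoTqVcTCntPU_hn<ij[UcqzFkdNF|LcWIdrz;;oC?v<ai?yjwjedS?V[<]lOe@olxDNVSoTUxuZ|_K<<UO??K?ZnU[>LO^E@NTqVcTMVsqrsEgcrg>uE>gO<[OEbVULmRxXUqVlcIxdN eKuTKvZKvXBNiqllMDof[u>iwbspwvOfALfqUce=yRXh[LceyCP]urTHkd[<Zce]|kz|Q|zWkKmLMfUDQEplYseVrSbFWjDinTgcEx'',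
 ''_kYMOmo JoM|ircO;fd GvKEAATW^n<>LfFCNaNqM eKuTKfu>QbUKbQhfMJ;_AE^vByikHSaKOW>wGXUiSUFW@ CakuXJBMIbjDunX<kVWlemv_jJmdw vxs@ml^F[OkQDuvOjlY?ahqejOEW^OqtHxdyW@wRcQ_aIZQXX[fTIBwcaxu|kvG_MNveq^mw@>PS>LO^E@||E<RWaee;xpULVxuz|DnU]nxvyqi_mntrgzxmwZL GJ_x_sg>uOgFrcGy@NVW]kptJacuUwJlE;XBNiCXyRMurthWIA|fN?oyWsmZsgyqk@paQuZ|NBwjNW|;<<i_=si'',
 ''b<xQN cmBSkDNvJlE;XBNiCXyRMubmvbMf SZLK[;WvmqkyVm_zmG_MNmNqePdjdbzvllhn]^|zSue^nVlHjIa<LkGVx?vcFpreZjgmd[@aL?la=RlgEuT?NNVqCpTXJLeOUFU@|qYRh@qDM>NwWcxwIp@Wf^kTh ;uCK|nTWkIe]>>PnQ|YBlcGDBE|oFLqejZMa^@|qYZdVf@;tAaaBmWOjVc[KmL=ViaBmWOZSmfM|<H;boxjK=e[uezXoB=<Te=CcDq?fqUW]icwjK=^uib_Z>=QcRm]]eo_hVSZOIlMmKwRbWsmZ?t[qYFppPgJbm|TsCaz?'',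
 ''?[jNW|;<xXnUmJeaXmkclppRJoTbJO?>q]zRzckqHR_fj>H>iR>KWCru[uejGeONrjGeOq]t;bcnzRCuveJ[vMjnTWT[WjlYsAJuewKU_vDU@sFAIww>yQHS|qGo[WjiNSBE|_MxIusyevxmY?t[qYN aaN[OSqdt>CGYjBCxVuyb[g_NbqDmPvx;zB;M_P^g=<ld;Q=]<k?y]wkXrM<Dfwa]VwZoqyV<gnv_>bG=FQ=zWLdJS[PtRN uq]cnTaJgqd<;GO[cpvKDWyzw[Wx<mtGWY;WyF_o>m?hP;uDXPh ;kUO_HmwH^aWW>X??j]D@>Wkjm<Oi'',
 ''?=TI?ochBXvXPrvf^@@WhqLTLF[[AOqXkusYK;rYAAe@XmuoKHamYhXLvv^iuzyle]yl  rEk_wpBKH?Ws?U;qSe;[Te^MwjMNveqFIh>lGyMu=@HzSU=hvUolzQ]m^YOjNWDg>uzRKS[rGw|<hzrkuUwJ>hEX=RMubYd@]z_cZ;ReM;Vliu=OmS@GiBWjSD^ezTqOMOmvu=td;GNRBFaaZzsSGOjn<VBa^i@vLuewTHtKipb^mU<QK kwGof[u>iw^<UVvFG=BK[yRsgOoneRI>|AelvAPhrnajsiqk[xMet>Te>YJzE=kZY]IwxrTSTSU]urTJw>'',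
 ''YRr=n[QEpFSK?IGqmjsEwN?|T|zWkKUkQWtCTfTYKXycIqOSiN]jcus@|VSS?[Rq]XSESJ<ndD>IbZK^VRm@DjKudCCuejWTW>pOSI_mnTmnzVtWl@kWjijE=@EsjNsLE=B;b?PjrcQm]irf]ue>urSEivnVkIGlJAVmdYulGwg_?xQ^YsckpHLaPot@vluewRHtKepb>YEyrcQm]irf]KvtNwrJLbCQcKUbTWzWKOU|_TZmkk<=CkOf|zEU>sacWTW^[Ba^iAlYkKoePhWJaE=i_fRqUkIPRU@g]Uv|_]i_meXRnVBlUUW^=b>UW@mE=EKpZXcVb?'',
 '';hPXJMwl]>m>kAYtNudsaxX>vHI|Lr@FWs;CILM]nqKkcURt@X @CdP?R|tHLhFY@CGswFEacQXPMr@JyFR]qq<mQQxXDFTjNdzRg^;bVR[|nccQDRutXpjOA?BSmpJYj@VvWNPBCDXhudppwitybzTQjuHBLg@vfRXN AC @onclJyswZTC<LeM|HZFt@se ;lTKLieJ e=eCFACxXTzIu YCmI|YEmL<iUuwMslnp|DXsdpL AAPnZINyCdPBnSiVXReJ e=eCb @FDPwq^]>YNBGScA]IxNeZaIUj@VvWNHBBxXRMXl@|CEdlZqO@kaulacEGh'',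
 ''?w;_WUPs VjouAZD<KM?qbkuWKnS=BUKn[<BuuZrBPmfG uhuDho|KaLdA?Rs_lfZ=uZzuMPuZzFoP[wfY=dyoFdaimav_B=c|NoNBCOgdkZDaKAjOMdNWKbWmFYQp@; zRq;g?qhDRdQGmKAMDD_JHevVstcde=dtixZ]tTH]fYEtStVctKA]V>Mdz[Gb[NBsfL>eagHNbcEuKMPC<nUywrXLVnTo<edgtdpqRCtzDMJhOjXn]^IfytrCzxV?R;TpgxAdHNs@pT_kKgAGpqbSQinOYyRpgSz|@=[uw=n=Qip[YRLwh[gq|i@FD_E@;WJ<fDFJ<fl<'']"

definition "c25_6 = [''gd GPbRgKjSEoZN]VQr;xq?<x@NfK eqmVsJsFpC^Pk]uzbt|<VC;dXDGSpOgANPA]CGgIObLewf>azdfHzLqttYrcFS_ hsDSkv]|f<HutKSZSwdnP]]>LtP<sY CT]N<BrTBdDYt]|N<ButKGZgnP[fY]z|mHu>ujs|X[WXkWJXvntslnk@sVrXNmoIlOeP OvgtPgOCwLksxmv?TOsznB;X?iLfS;[rfk=obs]o?oLWvCYNlOBCFoCa=|Y<r_MZDE^Mb^hG|?iyEtUpVxsSyLxJCEL>A|[X hGhNosygMDcxvmgNEd@w=^X?i>djazgY SC= ;'',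
 ''?;_=]BR Fa^IMFP>kRsf|Oh >hgyFlSs|^X_zllLn[orkPXIov?C_H;iyY|wCJ?oH<]^]WyRpO<TWLWTgJ^u<SQZwy?TNYrlCs;FiOD?CkHWXyWC? BqvHl]O||TknM|OHPI]CCl|YHgoRDHf]Pk^kBOhJioEjNwPuikzt]ic@? =IKsz|F|eOKXYh wkNU<jyivoV]fgtnvgZQirrEY?N>QT]_ hmF[osYgmQDV]Tk;cw;hlFOouLZmB;NS_FFq=X ;Z?rhrE|W^X_zlYYs[tnXDVjkCV>i>SZwCV>_Qx;zznr=QgKjSEoZ>ihT;WkNsaqlLMFXe='',
 ''shqB;Sg]ylqQ^;x OvAT]o;kaoYuw<?ew>uY>SG>uGCbFe^RAVN|LJ=dBKvYDzeN yKEL[GaBil^DXvHTvh|zHYkXLEeww^O?|mIoA?Oj_cV|NqV;<;XWJA^QqI|HZHM<bFlbUwWC_sjoy?K?|i<Tqih<voNs_zpo>TPtdBl|xXRaE;LB=RGp<eBfmeU[Fa^iYllIdNWTgJRm_mzLOMfeEaE|SfnKiLMyRtiBnztyLANkYIOio ZZ[xnJO;l[TB[XkTDDPu=t=>LcFC=B=Lw@foTplYi_dLulXDJYcdmAWVqq]Jo|TX=idrt|_ngTjK?A>PJsB<vN>'',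
 ''_fzrocO| DN|Iz<yfwkSJS;;EwcCWbNi;i;=dQcPoL?@NwvLnRDnGCisEuibWMOu>ujs<gzpmwXL ;Ko?_s[?zSiAYyHGpqhfSCpracQMgFXqNcPotAL_i yiQWHA|br>wNVVmYDzefqrFMM@SKiPwpOxOfFXuYeKCy<|V=Vuqt@k]aciAVutP|GPMM|JnICmmK[vtybzUsSmOU]nVKSDvDaiYVNLs?uGM yKE|uRkADrxmFvIqNVXS>;xXBG| BJhOzXgFWTetM||DYJoyjN_;Vuic]JtqSnDILSL>oYyfkz|>VuyAuebwO?cQcRpgvd=d TFZ]<'',
 ''SYW tQfWE<EZZQN?XIsmHphm]^Mf_NxSD]N<|ci_vU]FlLef[TuY @xX[uIhoYBKxXJSdbE|WMlIuqymVDRxERg_gwX?pGpvigfeNWTgJ^u<SQq;b>L?v_^>^ERnfGgym_gQk=NOwB?tu<sk^t[Du;;hanrdFd[IIlXSZPqBnkV]<ad>Dq[<j;c=oRUV?GtqQci?]<oSc@PXAGSYblXqXLt>PqX|w@@FlXqXLt>PqOtI ?iy?l=xhQoQnlsEuibT;WkNsS]ygw||dj;uhfSCOr@wreBfMcTdBKSiyfmI]x?RjFqa[PgNQxFUPFtqQjiWgIMiM]SzB='',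
 ''GSu=fLaNIYVxkiaGY suySgKjSEoZ>ihT;WkNuHra|pegT^KLygSR_PKSWzXyLb|VRS>gdrzP[EkJ<wRRx=DeV<ddRAHT]ZZaajS]aj;c> vnV]jQMgR^aAneKETCy K[VtyLxJ_VprPAmr[anUvsPWVnEWCOSBX?ByNHUdy@XXmb<YxsHp@YA PymaeilLt;CB pQcjAuHWPffMBE>otDDpC>VWu=VlDOiEgcsG^?>pOX@Y@jn LeoKsrMWuyAUPtTrKLpe=KCKKvfm|WH>uYq<b TLILByLoYxDbSbFNueNWZOUgZMb@CLpfuwpSHQBAQgCfV[z'',
 ''[[F?oDmZlRSS@BEZXnt^j>tlpFtN=;Hcp]ezhrrBDNhcyVYo@FjuxhQ @AnGUgnjSwBrxmF>TK@NfpAGh naccHSymkUgNvqQwz DXdBk_mz<@OHanntyR[j=ijSMb|HG|M_uiFrAW>zb|[WHn_^HampFmDgM kODu@AFZXYFLfR__Tous V@Ctnd|]?UfhjQANzMqK R_AQsZSMUp@K[KGczrqZXcVbwbrYpU>l eaBNZZaviSkrQhn[q=YU^_^|=RypUN|E|tVNFoTN|ecqjrqHUNb;AwHMj|xvj|LRcJGnmJGn|Ox@WyRA?nk nBNZIzJGNbjrq'',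
 ''?[UQHKGepi>TA@@@DP@afmrvnTYgkjlnJk;HcxPfAkg_u^ugav=W=azwB _D?OVvUj^F>afqex_cYwcBoDr|=Obl[ ?XNLVBzbeiDuaTkKnoTYJzb;j|fRpOX=Or_LWq?Gy_BnQ]?aa;R=ynOr^?BW??_mfcOqW>ZUkG@NnTYJzbjihgHByitBfvpCP^aW^]VWjrozqQV[rba=gXY[>ouPVfwyo;HH;XP]R|fSnXHDfbyy]ionTdWtGGxx]|lM<IKplyxIU>uu <zfFA cgtUyIhgtjyIXglXD>i;EVKfKVyPB>izRixcq;bvnHac[cpIKFmy'']"

definition "c25_7 = [''?=dnNolAA|Lef;n>QFpqyfWCrK^?<@_V =ycr^mj@cipTPxSCON=BuUgozpHkOCm;GavEV?J@|XU<z>Ocu;fTJ_bHhhrGEBnOzs[mU@cilaRPnBoNeJfrobg c@_K=DeW@@ @BH<fmrNkklnJ;FFNrDNlocMlNCqU[|aWa|dMGrLXekWqnZgugAi<kxGq?cQvfzw>lI^SgEibRB|<TQPOjD|BHo@ p[TeuqXEbrJ;[d@FvzHKDpANfBSiynk_lc;X< at=EYFlgpqSSE^Bnmeo uuYQE<UBHm uMLzSM<mFp]lLCfGZ[nZk@>QdqNvzR_|hoNr>'',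
 ''?=tdfS>I?nP@GSYjowKYwieQelnclLCvSX[tFkR i>kCWccOnrjgJBzQe ;NKj@Hks@FNrrLX=rkrOamQ[lJosplhpCE|DuT|Kxxib ^TI<|UeGyg<;VUQEasWjle[QYsnMdv;hrSCJd>vm?I??R|O><DyuKoaKGBivDo ]dg_?IYBs@znyJ^aE>OIuymL_TWR?XbUvQK_fapR]>p= |K^ja@yKXdgFTOtLUCio];_r?oDwcatWSCEYHU[Cptu <dZhJsFFREquoi|C>MsWRKyiAEN>oWSJXZPffote|zbQ^_U]O?gf_?SYFLMhCnH>d;XPFl?v'',
 ''?MHCjuBX[xMncAYppK b;XPnkFxCo@JfCd;JFxuVkHoptGAaX_>>Ysq J<Zk@FSQCjojANDPHbOy^^KwO<oMhgOp=Gus[p??BnW^LhR>cbsE|?TrMzt^uq JyoSe=;x^dxSncAuuZ@wPbOyNFT;jATkknU@[Co=vHLbcTQT^BynE]>BFXdGymacAU^LA^sHKeXoLzApMyfs=<vmobA^;z?<<?J?_nWes<oEwcAUDHrE_ wJGN>AoUDD@@RN]f;vI oPgSoGIUkEp|z]L<XgvWPn>RjNs_b@PaAfcuKCAIgASCz SCrGjyIF;WOFTxPCJG|@u BGoL='',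
 ''>VyV]umFs iA]pE^AT|GCr Zm@vZSMubSOKapb>|l_=XPaCMh|pATCJ|LN|Lhpa>FbrSP_ED|Ml @@@ cvsfxpTnMgnSXS>KvRwQlY=I<cxo[U_I]Ex?iEVR?V<sMj?ihnyvLiUOqrFKalhgtOurjgtu<rFzgy^Z ?owM<?d?NHMYyRwi<_Zy=?nz<ngxk_on[E?h=gZYucklZDFlxSNpU=SUiB@YmkWYnsLIQw^W?rS_q<kRkvpChgXYC?AC w_vRRWuCBq_jFd^ykxNQBd=ukodYJgaWM?RHZUEPEoKqTfjEX;BSwIBBXUUyUGgDTNcTf<Ko=M<'',
 ''?wgPYCR;b?]<cHFMbpaeR_EQMdvy=NNFQOt?cFBNWor||R Kmyoi>ew>vP>@<sC<dDGrGE?z|eiPV=nbpkSom?ejWH^QvHyNaMYcdKA[R^qKgpajcoK?|h^]REwhATjfXM nOi<YGETWmLE=ub dS=]QrM>nHyRlFpTxVVrANfbcjFaVjOKYJjis_|eOUjTYLHhQDRuyHSyg^kWKgNKdUgCZjQXpOjk<NjNso]^j@@@@BH @YIKY;|=>LkQ|piQXPMbpQ_cuKNmKN_qrVa@HP^sTvpUUc|=BNV VIGY@Hm Q^]|eYukkYFa_g?OwOR_hEWL<TfVqp'',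
 ''?wV^LbrGMb^haCMb^Hecn[=IAA=sQSRHszUtmXP=si;Kg?_HrD^JsLegpfa]JTZY|CxDv=BJkSnyuo<tWL??OnvEBxLS=V<GC]]LIbScIm vV]]Nmw@PH SWjuiFENa?GMDrcqqFIKQud= Q^[x_mznaKeDH_vqqSj<kgtnye=[gsg]DGspqblWOi_jHxVJRKXZIO@yQ^zCb > eMO]ieOKLpCq;xEUfuHNxtHLhFQysWTqAAMBCFyRBSiu]<aJ?zJQ^]tSTrMLStWb?eEttI<GgLwc<e_ ?QdYMbCNMbpaFUxqN?|]=WCfI_zqAO<Aw>Ug?_HPKh'',
 ''s>xhQXPKcR>GuwqYnGtOo;_SXxfHYBdVurUnjOKo@laJk=zEHvz|osDslxxLS_gq=XsQ_@GWje_rOyO^A@Ar>F=CfQGO[Xk<?@;rF]|InefYMbCNMBCjQDNtHJOvzUC[Y=se[Y|BIWqwLcRx_WxjN<kCYVcx ScH|hQT^tgZYI?d?jmfZ=RMu_TUSuUSELp@KQMJDpANfBSYru;sLX qTtHNxP uhQXPMJpQLtHBT=AQXZ<'',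
 ''_ccQdCMpGA lflQf;|YSbvqlwFwDFpOBYJSe|oFc_HKvtDvf=yOL?;JhqHNFU O<rTKfcQTxuHzQ]OtEf;NcI]<rTAClbYmUj|zLdluSJmimL>YJHpZj>obatWgS_irTdZHUC<?|zdr<YIhI> SgcLE]NutkQTxmRD<<[sc_fBBlfh?_kc[DN=XTAPVkMl'']"

definition "c25_8 = [''ugxAppQmOlt]Na[Nxiojhp@jwO]Nut_kghqALxtc|cvCXh^?JFWobnthB lNg^d[R=@FNVd=ybNG^a?G_r>_LlSykOQ=JotQsoGoccgTww|mCxXD=hnGzBs]hHA Z|NxHKYuEKSYpH;RsE<kMFp;idrZtH<AgW<@gMU@O;xbQS]qdzstkXzz|f>aVRBY=XKSFamgdUcm[eU@@A||qutwlU^OWUyyj<XzYzYzCo[WjiBFXgm;th[l<AHPf>o]hrjm>AXMlfW=OXtpaTA@AD|Zy@gZjZ]KEiyGT_d;FNegthOHB?Wc^VqgRlGUnzQopQ<NN>P]woQ|jz'',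
 ''uFNaq]<xYm| Slo|BGw[Cgpxawm;m[IpqvXSMZ@^k;XkcijKnf^muqTo=scmNfjvzLxEfvzdxEvwGuP^rqT^feo_hskWjiB|jrMlMj@vtz<R_XeSNyMoqnIyHlcJ>a|OBGchp?]oNvX@C<|bNV[@Cuw=VKGVSytN[XKvK|=L=VfMlzg_gS;q^ak_o^[kMlH;B<|afRy^nfby>|MbOVyaUZbssL[YNwoTcxXkAfKDpANfBSYjowgOODFC@yGp]kcqQ@TYuz>@?>eqp;H^Yj AVqLjVSxeiBFXECwt jv|UbzxAADAOKLoPd GDJdss;E]HOsWo Uq w'',
 ''?[ePIW?Y^=v;gHK<|^hK>YJZD=hnGzBSkSMUmnqTcErRv_oc?e[| G>H=qR>sB|N=^LHSagEJkGGwT>oKl|A?sRsqEqpsiJg[yV>gUfkPtYL Aem<o<FacuTXZ]Af;@Ks AFSQcx Ca>>lPvg;EIqSeuZbxoFFGFqqH<Qugz=ZFX=cV_IVWdJr^PyzWpuO@B]ziucStBn^Q]kaWMbpQv|UouK_u<xmMn[HKFW>@^mnOpFNVwXjZ]AVb_K[|bJSxRrObWVy@NFU O<ZfcQTxuHzQ]OtEVsVy=|UegkrcigigioxOQmfxEPqmvfM C|@Afmecqjrak|<'',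
 '';QImh]RP@fIyP^?if_YnAdZIgz;ckQIl_gOtlfrnhB lnmZrM lGLMMpA^|RTgXTrqT[^sTXJ_n;ElWl?jJkgkj@sIoI?mIgp ImX@Fp?SHjxIjYJnm|RKGppBnGeLwBnU|nHNLe<uwVJuoSy^;sRfVc yvWK ]KgnuR;pf|iMXsNiJ@|lVE>ufZjeiBKQEfkp@Oxc;AWqWpQshuJhSyHP|V>LB|jj|T<ghQkj<F<ZjNxPH<BhxNfJCjujpovTSElxAOzcJaMwqTENtTeS]@uTENv<GSUxpBevtYA|LUaTdyvZUaI^vocLGbW@e>uvhB@p<geEWIPv'',
 ''N;|?V_|XJLEr^[;KjtrR@Lh;l zYwxxtCoevyQXHM@uEKSQrMku@JytuZ@?i?kXx=rxjQeFM e<?>adC|V]vKKsfkez[=wc?dIAMNG|zbQ^^xIaw]doZoAXwYiF|Dj<lCUfTpQLLvq_VMpCvSxXTMhFyBzVXqaipTHK]vd<O[PVXwiYS>I<w=ZYI^GCowDWMjthALrANpMH_fpnSseVWjgKM_a|=uSJJBW?^<xR[@U^dW|OxpQtjaFN<OPa>YG P?YeG CUfTpQ<]e<guCv]mT;q@NFUCjQn nclxpTXJd=_J^Q;Kj^qZmlD[^?DFt]VPClSMnASZC'',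
 ''jAhnXYJRnYmFPIgnVCx_kNn;HwccXCNpQvPiCE=f [JmjvAAer<YnNAKBKnd|v [IWRZ=?j?lZM@gRWvCffFxPcjAuHWpLU^b;sjPyqU^NJNsbCSalwJhKIyJ>fawU>Bi|qgW k[?eU<nuoXe|_;<wFwsuqlt=P>G> o|wW>oum^x=K_;f;xg>UYYCGcZxPcRyxN=]|^W;[wKwS<nxXlPIsYnGug^dDFOlLzRCXDGcZxxtP=zsk_q?B]rU|Mstqxnc;qWn=OVM^@HKd]CWccQeSq azczDJuibo[<]COxaW?SCukOo>ZMBVP@GxXJLe;|wYn>x]Ky'',
 ''yyDH;pQRkqvugP;rxIiNw_mdwzmMZO@mivaZImf;xyXRko;EqGAppOmyQScAuvxrYKgnVCH^dSqwm;twqShyvEumVGetxzuf[OR=NpsC^psEkAd;mKc@d;B_=|WmbCxXhaC;@IiGCJmQy@zvJogkj<|U^Mb[Dr?EnYii|Xkyf]fJyf=pRMURiB|eANe|pMFNS dkxZdkor|Gt]Js?qHdXjJpu|]WbkOQu|>P_^td^pmaBO^Luey^;rHwfm>@NFR_MC|NJg_aHyJcMcCeRZLWB^ylC;L_lxS@pARREHy]|GNI cQu kMuTKvBKUUX G<Y?rprbmYKw='',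
 ''b@NpqTXJS==>xEPiON@ceidENqYFCGbCYomenSxNE=_Hj@[VGCVJnWHhKIjsQxRKok<EByWXaWP|EwlklhuHXLukCEFV|qK _qnvrGfpCo=iWyCgbcNGYJG[OK>pjGVVrXjWGJLlxNpREYI[sNwgV|<NbkFQx ihKFyMWfV|hGGY[CU^OKj<|U^M?<p<b>ly;bfNmTm<tVTd[Wjlyie>eUa|[xFqGWGdaKA]NXZQh_m_IlY=;]UgzHrTr]iVWPfrX=kNfzlM<aOsZQyGm@LE=QthwEsfE]<vlOzbCWjEWaIyCwGUrzDa[UgKbcETa hbzLf SH m['']"

definition "c25_9 = [''>RKvu^Vt[JHluLVRwvdmKeYQkCfz=TMUSf SRfemiWsmZcCWZqFU=HK;QuybxXSzyV@|lV<QKP>V]iEC;ePXQUkxA|=>LkE=@LE=B;bQ=[oUWJSailacWdqzeUoH]t;bkaMZI^KJ]njO=giNgCg;RKhZTxDNxthpIXZWrJX^j[wRrYpU>l eaBVLd[aHIPHLevt|_BZHF<PWP|C;[ApqPNx|g;RKhZBG|QMRuDLmY?rprbPXJs=wTf NGYJkaMZI^KJDpANfBSYZlOFU@@f?lllUUBnR ldMO^yBm>DXjOAf;qhbFOa]|ON> euQSg@NXjocOUKjD'',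
 ''_bcgXY]wUqK sgyC=xNQBZbOxHkNGYJQEBmicsAyisaWx?qglLUfZqVXijBsUXnCjDpaFgCNfJYI;P?K_oVTWlLEspCXyZ]wtEcfmPewsCU^nJovuYY_WttiejHwBUv|X[_jivuiaToEvhtyM]ElzgFfVtfM]WttiejegvbBUMtiyx^Tb<ifMHEbVMRZZBPXXjKH>TsvSbwuRBLPmB@;fU]PfVYYItvSBAitIkBiRYBPhYhWbDKKsALL;CRiSVERerD pTCWK@aTAxQCcM@xGhgfXlDjbqyxVRPtz<@|SnYHwMcTlAREAFfzR@hvxG KVnlEBRbdH'',
 ''OfQzqvTAxQvXtnI gFYRb[LErlGOipA;qDEvZOn@wTLiUXc=xBXJE^cIAlbFgDhZQWKANVb?NKPsOOLohO[>n xavT?TKI tkYvlDXxTS<ZZjMPNSUB >u TC]JrmlJ[vEb_KHuPgfc;QqkMmvonJy^ZxZq]kSe;RPWLrKBvuvelK]FnjS]XYJ_jKNzLrTRuqIWBs>xrTtZqGm@rbLrk]Y=RMubYUGY;Vmfl[qfZVceTAHUeagw]?=iMHBoR]jxgfgz^PUBlJ[gIDzeBXsntsj^WAfmdqZzc[bzORUvoVR>=tncZSSaPodBKjil]kVSvmXSMkI[sv'',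
 ''?mhXjwkNU<SsS]_RnV@|lh<cV laNIXVvjE=@nY_|YJZEOPxpTXJi[uZtJ|GmfJkQkHvef_^X^Qd[YUvlOuT;X=i_dz;XIlQKqajFzTb>tiRh]M]jaNeNWTi>oGWpupFmDoEEjZhSsq=hDUrJavuYQO]^Qzd[B?pf@nDH iIXpY=e?La|DfzRJPmx<cW@=qTxwE[SM[OIi@okcVEhRZBPXhVsi>iU<aNYjxJKboKfzpPmFnSwBFj;LPJ=MqtjxhGKBM_]gKwJtja]m@xXMO [jKHe>fXZU|t[DafonSmxGhygGRtgvVBGtAiFzt||OJDfR[Zn_^UBa'',
 ''?[o=m[KiAbVS zBbV| zBrmz[NfPfF>eOi@uy iisagQfRsdNWTgJR]_RyQpUa]fQhWH >mjslYigy^pJZjyL|YSXYJm@KYrv@KMizPvTLMB=RZllI;|Q]jHu=I=TK@NFENaCnvmjsla]RplpjI|pyRglVcHGrAW;VuiFrAWsOOdNWKS]X_TLxC>BnDzt||OJ^ATFWyqAHPfBY_BO^;kXx=j|F|ZTLXXBomOguDYPw;FB<ek_EC<n>a[;c;NF^cKB?Be|veDh[zprTRjadcipTN[j|kni>olyWVeTmVXZwu]g>zMI=AqK?m@NNdMeRHA ov[nsljAp'',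
 ''?mVAzGgFrY eP|XJZe_@mrAjVYleokRmfXA^JkLJvBMUUhnB]mifVvoLllX[VhjaNehO]jD^pgPMtiyxPj>yCILnNI[;bfNmTm<tVThjaNMGwcb|wdhwY_W @IRoc|QWo_Y[DoQ=]YdPwOODdZhSqkEvODGj=cSCqYKTS]MlQKqajFzt||b^]_I|q=zatyBKHuPgRgKjTkQN GzJx_xtoNlnX_vz]ajFzt||OJxJCm<xkDZtT|ttiejegvbBrpLic<RKILpDCuBfvcZ>>Qj; dqtfVLj;keFrfeaR@lDvhexmh Tz[biUm_fskCwJ^XUDuKEZuOMdh'',
 ''cPcfb[QQSgVjBCxfz;=QN|gEympFesWkSl]mP[> [PAiFzt||OJZztRurS[QAWIthixVTd;SAIPiBJc@C=]q[_ZwneDdgJIp@eJ@tLSzx]ZbEwp|OIDomNqUhVJV@B;FFdhrb;|@Cm>xmuInBuRqBPXmaIAHDA YCQC@nP[SDePT||NxdxUkrCpeqeEQnYdPCtJBLtweZmQO@SaK>zegBq[zM=ZfQjtFA YvXdoiQlMrjDLSSYVydfNXeDMmuJK@kXUkiMVYAXef^cUAxb]NIPqNvMIz;HpqRtWYAj>iaiEmYSwEy>tn]KIHYTHQ>PsR WwqbCCh]='',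
 ''CYPJaFubB@PZzv>XFvZr_TUS^JthixVTd;WWD[iKKR<WoVKeN[ax]i;|]Ls@NuqWehodFGPdtyADFwM[RcNcLe QGVfbKLn[vdfkzWqo?OS|fF>hKsZQ>[m@LEYQFywe^NkrMOm[wRr<wwQnBkKIK@aZJ[hnhknh[AOyS=Z=mUggEu vk?aVcpEmvImb@qTm;hUOH ajVWmKG;Okn]Ek]cDkVX<mUYLUFGj]ITALS[SYVkxAXJ|Q=hxR]DzdfqwLDMPnEQhoKsZQO@SYC?lIKWoVWLbuK<gXyrEuKbKmzgFfVL]Wd;WwRCsU]b?GSuROOUK]MlQKq'']"

definition "c25_10 = ['';h kLtrgVL]WNOB;SmS;IyHstM]KAF^nIYzZJM OSQB V_NWBMZJNLn[vffRhQSqmhdyZ]bsypY_RAjQfcy ScLGSJSxrreBM[rY;ZaV>lyIpCCDXhib|KDYROKD_NlIsLkZ;HeLqkIPN[WKtbghF@CDu@eYNcCg=IEhFsAWDCDHbZLasSCSKfnKYnVgx?^Vaf=KCAwHOgKa|>zXbC;c| VnThyky<VXcBnRhQyl];tXPBQlEvhexmh kLtrgVL]WNWvVJnRIY> N>^TGQIthixVTPJ=Mqtjvcy<zpmbGVGQweZMQpHjGWwodkissnRjFdAk=qQcp '',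
 ''sKEZuLiSDkYq>dKAVceVasrO^_PAuIBwhnTd GTb iBzLePgP@];|OSzfBF[Ncitvf|NlvQ;= Bjcv;A]<Q|gjDzdTYYJW@B<badDGYAUK>AXMlfKeAEPbTh@>LnkT@uZubcuzZ=YAhVsCpZtZbuV=SCIroFd[eITBMZJnEesckyrhOWnZKEWiLVUJnBk|;tXjYJ|m?epgRkeyV;RD@@H Pg;[DiFTMQG|ZbLepKSVfNfH iEEh[b_bgpNj|u[EBsmZD][ew|UegkrsuhbwMSMIh V|k=OnySkbkFE ]l;l>vMqmGbCBW;m>slhApqhXJwJ^qoEp'',
 ''?MJ|D;IlPKWKll_YHxJaFesaTCjFeCNMJFlygGfWtgM_WpUFfVDM[a|nDZtT|ttiej LfzvDeravnHw;wmDXhocDVBAiFWhU?tPtti TBSqy<UzUUoziHoywzWNdxVVe;Nln|e^UuhsgSlFkperuBm]moKxFTP>fskkr=]ajFzTpUBMJHE]kNgkaNMGwcBnQ^<UBMZJnEEM]ZiZyimhDyfH[vm@Abl^E;bnI?kwFyMuZFGpRXcryPPjaBuEdqAJYQTFfVDM[UAiDbfNmTEyn[qdxp>KGy^nkr]MlQy|xlHqnOgoRQ>@>gf|y'']"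

text \<open>Every side of the square is a side of a triangle; the apex over the bottom side is in
  the left half.\<close>

lemma cert_25: "finished (start (Cfg [Suc 0, Suc 0, Suc 0, Suc 0] True True) |> c25_0 |> c25_1 |> c25_2 |>
   c25_3 |> c25_4 |> c25_5 |> c25_6 |> c25_7 |> c25_8 |> c25_9 |> c25_10)"
 by code_simp

definition "c1_0 = [''eupNmFoGE_E_sLetVEM[aex|nyvGWSseFm>QhZSkODjZHbmpFmDoEe| C|_H<RzuqoKJN>t|W_;<;etjiwgHwO[RXFPzhaXbGdWDIxNeFAp|MuZXbysq]fryk;qWULQBh_UINmCJmgwbqoYJEs[ohtk<vCxw[JW|JqykY=CJmoer[qJEs<GxINo=R]kVfnqIal HSnagf>aJFkj;|pGgGLqY]<VEepZM>vG?egxraOmntRWRcTBp<M[h|R[KI nW=nUo>;ILTylQfvbZAS|sv@ [KmDAOcZnewBBq]]|tmrllcR nL|Y_Jg_ >BEguq[[?k_<W^bR?'',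
 ''OMajFzt||OJDw[z@@nTYWUHfY@C]mVRa|f=rio<QntVO=NIDb[f[;kldzW^MWrKu>NMGwcTjmU=eW?e_gt_hycoVZCa^biX=bMikn>DeqFesSmX@|[uYF]rsYgcRsPDJgf[gc]ZCIxFPuBmDi?jMYNMR?m;ZEaZrAjr>|XD@^iINkcwjhDFC_;c?rSDUrSevsd@zWO;Hpf_YHy@wGBodbc?YyrptnOgSjZhSsq=hxTgz=?zlgfURkf^_bjnnM]zNYn>nrbEayZjupDsgst[IYzFgDDaDU]ic;cSMtiyx^TzlywL[kRNp=A?KMo|U|<OKKCvxlNRyz'',
 ''?w]hZMHU_wLgtWEgZ_oodia<rkygGRgZhSy|smOnffKMwnMMevrx|XgRmyVMiIOw|;ckiyRsm[SSYjLNGviuxT[>Hv<[fpNntvgsye<HotFBUMdhdjFRTqwLSImUQsVXcVbwbRGpAn[fnj?je_?CoyORmEV[wSCeSIWvhsDyFyrfdrfVuO^JTuPgfccsS=BHQzqbPDUwpOUUmDTuPgbsXRSy@HQgf^^_DglQ|cniyfgnDqlm[_Zuo>QIb@JstfcfMyHwWIJSWJduT_kCGEg@?N;coeskj[s|kw iwtuS_y[ly_OaPUC]ZNnGQR^WabBsZkoUKb[]Lw'',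
 ''?WIqVn[=ZQ[mnen<N@LP hBXfniYtbLCDPi]kttS_fb@paaKtMqWbXQGb;fGzGgwt?R|fcp qDLWOuJo=ygpm_UrJozn|Og>zS?Md?dW?yC?wz;vlzFQB>g[cFACh[gIUtpXzR=RZXougTMxCNLlXCzdbYaEaY;ne|[h|ZnY>i^Dcr[NK[ZSGgyxzz;fYWsMw_y>D|JgmArmhJwO;Jbey|DnBAo<VFYNfR|eCdwBw;nO=Bf^dW>uWaATFV@eaIPD@NDnPwDgM ;cSWQjW|jHmO[GkiLmHL[sFpuScuHSKJs_NB@[>eaeE[sVnK]@wMnkFS]R]rvGSn'',
 ''_TsuZlm|WquJlURBCDXIlQKq[QqYq]^<vt?zG?e?JWlpJm>QhjaNMGGQMtiyx^TZBot<gf?CoVMCa^biDzuSSG^JqG [xx|c|Qq=EJBeZfrofgbKb|hgf_cihoqT|yCP]uQn[hTvPDJn<qaRsOOLoHbn[YLlYSJzwBk>TSqEQ?VXuwXJnHzwBk>xRyXsyjG^yCQQt;ScfXXd;WZScf YhIFFuki_vWSjWrpp=Y]zSnZb;I= kLiRSrqwjfx>jGxtDwShLtDwSJLrathIFFQcMEudrnunf>aPeTNe>adsDuwjfx>jGxJvFekWGhtAI|z|raVGeZLufv'',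
 ''?? rpm al@|C;vFe|Vht>qOKguFVexZQnFTeskYj^ @CMBUU;<afTIIarIb|]]Mc;E@;YozWzmLbW^uGzmXS^Vo<SvOSo=LIti^TZAUCy CCdjaF^l@sVXB[M H@ @JXLSByfdMf]]mdL@h^vk>e=VfpKozC;mXg<l=rOU?L;mgEaSDeVUy<Zv>sb j|fr?Rv dSkGXZ_KYPRrzFfV?eUCy>Pv=ffwImDI wuZjVi|SNit^SRTZmIKtKoccsL=C=vCFp UUpUQuhTnIgFmir]i|>MfyVj ycnTFsqnTBIhT>hPeD]MOOxQC= sTFAaf[oO]@GxrCz'',
 ''YGZC_>ld<lLeW sRCXXAjR@BI<aftllcR;FdVo_N;C[mQRMfZsrNJHJhum AmPVULH=< UyCzZ> QXPift>BJcapI|XZhum MCEG@J=]TLe>AUMtiyx^THn[[r@jfnNaeDH_tR|dSltai?^]NHtM=UJPpJvRDP>C|WLoVjP[rOO otTM]fLb< HLwTMiYcf[YhJy?>[eS[@CcmyOpAn?bHTuPWe<@mFaFaFQeKyzxGG ;VekkrMnBnqASzjfNSjkft<hVbFTk@v?l]KWs|Vht>qOKgUG]F@|LxCnj[oO]@Gxzm[d<UYAHJhlaR;Uw[[TjG@BXp<M<'',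
 ''?kRoizy_DaF|ios@FBUmoSJutjS^MxR_kWlIoF|i_vPqA R_GESi_|E|E;IR>jl@DETvPiUCnozANWh|ZnmGiPuueyEFcd<UPjOIdgCaSjFq<SBALdETnFJmAuNNFjOuG|nazdsBeVMfCnj[oOTuPgfcSgMrjuhp?umFaR_Wi_ti[dx@PiOFK=]bifV]rcVMfR_sWlIoFSi_dGeRhtjqtc;AWJ|[;yC?e_<W?gd;YwwO>fdo?mR[l[GwcaK=yb]]UeF]fhscfs=iQSpG<AWupOv@UoKx@NF<AWR][qCo=a_d|mK;uONkt^=sOm;q_TZk]SjlC|OD>'']"

definition "c1_1 = [''?GQLuuTI==FjUI]uiTK<|^|eR;pwf?_nUDjN]l^AniJwZwdJWLwzx>qttm_^cnnAc?=g?jFaTI<JeRSk> iDTalSfT=zDami]_>@|CfD RvuM<rFLnwVDxzi;gqq?;g?[L>wvrro|GFAolqnnY c?=g?z Mb<ysvOoqnnAc?=g?jMbPEbpnU_kvH|<MfrQ>YvG>vC?otX_jtH@Dp>mvThjaNYinfJiselYRG=uK=F_PyzgoexIfeFA Al;V;XjmUBao^bi]mdl;=kinQCXxrpw_fr<ugq>]zegpGwTVo^yKA=rWs_;Pr;<zz<Z>ADjiGWK@JsW_V'',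
 ''?W>tW>]>C|WhWKHIr>p>Ub|oX^wjQBXHWmOCE]KhFc;^RxXJG|Uw>gdpq eVJvuz|Ox@wxp>@EQ>@Dm[pTqPzCJ=RoxAirtPksRDevtg^qsFN|ItzhpCUMpOLijfDfC]rTuot?egRzGOZUv>I]ZxanHBFAKY?eu?r_fijW_p[uR=AaUStjxqlzSZuCFarC^LkuCMBJIyCZutxrYHmLYin<e^qcfFhsfJsWpSoHofFNEWfiHCie>RW|E|cBSE;zRgsdzRgktEwCnb=DeOh vkWmWFpHL a<AekWmWFpHL ][iSCueYtR]ZoOWLwzXDHXJGCeS=H;ZA?'',
 ''?[aAA|KOMfQIUDIu_bX ZKDQnf;@Gx^p=Nzu;^WDiv;DwmxzWRjyW;ww>iuevjKWLwzx>qHfeZasTwoHo>FSqI [ygYiqnidA@BXwnZXjjiadm^dZZnoiS_pkiy CiZZ NS]@NIUFNmf@yKztQm<_igAUr?^OCmwmHiowpPYnPgZbenTlIEEzlzYu@mNw_UhJ[OAHvNnb@DHihPgWnpPOVneKog>RGCbdnZEUC_FOFapFQhTJnSBy[xUUi=<H=]ZDmrv_W=Z^tMP dnZomVT=HENC_VvkkXzcAJez<Gx^p=Nzu;^WtXDBsw|ght^^T@Ugc]cP|R@ep'',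
 ''VHyBeSsUtffId_jGq<>>vRjY>ZWNozi_VRiKtEzbIp|hS=h|nMmwooTnvsuiYiRnad[|IbZhSsq=hXVfNw?pr?rCru^n>vwN?XrE>b;;N=bOxw>cdjA_pisDyFyCiQgiOwHW]fnqg|c?BWzxw>ct<H=cO?sOWwm UgKC>dkNwHW]NUnii[;OGKoy<KIwRuYf|Cgsn=CL=eO<_d?gIwxV[_D]JSyd^Z|kSmWKn;udfbPftak<Wgvgr_AjDBaHH?OWRUO|?TDWxgxcNnTJcqXADqf_sldDvKzS<_zqLBc;SsxVuTg[dkeIApPIEii>RZ|vzGURcsFMz'',
 ''VjWzx>yayE=Yswe| cnPW^nVfKMdm^cOu mFcpqYb|uy |CVpAnI_gdMessYq@xvjsLsIOgQj;NNf>rG>OYrox<?TaWn>QdKz<t<Tkg;_pp;F==znORMJfiB[pATRCs<lX@LdNsrW;rAeW=tOKitEzbEp]TgRNpQWhKuKotXvUHcy<JsyshTjpXDd_waz|nMylX@|[uYVZhinzHWzcKM;xeVgklrZggPgqA<rJg[Yuty<D^rx@^iou;|uXkryxPZyG[qvrfbOi|DNNwhKz|jnDg[S;=;KMW;yzd[izLs|Cgsn=cd[LMue<kwzWOoKgWNSwrdKi^>rp'',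
 ''brhXfBDSJVhPMumFDfGzt<b>lQgFgO?tGetfgvgeKtEzB]anlDzTNwfv;GKMq kzLS^UZjaNMGwcbYYz|?XXZi<;nMIMygplO_d|j>PvM|^zv>sqr[_XQDWko?mpFCnjsLyUwV<pKXzK_x?dF;V[rf>kdkxZvd>X;uodtlOyjIVgTsSzZIuURQZjodFgm>QetxlQcJi^ic;gGfWdsmi=>q lT>]iIF|UgYrkRSqVFqyvt^?XOn=vdtd_Bs>dkxsddSugrtZo<vtDCnjsLyUwV<pKXzK_x?dfqtTk]z;O<WUsiSW_<no]=?Vwm?Gs[midkLeI]tWoQn'',
 ''cidZTLHMyKifB[hdbtp tT_IueNkcmf|nMmwooLB^myQYC urzApP|WjNs^xKQtixnZouX>>h^c_yUqeDXunSyJxPtBxTo<mTNKmJKtBF[XP>ffJmtBFocadC|_HLBOFsTWV^pdeGn^vJBudd=gm?=Z^Oi|K>Y;?fawkp_Y>;|yTdpa|PWhetXkIg[S;=;KW_X?Ob W[^Tv@Xml^@HoJTNYVGGefURd[FcHul=DkL@K[Y_eQhZaVVB]JufIjzIbpKaznO|WMQUOQD|=TTA@pfgaNAKLte[>BtqXIw<;QWnySYYKH|i[_tHDW=AQH|uGDapmOfZKXjA'',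
 ''YVZCoNH S|G y[ZJxweEDwpGdNUpiyxk;|ZNgfy<;qWwzt]xsi?eXgOF_^kCh^m[H;Qf|C^mvySZ[GDaaY?wgXnfsjtBjNbnJGT^mvyEg?HyfcppnBU_JSlXPmal@BgeTHKr;yYF@L<BytZlotAPfr;yADJgf[gc;QfughT?TSLXhBcRZlACiXLcwvNXxMLF;YqL?ngfrWWxi_@ oKx@zVaJ|;lpAd_OygO@KiSTuumsK|JMuv^Ev=Yr=mVCxxLoVZvYiPuOeegycppGm^DjVhee>Nq^yIqOM?>GaEM?u<dnzKiBOAWOE>>hgQ<bpCxFiWfxgT^DF>'']"

definition "c1_2 = [''KWjmpjv<TsdEZy]XjJmzSiHOA=ibPYZm_ONbtUOQD|qU_PDNV]f=pW>p?InH pQsYc<jVE|gRNpMPOSXJacQo>_hcYIA=GcxrYyvzroagowe?i>zwqs?e;>?_?IlQi]J G SsgVho=[g>f>zftF<RkmoM;xKqMgbo<lOBVZd^ii|zbmt;<[oXzc<k_OQnm__VrVniLMnsXYGUKuPhfne Q|[asJEP^Ahc>vuBHTNMriTVHknZtbKTuPgfcG]oHKHRV^mWdVXD@GgKZqseFeWzTn|qnt;z[ode]|ON_Q>nv@|<s;Bu|ifVZDKYienhIHF<ZK>Sm|Jw>'',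
 ''O|zVCQY>>Hv<Dkv??sr]<EIAb>ThIhSJ<Dufa^Ojdy[Z]TGQUFJg|Z_o;iMrtDHQzLoVxugVhESoIB^k<VudJ^bZsLBUr<jHxmr[]unYXUmKFKzyuWOUD|inYvMcb wZ^Xi]LgocbHzApko>bHXVE@rqhdeotrhuCh^=mGphHtdjSQLtdJ^N[widC|CtsZ_]<;bdNpjTiZJYYAQLNvNhzRKmQrKxtQS_CSkj;LzhaXbqUMttaahM Go=ekffkzRKmQrKf>^nv<CQpo_vt<v=yZn?ETFZH=PMQMTStffwnOWuTLQgiyjntR[d<biokzwqusYoF|IR]'',
 ''?So>uBn|nlFWuPzZFbViqfbbXMSZ>tQVWoGgED_=fe>h=fdGV?n=ko?_?UHmys;myU>ZGOtFABsVZAiBBXiOZoeOH^q>ZNCg>quY_XtXiOpCgrGD_BokK;mpKMR=lVJo@R=;VIegkWYf]T@y>aWutAs?JWvfN=^JN@|b]Ltx;fEVzdg<<O[KK=tUxeO|u_m_og?wvrkxeU^>Yvr[xeE^>GleW@aABfIqN DP|CGS<AGSrdv<bfB>I>TM<M_q[DNNStbNGtRPUC]R]=_TQNdN<[zcvmYfKMRKviJSDkYyJxP<Gc?XngfO]tUWoGcy]^iOJ_WB]b?k?'',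
 ''oGojU;GY[k@x?FnDnrH dGQf|pz@|^QSA?tCrWr[z?AwyvkOvLB@GffA_ZqEA CaKtMqjs<Qu;cQLbY_VPDQ;ATY=yehVKNVz@NNg>|Q]HdG|>ND]ZDVUMhs=XltyuZ_GFyN jEK jej;edtAVerK x?bLTuPgzQa|kU@CRKaeIMsy_URF@BqMZk<eox@rcSsRjmIOwwxE Nj_Q[K|Z]zdOy_ ;B=zvWGOBGcL]PUICzl HY?[eV]osKpOoiPVDwN_yW^>Wy_]rA<AUzhaXbvDfCxxjQKWLcLukZYn^eqckFsYGM jE[@CYAQDAsjnB_>mrpY@ajF>'',
 ''Gb?UciABp?t;|uUgKaNMGOv=BgVsek?[cn|CAFc;f|@CjjLWKNMNJMdUg[R<iE[>fAIlu|<LWuxa|USpDKn|Ox|kMTZqnJbRM@]nvirsGt^zm]xqDcPhjaNMGwcBINDUz|;=Xhs[Ou=qBOmVWUoSxeZ]RnfXpNYgWk]UN Pj>nior^R<QenNXOUk]dgvjceN qiQLGzt|<XpbxuN=dxcEnDujyQaIL^mQOmwedflcocqxUS^isEmhsTmT<kUtwtzPeg|OPR;suYi^Jge^JWsEMASLhjaNMGwcXTekHNV[RnSwA QVjWrYSOektRl Hb[hZywZ>PI]Y'',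
 ''_eI?Y<YiTANqe?H=;dVPWF>l<?s^A<owp WNK>SAOmF_>crxWo<Ag@rUpAnQZoW^vmYariyVmx?wF]D|i^ss]JwNmyaw|iUmwihli_=ao;t;USDeWUs?XS?Ou<Wnwq|_gtwFX_kFA;GLgpyLzOOR yPgfc;QQ@@aCdz[]n|OWm=sJ@LHHC?_jpmkvs_vGPekU_kse;yjQdYocdC|CF;P?_w=wEBqv;pSw;|_HaagZ<RG]S_XS;=RyvtYloU=U^D^IYGh?nyowJD[?etAxez]^ngr]gv<p[^iUmweh|S?zC_wSowZbd<ju<Oni?gu<W^ocS^NIeWYJg'',
 ''?OTC cIHovQZoWnltA| kwTV]euX<A?HLbcIeSQdOnG|HNRc tWVudRQFovkW?JFhkRnA|ZJ]NQ<SZ]zH_lpHDjp;cBHWAwHqkNH=rsnMKm RKXLT^R[SGqhxq@kuNMG|gFQh|Zn]NvSkmCu^D<R=jNNryy^JwTiDIgzRD_wVDsoNfwiMO<f[wJk_iwto|;>iUSGs=WsLBs=]ZNV=mgdNWnzOLr@T? sI<|fsB[yJ_nR=igbm_rysONr^GsS]r>vpHuwZcXHB@GzoPwD_IR=mgd|gtyrU?AgOUXesmxag<|tyFn;hMmyaWoGeplU jo[VHF<ph=oAF'',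
 ''?bW]rsnM[HmZBRWpXlvy[aLZ>L^b?pAgr hchSvUMdN;[mwc_Ry|qvis^zQJB<<N;tYOMgRI^>d=x^GacIeSQ^=GI^uAiW^vmYy^paHbcfKMZZxGFLopALdO;hp?lqVF=<B;jRHv>uv?qG?=j?qo?JBUMLGOvVnkgm>F_NI?Xe[DeG< G<Tn<U|LifhkagO;hpG?iiy ;Kz<G^nX^tpsJCe>TaIgqbP=yaZzcR=dr@cGW=zWtymo?Ek_gk?lwQn_DNffCN<<;n?KcgvK ciqDuTdW? riyvyx^dezFYjZTv?OGMWqYnHAZDbXNeA_ihcfOAMYN jn'']"

definition "c1_3 = [''vpfkxLweJ@tgG^<zWae<rknMsT>HKee=kf<AqMTFI_>TC]ZNnGek [t<jfqL?ytBzHeNHfMiobKlzNwOnkH]vL[tXfkD_JwyLapwM;|K=|kGGHlQKzqLgpydyGp=B=FkssFGnd;yEll[|Ws?PInTXC|RXNtiyxQW;C_pisEmLujOu;R]wVIBCIwCtsZ_]<H|LboXmTGoVe=sSUfkpeJtU^> HxuWCCeZ<][CU]X<D|jr|EgynTQcMv?rM?v|E|guNwJOMYZm;tKO<LdI;zVotKmgQ=L?Yb]=w<gk?;o?UP awZ?PkFp^xeFS[Ge@bJux;VuMR^eyGp'',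
 ''?[ackFm|^XgBeSsmsq=HY=IjZ>uYis<r]eLgCpjuy]>M|vYUE> z[>mQxFyEQBnky|D>n Cx;n^<qegpEAsl|hdZguqltiDsRgJIaLApyY]c|@J[r@YZCO@yigtOUDtSEA;tAfs|ZNsICFaoKX@M[=z?kWKOVI]^c@BW=eTdZIlaRzUoi]XcQUQbjnn]^Q?>y?[z L;jgAdobyd]kkARR_MMPVDfO cs<ZqVjiiFTULdED_BwczugW?HjzzvyE=;g?oiSo_LgHGC@^DFJYYgStcyim Ok=M^jtIiZVC asSNBIxwFsAxAL;zvyENefZGYbpeVfoHCY'',
 ''FOxuQukZaWOUD^tI@MwxjkFvUIdjs<ZAOKaNMGwcBq]=cFpEuMbwO;c?ciyILO csAm<DjVhEZY=ejOAqMsj>JsfP>;fRq]N]B?gVgveNHKw;@|jYH]nrFyYyNIfcHA?V|w?tAx@jVlATmPKq[DnvWR]is|NzvuaJoG|HNR;d<LnXLojUe| [ ^fpY]MBGc^=?hCZs]H_qsFDTN?N[QxiB;pY|fKp]SkmEngrqySBL;XnCpCpetIrmBdsslenDvO;CHayGPWWo>MkWjUHvNVy@NNskeAs;Vy@R@ttxCuc@pqYbVty Vl]x|=z;DPuBm<yp[tDXP^F?'',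
 ''?wYLoJBMir[USj<VqSaJYfGiAv<i@Fr= CqQZoO_?WWFkZAO<z?n?XJbUKWvPD];qTDC<dBmi^_Nwfv;W_HnayViEQLCxvjslHn^VfFcYrJbjQtkZJTi|EqXYG?N>JNFbI^lLWAGbct>et^bEjT<gRd?|dH]WGo]XTh|Zn]NnGi xzBzN|^_VP<I|ONDN^mOrmPFNfH@cvko=nMsr> Ern^O^iVnE?uwmae?<GIr=sfDdp]jEiGdWDicDndwbpqWSa_BVTM=LEDt]PTB=ohywyWgee]t]sCvpoQNU_;_ly?Ev[eU[C?Fz >v?Xs?[> HbOx^g=uKx'',
 ''O]SMmyyUXZxe[ruicx]wXZL;Asehjk[gWdNZZLQSsM<fdYY]gQTuumIdaZhSsq=hP|W?xxDpEuMbwO;c?cQew]V>l[wge_q>tPBwQBsMsjVZftAqu^sI@ae^ZJTrB_pEKSMB=RZl<SvAqu^sI@aMSxCNMiG|ntAqu^sI@aciy kygGzsRGDs=vHBqMsj>jyo[sZyrMbK_ZVt[DAI|HunyCyZpM_HWepe<vhZyYVPHwAcRd?E[>]=uYyjuepTBna_?s?QB>@CSHsz[x xgYno=OeoK>nYNioJWAGbHV[swy[fUmxHPY Qi?E=^CRfZ_e@[Ns^N@NDn'',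
 ''V^IjI_tQWsssRhSsq=h|E|HbXYXmImdKFX<'',
 ''??TZ>Lwl@?tZnCnaLsodBCoorM?Feyxog[@GBGRsvOV<YsWq@;;Mg DF>GYDz[ qwhGDie|qxgU_UpSyf? [np|GpOEnaldK|opy?PS;>PJ__gw<V>SVD=ANb;y<<|O?kz=O<M?>G_w;[wkcIFpqDCqxKXv[fUmXNvNpQ<bpnq[PiS|wwr<fENwAlQp>c^C;YRBQyQ WKODnzcyXkNUx<|oYAAfZJOqUpaHbeaufpG|SnNyfEQ@@@BdECLf;D cjYmr<LWPXnCNJIKXXg?EoywqmLA<nw]@UnvMsjV>F= HbsB>aVsqyiLPhLV=[]yYG?fvyr=>Xe>'',
 ''?g]beCxS|oOjttapor=|k=MlsNmUeOxgRliWP^ioamo_owW> CXrU^RaQwjqWkN_XTnbHbeitncrPBGR?vPDH PrMzfHfeis=Ol<o<@]mguc];|ZyuVBMO?v_DQjGpLI RHD=VNiPiH_UjqkU_Jn[nHtw ;VZzv>sqtwLvMQDKUgYtucio<a?C=Yi=bxdP>T[_=wgGJ^mRxTdINCqBEqvxFQiEesyKmp]c;v;xPxz=M>ncjEn[?d<FxN?FUu^sGpOs<Fv;|sc^@GFlTCAJaYzFe <UE<ggQWF_?dg_K?ynonuGpapu;[Hzb<EY[hn[oWy<Y^syXD'']"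

definition "c1_4 = [''?I|KZfZ]bEqT_IMN[=cJin|vhQetcUt]Mbu[c ]MbuqQP[ryvt^?>ruGv?cHxur[MOnSrw[smRUPzeWMnCEBH>WMQo>FQpE?zSEacUgYO<eO<_bH=oXN[HOX>nqKTYDo>ZREOa?EwyNvsMoHzyu_mIjtb^cH|vnSIGxFhgu>zxqacQRGXUJoHQUSBRxPJo><z_P^Qd >XJ<SPoQDxuwrKl TjbulDU]][B<zGaGLcSjguRyEv|Wn?Js<I<xjq;PnYGEPVPdIoXM@sK|sRLus=^LbGjMopMKqUS=z[CFwHNNc^hmQkIiOtGzS<EYtg_kyCete]NS>sx'',
 ''?OJeJpIn<Gi_gtBzrpge?_vK zuWBwbNq]HFwCNDGi=^yYwfev]<_Y|A]uRPejssK<feQeVt[DawUN_iw|I^GGBGRudJoUw;=iCxB?kcwNLZ[y^paHbeauf<=E<UT^zN_fFo[M@H_^AegGKGY>Lwl@SvQf; [Hs<KeppnUnywdLGGg[@gkFo[ZxycgMHXUH?atN_sGCu<Mgy|IrK<Er<FxVe;<kLy <G<EvzMoS>DwW_w[Hq=mWx_lQ>m>Bi<O^WMklz^oyOtwby_<j^GwcCaCi_cbx|K?Pg|E|@wtrOtIWAGPyAYHd|cvvMAgwfsmi=>=ekOPo^l'',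
 ''?^QlTEQHy@Gx>PxetH<X<;bXjKQn_v<t>_]VBRfxuvnds<zGg[m<yFTsY_FHLdNZZLqCrKbDtG<GKBmkyLo>qY=XQhYsK@@PxqagFhiS^fdIyNwJc[ej?noZl|M@L a|nMqbCuGTneEuHeOsr^Qh< Gwb vidg;TrTo>[xbtRRpS;DAR^DYrfonsxl>bKsSXp?laWox]sF]jGO^Wb<p|SBRfxu^ ntf > ?XQhZUVA cGKBCfPUC]ZNfwO<rRXQ<qMo;yD<[FaCYbnHy nTouoMndGQIS=z;Wrchdie[tEwv]jKyI[u^VskUnlB@GrtMVzRsOOtgq'',
 ''_t=lVeuy<lc[FG@x=>qRPrD]yui|nykW_^=cstBmPKKa|fnPng]cSoUVyzgjnJwxL]a|O;Fg^klruOU]UnCWFAYJgWrOFlheVhE]X]eOSNP_aryvt^?>ruGv?cPQKtrRhSsq=hT[Ag_ttAHiIOYe|Q_<gez[mIObnY?x=?slT_kMyQLjmpj^OMo@ @Y;F][kQsknc_xivgvR qsRndOL;GOKY]nLKeeWKUgYO<eO<_R][XwLnHzCTDhHX=@x]TvzfJsr<@NdizcY=L zU|JYN_>Gjrrg]_>d[DGrE=ISajFR^ISuGsr j_L>NBajNuIvkog;noMy?'',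
 ''>uJYj>xG|Ef;TVtDtAKJepKjltHvdqSLDs]@GrE=a>P_N;viqBUMtiyx^THtRsYjAfJyQTrT=QrE=YnptRDsscftCnMThzZtUy RgzZPw|]^;q<qSizdGQrRgRfjOAiz;fyd>JS;fNg<HRvM<E?WqaLU_liEyQWssChKaNMGwcdvNiS^DI[;zWq;iHtwXY]ye>TK[]pjjqgOoCjpjI^gv;HtFUUa?jzDNdizcUZhUd<dm]y_j>OUv=Z@tzTUx|J;EERrFSrnud|MLPiETMdCNMdrC^dLU_<AWQVt Ee_ZOFlhMzhAkCqgFWNSyT=InBnQR^FE?KJu'',
 ''?[^pR=|CwyU|sA@LHOcb?Eer]pR=|CWgVSiuyUT[MBgHyY|Sy^pRC@ILj|@DxPnhOtGzSd?WmgmIc?yUVcPv@n^Zd<DQgQZlgOR>JcJEpUDQGZecd_@@udCTe]pDjZhzdNiEZYItiyx^dBE|[chJsFsKDV|=AmUO^F]Pw_vBogsSsYO=j]?vWnuE>i]<oNFlhyPyEnnoF]oXaDD_T[yFmMgMZ<]aWmco;h;Y<OaDM>vxw|@GCVDWFFOKlWGOy@^Ie?@wCawQoN>]QJTpmubTq]q]fFOiNxJEpxYDSJAgvyKdja;dv^vMmSJCnUFEK]INMsM=ftUx'',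
 ''?g=KwtWd>HN=wBhDPHQcgEv;lRme;nUkmYn[Jm]o;fP@y|[Zo__I?h_dwTgAxlNmm]<dRolvA<NcBRneLkc[EvmNjdyKxvsccZeYygwQ jE]TWf;J_fTWqeynrgIs>eaeE[sVnKg[n=qut=OV?kdK<mmesjKWl[iY]HMfMWAwXkdZ@iDMIP]@NCArNp]a^]KCUIMl_xHwMLdKvmUVhRJMxCnRXm]?pzOre_|[rmjnmxaw>pORN;zjzSO?xlR[m[RetUwm]LuvJag_;IfvuRruf^OpoM?o<ln>;PMUR@pq eVLAJETbKvtZ?hWLjjvOGjiruawVrj<'',
 ''?w<|iMvAnG|oc^=nwEQj=NquodtwOq@aePnt|;ck;w_Z=oS=j<aGSSREfKCedCZi<yvuLgTuPgbSFEf;bpnUoV=DQhDV[wwm>Zj?qxPmjnU<pC_x>T[WWUajFzt||r=N?wuFQfK[RJ[JTuPgfc;Qqq;E @FTUadUBCo<cHxzbhYDzDuKUKfDBUMtixdQma]JTuPgfc;Qqq?l|qURkSjjQjRrIh|USPZgdwsrrjrMKQaYijgrBbOaa]aCiQTuumsKzwgp|DF^r=yCfhVsqewLYvzOJkQhvhterXItiyx^TH>mxLGpevKoePX?|PKy[=VALtWjjFEZ^?'']"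

definition "c1_5 = [''UDBqgf;zIs_t?V|fCXxTySsLUfk ;>ZW=HId wJ=RuRLcpuqwvdk CqQZoW^vmYYaVpxI|OFLwIJuzMy@qYsoAgXDgliOh|B_Zo^KCgx?vGDXPK=Cdp <J^ gv@]EIgM]LXQ;yFnUABUKWGKinti_]QnmKTuPgfc;QqyV;MrOn<=OVRCg[cwt<qw_?<RzRhSsq=hP<Kse=dyGrydd]@Gx@wMakhgG_UTjM?zpgV<xoBUMd|ciHjaNMGwcRSyVUWyRsf|c[_yPR_j=nwRzPOqYM[_Onfe?r>d;hyUZNU^KO_>tujNWrMnM]LbThkNrmygGfWtgM_WZ>'',
 ''_RwQ?<[?xsUshiX[volxW^oZVntlIwXZjKSsHttS|Vsvwg?r|ciinLisMruMTGqf_sDV;zjXO]]YhjaNe|o;rwqcHseMvePYWVk?tkO>;PUC]ZNnGeVr=^?IsiUQMtOneE>izH|ZJ<Sqf_sldLzl;OmK<S> ;N_^QnAUMtilHYbVH[dSrDm|rgWf_]HbM?fIjf_]X=c=_Fqf_sldlmbu?Jsvg_JMyRjgoNDjOhsRREfkBedizSyrfMoCOvGuOvRQL|KgoeFuTmMUoi^jHxbj>bHdolhwvgygo>=<PiI<dmzwLKI[kBUMtiyxD=z[u]kMMweg[eI?'',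
 ''?[_=xkq]Kbjnn]^Qr_il>=KrWC]ZNN<=ix|kLy?ykGgKZY=VuRpozzvyEqYLf<Y><ATrmwF=ghMStCXfnQrRwFeyp|w[vE>Hp]SSzodalruUqzbHv<[fLohBefpSVLc@BE?KLQtMKu[kXm^Wo>|hjaNe|aqqwnOjYnM?fYIImdKovRxdQRY>rrhNgdrhO[IW^meqh?o]IbPhjaNeEZalQNZydOoL?KLQtMKu[kV>Nku;zuwv?]hjaNMGwcRtcv;xWOon=QDooZR_rGTuPgbsXZlHrhS>gO<<EWM;ywEQ_Zi[KYycmoEjZhSsq=hx|n?Rv;?uGcj[FQ'',
 ''SWwFgZhSsqamNM|zP|RV?Z|rAhdkfpSV?uH>knklO_qUw?<?[hPAETPYItiyx^TD]wrxVzrk[_MC?r|U_]InDzt||OJY>knkF_^z[>x;?ktXwVS_LI=IwQWtkI=i?OFch;xn[ SyN^Xs>d;h;UGrgpCXxOci?ips[ozpw?cw<OiyQwO_zzUUsdzvbG^;C?HM[nmqO?qo=^u<zXD]wrxVZFIkNZdkSDrXFpf[Y|Keun=ZT^MzwG?i]aUSzS?xsN>nVzDxPKgD_xitg|QysDgdxBEA_k=aRl?sRtUbnrhgJqxlQcJQWN[c|jmD=bc;gGfWtgM_WD]wrx'',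
 ''be?ZCVpAnIjSQt]KjmteWYnowuWMohDsneqmteWw>ZN[ckmbFokFrGkOIZ;]kn>?et_b^_U]?lH_RqC^bFPO]nn[ZR_zOycPgyiPnSTgbh;VT[iKor|_okoZ^QF>Xu|umM<[;H?UYO ?==?vsyILu=nmeHyg<Gg[n=quttdMg>LbT=DmQajFzTNwFbCR[MDHNcf|nYw;YjtVwCIObYZckmE@eqrPgfcYqoUld@Kb<llA|wxor|ujtZ_Vuv[S;mQZW_zPiAc^Zcb@@ CCWh[bYqoUld XDyYy|smOnfn?qz_e|vmjuO^iLkn=>|qnlVmGGrMiTANgh'',
 ''O[S^ IJKs@r= sqjP@lVAHhTC|VBcuGer@RtrQVOMmV@WOR <GxFhWKYhzzsxxiWoea]I?w_iLoXYhCKW_<Puj[lMWlKkUadDMuG|epZ;>au_l?OIws>ow<f]endzvbG^;C?HWL?jY]SZSRHKreP[ldDsnVg|vXikNNYXUlW T^Kcrr|?Gl<zO>ewTMMdZN?pzWOwH|m<nsTjr_x[dsFK]Zje>|vo[VSvWeY;zj|_QredpE_VtybzbedDf;CQrT=i|ImvgUmgCu[f]lJ@WrzApl<N[mOkZOGjwTjDR]iu>ljUbFRKSkt>iuMY^QDrbz|qGf?PTfmi'',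
 ''Q?c_d|vuvePrv|Y|Y_dCxx|Q]qRRL;Z]ZMW=zrCK=TDkEhpwx<mu;qioyGHo^YAVvJyQV>mj?nzlmc@T>;tg>Dmfk^]ZhbogGviPj>nYNioJA?Z_Qv<viwUZ@IMlG|y;CMJ]i<= zRq;g?qhD<iy>g>H[nvY@CgIkrqGDf||]O>pi_XW|F|^< CHi^vgeRvAVJIElTRJXadDpRIi ERR@KEplkONgv?X>orF?ViyaKeXNHQCnTrIp;s;YUIPukNkzvlOlOESt=UgH|Q]SqG_;=?Hln_vLoioJNsAdTIWHKR=lMadDpRIi ERR@KedBVJIElTrNpRA<'',
 ''SISVTFfEdP^cpuqwvdOHnajO?VsGJeK;|FWNcOKyAANqyrQywqCEreaOK??lg@_weOxH |YxkDOhd[O>zi?wBywreCoekSkqgOK?FnlC_MeGxxOREIxRF>c]|D?Hr= [dv;yok_XxGFuqJCxXhrksqwjqISvD^wpQLPWANmKyZC;UGSmhktr;ePJxc|@T=AiWMeLWv|s_c<rl[nglYi[ycm_Gb;fmss;oDgsjOn==OTrNt]i>=[>xlx|v|I?=K?x=elEWwFvPgissy_RGVDPXv^SCKc[mh;>Kwsrk[Ogsh BJg];ckGw?_Y>G_o>;l|[KdwIUMtix<'']"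

definition "c1_6 = [''J<==iu>l^]RtPZIlvnglnHs<kKIoU<p[_xeL[WVu;iUVMXQixSkMUonuVVe [iHPQszIpgidfwH<Y=;rH@Kg cW?zGmvT=zNOlSajFzt||B>e>blI<CeA<>rONOi=PoR@bP|j=elSCMcjb]AT>DSud=UyCbxkYJFNbzkXRXrluHj?x?>_K?nkVRMBb<ykwJ;q@c jFzt||OJA?r|UvhaJr>RYRwjuiLTjtiShTJw^TTzt^Td?ZjHDgZ_I;doudOX AFXLS[f|nyvGWSw?X=orE[jQV[qVADYhpXItidKsgyFMjJAPsybDnnrES<xNA|nrZu[EpsEk>'',
 ''JgF<AWPyt|[rkAwW=@gsbZlowqRzKj<;luMjLf|hUcy k|MyQkFSiO^pC^Rj[K^xmO<c|q|kuaBcePgfc;QIwXtkmFIajb]NtlpG|d;Toov|O@ouMnrHHu]geTfv]<U<chY]qvd_>ALXD|]M^eQDD^|ajbdOyCnink[]]m^eqmbdg|[MBxAfqEYQCu< G<|^XoOTuPgfc;QqAiu CpmnqJcRJPP^]ajg|kYVaee;x^LXrVRG?y]^kwxJkpkEuuo]iYlXic[dpk;uVWckLnUD?HuyxbDioVDbHLV|];<b>=s?wxLFlj@iJSXPs<Z[S^ft^@WW;mnwU|'',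
 ''udRDDI?puvxb]^< Ibx?qvx_^@I_Mtiyx^T^@e|QZsFGdZSJFx;HAISHuY]MnrxVQ|PzCAKj]|[risMrMxCNw=RWTs?eLyL?WawzBWy||f>tQLWxjGppYgdi?NwW[jnpqH|]M^eqmBSN PA=ZGpuEnNaWavJLy@[J?vRWWkWiE@CVaF|lFOUJBCWQxCnIjOZqBGWJIONHuqPeKjp|iW[fcOQKsdTLK<ZOzxTZi^<V@LXUaWkvqJFD]eKr<XFl=FPrSnSCVT;xVI|DxVd;xBIIHdZqC[KaeIUxZSM^icYRbQXmESamPJwA|feYDnz_KQGsZKvJh_[V>'',
 ''_crx[|nd?vSr=AN]rufbS[yacr=NNmqufbSkxa]zt[xtJW[BNm GviSobSK|m;piU<pA]ZN^c;xS|IED>bw@lXQh|RGj<ZUNnYd^h]dwZecploSsic<x|Nh|]|obXdKr<x|NDkeMU=]IwCtsdzPEovbG_z]Qf;d^HsEyvtB]XKof;bG<@j|uUcz|tUX|QV^AGCVGjyAiW]ombncyMB_vYQrq=xHqcRALXQmc[eOgKUpwzZsMNk>mwz@w|k=ZwcJWGR]|b]zEovXTwkCI^mk|<N<?NiCGLwJovTGgb?GS@CVWckthSyNnP>mXVpEQ=[oy|fKfyq;l'',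
 ''?g?fVNbOe;bIxyXONF_JsES<xuZIECxXhbG< gxAtYjrEi=vhWSzs>^?fOB@stMr[^zRDyfE=rcYCxz]OwfygC__UHkuY>k>wXsyUE?hxMUadg[nuTVMa @Fa@@ CaKtMqWbFeM C|wL|E=<eWEev>tRwVrr<moeYsoN<iEO>kd[i?|Vu=QnE?yb[_oz>b_]H=WNW?wDos> jafSsK?HmwgvSvtf=OQ[ftBjFrKOdboQKhZHo<PzlM;oyGeVfjFrKOzBBH|p]qNJm RnHUCy]sYZseMIUMDgtyvgi=FmQi=DUhd[OURgodMw<GCy];cvSTaNSGCyew'',
 ''Mjdv[sFpuSleFKzQ[=rdnm_zqhYKlQajFzTb^cKgshZhSaxayj|^KlQKq[QajFzt||OJN>tLuOMG?O?z_|WI= invfKQoq?Nsk_OaPzhwAF?Zw[IZZ< bF_NGO|zmGcKFNYi<aur^GwD<age=[>p=r>W|[SyRD=F?;LIhwaoQDt[DaHROVDZ>yaD=>KoVdsYTfVC]ZNnGeNgmWjnycRL[VtaxayvDr [g;YQoi qfsXI=s[B;ZJAHShSRfEv|Cx>X?UD;EiUCNDwp@;lhkkDOwsZizsHaaP<p|[NkI|pu<sCsKzsfoK]NSWDw<<eGJqhsyiKtMgJq'',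
 ''kaMJdjOaY@s>nYNa|ybHlUSNkc<LBRuwMIhAGZW<]C;OgMuPgfc;Qy|[Zo[]Sntl;ciIlONpxdiLbKmi=>=e;?QjmK;kRnowOdf_VWm|lzL;ao<a?Sj[n=qut=wSShUtN<KskfAKxfhNeI@HPvNj[RJFocDtx@Cf<S=c@p S??iIRGL|IuiJwPdg;>eaeE[sVnKTuPgzQqqovcKWxZchZhSaTGrydxSs]=d|N;@Np]SxJzyqWEEqf_sldlmJTuPgRt;]onONYTMtiyx^TFgknT=qG^?=UsX|n?R_uLF RnZBOYwLDqIZcb@paaKtMqlxwJVRPLb<l'',
 ''JGxF|Osfp;ConJgoUgpW<osFrME_T<nj|NIUw|Jsf|FALbvSTaNSGCyeWOURCM[aMZI^KJNZeOPmrGHBHdLwRwny<jd[|[bubcYYz|?CK?KO<W?cHVGnUUyQKQCYwpYjYRNpMPOSrTWcb@@BGfntgNwnn_Ig_p<lmo|EUwDK=>npKigE?nHiqismq[tWVWrhEZINwfbPk<]EFVvGGmrGHBiid[KlQKq[QqQk<AjU>@Q@adyVzvMgWEJzB]anPWb|c[YjFzt||OJyFwfXmxL=>kuwZ|>Om^=nia|nMmwoo|=aHtSc[uiceoMF@wV]f=pW>p?IB=tx[='']"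

definition "c1_7 = [''vC^btL?xvDkEgsmi=>uGbh;VFBk;f;S>?OuibLVdU>OVefQWu<<TzS_hOq_ [ ZwR>Pr;>d[|KSYnqmLe;GwfXmx|nMmwGqf[[XIMcEYe?cUQlEvhLVJk<S_hOq_ [ R>UjYRNpMPOSrTWcb;b?|?mGruTlNt;S;CvsFRX @otP]LTuPzd]hEZIQMSrAnAzYrg=pKcXjkQSow>]Nwfv;wWn>p>_dZ;rZSVrhp|UbVssbyS[vZSkzGOEQKTo[YwbauLpYy=swb>iBKzshjo[b;M^fBQhoQDJSk=;qi^m;axHVjNs^xK_x?dzf[wnoLmiH<l?KIQXUQ?'',
 ''Vx be=bpJOblMEfYebpnUouU;faUun@|>rIJ[WWars[sXMZOBe?Z;?F=K]gE_xczffuZtsc>TXwjwjfTqsY?nY=x>wruunOlOmZBG|aHDafPyi^]?ZnOoG|cD=]@HbPVlKeur@S=XQwZIacazk<AVfV;vSsuOxoeEqb>L?a_?a?MWm[;GRdSQdB=ivuFmipnvFsbYKkqbYKkgGviDUgz==e?zCIxWb;|@WrsPfT_wwZe^A@wT]a]yKw<?eN>mgRKKknMcjj=BpG?mCjn|?=t?C]_PpO=kO?KS>zz? '',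
 ''?gG?awkw^kZM@O=k>nyWOfis;sPKyA|;_h<xJOGtWxW>]f<[=CiSNjRflegxMBW;KintyKf|OxtJ_ ctNIOcGtr]HQu>^__IQeyOepm|;Pg@nizBc=CfShwFRpYBGlck]@]s|soN;ioiCMvi|JmzA^zcg?dR=|g[e=pAUkpk;U?N<zNuoFCxFm^ LOcu>]QD@P@OnHtdJoU< LG]ZxDYiMlw_LEqJo>CFjcx>mo|EU>DKgiKtEzryi]Z=t^|nZWO=HeoByX=]Kh>sh;GSCajFzTzhaFnydTb]GEPztIA|Ltx;F^pSqgkyu<>vpNEjZhSsq=htylnd='',
 ''k^UExSYjnHap?uFwYuZtKNUhZZzsk_Dja_=mLBWZMBMQ=zSKtRPUC]ZNN]NkKYkvMc|BTNe> F]NwVrVgvhtgVhEZY ZSTi|nMmwoo|=a=?HTtBmlDzt||OJuveU=zc;OZzvd?WtTV k<g^frsxzAB|NwyEfvfWaHtSDaojNIn?Yw=g_yNoTC?xTr_GRwfW@zh>U[[aSkko_zJoVNV]f=pW>p?IuM;nITuPgfc;QI?WwIYIfyn;w [kdVxyNzRR|KUjps]peD@ uM;KM][r?ou?^wOBsKdvfVzC=yl_gVODjZhSsq=hlPgeaPfwVagvXuLgne?Ql='',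
 ''c|O_lSSyWP^tt|pAjnT=jviZajKE];[UisEqiBOG?|jKUwxfdDbkuHFrUME_eOpXyNvGBqMsz>J>Km;^fWR[rQ>Ka;>=^isfleoCN OTERHdZhSsq=h|E|NgWHaaIrtv<ZopALtpdDgW@|nmBOUcXEAFVJ|[S_vvl<?[xhp[;^uKNmC?|MGwxdWqO_acO;m]iO]g@NFborGh]uODvys?bg>nO=IW=Kx_f;m=^_zSnz?b?YN_TT?>aq=Bg;deTegH??q=O;?c<HRqOjsUpMR;WM_atvtFLoPZ[ZoR;WigY>BimuwOMEiOtGzSdWk<ANPUvdI?ikV^?>'',
 ''_y[WRn|Qk<AjU>@GhcsHyMxONcdw ylInZeokppPHQtSPof|i_mrwUxkJpcPbZfxjU>nBCCada^Srqk_lWk<]EFv@]|FIoAS|uJ_WaaaPvoLllX[vr]qQk<AjU>@Q@atTreikTsd| [ ^f<YO<rHfzZtt;m_gsMw>xz>=gV?;HVzNW?plzfIUjmPDM?nIWmiufHVyO<;|eVBWmrwUXXHdfFe|=kKrxhU>@QH|tJ_ ZeOPDPxxpYzvEgcRnqTNwB;TDtR]ZjkeLMo=mtA| ;fpUtscoJJbM?fYIY[UhjaNMGgiwL=nndfS>udVC]ZNnGegs=Wrj>E<?'',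
 ''SWwft<ATr=fah?d?yCQ|zZImgJiaaVheDURCJzB]iQIMs;TvANzr@ufRZHiI_pQWZTRW=IWfnRMSNwB;TD]c<eIWsmSyJxtJ_ ct>HEf<ElnMK;xwQrAnAriDnOQbaD^IyTBwgHqPBgifIy@w@=Lys^xeQLuuhiw[?NB@@P@aCaKtMqWbRgM?fYIY[UBn_^X^Q|OKj_;ca;gGfWt?U>y|?elRV<sY?eb[>hdEAwOOdQNtt<nwY?MCismkiSv?FmQiCxnYxJzyqlxwJVRP[DyYiv<kCiMLt=x>hO[M?zpzb=_E=K=gsj[FzW<gK>pGuMuJ_ xItC@a'',
 ''?kGnPcR^nsf_^H;s=wnNJ]^ ^f<YO<rHfzZtt;m_gNtEzbVyCTk<Av_=ybkR^>sUn=tFe^_wpKigEsb_kXIA[cHOKAwOOLoHngEuo=qp=sCsKz?J?|n?RVIK>yl?RqM_TrhEZIz=]aWRcR_PQzAS>aVhEZY ZSTitA|wDnbbPSxIsz^iezrChZR_rskUk<AfiknFQj_fSrTWN[thtBJmXVCXmIBzC=i?rFqmERkinEmlHfsehtNnVX>Hi?fmKTz[|=S'']"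

definition "c1_8 = [''?MagLs;eO;aWFiTW;wyGzcVyCl?zHK=NVKnJyyOOZ_Z^yOrkU>@GhJ[br_zjewodo]IyrsmpNmFoGEqf_sd| [ FW|QHQYa|GFGW|szvPZMj^mgGb^MiOyOODaVy;JLLmrwUXXgGvixbpqasTh|JKZeokpWjagndhfIKZeOpAzxLR^I_rmzkW_mrwUxkJpGTNEWDRTVVilTC]ZNN]v<KIriR?d]jxWGVWlO[=nx[LMuuRf>h=mhYKlQqYq]vfKIuzPwdf_u>WGHaABDjZHg[a]JbZhSisXZjkeL=Q;[QsVXcRGp]c;jqH>zuRsZXcVbwbBUMtiyx^t'',
 ''JzVsMIW>]ByyPzhOFFuk=kYJg@tQLv@ |NDGOTwY[ OLFW=FQhygGfWtgM_W|B]C?zSO=XIMb<ksb^Rzdg_?XN[TsqQ|LAqeHdg=kqqMu]^zV|SGwTwyRhSsq=htyMWkZsfP<iD^g?m;DPBSKZd;sy<BmXrDzddYaMw@n^zymlg?jwRKhHumODS|CCg=y|sm[seOhsEwOOLoH]BSYUmAiz;fyd>jDrsaW=o]Uzxr|^ifecZ@=KszyGsyLdgk>nYNioJg[n][r=hHW> NWFcUKQG?ZiQGyYlDzt||OJg[n];zb|Yu<altDvgXX|rVFGMOhseliyvG?'',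
 ''q>=gRm]My>poSsrpYuCO<a?LbMwvxriLnu_c<cK_?KUsojshDJcXB@BMjrFy^EuipBnIj[RJFXLxHY xeU wOQ aGpPN[vUiBmWWXy^N =qQJT[@wNXkL|@Ct<yLyzRG?ZiAcl_YXYqvle;BUMtiD=fqwYsyLrofsuPgfc;QisyaKteWny;eXP<iyn|N;@Np]SxJzyqWEEqf_sldlmJTuPgfcSt[f^WW|rH?Z|jaNMGwcrx|?elw?kOFUMCvjk[cSN@e|uD^rz=O_HbSWcHUOQ[TD@NL|anIfE?VqRBbQdgesMwnMWBCf]^H_PgKf[unN_?etnh^X;'',
 ''?g=Puyqnsu_XsCsR;by|>GV>p=UgH QlA|=thtBJm t>kcbHulEvh|Vk<A^vmOFqVXcVbwbbcVyCDadIyrtUjMe|ikVy;JLLDRfQIWwoLDGmrGHBacVyCDaDe|YzJufRn<|KDaVy;JLLSyZ<eNyy'']"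

text \<open>An ear over the bottom side with apex on the right side, and no further
  assumption.\<close>

lemma cert_1: "finished (start_ear |> c1_0 |> c1_1 |> c1_2 |> c1_3 |> c1_4 |> c1_5 |> c1_6 |> c1_7 |> c1_8)"
 by code_simp

definition "c21_0 = [''zvoyHlSkq;QaJutiejegvbBnCFX YDZtT|<ZnU;g^K=>tPdKaFMEwbb<f_sldlmJqn[^xWW?t;undgVtaizzvyEiYFP@ZIvd;lSWwNo L_aA;^^yq_;gY>|=;?Ms?wZWBV]DYJzpoKKRYrY[foyXOCfkjM_ILmKUnYsbNQ@ZTe;N;KjSdEaA|LeIj[bWsq@IkOfiTgrNkTEcYmbFBSM=A@prL@PkzXvYlN@@;lNOsrpvjeoOdYnXsMO<kk_z=ZWbH@Mjr]g=PDEaA|LeIbVapnLsTvY]^U?tPdw<[fedDw^ir]_BSXrJD|GLkpFmDoEE|eaV^X@w]>'',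
 '']S||jr]_JLpLBMZJnEEFpqTZTe;>tNui|Nc@tQer>TgWIDA =iNookR=AwuPp]p|]zWGVWlO[=nPexJCQsqDX yaBCxXJMJQGSLh[z[zhYCXUiPLAj|wYoVTInCfkcpNmFoGEjdA| C|;Lp@sg>;LWg|wjZJgFZySKfnKZvB[T|vB[tR<VT|FW>r>]Y|W]LU@OOWQxyv|NWP<b=uMLTDw]LLvghjk[SxXzvoLllX[vr]qYu_;yGVVRk=Sr|NORgqe=IRxXTLMSWnV_w>k_lfriaDegG=Sr|>IjSIzXBSL@Pgy[z>vUL;zzyOpjoS;>hiSKUKOmEi|t'',
 ''BWIthixVTZFnNEPbBpMwqTM>HgicxckIasZiJxsenG>eBH aO RhQmhDwC[[Cq]U]dKyfiXmc>geEWIliKAre|;hnIxJaFMEwbB@PjwBr^QttiejegvbhW]K?<kw>PL|Q;ETnFQWcy^Ozq;>ms>X>ezr|nUe^DVB[tR<VTZrs CEgyU^kJqdrts^MGyoN i|ofm<WIfKg?zU_yOLwK>huDHNZDfRX@=[zAoFqwpLGwWfq_s<VeyKgq_o;?|ko<VBdsZPAZbZFKTtKRC;RhIeSTmbGHPub^ unMZI^KR^aW q_k>g|wjLo|f|G<h|>;cnUi^yDyVy='',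
 ''_ne?^c[uRo<Bei[_uc> @tWcoPDHi;xoOy@j<B|ePcbfNmTEof[mtQ=wQiaKnOK|O> kDZTtti@NftiNehcILq@@]foi;[Wqlkkg?@k>Nm;cukhoiz[^zGbTNJq=pR;vv_[YpUBMjEezRhQSqmhPB]vyUiVWPfR;s ro=Q_fjnP_irT|iOnhKtUyLe _xiaT_n>=OV[IZueRQNSQWjLej_ZHutz=ygRR]HxrvDWxwuAWIthtrTecP]yixmOUoSsbFb]]dWxhnK[iNwSMYnOmhCnRhQSqmh@fUXhsjO=@zVU[IRuRlIc<ri|IvdNAt|iYN Akppcv'',
 ''?;lpn<Oi]JPZfCXpJL<h=uKlK?SZuVRGVSjmqftuNffy@NvT[rj_ZHMCNmajnSaFMEwbbw>T=NKvuQ]a?[LTw=Xbn<kdfd<YYljoUQ@gxlPWv>[k [;ywRZ?zva?g?Md]YZMwj=So=xkyolI[Wzjz|WzMNC;EveUh]gA|nx|T<[AcEPvgt|_bkDZtT|KJ@_jq;GU?rz[mzRcSAO@w|gRuxc|eNbOnVDNkij Ogz^xWR sZjJxsinG>eD @iQ[cMik]LiLYuOMdfRhQSqmhxmOUosR_RYRmB[rb[u>iw^<uxOTosrt^bM^F@GFUuOUD?fOiZkhQkI]'',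
 '';fxmOUoSmH[rbYUgYfbEo?s_MxXWNEZtTljtg^K>eEiUcz[q;?<WCnRhQSqmh@FAShCKjW_YQ=^]mNkVadrjYHeZueHMwH|XQU?pOSIOUoSmEubud;p_cJwNjD|y<khRHf^KMjDvPAvp=hr=QZTIDZHwLMZ[e SyH| bFre|sDGuePvWVVCq[bkDx]me@yUlE>dnpSnd[GuMAWIthixVTttiejegvbbLyf]Kzdrd[xcUnUu^yArB<wu^VA>oBBxYEdwgVL>]?H@Lt;s<VXcVbwbrFpyZDYFl^cuTzlfz[=?r<hLWNckOyV]rKkpos=hCn<Q>qMnUix'',
 ''?swzQK]yE<Uqw?j[uGxwK<hW|ygqHj<zhnI^?KCoM??ubo;nha|WC[tR<VTNcRYrAxhNK;rAJnxScrAGyY[UgK; W_KOse gUt?YUJ@@LYaThhWD|ePcfb[QTXQSgVjV^ZKRb|e?xk_zaXxbvKh]MbnFs=^tcw=[g=q<Kuey|kj<HLxZHO =K^A=uBgQiIdvi@^A=uBWfzdG=hsVL?^ZFavnL=zkiUjqnhsKhoVxrTg<hGc|_ZaRzuVo<KIewM=UQnnaNo >ZaKS]rc^<n_;lmsocw^K>YJ|q_LUWvZXcVbwbRJJLyKc_ECnUUxyRk^rcXn|E^^m='',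
 ''?wlrcR|y|t?l=vLOzIGa_kruHlJsK|tYB|QYRnWxX=Nmgqxe|glsWHusvsK[FyVV<iw<EVzY[yeW]KOzK<<uspf_qiU^v;<r=PgyYoqK_Czk^@yLxPATgwjJ_YEfTnCg=ZNzsRxSGRkFT F_u zaFhnXdZhJsFFhnFaWcpUy<oEnec<L?cLoUe>ry<<nwnuW^KAr=y>tDbyGu>ZD_SaN_pwj]>eKtyS>VezWNUSqgpqhFhZTJtWzcAT>Vy[MrKuX?Z|NQ;KtpQdFiT;WStdNhxvfoUUcyWVi>|<ltknuOJuW><XomBOov;mX?hT>kU^ompOZM?uG^'']"

definition "c21_1 = [''?w<j_t;DH=S?RT;]rwzZ_v@nQQfuhriXJ fGG=@Nfbid=KCKKRsOTy@VB[tR<VTtC@PvZ@wWUBnR |IwYsfIMsWcrgUxvTcaZvU]iL?@nqROayWhpgiGUFntBjDq>uHGj;um|NMYZpwjJ?rJM^^xMfw]luS>QL_yJ<<ZowVyGeP]>WqqS=o>R=IohM]uSEA=tHWnWW>A|=Awashmf@CnJwGI<rD@sWxhgIr[fRoe=eXmrk^vOzloltSRH>HMs?aX?l]V<H[WYrBa_;[yMv>hIK=CpGakHvK=j|?HnolpSR<KD;svEs|qZFvK AkSk>D_omt_Jvo|J>'',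
 ''?WrIacQtC=?ha@J bAFU?tptBJjWT[abhYKlDgFrc<jTH C|dGyQ^SfZjnZjSEuTK^Ez;E o>bAZF|XSLshNf]i;kCoe>nxwFQgphSJ_b^Vttiejegvbd;pyDWH=zeQ^^vNp>eAop_dtL_HMSYsgcAPLssvM?N zUE?tO=h??dzm^y;r<T cGUwk=rweynYQGcE<l]lPPTQ?Tf SR XlI>|K@Nvh>kV@WLZSumzAVC[tR<VdKlvldd>sceeWL=ntTzsfagwfbYjue>Y^TXrIsyAB<_RLvbolM_uPMEIj=N]?jJMe>FOgowHB[>eamYnpzd>yQsgy='',
 ''=eN;@FqRXcVbwb|aufedfR_c[>]wnvK<>uoA]sT||Fw<lWrtn @?lJna]cj;]C_?mrgj_jkefi]TyFm?aMgoccoDy>cgSKhd[mwyr=Q[xpNo<RdNgsf[UGwwy?nao[q[gQorBGqCwI;PNCnQzUUrgEsAlUPAtQk@bfNmEQHcA@ OOVS=swhoqB|ldK wRuTC|dWeFUSuMKUPTS=tphyFcHem]^NcBhEbMErJcfNmTm<tVDyaGEjaUWvZ?fTb@eSVcpYMRvmffTf<qsnUkA kytpoIOk eOrvDwtOeeVp^<l[uZ@xZN=Mk=ryd__Hy_ACY;U]=wy'',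
 ''?mE[rlSuR@TyRn AvZXcVbwbrYpaBJANrsE| R^ YATXepi^qn]YpUBy=]|Mj<|kJqCOJlFVpUBMJzQ |W;]bpkQxsZRJXlUnWrsupBnRhQSqmhtpd?_TmKUkSJ=ZDQO@DHWggd;ka[x gdxky@?cJ?@r[MbBsNi@CblU[pf<WGCPKqfD<a^@HXOiYpWSeaC^RjofC>Y=dpesu=>?cJobgM=rltVB>VRwqOWpeTLBnjSYWoHZztRurS[QcrVrc<XRf<scrWZMYN[GXre?@Grd_]pUFZtT|KbGN[>TWsFO[Q=m>ONz<kp<JofW]>Gq<;N?op<SzmU>>'',
 ''_>F^GMOOh_WnALErdVtClawRYzmfwhMBGKzAHWrMpUBMZJN@@uqq|>rdrnmaiaFMmlEMr<EnfTO[]vst|?jTNuybxgz_[ks_FgkEPeKynFhWWXY_YYMlQKq[QAWIthixVT@@jcSmfWxZRar<luuwZLiE=@q^mh^iOpRSag<|lQHSgsWiWU=jgxGkujFKOBDMJxJaFEYmbGH[rt;|o;BArd^jnbGhzgFRSIdImbG |QqFiUnfCC?IswoWkRm<y CtSaxBFXE?IJxJahAlLmEIQE=d[vx>XK@J<AnRhQQCXYZlUU^kiHXEJxJaFMEwbbfNmTm<tVdjz'',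
 ''jAEfdK>DnFQ^>ZDYfihGEyZO@oEq oU]>e]zW_g@C^kz<e]YfipnXO@VBKK=K?a>oozCpIfhOx@rD G[_cNslKvSjG<uP<CEzupoca?[pCXi[tUTyRnoUyXKnuz@|R]dIwXo>FZrwd>|>gSM=?V[@@jfQWqqRlIkNgtA?hoP=htBj=AT;b=AxVDXVyVrF<EZFeVPmO ZWlO fqdvHOUKb_nh^T]ovCXp[UgolcWMNQqkR_VaSrxor_YfObs[;]@u=ZSjWEXPd__WGGpqfZS^uzutNBGJy@RJSzVp mHF<BzAkj=lBgirGnX<kvF[R;uhG<YR^huA<'',
 ''zwmpFmDoEet]TJLyKC_EylFdIB^;@>mjxjQXJzD>[]D^kk>;Lv@N;sJrlFqAgFQxbFU Wchp;<VuyK;pdrgUxu|tgepgNdYMhCNMh@u^@GCjp?mNoUdolESe>lB|JcOp<V]dO]DOr=ATxAo;JF^@IOxYr@hmqfL>U[jMYdG<LyODqOxYJNO lQchp[Oi]pwjNF;oG>BEC<KXxcNWSq IUCvFruhro@nNxCxv>sB^QxcN^Wjgm[toskoo?KN];p?oL?HTxIoSaFMEwbXmM?ANpqTXJUwKKbfNmTm<tVdIukbG_=SODYre|mnvBHeP^MB_fNOsALxmj;'',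
 ''uWvikmya|WC[tR<VT^@OyFguDUxmoU]>e]cnB_ablA|cbQ^UqnpTIOuxGuxKOb^nw[g<Y| m^K[MUqSg=cr=esM=pHHq>@F<mjro|shkhT|vvRoCDOUOx[Ua_DJ<nFTuO>N_R=pVfvnwPBZ[i;@msdXZgqk]>Be^fLgQqCPY[s=@FAhlmy^@wUxBE=baC;dpFb_pS>i>zReiTF]Mu^VyH|=vWakQxYlQGNZ[tC^aciiH>owEgQUvoccKeWQfbnT?]Nyzryktkjbl^Te_Tt J<NWcrsJFY[jcfP^@oftCNre|?;=<aFLUNBSRO ckJfbnFYJzZ<wyd;'']"

definition "c21_2 = [''RSgVj|uz=Z= afu[eqWvKBUnkaMb?nv[Uco<h^hg?n>oV;CxxJQ^zZP^dGyQ^qooN<Vz;b_[D]bslxgiP>i>EcKTvKpfJyN@nuLYttIFwZ@UnkaMZI^KJgAGJu^mQ@mU[D@XPRmoPC<m^@CMJoFads>Lfg=SmICxMIoyK|vsD@xX[dizvwjXjESttIFsM JwupRly?bWHrYkH mjse]=blW[QfFu?sCcVEnf|O[_ttiqxHj|uVDLguH|fNZztRuhLimbOZAHWre|IWmU@C@S^e^ka>sVhhWD|ePcfb[Q< T>]QSgVjFGJOmEieRs_rKHb<fvsjRSx'',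
 ''?;TqBGOVQB^VEPmWcpgqlCBg_omlsWxX^XWnMus?Avlts?Hv<bg?GXsoF_Dwx@b_mE=EK vjGXMlQKq[Qia]I^XW|ok=mjpolt=FwORxKKxoY>VeyWNc?^goUk=Koq=@=iG<c^tWNADrGmUvdqWmU@C<dgMjSYWpUBMZJnEMR^VttiejegvbFW^HWwojLgz|QLokuyEfSxcNyeOY>|_aXOKI>YJZk^@mUvdZkpVnmqyE g>hv<yx rysM epFmDgM [TdYMBSQ[jxBxAOy]e^;H=BuTXVYpUBMZJnEEM]ZiZ|O^TKEQf|snZKvvTy<LCxXk^@p@Oy='',
 ''UkzllkWD|ePcfb[QA@hNNFRmfWT_kaf|RKU_qBlvJWNJqrmtOBE^rsMOD|ePcfb[QQSgVjV^ZKR_TOVdIwl[Qg_?R?gd>BrtL?Zd]aJ;qS|URp@FTmwwjJ?rZPxvF_ToWvqRuv>drdW;jmXoUM>rc=BrBxt^kDdyIeI_G?HNIsLSYCGkJ_tBhU=ArTNcRLkaJxAOxAOyuy;WhuG|ePcfb[QQSgVjV^ZKJ^WTgKn]ncJnKurrNG>HGEYyW|a?pl_Ds^wkxueErd[^ NAxCA@PKzAVC[tR|RwQNkAYb?kf? ;BBstxKhrKfNfeYM@Pgy[z>vUcpjoKS?'',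
 ''JEEfTgyuZGuoYvPpUBMZJnEEM]ZiZyimhx]mpGpIS=>]_G=BGP]oT?HOJLiNs?|Q_IWrmcFAsdTTXrNs]FZcfyPsJsJPXEMV<BXtWos_i=URBInSP_fWXiBKMKkfZUJ S>SGjwO]fWk|oAnRHZvjbLyfMK]ymNs?ho>nOG|aWww=IzXbA]FZ=XUrwnbyt^ZpQNUJ DuoLDTmAYiU_@ePcbfmjx=BofZi_]LnKjslxRnd[GughUG|ePcfb[QAlrn= ENJSXtFeYQSgVjV^ZKJfYnCgS<ht;b]ys=cXlzgTuemFvhmhlIlrdOqulvsv ][drqTjky]='',
 ''_=CO  FBJ TouH]VEAFlFasTDxLsVe<mk]vnytd^o=g[iOGsl_<XttIyy^MYf?hO JoXzXVCzLIe|gnvofhTSgVjV^ZKJxNXaEvQhQSqqkyVm_zmG_N;F>_YHcRhQSqmhP@GxXJLeIZ|phDA@Pgy[z>vUcGV=]Zzt HSR]]T?flax]mp@NYjw;=]tKDPbiNrc<zhnIMhpd|Qjks_|qo;[<BPgy[zr[]no>Q^M_<nhNWppTdcO@>OxviNefWQGW<sASms||qoKmYjnmsm;kzGQ@zL_;jq[kxu|kvxfnNUyms=qOMDof_mO;>eiqKrkuq=XBSXBSYJS?'',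
 ''kPp]pnB[tR<VTpUFZya@n;<wYFWLTScj<vgEVXGaFMEwbRskhcK>yXbjI;LwYBA|LevXewDq@eH@]T?ZRqr>lgkU>wy=bztqE?nu=Y;Tgjzos[MD|GlWg>uauE;sVoKTYtqDfpDC@@h[z[z>vdoyco=[aqoFo;h_]VtSf_OxHgSaFMEwbBHQ=qx=Ktfc@G[PVZuGPILEGM]ZiZyiDw]KCi>k=U]d[Dsdmj ; uuExNX?Up]p^h ; qyvQ]JL C|;LptghYAm?nDfE]NB_;z?ifriaV>tbi;T>c>Ky<G;nf?csKGdKyNQ]SpQngBMZJnEesWiWU=jg>'',
 ''?[EEy>u]kkiulzTOoFCPiYcAMtweZmQO@SQob?qWE_fb^EdwNlUPixmf^@cLSPAMttiejQh<tVDgz|MbDnccIrTBo@@=XsyZORyKklOHacyQg<eslOlg__EHLXMFYcA]UyZ>mAThANr]g;qG|GLNw@WYHZNfBCLpB;HthixVTX@GSiQizXjA]SccfEMIcKhkjsOH Jo]nWgWWeaJY@GxvY yPIzXbAd[ ; ='']"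

text \<open>All sides of the square but the top one are sides of triangles.\<close>

lemma cert_21: "finished (start (Cfg [Suc 0, Suc 0, Suc (Suc 0), Suc 0] True True) |> c21_0 |> c21_1 |>
   c21_2)"
 by code_simp

definition "c13_0 = [''bJudw^ @BHQXgVcwcBnCZhGaFMEwbBMx@WcjlM_e=N?]fkSn[UjGSSzXU]][rT]];<Bj<vcYRgxuZ|t<QqzWIFN|=NHqY>iKqzIjSyhywMkII<eIElqZFybeYXhL=Fni^JjuBQmwIQJ;KGilY]mhl;NbWf?egs<TaZZPH=FFzdPYyZ^t<;fDF>iaiEyhXKartZWTzWB]IthixVThAWcjlAyiOkiNYkizjiNQ]JJ@rtES|Px_w>wDrJpOr>_NfCs]rHfxWp_T=GBYEx;|EtLjpwe?NvhrAymsM=kCAwA=Htht[xsQso[bRsTYOGviux=hPCNpAn]Zh?'',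
 ''P_hJ[sWY[Wklwyos|]r]kbUuumsKzwO?_Sfn[Y|K]yumoVS]G];VFCnRhQin;VFwRW^];kAWIthixVTjGSSz<FADnLqtY<X;;Ve>stCuwOSecXsMRfvuvbnt<YGgCqI_cpEskkYX[zG^mIoG>iaiEmYSwezOXoUWnUiP^rWSuUS]jkfzdmfjkfzdnfZlA|HtS[ndfNGhMZsetCTakDRm?YrdiUWwNoHxJaFMEwbR=HtvfIr[qumsKzwO?_SFpANDPhgvhP^|xNzzXnv_UqsSPHbmsRpfbrf[sFW>vGK[nMKE^^xvkq=y>HOYGmojan<<pux>SSrw?<'',
 ''oSyeZD?Jol>qob?]u?sKuuMyoV^wLvZ^^WTzWc;Ajsc<fhZjANrkRcjiFxHoJq nfZ [Pl=RTHo]tMUFY_YDSy>StFEE@d;Nz[ZsD|ePcfb[Qi>q|uQVqfvqdAXk[TYLnLEwkMvzNU|[Kc;Nj<NMthiXmncEW|?xFE_q@FjiFKGhvS kDZtT|KJucpT[[[frVrk=y|Z?yyoD|ePNZ>]Ja;<r <bI@@ZvoebKBLEnfIbvPrhi>]_B|ePcR=k<qe|[voebKBLevmzZx>DxJaFeZ]bWkzD?c>z;teXenOQ]JJ@rtES|Px_wfL kwlMJnd?hz_iyZ<_ vh'',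
 ''eWNVN?jKGInRhQSqmht[xftNk@WOfL kw<<ZWiYktKOZ@Cc^Guio iPcfbywk>CaYE<;|KhUTqoK?]lQec]TgwDuih@@PfnXRFpANDzimQrErJCnAMuNEsuuWUhRceGEggp<l|jQXYZUkvYO?;F?zrOS^rRvqIVOc>vSkrsleCu?YfBGhyURVwmoE=iq?GgbSfglc=ojNOT^wCXxOMNKOyKaFMEwbrLBLeOt=LyLY|KH<rzW^NA AjVbAkvobAGUaaFkkQD>nVmnrJunlDGx_WnVosJiukMPuFdiTMI@<I<StOi>mZkmvA<h=kh^]<znzhVFg|?j<'',
 ''B?GevRAFx>Vs<kp=Os|ZA]g=gx>uI<UdvBWcRLH<mf;Wyl?YES|Gp _TeonFobRKDG[p[M>QgqGTFaAouu>JM>eUfVcWu|lt@bS>hMu zRmlxPnDoNyF<z|_z_Tp_IpRA?k>SHN?N=wT?KuV[mCH_@RvXoFjHheJSa<dZpkUjDoV;ZKFvfOjbez_GukcWwoYBJP[kk]efQqYxF]EG[QfRuOMLmhM[znx<;t_S=oTkvZCxOZ?g|W _MC_OszNkRkEsCJP;Ev;biFW =;<BkyoYXntZK|@?HfBMZJnEEVpANrNYbCeFdPMuiJwzZoRco<H?WkBrs|>N>'',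
 ''?gvsRguJF<BZcYdt POoJoss|nnNkxHp cjlnFUFkiZWPXQ^|htUuHk=xFwqI^vNTXclvDGoFeM?qf?vvQV;VGorsvc_p>c|RYxKhskrOMtGbsoS?Mu?RmuV;@B^@LE vmnvktxKOr?uNH srtW[sChmQfbvFCZCxX[ptXZ_mcynl@<]TewE<@XJ@SSm^kUrsBhyN>lufyxSqyw OkTGtIL?ED>b|OfKoDcdMbA>ExChJomuunRcW^|DFx?LsVowURRXG??;uCNlHypq_^gk]wsWEgyGo]yC?rglGX PMMff; HN?N=wT?KuV[mCXn=Ox^AI>?Dnh@'',
 ''?WU>;hJ_o_;Fy^YVpIIlc?CtFmMRnPVYpUBMZJnEEg_C?N>JRoyVWsoW=;XpcjxOjp@Zf|L?hJ=cj_GCnuuz;U @UJwgl kyXPCSqPN@|kkuwk>]LdcyGUi_T=;xXZNxbcycj|]MpWZEE[JNaA[]mktxeU pOBKnT|R=zlEWJNi^]U?tptbvlt;i^uJ]AaqgopEsaWxBl>YKrP K iVnnReZKOTXgBMZJnEEgO_l|zjoeXCx>t WP;bJ>CrZKvT<;yNNwCXpKH|QNKJk=xFwqI^vNVXV[bcWsrf?Xs_[kunuqk<l=<Gl?H?o]tZyNfyAxQUlX?]<Fs'',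
 ''uKTzbRVZLV^Ewqgxws<lL>cr_GCvzZ>j=wauJ|LcoJ<Lv]inxNcOpWO;Evyb[xkI?mDcWsog=wv['']"

definition "c13_1 = [''mCN^og]d? ?;xGQOoJok^]=>m[d;eYY|Ix|rqrrjWgF<Ko^Z[d|alr kDZtT|KJ=F>I]NLKSZ@|[AUUnvtqy;[<JMX@lJp@lVacYYFADbV|jiAffDNAALLxmuunRcW^LNo _DwUzBBKrs<wif[>]||D=UNNZcmFkec_k|<Icy^VFTFC[qoNYm|Ggc_e=Ov>UDg|_^hI|p=NJOzH=Qukz?MGGnQocjlnFUFsaFrAWqovGgWP|Ff]oZKMVTn?|OUeKnt@tzZktxrcyXLUmVLddPXyOMiG|nQeVKmbre;sqXjZUSsAwiPcfb[QqysGKgwGrq?i;Od??H;'',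
 '';VPHh@XJ@Afz[S^AiKJRKX<zlkUlI<XfOcMhos?[E?ACCXpm>lWak|K^kVEE^Sh_Hp@FnI=BBWdgCpJvtjM<@ZCrTtFLhIpqFJ<VeFW[i^mACRM@OjruuXeQ>;q?h_xQV<ocB?KmCtq=Q;o[mWWreDWYW=nYO^g=;|^Qb[|A<Ut|=[<KpVWsWm?NFlVA_eUx?r ZKpSyqOx_l=Rs=xkhQSmSq|]=UEjtXyQqyygSvBokp?=jB_oop;J<_gJ<qO Ca^ZDxQqEfUf<@IKN;iKtvUc[I[|VgEWbX|=ztT<wLr[GmQ[cIOxI[>Zy>]tfoLuP=wLr[>Rr<'',
 ''?MxW^Yj|d=ec]TgGyQ^stFEK@QEyQ^dWgm|xJG[zrAyuQ]SpUBMZJnEeL Ca^ss;nZeU|[zeOpzo[<=IXS^@^TceGSJWc;;M^Tw]|srSz<H|[nmb<rv<|bvLyp|^AjW@urvVGwAYoYmUkfmBGkSOMdCNrOywMtqu]nbscZl<hWPxxb<AHY;O;@JOxAOZpo<psiPcfb[QICxPhgvLYFAfBWsShY>G<?Qv?He<ROk@?ekvMgGuaArrNnfnjpUlI<zNnf|EkWPdzDU[PfrWZ]@M]B@]Z]G|F_DyqEl=DH<iA_DyrVjFoXo@hj=be[E<W||jtmR;K[x?mx'',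
 ''uuTpQxsJhJT[v [UgolsKJDsqbX j@K|jl?sb;aKVlUdO@?kcnfzQ^]RtJvzDAuVLle[UgOBWuw;<QM|P;uUkr@>]iOjH]AZMp<ueAopoPjgmsX>BC>mwfyGmqKW;WXng=lFV?ski=JtX_qeFoB>GmvOXsO=K<UMbCUlkIPA@LyEoD>]>@tzNob[tUtLcnbcmHSYGU[NYKLWa==jBCOxAOxa<;b_DXJ|MSFE]IcF<KO]jo>EzAdiKfQysIzX|_xIKWSOmM^LnOwocvhKtvHyBsJSFpuSle@_U|KYcszT|Icqu;wNz_c;s^=EKoLUNvQ]^dwdo;cB '',
 ''[zrDmzdA|yKWQIlc?Ct=ekHrErdLFCNk^]Zpo<rTyXGuyQ^AKx@wNWx^hJ[sWYos_gyzd;VMJszPOC]hgASaitlGGz]]mOONt;zhtf=NJV@zh>mdQS=;>hC=n_AnRhQiUGUz;teQqzIZDLJsobNNts itQ]sqa^WwdIV@ZWSFMuo<S>i<AnRHGM?NepAotoNlnX_vz]aF| [gFzCUY[>J;ttu]we|=Gw=mXyWSfLuoF|ePcRmwWWsintR^qD NJnOQ]JJ@rtESr@NDzimQrErJCnAMuNEsuuWUdp||nsrCKxtEllgBMZJnEenLEfb;QRmBWhpb<Mf>'',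
 ''[nsXp_j]rERmXjx=WeX<VgeB_R[kKD[qUbWC?ZuntxUN ?CtFmMRnPVYv@n^wK|V XKI auFKpkWgmXNJBqy|zhZS]amFovYIV|MJgEo=j]FoA__;_;p_dzB;mXJ>QfZsL^osrqOJ>]|LxW^Yj|lcz<Ho@WIthtkMVYkScecf_wDeCnyuUYhAwN=ajl'']"

text \<open>Exactly the bottom and the right side are sides of triangles. The reflection changes
  this pattern, so no half is assumed.\<close>

lemma cert_13: "finished (start (Cfg [Suc 0, Suc 0, Suc (Suc 0), Suc (Suc 0)] True False) |> c13_0 |> c13_1)"
 by code_simp

definition "c10_0 = [''bJudwfxrCpAn;CghWE_JJgoRephoDFiRHnG|cthRXdnP|nEqVNwbXKGQN_eJaQZgBMx@WcjlM_e=np]tuqwEErSTMuI_MuIjfZT_G?HnG_aFakth;W@p]>kGR=]<cxNjSAE@@fBSAHpdiYXhTRYZ?M<Kn_GqBPgk;| HPyxl;wQRIoOTxzKdSXDa;En^Nke??Oa;OroVABQApl[sYFy@I rAyMS[N>ScCErsko;C=@f]volJvR@Rhrc<tx>|_DpAo[qLyqwmPApl[syYdOPN JoYZkqGJ|^^tCHS>lBOecXcoPn_RNbLrLw<aGN<gO<nLr<CG=<G<='',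
 ''=SJW@>hOKqSSPd;gdR>hrK@?bO;y?<q?KJI>rk|s;DAp[=YK=tM>IIdOY_zMF_qOLss?dop[HF;g<UrslO]?_>pOeqw<COyy_tWxYDWh<wA?M_Vdg>]?d;I?t_>xwEeH=O?rM?C=O?=?wG<tG|@ owgEyiQ>I? <cv[O=; ]oXomtM=j=ew=c@;J<kg;fjMBgifIJ@fM[FYewU HwPCUYzB i|Km;]RAYnYyqao;cyb<wagrtyC?yC_jgSxcxxuVAxys=Ev;b;<CgLyLk|[s^?dmN^kOKqSO<gO>lvf]>I[]<F_Vbg^<<C>BOxbOzG^vdexeg=<?pw'',
 ''=oyb_;O_xQ=|_ Ww>GoXwmtozKzz;>hgtymX@^>e>Bo;bs=CKMIeuEvfg=Sfyx_;s^qSWqzWmM?O?d?w_>xWuv<]?doxx;=Y?rS_EDXyWv]Q<G_Sc_e?q?zx;uHl;NxWMaEa@JGdw<xfa>REZLTGK@xhcz^sJdrYdWo__iaM|g]BCG_?YSObgxDxxT_SoFwG>X>wPeWD? ydaOzl@qA|OrxdyNCIgYDI|leSyg<]_PApT@VgdXcrSTgbE NSwPkThL;@GYkTMuAjQAE@SAXruLNiTMRjTB?waobzw>parlOSXzRO[i_XayS=SVxtcZb;KlqkYeO[o>'',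
 ''_s][wXz;?yCoj;^fertTIIxvfYZj_r^ofcxuB_a]^vN?PbyS=YLg^BontWxYO;q?<qGuG=aW>E<zJ_ag=lYxSG]woqRKtxR<ug?QxKlts^wOlr<[Z_ciynmO[zL_a?tsnsO<Of?;N=DITSoKN?l;wql;wql;wQyhYj<H?aE F=mfQBEqyGZ?Q<km?azOJ>c<?XW|uU=n>xhQU^E_PATiZJ@kDezhXTaU<EvHmSiK p;_cji@^pWLE<VZwdL KSe@X=tFEZpuhJKSmQwMjMEfTFE@snMCmRqdmQdy?XxkHN?n<wQZqi=SD>denPbESwVzlE>vlucOj'',
 ''?Wp=C[vwkYnW;Fc_?O_xU=ZOZ|bsvy[s^<FwOI?tV_RbKlqb[=x]xme>aW<IO>gO>W=Cq>dO|aUV|cG_ eY^m?vx_;l_;[sK>IK?sG>m^moY<SN;Q_[^FoMsO|oOyGnp=^<?Eo=O>a?cOy?xBwYqg=xEz<wXy_=Z?Sc?Sg=w>vDyG wzWyw?Pg_a_?W?og[D<k_K^ydfwb?yc_G^kyVISgKIarAyagF]gqPq^Ql@tF?VCmRGDLpMiBFW|W=zov<Gy?MaujXcP@ecnq>HmZ[SmCh<hkzyqIiXHmLuSm?wj?;b?;<?;]q=ot^M>_u^MJ<QFpeiRHv|b>'',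
 ''FkgvhQAEPeji@lRgMieiFnwhWLrWF?_[nFwcrYu_LMkmOp?'']"

text \<open>No side of the square is a side of a triangle.\<close>

lemma cert_10: "finished (start (Cfg [Suc (Suc 0), Suc (Suc 0), Suc (Suc 0), Suc (Suc 0)] True False) |>
   c10_0)"
 by code_simp

definition "c15_0 = [''zvoyHlSkq;QAWjIiNTPAUTgaNMGwcbW@gGvidciTMSTN[>H@Pv]mioPW[ji=GNFBnTSR]h zuBWjy[NB;tZ<'',
 ''YTt|@kL C| kwoQAWB@@@pqasfh@XWyM]c<fgnDYlXao<B]EUn;j;itciLS[SFWPOO=XJAuavCEuPeWuMQajFzt||OJl cixNHmx^_<Vg_ktSqdaYaRoHw_Nsg?t XaCX_b@C>ur|lb@qOBrUq;TGUfrRhSsq=Hsm i]mui?N>Y>O_x^<chGbIMYHijaNMGwcbIW^A]wWqk[^gn>=Nd]>@o]tgfx_;A^LA[S=i;<GxXSO;snNQ]hbVuciTGghhB |wu=ueV^zeF @AViP]h jgVbZThNTPEUOMfvRhSsq=htC|LeOL<RRI_kHJ@fiJ;nNOmAjYdVDe'',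
 ''FPnZLOl]]h;qGjCET=tBjCETQEmh]Fzt||OJ=@GSIrmcaJ;@MVT@PnZIg<rS|k]|A=PGz@^SAWR]hXG;ZEnStFE|SWG^^<UQisNnG;>BmgJt^jP;=EZP]hbzLLjPWFFUhA@PbJtDUhIjPwuIjCETlC|lkEmsPgfc;QQAPvTB;pvQhbC|L;k<|U^stfIh@NN|frNfRuxuVnUHVfs k|ydQ>RjR_mBn=dqRi[kwZLtDALWzQVrnaaTcCMJ>D?|<ivDvqquXYuh@lgkItfOSziAWlvO BCOZIGtjQqROnIgAwx <ZjJKJ=qe@yFod[sDpPcL_zm_EY_z>'',
 ''?b@DYfOWZv K^pO AvsMwYeNY>=RwgGmiFTcROi>;L?ha |C>vGnZT@FXxYWgaUzlI;@GSalLuaqvHuZoVR@?Gzj[=@K>@@dhBeioRutokC]M?fOTGJvANB|I@PbJtDUh;ZQ[;zvuhdxRjCETPEUtbvYhSsq=htA|=>qEE@sTBGz^SI|hC]@KT@IjpRTaehB[WwfJO;znN=kCkKvgm^Wt|@K|IuaBJhbzLtiyx^TzANfrGBALhZZ;Z? bB LUB;pNwLesfg|ovZCx@vF;ZQ;uyu Ku|@KjCET?'']"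

text \<open>Exactly the bottom and the top side are sides of triangles.\<close>

lemma cert_15: "finished (start (Cfg [Suc 0, Suc (Suc 0), Suc 0, Suc (Suc 0)] True True) |> c15_0)"
 by code_simp

definition "c11_0 = [''zvoyHlSkq;QAWReZRBxXJMJgsckTyhxcJ@rfgdYCbSU^?aEndJu<MK|Iuw|Dviux=h KiRMGpZCx@Wo_cBA| cipTfhNEU@dMOQsFdD?MZ[R|QP@dFoUJj;nzTaPsGgLLC M|g]PZjW;QywXl@S|v|tY;e^tkeYlF@uTAS[=I?a^@dMOIsFdg<]_TAPvFUyMQ]JU@PhYjl]S]cxRZvtzjjs?<e<e<Gy@GSyCaWRI=AJU@P l]Scqmv |@kL;x^l;KXOUp@APbJXbJXbJXdYG;>BfirQvWNziMJj@rfRXGVJwhJK^psLmYBB cCgiP@GSYrhXiqMqAx'',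
 ''?Ku=?R^MvE?UeR=PxFWR oouJULWc^kHl;SxN>Zs=H;Iop?Uisv;yw;B;=ESMyhfsP_fgKqQI>q;>sG?T C^>UflQsGP?NOWjcv;kc;WyLGOxwzD_eDtossmuQ[<umsoBg?]aF fkP_iuI<Hd_vqqhZPr[bzcJVX|YrqTjFW[iqRlm fl>m?Ouh@wEOa_dyqYx;e?NNVwC^]MOOUjfJXUzlIy@GSYXlMRmvZIATyqtG?lc]_aGOqO kwOJj@fil?Fe=GpJsNv=ELSec?pi_]X]q>lu;BndJu|@KD@GGNSIGSiZfh|FGxhxSE@rnC?PuTOFNSIWqgp'',
 ''^M?aCYpeTifCx'']"

text \<open>Only the bottom side is a side of a triangle.\<close>

lemma cert_11: "finished (start (Cfg [Suc 0, Suc (Suc 0), Suc (Suc 0), Suc (Suc 0)] True True) |> c11_0)"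
 by code_simp

subsection \<open>Extremal areas\<close>

lemma Q7_root:
 assumes "0 <= a" "a < b" "b <= 1/4900" "Q7 a < 0" "0 < Q7 b"
 shows "EX r. a < r & r < b & Q7 r = 0"
proof -
 have "continuous_on {a..b} Q7" unfolding Q7_def by (intro continuous_intros)
 then obtain r where "a <= r" "r <= b" "Q7 r = 0" using IVT'[of Q7 a 0 b] assms by auto
 then show ?thesis using assms(4,5) by (metis less_le_not_le nle_le)
qed

text \<open>On this interval the constant 4972 of the derivative outweighs its only negative
  term.\<close>

lemma Q7_strict_mono:
 assumes "0 <= x" "x < y" "y <= 1/4900" shows "Q7 x < Q7 y"
proof (rule DERIV_pos_imp_increasing[OF assms(2)])
 fix t assume t: "x <= t" "t <= y"
 have "(Q7 has_real_derivative (864 * (4 * t^3) + 2160 * (3 * t^2) - 6060 * (2 * t) + 4972)) (at t)"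
  unfolding Q7_def by (auto intro!: derivative_eq_intros simp: power2_eq_square power3_eq_cube)
 moreover have "0 < 864 * (4 * t^3) + 2160 * (3 * t^2) - 6060 * (2 * t) + 4972"
 proof -
  have "0 <= t" "t <= 1/4900" using t assms by auto
  then have "0 <= t^3" "0 <= t^2" by simp_all
  then show ?thesis using \<open>t <= 1/4900\<close> by linarith
 qed
 ultimately show "EX d. DERIV Q7 t :> d & 0 < d" by blast
qed

lemma Q7_inj: "0 <= x ==> x <= 1/4900 ==> 0 <= y ==> y <= 1/4900 ==> Q7 x = Q7 y ==> x = y"
 using Q7_strict_mono[of x y] Q7_strict_mono[of y x] by (cases x y rule: linorder_cases) auto

lemma r7_ex1: "EX! r. 0 < r & r < 1/4900 & Q7 r = 0"
proof -
 have "Q7 0 < 0" "0 < Q7 (1/4900)" by (simp_all add: Q7_def power_divide)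
 then obtain r where "0 < r" "r < 1/4900" "Q7 r = 0" using Q7_root[of 0 "1/4900"] by auto
 moreover have "s = r" if "0 < s" "s < 1/4900" "Q7 s = 0" for s
  using Q7_inj[of s r] calculation that by simp
 ultimately show ?thesis by blast
qed

lemma r7: "0 < r7" "r7 < 1/4900" "Q7 r7 = 0"
 using theI'[OF r7_ex1] by (simp_all add: r7_def)

lemma r7_bounds: "2011756316409390820336285676 / 10^31 <= r7" "r7 < 2011756316409390820336285677 / 10^31"
proof -
 let ?a = "2011756316409390820336285676 / 10^31 :: real" and ?b = "2011756316409390820336285677 / 10^31 :: real"
 have "Q7 ?a < 0" "0 < Q7 ?b" by (simp_all add: Q7_def power_divide)
 then obtain r where r: "?a < r" "r < ?b" "Q7 r = 0" using Q7_root[of ?a ?b] by auto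
 then have "r = r7" using Q7_inj[of r r7] r7 by simp
 then show "?a <= r7" "r7 < ?b" using r by auto
qed

lemma HL7: "H7 = L7 + r7" "4 * H7 + 3 * L7 = 1" "L7 < H7" "1426/10000 <= L7" "H7 <= 1431/10000"
 using r7(1,2) by (simp_all add: H7_def L7_def field_simps)

text \<open>The origin of the quartic: with these areas the difference of the two sides of the
  relation is \<open>- Q7 r7 / 2401\<close>, where 2401 is the fourth power of 7.\<close>

lemma area_rel_HL: "area_rel H7 H7 L7 H7 H7"
proof -
 have "(1 - 2 * H7) * (1 - 2 * H7) * (1 - 4 * H7 * H7 - 4 * H7 * L7) -
   (2 * H7 * (1 - 4 * H7 * H7 - 4 * H7 * L7) + 2 * H7 * (1 - 4 * H7 * H7) * (1 - 2 * H7)) = - Q7 r7 / 2401"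
  by (simp add: H7_def L7_def Q7_def field_simps) (simp add: algebra_simps power_numeral_reduce)
 then show ?thesis using r7(3) by (simp add: area_rel_def)
qed

section \<open>Slopes of the relation near equal areas\<close>

lemma mult_bounds:
 fixes x y a b c d :: real
 assumes "a <= x" "x <= b" "c <= y" "y <= d" "0 <= a" "0 <= c"
 shows "a * c <= x * y" "x * y <= b * d"
 using assms by (auto intro!: mult_mono)

lemma small_products:
 fixes x y z :: real
 assumes "1426/10000 <= x" "x <= 1431/10000" "1426/10000 <= y" "y <= 1431/10000"
 shows "2033/100000 <= x * y & x * y <= 2048/100000"
 using mult_bounds[OF assms] by simp

lemma small_products3:
 fixes x y z :: real
 assumes "1426/10000 <= x" "x <= 1431/10000" "1426/10000 <= y" "y <= 1431/10000" "1426/10000 <= z" "z <= 1431/10000"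
 shows "2899/1000000 <= x * y * z & x * y * z <= 2931/1000000"
 using mult_bounds[OF conjunct1 conjunct2 assms(5,6), OF small_products[OF assms(1-4)] small_products[OF assms(1-4)]] by simp

text \<open>The difference of the two sides of the relation at two points, telescoped into slopes.\<close>

lemma area_rel_slopes:
 assumes "area_rel a1 a2 a3 a4 a5" "area_rel h h l h h"
  "!!x. x : {a1, a2, a3, a4, a5, h, l} ==> 1426/10000 <= x & x <= 1431/10000"
 shows "EX s1 s2 s3 s4 s5. 119/100 <= s1 & s1 <= 122/100 & 79/100 <= s2 & s2 <= 83/100 & 12/100 <= s3 & s3 <= 135/1000 &
  166/100 <= s4 & s4 <= 169/100 & 130/100 <= s5 & s5 <= 1325/1000 &
  s1 * (a1 - h) + s2 * (a2 - h) + s3 * (a3 - l) + s4 * (a4 - h) + s5 * (a5 - h) = 0"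
proof -
 note b = assms(3)
 define s1 where "s1 = (1 - 2*h) * (2 * (1 - 4*a1*h - 4*h*a3) + 4*h*(1 - 2*h)) - 8*a4*h - 8*a5*h*(1 - 2*h)"
 define s2 where "s2 = (1 - 2*a1) * (2 * (1 - 4*(a1 + a3)*a2) + 4*(a1 + a3)*(1 - 2*h)) - 8*a4*(a1 + a3)
  - 2*a5*(4*a1*(1 - 2*a2) + 2*(1 - 4*a1*h))"
 define s3 where "s3 = 4*h*((1 - 2*h)*(1 - 2*h) - 2*a4)"
 define s4 where "s4 = 2*(1 - 4*h*h - 4*h*l)"
 define s5 where "s5 = 2*(1 - 4*h*h)*(1 - 2*h)"
 have "0 = ((1 - 2 * h) * (1 - 2 * h) * (1 - 4 * h * h - 4 * h * l) -
   2 * h * (1 - 4 * h * h - 4 * h * l) - 2 * h * (1 - 4 * h * h) * (1 - 2 * h)) -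
   ((1 - 2 * a1) * (1 - 2 * a2) * (1 - 4 * a1 * a2 - 4 * a2 * a3) -
   2 * a4 * (1 - 4 * a1 * a2 - 4 * a2 * a3) - 2 * a5 * (1 - 4 * a1 * a2) * (1 - 2 * a2))"
  using assms(1,2) unfolding area_rel_def by linarith
 also have "... = s1 * (a1 - h) + s2 * (a2 - h) + s3 * (a3 - l) + s4 * (a4 - h) + s5 * (a5 - h)"
  unfolding s1_def s2_def s3_def s4_def s5_def by (simp add: algebra_simps)
 finally have e: "s1 * (a1 - h) + s2 * (a2 - h) + s3 * (a3 - l) + s4 * (a4 - h) + s5 * (a5 - h) = 0" by simp
 have p: "2033/100000 <= x * y & x * y <= 2048/100000" if "x : {a1, a2, a3, a4, a5, h, l}" "y : {a1, a2, a3, a4, a5, h, l}" for x y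
  using small_products[of x y] b[OF that(1)] b[OF that(2)] by blast
 have p3: "2899/1000000 <= x * y * z & x * y * z <= 2931/1000000"
  if "x : {a1, a2, a3, a4, a5, h, l}" "y : {a1, a2, a3, a4, a5, h, l}" "z : {a1, a2, a3, a4, a5, h, l}" for x y z
  using small_products3[of x y z] b[OF that(1)] b[OF that(2)] b[OF that(3)] by blast
 have bs: "1426/10000 <= x & x <= 1431/10000" if "x : {a1, a2, a3, a4, a5, h, l}" for x using b that by blast
 \<comment> \<open>Each slope is expanded into monomials, so that the bounds for areas and for
   products of two or three of them yield its bounds linearly.\<close>
 have "s4 = 2 - 8 * (h * h) - 8 * (h * l)" by (simp add: s4_def algebra_simps)
 then have 4: "166/100 <= s4 & s4 <= 169/100" using p[of h h] p[of h l] by simp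
 have "s5 = 2 - 4 * h - 8 * (h * h) + 16 * (h * h * h)" by (simp add: s5_def algebra_simps)
 then have 5: "130/100 <= s5 & s5 <= 1325/1000" using p[of h h] p3[of h h h] bs[of h] by simp
 have "s3 = 4 * h - 16 * (h * h) + 16 * (h * h * h) - 8 * (h * a4)" by (simp add: s3_def algebra_simps)
 then have 3: "12/100 <= s3 & s3 <= 135/1000" using p[of h h] p3[of h h h] bs[of h] p[of h a4] by simp
 have "s1 = 2 - 16 * (h * h) - 8 * (a1 * h) - 8 * (h * a3) + 16 * (a1 * h * h) + 16 * (h * h * a3) + 16 * (h * h * h)
   - 8 * (a4 * h) - 8 * (a5 * h) + 16 * (a5 * h * h)" by (simp add: s1_def algebra_simps)
 then have 1: "119/100 <= s1 & s1 <= 122/100"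
  using p[of h h] p3[of h h h] bs[of h] p[of a1 h] p[of h a3] p3[of a1 h h] p3[of h h a3] p[of a4 h] p[of a5 h] p3[of a5 h h] by simp
 have "s2 = 2 + 4 * a3 - 4 * a5 - 8 * (a1 * a2) - 8 * (a3 * a2) - 8 * (a1 * h) - 8 * (a3 * h) - 8 * (a1 * a1) - 8 * (a1 * a3)
   - 8 * (a4 * a1) - 8 * (a4 * a3) - 8 * (a5 * a1) + 16 * (a1 * a1 * a2) + 16 * (a1 * a3 * a2) + 16 * (a1 * a1 * h)
   + 16 * (a1 * a3 * h) + 16 * (a5 * a1 * a2) + 16 * (a5 * a1 * h)" by (simp add: s2_def algebra_simps)
 then have 2: "79/100 <= s2 & s2 <= 83/100"
  using bs[of a3] bs[of a5] p[of a1 a2] p[of a3 a2] p[of a1 h] p[of a3 h] p[of a1 a1] p[of a1 a3] p[of a4 a1] p[of a4 a3] p[of a5 a1]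
   p3[of a1 a1 a2] p3[of a1 a3 a2] p3[of a1 a1 h] p3[of a1 a3 h] p3[of a5 a1 a2] p3[of a5 a1 h] by simp
 show ?thesis using 1 2 3 4 5 e by (intro exI[of _ s1] exI[of _ s2] exI[of _ s3] exI[of _ s4] exI[of _ s5]) simp
qed

text \<open>\<open>m\<close> is the mean of the slopes over all seven areas, two of which have slope
  0, so the differences of slopes and \<open>m\<close> add up to 0. Hence the deviations may be
  measured from \<tau>, and this makes all seven terms nonnegative. Their sum is 0, so every
  deviation is \<tau>, and the sum of the deviations gives \<tau> = 0.\<close>

lemma weighted_extremal:
 fixes \<tau> :: real
 assumes s: "119/100 <= s1" "s1 <= 122/100" "79/100 <= s2" "s2 <= 83/100" "12/100 <= s3" "s3 <= 135/1000"
  "166/100 <= s4" "s4 <= 169/100" "130/100 <= s5" "s5 <= 1325/1000"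
  and z: "s1 * d1 + s2 * d2 + s3 * d3 + s4 * d4 + s5 * d5 = 0" "d1 + d2 + d3 + d4 + d5 + d6 + d7 = 0"
  and d: "d1 <= \<tau>" "d2 <= \<tau>" "\<tau> <= d3" "d4 <= \<tau>" "d5 <= \<tau>" "\<tau> <= d6" "\<tau> <= d7"
 shows "d1 = 0 & d2 = 0 & d3 = 0 & d4 = 0 & d5 = 0 & d6 = 0 & d7 = 0"
proof -
 define m where "m = (s1 + s2 + s3 + s4 + s5) / 7"
 have m: "m < s1" "m < s2" "s3 < m" "m < s4" "m < s5" "0 < m" using s by (simp_all add: m_def)
 define e1 where "e1 = (s1 - m) * (\<tau> - d1)"
 define e2 where "e2 = (s2 - m) * (\<tau> - d2)"
 define e3 where "e3 = (m - s3) * (d3 - \<tau>)"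
 define e4 where "e4 = (s4 - m) * (\<tau> - d4)"
 define e5 where "e5 = (s5 - m) * (\<tau> - d5)"
 define e6 where "e6 = m * (d6 - \<tau>)"
 define e7 where "e7 = m * (d7 - \<tau>)"
 note e = e1_def e2_def e3_def e4_def e5_def e6_def e7_def
 have "e1 + e2 + e3 + e4 + e5 + e6 + e7 = m * (d1 + d2 + d3 + d4 + d5 + d6 + d7) -
   (s1 * d1 + s2 * d2 + s3 * d3 + s4 * d4 + s5 * d5) + \<tau> * (s1 + s2 + s3 + s4 + s5 - 7 * m)"
  unfolding e by (simp add: algebra_simps)
 also have "... = 0" unfolding z by (simp add: m_def)
 finally have sum: "e1 + e2 + e3 + e4 + e5 + e6 + e7 = 0" .
 have pos: "0 <= e1" "0 <= e2" "0 <= e3" "0 <= e4" "0 <= e5" "0 <= e6" "0 <= e7"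
  unfolding e using m d by simp_all
 then have "e1 = 0" "e2 = 0" "e3 = 0" "e4 = 0" "e5 = 0" "e6 = 0" "e7 = 0" using sum by linarith+
 then have "d1 = \<tau>" "d2 = \<tau>" "d3 = \<tau>" "d4 = \<tau>" "d5 = \<tau>" "d6 = \<tau>" "d7 = \<tau>"
  unfolding e using m by simp_all
 then show ?thesis using z(2) by simp
qed

lemma opt_areas:
 assumes rel: "area_rel a1 a2 a3 a4 a5" and sum: "a1 + a2 + a3 + a4 + a5 + a6 + a7 = 1"
  and m: "!!x. x : {a1, a2, a3, a4, a5, a6, a7} ==> m <= x & x <= m + r7"
 shows "a1 = H7 & a2 = H7 & a3 = L7 & a4 = H7 & a5 = H7 & a6 = L7 & a7 = L7"
proof -
 have m': "m <= a1" "a1 <= m + r7" "m <= a2" "a2 <= m + r7" "m <= a3" "a3 <= m + r7" "m <= a4" "a4 <= m + r7"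
  "m <= a5" "a5 <= m + r7" "m <= a6" "a6 <= m + r7" "m <= a7" "a7 <= m + r7" using m by blast+
 \<comment> \<open>The mean 1/7 lies between \<open>m\<close> and \<open>m + r7\<close>, and
   \<open>r7\<close> is below 1/4900.\<close>
 have "1426/10000 <= m" "m + r7 <= 1431/10000"
  using m' sum r7(2) by linarith+
 then have b: "1426/10000 <= x & x <= 1431/10000" if "x : {a1, a2, a3, a4, a5, H7, L7}" for x
  using that m HL7 by (smt (verit) insertE insertI1 insertCI emptyE)
 from area_rel_slopes[OF rel area_rel_HL b] obtain s1 s2 s3 s4 s5 where s:
  "119/100 <= s1" "s1 <= 122/100" "79/100 <= s2" "s2 <= 83/100" "12/100 <= s3" "s3 <= 135/1000"
  "166/100 <= s4" "s4 <= 169/100" "130/100 <= s5" "s5 <= 1325/1000"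
  "s1 * (a1 - H7) + s2 * (a2 - H7) + s3 * (a3 - L7) + s4 * (a4 - H7) + s5 * (a5 - H7) = 0" by blast
 have "(a1 - H7) + (a2 - H7) + (a3 - L7) + (a4 - H7) + (a5 - H7) + (a6 - L7) + (a7 - L7) = 0" using sum HL7(2) by linarith
 \<comment> \<open>Since \<open>H7 = L7 + r7\<close>, the bounds \<open>m\<close> and
   \<open>m + r7\<close> give the same bound \<open>m - L7\<close> for the deviations: from below at
   the low areas, from above at the high ones.\<close>
 from weighted_extremal[OF s this, of "m - L7"] show ?thesis using m' HL7(1) by simp
qed

subsection \<open>An optimal dissection\<close>

lemma ctri_nondegenerate: "0 < tor t ==> nondegenerate_triangle (ctri t)"
proof -
 assume t: "0 < tor t"
 obtain a b c where abc: "t = (a, b, c)" by (cases t)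
 then have "ctri t = convex hull {a, b, c}" using t convex_hull_ctri[of a b c] by simp
 then show ?thesis using area_ctri[OF t] t unfolding nondegenerate_triangle_def by auto
qed

lemma (in packing) inj_ctri: "inj_on ctri P"
proof (rule inj_onI, rule ccontr)
 fix s t assume h: "s : P" "t : P" "ctri s = ctri t" "s ~= t"
 have "otri s = otri t" using interior_ctri[OF pos[OF h(1)]] interior_ctri[OF pos[OF h(2)]] h(3) by simp
 then show False using disj[OF h(1,2,4)] otri_nonempty[OF pos[OF h(1)]] by blast
qed

lemma (in tiling) dissection_ctri: "dissection (card P) (ctri ` P)"
 unfolding dissection_def
proof (intro conjI ballI impI)
 show "finite (ctri ` P)" using fin by simp
 show "card (ctri ` P) = card P" by (rule card_image[OF inj_ctri])
 show "nondegenerate_triangle T" if "T : ctri ` P" for T using that ctri_nondegenerate pos by auto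
 show "interior S Int interior T = {}" if "S : ctri ` P" "T : ctri ` P" "S ~= T" for S T
 proof -
  obtain x y where xy: "x : P" "y : P" "S = ctri x" "T = ctri y" "x ~= y" using \<open>S : ctri ` P\<close> \<open>T : ctri ` P\<close> \<open>S ~= T\<close> by blast
  show ?thesis unfolding xy(3,4) interior_ctri[OF pos[OF xy(1)]] interior_ctri[OF pos[OF xy(2)]] by (rule disj[OF xy(1,2,5)])
 qed
 show "\<Union>(ctri ` P) = unit_square" by (rule cover)
qed

text \<open>The line through one side of \<open>t\<close> separates the two triangles.\<close>

lemma otri_disjoint_edge:
 assumes e: "(p, q) : tedges t" and s: "0 < tor s" and v: "!!v. v : tverts s ==> orient p q v <= 0"
 shows "otri s Int otri t = {}" "otri t Int otri s = {}"
proof -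
 obtain a b c where abc: "s = (a, b, c)" by (cases s)
 have "{a, b, c} <= {z. 0 <= orient q p z}" using v orient_swap[of q p] unfolding abc by auto
 then have "convex hull {a, b, c} <= {z. 0 <= orient q p z}" by (rule hull_minimal) (rule convex_halfplane)
 then have "otri s <= {z. 0 <= orient q p z}" using convex_hull_ctri[of a b c] s abc otri_subset_ctri[of s] by auto
 moreover have "otri t <= {z. 0 < orient p q z}" using e by (cases t) auto
 moreover have "~ 0 < orient p q z" if "0 <= orient q p z" for z using that by (simp add: orient_swap[of p q])
 ultimately show "otri s Int otri t = {}" "otri t Int otri s = {}" by blast+
qed

text \<open>The configuration of the first two lists of \<open>opt_list\<close>, with the triangle
  of weight 2 cut in half: \<open>p5\<close> and \<open>p6\<close> are on the line from the origin
  to the apex \<open>p4\<close>, \<open>p7\<close> and \<open>pm\<close> on the top side, and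
  \<open>m\<close> makes the areas of \<open>t4\<close> and \<open>t5\<close> equal.\<close>

locale opt_data =
 fixes u s v m :: real
 assumes u: "285/1000 <= u" "u <= 287/1000" and s: "59/100 <= s" "s <= 61/100" and v: "30/100 <= v" "v <= 32/100"
  and m: "m = (1 + v) / 2"
begin

definition "p4 = pt 1 u"
definition "p5 = pt s (s * u)"
definition "p6 = pt u (u * u)"
definition "p7 = pt v 1"
definition "pm = pt m 1"
definition "t1 = (pt 0 0, pt 1 0, p4)"
definition "t2 = (p4, pt 1 1, p5)"
definition "t3 = (pt 0 1, pt 0 0, p6)"
definition "t4 = (p5, pt 1 1, pm)"
definition "t5 = (p5, pm, p7)"
definition "t6 = (p6, p5, p7)"
definition "t7 = (pt 0 1, p6, p7)"

lemmas tdefs = t1_def t2_def t3_def t4_def t5_def t6_def t7_def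
lemmas pdefs = p4_def p5_def p6_def p7_def pm_def

lemma tor_t: "tor t1 = u" "tor t2 = (1 - u) * (1 - s)" "tor t3 = u" "tor t6 = (s - u) * (1 - u * v)"
 "tor t7 = v * (1 - u * u)" "tor t4 = (1 - m) * (1 - s * u)" "tor t5 = (m - v) * (1 - s * u)"
 by (simp_all add: tdefs pdefs orient_def algebra_simps)

lemma bounds: "0 < u" "u < 1" "u < s" "s < 1" "u < v" "v < s" "s < m" "m < 1" "v < m" "u * u <= 1/10" "s * u <= 2/10" "u * v <= 1/10"
 "m - s <= 8/100" "u * u <= s * u" "s * u <= u" "0 <= u * u"
proof -
 show "0 < u" "u < 1" "u < s" "s < 1" "u < v" "v < s" "s < m" "m < 1" "v < m" "m - s <= 8/100"
  using u s v m by simp_all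
 show "u * u <= 1/10" "s * u <= 2/10" "u * v <= 1/10" "u * u <= s * u" "s * u <= u" "0 <= u * u"
  using mult_mono[of u "287/1000" u "287/1000"] mult_mono[of s "61/100" u "287/1000"] mult_mono[of u "287/1000" v "32/100"] u s v
  by (simp_all add: mult_right_mono)
qed

lemma pos_t: "0 < tor t1" "0 < tor t2" "0 < tor t3" "0 < tor t4" "0 < tor t5" "0 < tor t6" "0 < tor t7"
 unfolding tor_t using bounds by (auto intro!: mult_pos_pos)

text \<open>In the order \<open>t1\<close>, \<open>t3\<close>, \<open>t7\<close>, \<open>t6\<close>,
  \<open>t5\<close>, \<open>t4\<close>, \<open>t2\<close> each triangle has a side that separates it
  from all later ones; this lemma and the following ones of this kind provide these sides.\<close>

lemma sep1: "t : {t2, t3, t4, t5, t6, t7} ==> x : tverts t ==> orient p4 (pt 0 0) x <= 0"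
proof -
 have o: "orient p4 (pt 0 0) x = u * x$1 - x$2" for x by (simp add: p4_def orient_def algebra_simps)
 have "u * m <= 1 * 1" "u * v <= 1 * 1" using bounds by (intro mult_mono; simp)+
 then have "orient p4 (pt 0 0) p5 <= 0" "orient p4 (pt 0 0) p6 <= 0" "orient p4 (pt 0 0) p7 <= 0" "orient p4 (pt 0 0) pm <= 0"
  "orient p4 (pt 0 0) (pt 1 1) <= 0" "orient p4 (pt 0 0) (pt 0 1) <= 0" "orient p4 (pt 0 0) (pt 0 0) <= 0"
  "orient p4 (pt 0 0) p4 <= 0"
  unfolding o using bounds by (simp_all add: pdefs)
 then show "t : {t2, t3, t4, t5, t6, t7} ==> x : tverts t ==> orient p4 (pt 0 0) x <= 0"
  by (auto simp: tdefs)
qed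

text \<open>For the two separating lines, in \<open>sep7\<close> and \<open>sep5\<close>, where
  signs do not decide: the products are compared by numerical bounds of their factors.\<close>

lemma cross_le:
 fixes a b c d :: real
 assumes "a <= a'" "0 <= b" "b <= 1" "0 <= a'" "c' <= c" "d' <= d" "0 <= c'" "0 <= d'" "a' <= c' * d'"
 shows "a * b <= c * d"
proof -
 have "a * b <= a' * b" using assms(1,2) by (rule mult_right_mono)
 also have "... <= a' * 1" using assms(3,4) by (intro mult_left_mono)
 also have "... <= c' * d'" using assms(9) by simp
 also have "... <= c * d" using assms(5-8) by (intro mult_mono) auto
 finally show ?thesis .
qed

lemma sep3: "t : {t2, t4, t5, t6, t7} ==> x : tverts t ==> orient p6 (pt 0 1) x <= 0"
proof -
 have o: "orient p6 (pt 0 1) x = - (u * (x$2 - u * u) + (1 - u * u) * (x$1 - u))" for x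
  by (simp add: p6_def orient_def algebra_simps)
 have le: "orient p6 (pt 0 1) x <= 0" if "u * u <= x$2" "u <= x$1" for x
 proof -
  have "0 <= u * (x$2 - u * u)" "0 <= (1 - u * u) * (x$1 - u)" using that bounds by (intro mult_nonneg_nonneg; simp)+
  then show ?thesis unfolding o by linarith
 qed
 have "orient p6 (pt 0 1) p4 <= 0" "orient p6 (pt 0 1) p5 <= 0" "orient p6 (pt 0 1) p6 <= 0" "orient p6 (pt 0 1) p7 <= 0"
  "orient p6 (pt 0 1) pm <= 0" "orient p6 (pt 0 1) (pt 1 1) <= 0"
  by (rule le; use bounds in \<open>simp add: pdefs\<close>)+
 then show "t : {t2, t4, t5, t6, t7} ==> x : tverts t ==> orient p6 (pt 0 1) x <= 0"
  by (auto simp: tdefs)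
qed

lemma sep7: "t : {t2, t4, t5, t6} ==> x : tverts t ==> orient p6 p7 x <= 0"
proof -
 have o: "orient p6 p7 x = (v - u) * (x$2 - u * u) - (1 - u * u) * (x$1 - u)" for x
  by (simp add: p6_def p7_def orient_def algebra_simps)
 have le: "orient p6 p7 x <= 0" if "u * u <= x$2" "x$2 <= 1" "s <= x$1" for x
  unfolding o using cross_le[of "v - u" "1/10" "x$2 - u * u" "9/10" "1 - u * u" "3/10" "x$1 - u"] that bounds u s v by simp
 have "orient p6 p7 p4 <= 0" "orient p6 p7 p5 <= 0" "orient p6 p7 pm <= 0" "orient p6 p7 (pt 1 1) <= 0"
  by (rule le; use bounds in \<open>simp add: pdefs\<close>)+
 then show "t : {t2, t4, t5, t6} ==> x : tverts t ==> orient p6 p7 x <= 0"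
  by (auto simp: tdefs)
qed

lemma sep6: "t : {t2, t4, t5} ==> x : tverts t ==> orient p5 p7 x <= 0"
proof -
 have o: "orient p5 p7 x = - ((s - v) * (x$2 - s * u) + (1 - s * u) * (x$1 - s))" for x
  by (simp add: p5_def p7_def orient_def algebra_simps)
 have le: "orient p5 p7 x <= 0" if "s * u <= x$2" "s <= x$1" for x
 proof -
  have "0 <= (s - v) * (x$2 - s * u)" "0 <= (1 - s * u) * (x$1 - s)" using that bounds by (intro mult_nonneg_nonneg; simp)+
  then show ?thesis unfolding o by linarith
 qed
 have "orient p5 p7 p4 <= 0" "orient p5 p7 pm <= 0" "orient p5 p7 (pt 1 1) <= 0"
  by (rule le; use bounds in \<open>simp add: pdefs\<close>)+
 then show "t : {t2, t4, t5} ==> x : tverts t ==> orient p5 p7 x <= 0"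
  by (auto simp: tdefs)
qed

lemma sep5: "t : {t2, t4} ==> x : tverts t ==> orient p5 pm x <= 0"
proof -
 have o: "orient p5 pm x = (m - s) * (x$2 - s * u) - (1 - s * u) * (x$1 - s)" for x
  by (simp add: p5_def pm_def orient_def algebra_simps)
 have "0 <= s * u" using bounds by simp
 then have le: "orient p5 pm x <= 0" if "s * u <= x$2" "x$2 <= 1" "1 <= x$1" for x
  unfolding o using cross_le[of "m - s" "8/100" "x$2 - s * u" "8/10" "1 - s * u" "3/10" "x$1 - s"] that bounds s by simp
 have "orient p5 pm p4 <= 0" "orient p5 pm (pt 1 1) <= 0"
  by (rule le; use bounds in \<open>simp add: pdefs\<close>)+
 then show "t : {t2, t4} ==> x : tverts t ==> orient p5 pm x <= 0"
  by (auto simp: tdefs)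
qed

lemma sep4: "x : tverts t2 ==> orient p5 (pt 1 1) x <= 0"
proof -
 have "orient p5 (pt 1 1) p4 = - ((1 - s) * (1 - u))" by (simp add: p5_def p4_def orient_def algebra_simps)
 then have "orient p5 (pt 1 1) p4 <= 0" using bounds by simp
 then show "x : tverts t2 ==> orient p5 (pt 1 1) x <= 0" by (auto simp: t2_def)
qed

definition "PO = {t1, t3, t7, t6, t5, t4, t2}"

lemma packing_PO: "packing PO" and card_PO: "card PO = 7"
 and distinct_PO: "distinct [t1, t3, t7, t6, t5, t4, t2]"
proof -
 have d1: "otri t Int otri t1 = {}" "otri t1 Int otri t = {}" if "t : {t2, t3, t4, t5, t6, t7}" for t
  using otri_disjoint_edge[of p4 "pt 0 0" t1 t] sep1[OF that] pos_t that by (auto simp: t1_def)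
 have d3: "otri t Int otri t3 = {}" "otri t3 Int otri t = {}" if "t : {t2, t4, t5, t6, t7}" for t
  using otri_disjoint_edge[of p6 "pt 0 1" t3 t] sep3[OF that] pos_t that by (auto simp: t3_def)
 have d7: "otri t Int otri t7 = {}" "otri t7 Int otri t = {}" if "t : {t2, t4, t5, t6}" for t
  using otri_disjoint_edge[of p6 p7 t7 t] sep7[OF that] pos_t that by (auto simp: t7_def)
 have d6: "otri t Int otri t6 = {}" "otri t6 Int otri t = {}" if "t : {t2, t4, t5}" for t
  using otri_disjoint_edge[of p5 p7 t6 t] sep6[OF that] pos_t that by (auto simp: t6_def)
 have d5: "otri t Int otri t5 = {}" "otri t5 Int otri t = {}" if "t : {t2, t4}" for t
  using otri_disjoint_edge[of p5 pm t5 t] sep5[OF that] pos_t that by (auto simp: t5_def)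
 have d4: "otri t2 Int otri t4 = {}" "otri t4 Int otri t2 = {}"
  using otri_disjoint_edge[of p5 "pt 1 1" t4 t2] sep4 pos_t by (auto simp: t4_def)
 have p: "0 < tor t" if "t : PO" for t using that pos_t by (auto simp: PO_def)
 show "packing PO"
 proof
  show "finite PO" by (simp add: PO_def)
  show "0 < tor t" if "t : PO" for t by (rule p[OF that])
  show "otri x Int otri y = {}" if xy: "x : PO" "y : PO" "x ~= y" for x y
  proof -
   have 1: "otri t1 Int otri y = {}" if "y : PO" "y ~= t1" for y using that d1[of y] by (simp add: PO_def) metis
   have 3: "otri t3 Int otri y = {}" if "y : PO" "y ~= t3" for y using that d1[of t3] d3[of y] by (simp add: PO_def) metis
   have 7: "otri t7 Int otri y = {}" if "y : PO" "y ~= t7" for y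
    using that d1[of t7] d3[of t7] d7[of y] by (simp add: PO_def) metis
   have 6: "otri t6 Int otri y = {}" if "y : PO" "y ~= t6" for y
    using that d1[of t6] d3[of t6] d7[of t6] d6[of y] by (simp add: PO_def) metis
   have 5: "otri t5 Int otri y = {}" if "y : PO" "y ~= t5" for y
    using that d1[of t5] d3[of t5] d7[of t5] d6[of t5] d5[of y] by (simp add: PO_def) metis
   have 4: "otri t4 Int otri y = {}" if "y : PO" "y ~= t4" for y
    using that d1[of t4] d3[of t4] d7[of t4] d6[of t4] d5[of t4] d4 by (simp add: PO_def) metis
   have 2: "otri t2 Int otri y = {}" if "y : PO" "y ~= t2" for y
    using that d1[of t2] d3[of t2] d7[of t2] d6[of t2] d5[of t2] d4 by (simp add: PO_def) metis
   show ?thesis using xy(1) 1[OF xy(2)] 3[OF xy(2)] 7[OF xy(2)] 6[OF xy(2)] 5[OF xy(2)] 4[OF xy(2)] 2[OF xy(2)] xy(3)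
    unfolding PO_def by (elim insertE emptyE) simp_all
  qed
 qed
 have ne: "x ~= y" if "otri x Int otri y = {}" "0 < tor x" for x y using that otri_nonempty[of x] by auto
 show d: "distinct [t1, t3, t7, t6, t5, t4, t2]"
  using ne d1 d3 d7 d6 d5 d4 pos_t by simp
 then show "card PO = 7" unfolding PO_def using distinct_card[of "[t1, t3, t7, t6, t5, t4, t2]"] by simp
qed

lemma tiling_PO: "tiling PO"
proof (rule tiling.intro[OF packing_PO], unfold_locales)
 have "tverts t <= unit_square" if "t : PO" for t
 proof -
  have "pt 0 0 : unit_square" "pt 1 0 : unit_square" "pt 0 1 : unit_square" "pt 1 1 : unit_square"
   "p4 : unit_square" "p5 : unit_square" "p6 : unit_square" "p7 : unit_square" "pm : unit_square"
   using bounds by (simp_all add: usq_iff pdefs)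
  then show ?thesis using that unfolding PO_def tdefs by (elim insertE emptyE) simp_all
 qed
 moreover have "ctri t <= unit_square" if "tverts t <= unit_square" "0 < tor t" for t
 proof -
  obtain x y z where t: "t = (x, y, z)" by (cases t)
  then show ?thesis using convex_hull_ctri[of x y z] hull_minimal[of "{x, y, z}" unit_square convex] convex_usq that by simp
 qed
 ultimately have "\<Union>(ctri ` PO) <= unit_square" using packing.pos[OF packing_PO] by blast
 \<comment> \<open>A point above the line from the origin to \<open>p4\<close> is tested in the
   order of separation. If it is not in a triangle, it lies beyond the separating side of it, which
   the next triangle shares; in the end \<open>t2\<close> contains it.\<close>
 moreover have "z : \<Union>(ctri ` PO)" if z: "z : unit_square" for z
 proof -
  have z': "0 <= z$1" "z$1 <= 1" "0 <= z$2" "z$2 <= 1" using z by (auto simp: usq_iff)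
  have n: "0 <= orient q p x" if "~ 0 <= orient p q x" for p q x using that orient_swap[of p q x] by linarith
  define w where "w = z$2 - u * z$1"
  have o: "orient p4 (pt 0 0) z = - w" "orient (pt 0 0) p6 z = u * w" "orient p6 p5 z = (s - u) * w" "orient p5 p4 z = (1 - s) * w"
   "orient p7 (pt 0 1) z = v * (1 - z$2)" "orient pm p7 z = (m - v) * (1 - z$2)" "orient (pt 1 1) pm z = (1 - m) * (1 - z$2)"
   "orient p4 (pt 1 1) z = (1 - u) * (1 - z$1)" "orient (pt 0 1) (pt 0 0) z = z$1" "orient (pt 0 0) (pt 1 0) z = z$2"
   "orient (pt 1 0) p4 z = u * (1 - z$1)"
   by (simp_all add: pdefs w_def orient_def algebra_simps)
  have o0: "0 <= orient p7 (pt 0 1) z" "0 <= orient pm p7 z" "0 <= orient (pt 1 1) pm z" "0 <= orient p4 (pt 1 1) z"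
   "0 <= orient (pt 0 1) (pt 0 0) z" "0 <= orient (pt 0 0) (pt 1 0) z" "0 <= orient (pt 1 0) p4 z"
   unfolding o using z' bounds by simp_all
  show ?thesis
  proof (cases "0 <= w")
   case False
   then have "z : ctri t1" using o0 o(1) by (simp add: t1_def)
   then show ?thesis by (auto simp: PO_def)
  next
   case True
   then have ow: "0 <= orient (pt 0 0) p6 z" "0 <= orient p6 p5 z" "0 <= orient p5 p4 z" unfolding o using bounds by simp_all
   show ?thesis
   proof (rule ccontr)
    assume "z ~: \<Union>(ctri ` PO)"
    then have no: "z ~: ctri t3" "z ~: ctri t7" "z ~: ctri t6" "z ~: ctri t5" "z ~: ctri t4" "z ~: ctri t2"
     by (auto simp: PO_def)
    have a3: "0 <= orient (pt 0 1) p6 z" by (rule n) (use no(1) o0 ow in \<open>auto simp: t3_def\<close>)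
    have a7: "0 <= orient p7 p6 z" by (rule n) (use no(2) o0 ow a3 in \<open>auto simp: t7_def\<close>)
    have a6: "0 <= orient p7 p5 z" by (rule n) (use no(3) o0 ow a7 in \<open>auto simp: t6_def\<close>)
    have a5: "0 <= orient pm p5 z" by (rule n) (use no(4) o0 ow a6 in \<open>auto simp: t5_def\<close>)
    have a4: "0 <= orient (pt 1 1) p5 z" by (rule n) (use no(5) o0 ow a5 in \<open>auto simp: t4_def\<close>)
    show False using no(6) o0 ow a4 by (auto simp: t2_def)
   qed
  qed
 qed
 ultimately show "\<Union>(ctri ` PO) = unit_square" by blast
qed

end

lemma area_mset_tiling:
 assumes "tiling P" shows "area_mset (ctri ` P) = image_mset (%t. tor t / 2) (mset_set P)"
proof -
 interpret tiling P by fact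
 have "area_mset (ctri ` P) = image_mset area (image_mset ctri (mset_set P))"
  by (simp add: area_mset_def image_mset_mset_set[OF inj_ctri])
 also have "... = image_mset (%t. tor t / 2) (mset_set P)"
  using area_ctri pos by (auto simp: multiset.map_comp intro!: image_mset_cong simp: fin)
 finally show ?thesis .
qed

lemma opt_dissection: "EX D. dissection 7 D & area_mset D = {#H7, H7, H7, H7, L7, L7, L7#}"
proof -
 define h where "h = H7"
 define l where "l = L7"
 have hl: "1426/10000 <= h" "h <= 1431/10000" "1426/10000 <= l" "l <= 1431/10000" "4 * h + 3 * l = 1"
  using HL7 r7(1) by (simp_all add: h_def l_def)
 \<comment> \<open>The three parameters solve the area equations of \<open>t1\<close> and
   \<open>t3\<close>, of \<open>t2\<close>, and of \<open>t7\<close>. The relation then settles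
   \<open>t6\<close>, and the total area settles the equal pair \<open>t4\<close>,
   \<open>t5\<close>.\<close>
 define u where "u = 2 * h"
 define s where "s = 1 - 2 * h / (1 - 2 * h)"
 define v where "v = 2 * l / (1 - 4 * h * h)"
 have p: "2033/100000 <= h * h" "h * h <= 2048/100000" "2033/100000 <= h * l" "h * l <= 2048/100000"
  using small_products[of h h] small_products[of h l] hl by auto
 have den: "0 < 1 - 2 * h" "0 < 1 - 4 * h * h" using hl p by simp_all
 have sv: "59/100 <= s" "s <= 61/100" "30/100 <= v" "v <= 32/100"
  unfolding s_def v_def using hl p den by (simp_all add: field_simps)
 interpret opt_data u s v "(1 + v) / 2"
  by unfold_locales (use hl sv in \<open>simp_all add: u_def\<close>)
 have s1: "(1 - u) * (1 - s) = 2 * h" unfolding u_def s_def using den by simp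
 have "1 - u * u = 1 - 4 * h * h" by (simp add: u_def)
 then have v1: "v * (1 - u * u) = 2 * l" unfolding v_def using den by simp
 have "area_rel (u / 2) (u / 2) (v * (1 - u * u) / 2) ((1 - u) * (1 - s) / 2) ((s - u) * (1 - u * v) / 2)"
  by (rule area_rel_a[of _ u _ u _ v _ s]) simp_all
 then have r: "area_rel h h l h ((s - u) * (1 - u * v) / 2)" unfolding s1 v1 by (simp add: u_def)
 have r': "area_rel h h l h h" using area_rel_HL by (simp add: h_def l_def)
 \<comment> \<open>The relation is linear in its last argument with nonzero coefficient, so it
   determines that area.\<close>
 have "(2 * ((s - u) * (1 - u * v) / 2) - 2 * h) * ((1 - 4 * h * h) * (1 - 2 * h)) = 0"
  using r r' unfolding area_rel_def by (simp add: algebra_simps)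
 then have d1: "(s - u) * (1 - u * v) = 2 * h" using den by simp
 have tot: "tor t1 + tor t3 + tor t7 + tor t6 + tor t5 + tor t4 + tor t2 = 2"
  using tiling.total_area[OF tiling_PO] distinct_PO by (simp add: PO_def)
 have "1 - (1 + v) / 2 = (1 + v) / 2 - v" by (simp add: field_simps)
 then have e: "tor t4 = tor t5" unfolding tor_t by (simp only:)
 have tt: "tor t1 = 2 * h" "tor t2 = 2 * h" "tor t3 = 2 * h" "tor t6 = 2 * h" "tor t7 = 2 * l"
  unfolding tor_t s1 v1 d1 by (simp_all add: u_def)
 have "tor t4 = 2 * l" "tor t5 = 2 * l" using tot hl(5) e unfolding tt by linarith+
 note tt = tt this
 have "mset_set PO = {#t1, t3, t7, t6, t5, t4, t2#}"
  using mset_set_set[OF distinct_PO] unfolding PO_def by simp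
 then have "area_mset (ctri ` PO) = {#h, h, l, h, l, l, h#}" using area_mset_tiling[OF tiling_PO] tt by simp
 moreover have "dissection 7 (ctri ` PO)" using tiling.dissection_ctri[OF tiling_PO] card_PO by simp
 ultimately show ?thesis unfolding h_def l_def by (intro exI[of _ "ctri ` PO"]) simp
qed

subsection \<open>Configurations of coarse tilings\<close>

definition on_side :: "nat => real^2 => bool" where
 "on_side j z \<longleftrightarrow> j = 0 & z$2 = 0 | j = 1 & z$1 = 1 | j = 2 & z$2 = 1 | j = 3 & z$1 = 0"

definition adjacent :: "nat => nat => bool" where
 "adjacent i j \<longleftrightarrow> j = next_side i | next_side j = i"

text \<open>Ears are excluded here because \<open>ear_opt\<close> handles them; this shortens the
  search for the patterns.\<close>

definition noear :: "triple set => bool" where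
 "noear P \<longleftrightarrow> (ALL i j z. i < 4 --> j < 4 --> adjacent i j --> apex P i z --> ~ on_side j z)"

definition whole :: "triple set => nat => bool" where
 "whole P i \<longleftrightarrow> (EX z. apex P i z)"

lemma less_4_cases:
 assumes "i < (4::nat)" obtains "i = 0" | "i = Suc 0" | "i = Suc (Suc 0)" | "i = Suc (Suc (Suc 0))"
 using assms that by linarith

lemma apexD: "apex P i z ==> EX t:P. t : rots (corner i, corner (next_side i), z)"
 by (auto simp: apex_def)

lemma rots_edge: "t : rots (p, q, z) ==> (p, q) : tedges t"
 using tedges_rots_iff by blast

lemma corner_next_ne: "i < 4 ==> corner i ~= corner (next_side i)"
 by (erule less_4_cases) simp_all

context wtiling
begin

lemma opt_net_tiling:
 assumes "net.opt_net (KK G)" "net Vs (KK G) tv clean cf" shows "opt_tiling P wt"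
proof -
 obtain k1 k2 k3 k4 k5 where k: "distinct [k1, k2, k3, k4, k5]" "{k1, k2, k3, k4, k5} <= {k : KK G. snd k = 1}"
  "area_rel (tor (fst k1) / 2) (tor (fst k2) / 2) (tor (fst k3) / 2) (tor (fst k4) / 2) (tor (fst k5) / 2)"
  using assms(1) unfolding net.opt_net_def[OF assms(2)] by blast
 have r: "fst k : P & wt (fst k) = 1 & snd k = 1" if "k : {k1, k2, k3, k4, k5}" for k
  using k(2) that real_P[of k G] by auto
 have "fst k ~= fst k'" if "k ~= k'" "k : {k1, k2, k3, k4, k5}" "k' : {k1, k2, k3, k4, k5}" for k k'
  using that(1) r[OF that(2)] r[OF that(3)] by (simp add: prod_eq_iff)
 then have "distinct [fst k1, fst k2, fst k3, fst k4, fst k5]" using k(1) by simp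
 moreover have "{fst k1, fst k2, fst k3, fst k4, fst k5} <= {t : P. wt t = 1}" using r by simp
 ultimately show ?thesis using k(3) unfolding opt_tiling_def by blast
qed

text \<open>If the side is a side of a triangle of the tiling, the edge is in \<open>X\<close>, and
  no flat triangle has an edge of \<open>X\<close>.\<close>

lemma mask_ok:
 assumes cl: "closes F X G" and m1: "!!i. i < 4 ==> nget l i = 1 ==> whole P i"
  and m2: "!!i. i < 4 ==> nget l i = 2 ==> ~ whole P i"
  and k: "k : KK G" "i < 4" "(corner i, corner (next_side i)) : tedges (fst k)"
 shows "(nget l i = 1 --> snd k ~= 0) & (nget l i = 2 --> snd k = 0)"
proof (intro conjI impI notI)
 assume "nget l i = 1" "snd k = 0"
 then obtain z t where "t : P" "t : rots (corner i, corner (next_side i), z)" using m1[OF k(2)] apexD unfolding whole_def by blast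
 then have "(corner i, corner (next_side i)) : X" using rots_edge unfolding X_def by blast
 then show False using closesD(6)[OF cl flat_G[OF k(1) \<open>snd k = 0\<close>]] k(3) by blast
next
 assume l: "nget l i = 2"
 show "snd k = 0"
 proof (rule ccontr)
  assume "snd k ~= 0"
  then have "fst k : P" using real_P[OF k(1)] by blast
  moreover obtain z where "fst k : rots (corner i, corner (next_side i), z)" using tedges_rots_iff k(3) by blast
  ultimately have "apex P i z" by (auto simp: apex_def)
  then show False using m2[OF k(2) l] by (auto simp: whole_def)
 qed
qed

lemma apex_of: "k : KK G ==> snd k ~= 0 ==> fst k : rots (corner i, corner (next_side i), z) ==> apex P i z"
 using real_P[of k G] unfolding apex_def by blast

lemma net_pattern:
 assumes m1: "!!i. i < 4 ==> nget l i = 1 ==> whole P i" and m2: "!!i. i < 4 ==> nget l i = 2 ==> ~ whole P i"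
  and ear: "noear P" and half: "!!z. hf ==> apex P 0 z ==> z$1 <= 1 / 2"
 shows "EX G. net Vs (KK G) tv clean (Cfg l True hf)"
proof -
 obtain F G where cl: "closes F X G" using closes_ex[OF balanced_X vertex_once_X] by blast
 have "net Vs (KK G) tv clean (Cfg l True hf)"
 proof (rule net_intro[OF cl])
  fix k i l' nf hf'
  assume "k : KK G" "i < 4" "(corner i, corner (next_side i)) : tedges (fst k)" "Cfg l True hf = Cfg l' nf hf'"
  then show "(nget l' i = 1 --> snd k ~= 0) & (nget l' i = 2 --> snd k = 0)" using mask_ok[OF cl m1 m2] by blast
 next
  fix k i j z l' hf'
  assume "k : KK G" "snd k ~= 0" and i: "i < 4" and "fst k : rots (corner i, corner (next_side i), z)"
   and j: "j = next_side i | next_side j = i" "j < 4"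
  then have "apex P i z" using apex_of by blast
  then show "~ (j = 0 & z$2 = 0 | j = 1 & z$1 = 1 | j = 2 & z$2 = 1 | j = 3 & z$1 = 0)"
   using ear i j unfolding noear_def adjacent_def on_side_def by blast
 next
  fix k z l' nf assume "Cfg l True hf = Cfg l' nf True" "k : KK G" "snd k ~= 0" "fst k : rots (corner 0, corner 1, z)"
  then show "z$1 <= 1 / 2" using half apex_of[of k G 0 z] by simp
 qed
 then show ?thesis by blast
qed

lemma apex_unique:
 assumes i: "i < 4" and "apex P i z" "apex P i z'" shows "z = z'"
proof -
 obtain t t' where t: "t : P" "t : rots (corner i, corner (next_side i), z)"
  and t': "t' : P" "t' : rots (corner i, corner (next_side i), z')" using assms(2,3) apexD by blast
 have "t = t'" using edge_owner[OF t(1) _ t'(1)] rots_edge t(2) t'(2) by blast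
 then show ?thesis using t(2) t'(2) corner_next_ne[OF i] by auto
qed

text \<open>The root \<open>start_ear\<close> presupposes one particular flat triangle. The reversed
  right side of the square and the side of the ear along it share the corner (1, 0), so the
  completion may begin by trimming there, which produces this triangle.\<close>

lemma ear_net:
 assumes t: "apex P 0 z" and z1: "z$1 = 1"
 shows "EX G k. net Vs (KK G) tv clean (Cfg [] False False) & k : KK G & snd k ~= 0 & fst k : rots (pt 0 0, pt 1 0, z) &
  ((pt 1 1, z, pt 1 0), 0) : KK G"
proof -
 obtain t where t: "t : P" "t : rots (pt 0 0, pt 1 0, z)" using t apexD[of P 0 z] by auto
 have "tor t = z$2" using tor_rots[OF t(2)] by (simp add: orient_def)
 \<comment> \<open>At most three pieces fit into the ear, which keeps its apex strictly below the
   corner (1, 1).\<close>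
 then have z2: "0 < z$2" "67108864 * z$2 <= 19202147 * 3"
  using pos[OF t(1)] tor_hi[OF t(1)] wt_le_3[OF t(1)] by auto
 have "(pt 1 0, z) : tedges t" using t(2) by auto
 then have za: "(pt 1 0, z) : X" using t(1) by (auto simp: X_def)
 have lo: "(pt 1 1, pt 1 0) : X" by (simp add: X_def oedges_def)
 have "z = pt 1 0 + z$2 *\<^sub>R (pt 1 1 - pt 1 0)" by (simp add: vec2_eq_iff z1)
 from trim_far[OF balanced_X vertex_once_X za lo z2(1) _ this] z2(2)
 have tr: "trim (insert z VF) X (pt 1 1, pt 1 0) (pt 1 0, z) (pt 1 1, z) z (pt 1 1, z, pt 1 0)" by simp
 have "EX F' G. closes F' X (insert (pt 1 1, z, pt 1 0) G)"
 proof (rule trim_step[OF tr])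
  fix X' assume X': "balanced (insert z VF) X'" "Submission.vertex_once X'"
   and cl: "!!F' G. closes F' X' G ==> insert z VF <= F' ==> closes F' X (insert (pt 1 1, z, pt 1 0) G)"
  obtain F' G where "insert z VF <= F'" "closes F' X' G" using closes_ex[OF X'] by blast
  then have "closes F' X (insert (pt 1 1, z, pt 1 0) G)" using cl by (simp only:)
  then show ?thesis by (intro exI)
 qed
 then obtain F' G where cl: "closes F' X (insert (pt 1 1, z, pt 1 0) G)" by (elim exE)
 let ?G = "insert (pt 1 1, z, pt 1 0) G"
 have "net Vs (KK ?G) tv clean (Cfg [] False False)"
  by (rule net_intro[OF cl]) simp_all
 moreover have "(t, wt t) : KK ?G" "wt t ~= 0" using P_real[OF t(1)] by auto
 moreover have "((pt 1 1, z, pt 1 0), 0) : KK ?G" by (simp add: KK_def)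
 ultimately show ?thesis using t(2) by (intro exI[of _ ?G] exI[of _ "(t, wt t)"]) simp
qed

lemma ear_opt:
 assumes "apex P 0 z" "z$1 = 1" shows "opt_tiling P wt"
proof -
 obtain G k where n: "net Vs (KK G) tv clean (Cfg [] False False)" and k: "k : KK G" "snd k ~= 0" "fst k : rots (pt 0 0, pt 1 0, z)"
  and fl: "((pt 1 1, z, pt 1 0), 0) : KK G" using ear_net[OF assms] by blast
 interpret net Vs "KK G" tv clean "Cfg [] False False" by (rule n)
 have goal
  by (rule finished_goal[OF _ cert_1]) (intro feed_ok ear_ok_start[OF refl k fl assms(2)])
 then show ?thesis using opt_net_tiling[OF goal_opt n] by blast
qed

lemma pattern_opt:
 assumes fin: "finished x" and run: "!!Vs K tv cl cf. net Vs K tv cl (Cfg l True hf) ==>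
   net.conf_ok Vs K tv cl (Cfg l True hf) (start (Cfg l True hf)) ==> net.conf_ok Vs K tv cl (Cfg l True hf) x"
  and m1: "!!i. i < 4 ==> nget l i = 1 ==> whole P i" and m2: "!!i. i < 4 ==> nget l i = 2 ==> ~ whole P i"
  and ear: "noear P" and half: "!!z. hf ==> apex P 0 z ==> z$1 <= 1 / 2"
 shows "opt_tiling P wt"
proof -
 obtain G where n: "net Vs (KK G) tv clean (Cfg l True hf)" using net_pattern[OF m1 m2 ear half] by blast
 interpret net Vs "KK G" tv clean "Cfg l True hf" by (rule n)
 have goal by (rule finished_goal[OF run[OF n start_ok] fin])
 then show ?thesis using opt_net_tiling[OF goal_opt n] by blast
qed

end

section \<open>Transport of ears and patterns by the symmetries\<close>

lemma on_side_rot: "j < 4 ==> on_side (next_side j) (rotg z) \<longleftrightarrow> on_side j z"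
 by (erule less_4_cases) (auto simp: on_side_def rotg_def)

lemma on_side_refl: "j < 4 ==> on_side (mirror j) (reflg z) \<longleftrightarrow> on_side j z"
 by (erule less_4_cases) (auto simp: on_side_def reflg_def)

lemma adjacent_rot: "i < 4 ==> j < 4 ==> adjacent (next_side i) (next_side j) \<longleftrightarrow> adjacent i j"
 by (erule less_4_cases; erule less_4_cases) (auto simp: adjacent_def)

lemma adjacent_refl: "i < 4 ==> j < 4 ==> adjacent (mirror i) (mirror j) \<longleftrightarrow> adjacent i j"
 by (erule less_4_cases; erule less_4_cases) (auto simp: adjacent_def)

lemma ex_next: "i < 4 ==> EX j<4. i = next_side j"
 by (rule exI[of _ "next_side (next_side (next_side i))"]) (erule less_4_cases; simp)

lemma ex_mirror: "i < 4 ==> EX j<4. i = mirror j"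
 by (erule less_4_cases) (auto intro!: exI[of _ "mirror i"])

lemma noear_rot: assumes "noear P" shows "noear (rot.T ` P)"
 unfolding noear_def
proof (intro allI impI)
 fix i j z assume "i < 4" "j < 4" and h: "adjacent i j" "apex (rot.T ` P) i z"
 then obtain i' j' where ij: "i' < 4" "j' < 4" "i = next_side i'" "j = next_side j'" using ex_next by meson
 obtain z' where z: "z = rotg z'" using rot.surj by blast
 show "~ on_side j z"
  using assms h ij(1,2) unfolding ij(3,4) z noear_def adjacent_rot[OF ij(1,2)] apex_rot[OF ij(1)] on_side_rot[OF ij(2)] by blast
qed

lemma noear_refl: assumes "noear P" shows "noear (ref.T ` P)"
 unfolding noear_def
proof (intro allI impI)
 fix i j z assume "i < 4" "j < 4" and h: "adjacent i j" "apex (ref.T ` P) i z"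
 then obtain i' j' where ij: "i' < 4" "j' < 4" "i = mirror i'" "j = mirror j'" using ex_mirror by meson
 obtain z' where z: "z = reflg z'" using ref.surj by blast
 show "~ on_side j z"
  using assms h ij(1,2) unfolding ij(3,4) z noear_def adjacent_refl[OF ij(1,2)] apex_refl[OF ij(1)] on_side_refl[OF ij(2)] by blast
qed

lemma whole_rot: "i < 4 ==> whole (rot.T ` P) (next_side i) \<longleftrightarrow> whole P i"
 unfolding whole_def using apex_rot rot.surj by metis

lemma whole_refl: "i < 4 ==> whole (ref.T ` P) (mirror i) \<longleftrightarrow> whole P i"
 unfolding whole_def using apex_refl ref.surj by metis

definition ear_case :: "nat => nat => bool" where
 "ear_case i j \<longleftrightarrow> (ALL P wt z. wtiling P wt --> apex P i z --> on_side j z --> opt_tiling P wt)"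

lemma ear_case_rot: assumes "i < 4" "j < 4" "ear_case (next_side i) (next_side j)" shows "ear_case i j"
 unfolding ear_case_def
proof (intro allI impI)
 fix P wt z assume w: "wtiling P wt" and "apex P i z" "on_side j z"
 then have "apex (rot.T ` P) (next_side i) (rotg z)" "on_side (next_side j) (rotg z)"
  using apex_rot[OF assms(1)] on_side_rot[OF assms(2)] by simp_all
 then have "opt_tiling (rot.T ` P) (wt \<circ> rot.T')" using rot.wtiling_T[OF w] assms(3) unfolding ear_case_def by blast
 then show "opt_tiling P wt" by (rule rot.opt_tiling_T)
qed

lemma ear_case_refl: assumes "i < 4" "j < 4" "ear_case (mirror i) (mirror j)" shows "ear_case i j"
 unfolding ear_case_def
proof (intro allI impI)
 fix P wt z assume w: "wtiling P wt" and "apex P i z" "on_side j z"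
 then have "apex (ref.T ` P) (mirror i) (reflg z)" "on_side (mirror j) (reflg z)"
  using apex_refl[OF assms(1)] on_side_refl[OF assms(2)] by simp_all
 then have "opt_tiling (ref.T ` P) (wt \<circ> ref.T')" using ref.wtiling_T[OF w] assms(3) unfolding ear_case_def by blast
 then show "opt_tiling P wt" by (rule ref.opt_tiling_T)
qed

text \<open>The reflection takes the ear leaning to side 1 to the one leaning to side 3, and
  rotations take these two to all eight.\<close>

lemma ear_case_all:
 assumes "i < 4" "j < 4" "adjacent i j" shows "ear_case i j"
proof -
 have 01: "ear_case 0 (Suc 0)" unfolding ear_case_def using wtiling.ear_opt by (auto simp: on_side_def)
 have 03: "ear_case 0 (Suc (Suc (Suc 0)))" by (rule ear_case_refl) (simp_all add: 01)
 have 3: "ear_case (Suc (Suc (Suc 0))) 0" "ear_case (Suc (Suc (Suc 0))) (Suc (Suc 0))" by (rule ear_case_rot; simp add: 01 03)+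
 have 2: "ear_case (Suc (Suc 0)) (Suc (Suc (Suc 0)))" "ear_case (Suc (Suc 0)) (Suc 0)" by (rule ear_case_rot; simp add: 3)+
 have 1: "ear_case (Suc 0) (Suc (Suc 0))" "ear_case (Suc 0) 0" by (rule ear_case_rot; simp add: 2)+
 show ?thesis using assms 01 03 3 2 1 by (auto elim!: less_4_cases simp: adjacent_def)
qed

definition pattern_case :: "bool => bool => bool => bool => bool" where
 "pattern_case w0 w1 w2 w3 \<longleftrightarrow> (ALL P wt. wtiling P wt --> noear P --> whole P 0 = w0 --> whole P (Suc 0) = w1 -->
   whole P (Suc (Suc 0)) = w2 --> whole P (Suc (Suc (Suc 0))) = w3 --> opt_tiling P wt)"

lemma pattern_case_rot: assumes "pattern_case w3 w0 w1 w2" shows "pattern_case w0 w1 w2 w3"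
 unfolding pattern_case_def
proof (intro allI impI)
 fix P wt assume w: "wtiling P wt" and e: "noear P" and h: "whole P 0 = w0" "whole P (Suc 0) = w1"
   "whole P (Suc (Suc 0)) = w2" "whole P (Suc (Suc (Suc 0))) = w3"
 have "opt_tiling (rot.T ` P) (wt \<circ> rot.T')"
  using rot.wtiling_T[OF w] noear_rot[OF e] assms h whole_rot[of 0 P] whole_rot[of "Suc 0" P]
   whole_rot[of "Suc (Suc 0)" P] whole_rot[of "Suc (Suc (Suc 0))" P] unfolding pattern_case_def by simp
 then show "opt_tiling P wt" by (rule rot.opt_tiling_T)
qed

text \<open>If the apex over the bottom side is in the right half, the tiling is reflected; the
  pattern stays the same because its entries for the sides 1 and 3 agree.\<close>

lemma pattern_case_half:
 assumes h: "!!P wt. wtiling P wt ==> noear P ==> whole P 0 = w0 ==> whole P (Suc 0) = w1 ==> whole P (Suc (Suc 0)) = w2 ==>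
   whole P (Suc (Suc (Suc 0))) = w1 ==> (!!z. apex P 0 z ==> z$1 <= 1 / 2) ==> opt_tiling P wt"
 shows "pattern_case w0 w1 w2 w1"
 unfolding pattern_case_def
proof (intro allI impI)
 fix P wt assume w: "wtiling P wt" and e: "noear P" and p: "whole P 0 = w0" "whole P (Suc 0) = w1"
   "whole P (Suc (Suc 0)) = w2" "whole P (Suc (Suc (Suc 0))) = w1"
 show "opt_tiling P wt"
 proof (cases "EX z. apex P 0 z & 1 / 2 < z$1")
  case False
  then show ?thesis using h[OF w e p] by (meson not_le)
 next
  case True
  then obtain z where z: "apex P 0 z" "1 / 2 < z$1" by blast
  have w': "wtiling (ref.T ` P) (wt \<circ> ref.T')" by (rule ref.wtiling_T[OF w])
  have "apex (ref.T ` P) 0 (reflg z)" using apex_refl[of 0 P z] z by simp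
  then have "z' = reflg z" if "apex (ref.T ` P) 0 z'" for z' using wtiling.apex_unique[OF w', of 0] that by simp
  then have "z'$1 <= 1 / 2" if "apex (ref.T ` P) 0 z'" for z' using that[THEN \<open>!!z'. apex (ref.T ` P) 0 z' ==> z' = reflg z\<close>] z(2) by (simp add: reflg_def)
  then have "opt_tiling (ref.T ` P) (wt \<circ> ref.T')"
   using h[OF w' noear_refl[OF e]] p whole_refl[of 0 P] whole_refl[of "Suc 0" P]
    whole_refl[of "Suc (Suc 0)" P] whole_refl[of "Suc (Suc (Suc 0))" P] by simp
  then show ?thesis by (rule ref.opt_tiling_T)
 qed
qed

text \<open>Representatives of the six orbits of the sixteen patterns under rotation.\<close>

lemma pattern_cases:
 "pattern_case True True True True" "pattern_case True True False True" "pattern_case True True False False"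
 "pattern_case True False True False" "pattern_case True False False False" "pattern_case False False False False"
proof -
 have "opt_tiling P wt" if "wtiling P wt" "noear P" "whole P 0 = True" "whole P (Suc 0) = True" "whole P (Suc (Suc 0)) = True"
   "whole P (Suc (Suc (Suc 0))) = True" "!!z. apex P 0 z ==> z$1 <= 1 / 2" for P wt
  by (rule wtiling.pattern_opt[OF that(1) cert_25, of "[Suc 0, Suc 0, Suc 0, Suc 0]" True])
   ((intro net.feed_ok; assumption), (use that in \<open>auto elim!: less_4_cases\<close>))
 then show "pattern_case True True True True" by (rule pattern_case_half)
 have "opt_tiling P wt" if "wtiling P wt" "noear P" "whole P 0 = True" "whole P (Suc 0) = True" "whole P (Suc (Suc 0)) = False"
   "whole P (Suc (Suc (Suc 0))) = True" "!!z. apex P 0 z ==> z$1 <= 1 / 2" for P wt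
  by (rule wtiling.pattern_opt[OF that(1) cert_21, of "[Suc 0, Suc 0, Suc (Suc 0), Suc 0]" True])
   ((intro net.feed_ok; assumption), (use that in \<open>auto elim!: less_4_cases\<close>))
 then show "pattern_case True True False True" by (rule pattern_case_half)
 have "opt_tiling P wt" if "wtiling P wt" "noear P" "whole P 0 = True" "whole P (Suc 0) = True" "whole P (Suc (Suc 0)) = False"
   "whole P (Suc (Suc (Suc 0))) = False" for P wt
  by (rule wtiling.pattern_opt[OF that(1) cert_13, of "[Suc 0, Suc 0, Suc (Suc 0), Suc (Suc 0)]" False])
   ((intro net.feed_ok; assumption), (use that in \<open>auto elim!: less_4_cases\<close>))
 then show "pattern_case True True False False" by (simp add: pattern_case_def)
 have "opt_tiling P wt" if "wtiling P wt" "noear P" "whole P 0 = True" "whole P (Suc 0) = False" "whole P (Suc (Suc 0)) = True"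
   "whole P (Suc (Suc (Suc 0))) = False" "!!z. apex P 0 z ==> z$1 <= 1 / 2" for P wt
  by (rule wtiling.pattern_opt[OF that(1) cert_15, of "[Suc 0, Suc (Suc 0), Suc 0, Suc (Suc 0)]" True])
   ((intro net.feed_ok; assumption), (use that in \<open>auto elim!: less_4_cases\<close>))
 then show "pattern_case True False True False" by (rule pattern_case_half)
 have "opt_tiling P wt" if "wtiling P wt" "noear P" "whole P 0 = True" "whole P (Suc 0) = False" "whole P (Suc (Suc 0)) = False"
   "whole P (Suc (Suc (Suc 0))) = False" "!!z. apex P 0 z ==> z$1 <= 1 / 2" for P wt
  by (rule wtiling.pattern_opt[OF that(1) cert_11, of "[Suc 0, Suc (Suc 0), Suc (Suc 0), Suc (Suc 0)]" True])
   ((intro net.feed_ok; assumption), (use that in \<open>auto elim!: less_4_cases\<close>))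
 then show "pattern_case True False False False" by (rule pattern_case_half)
 have "opt_tiling P wt" if "wtiling P wt" "noear P" "whole P 0 = False" "whole P (Suc 0) = False" "whole P (Suc (Suc 0)) = False"
   "whole P (Suc (Suc (Suc 0))) = False" for P wt
  by (rule wtiling.pattern_opt[OF that(1) cert_10, of "[Suc (Suc 0), Suc (Suc 0), Suc (Suc 0), Suc (Suc 0)]" False])
   ((intro net.feed_ok; assumption), (use that in \<open>auto elim!: less_4_cases\<close>))
 then show "pattern_case False False False False" by (simp add: pattern_case_def)
qed

lemma pattern_case_all: "pattern_case w0 w1 w2 w3"
proof -
 note c = pattern_cases
 note c1 = c[THEN pattern_case_rot]
 note c2 = c1[THEN pattern_case_rot]
 note c3 = c2[THEN pattern_case_rot]
 show ?thesis using c c1 c2 c3 by (cases w0; cases w1; cases w2; cases w3) (simp only:)+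
qed

theorem wtiling_opt:
 assumes "wtiling P wt" shows "opt_tiling P wt"
proof (cases "noear P")
 case True
 then show ?thesis using assms pattern_case_all unfolding pattern_case_def by blast
next
 case False
 then obtain i j z where "i < 4" "j < 4" "adjacent i j" "apex P i z" "on_side j z" unfolding noear_def by blast
 then show ?thesis using ear_case_all assms unfolding ear_case_def by blast
qed

subsection \<open>Dissections\<close>

text \<open>The hull lies in a line, and any ball has points to the left of that line.\<close>

lemma flat_hull_interior:
 assumes "orient a b c = 0" shows "interior (convex hull {a, b, c}) = {}"
proof -
 obtain p q where pq: "p ~= q" "orient p q a = 0" "orient p q b = 0" "orient p q c = 0"
 proof (cases "a = b")
  case False
  then show ?thesis using that[of a b] assms by simp
 next
  case ab: True
  show ?thesis
  proof (cases "a = c")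
   case False
   then show ?thesis using that[of a c] ab by simp
  next
   case True
   \<comment> \<open>All three points coincide, so any line through them will do.\<close>
   have "a ~= a + pt 1 0" by (simp add: vec2_eq_iff)
   then show ?thesis using that[of a "a + pt 1 0"] ab True by simp
  qed
 qed
 have "convex hull {a, b, c} <= {z. 0 <= orient q p z}"
  using pq orient_swap[of q p] by (intro hull_minimal convex_halfplane) auto
 then have le: "orient p q z <= 0" if "z : convex hull {a, b, c}" for z
  using that orient_swap[of q p z] by auto
 have ge: "0 <= orient p q z" if "z : convex hull {a, b, c}" for z
 proof -
  have "convex hull {a, b, c} <= {z. 0 <= orient p q z}"
   using pq by (intro hull_minimal convex_halfplane) auto
  then show ?thesis using that by auto
 qed
 show ?thesis
 proof (rule ccontr)
  assume "interior (convex hull {a, b, c}) ~= {}"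
  then obtain z e where z: "0 < e" "ball z e <= convex hull {a, b, c}" using mem_interior by blast
  obtain w where w: "0 < crs (q - p) w" using ex_left_vector[of "q - p"] pq(1) by auto
  obtain s where s: "0 < s" "!!r. 0 <= r ==> r <= s ==> z + r *\<^sub>R w : ball z e" using small_move[OF z(1)] by blast
  have "z + s *\<^sub>R w : convex hull {a, b, c}" using s z(2) by (meson less_imp_le order_refl subsetD)
  moreover have "z : convex hull {a, b, c}" using z by auto
  moreover have "0 < s * crs (q - p) w" using s(1) w by simp
  ultimately show False using le ge orient_add[of p q z s w] by fastforce
 qed
qed

text \<open>Collinear vertices would give a negligible hull; otherwise one of the two orders of the
  vertices is counterclockwise.\<close>

lemma nondegenerate_ctri:
 assumes "nondegenerate_triangle T" shows "EX t. T = ctri t & 0 < tor t"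
proof -
 obtain a b c where T: "T = convex hull {a, b, c}" "0 < area T" using assms by (auto simp: nondegenerate_triangle_def)
 have "orient a b c ~= 0"
 proof
  assume "orient a b c = 0"
  then have "negligible T"
   using flat_hull_interior T(1) negligible_convex_interior[of T] by simp
  then have "measure lebesgue T = 0" by (simp add: negligible_imp_measure0)
  moreover have "closed T" unfolding T(1) by (intro compact_imp_closed finite_imp_compact_convex_hull) simp
  ultimately show False using T(2) by (simp add: measure_completion)
 qed
 then consider "0 < orient a b c" | "0 < orient a c b"
  using orient_swap[of c a b] by (simp add: orient_rot) linarith
 then show ?thesis
 proof cases
  case 1
  then show ?thesis using convex_hull_ctri[OF 1] T(1) by (intro exI[of _ "(a, b, c)"]) simp
 next
  case 2
  then show ?thesis using convex_hull_ctri[OF 2] T(1) by (intro exI[of _ "(a, c, b)"]) (simp add: insert_commute)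
 qed
qed

lemma dissection_tiling:
 assumes "dissection n D" shows "EX P. tiling P & card P = n & ctri ` P = D"
proof -
 have d: "finite D" "card D = n" "!!T. T : D ==> nondegenerate_triangle T"
  "!!S T. S : D ==> T : D ==> S ~= T ==> interior S Int interior T = {}" "\<Union>D = unit_square"
  using assms by (simp_all add: dissection_def)
 define f where "f T = (SOME t. T = ctri t & 0 < tor t)" for T
 have f: "T = ctri (f T) & 0 < tor (f T)" if "T : D" for T
  unfolding f_def by (rule someI_ex[OF nondegenerate_ctri[OF d(3)[OF that]]])
 have inj: "inj_on f D"
 proof (rule inj_onI)
  fix S T assume "S : D" "T : D" "f S = f T"
  then show "S = T" using f[of S] f[of T] by simp
 qed
 have "(%T. ctri (f T)) ` D = (%T. T) ` D" by (rule image_cong) (use f in simp_all)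
 then have img: "ctri ` f ` D = D" by (simp add: image_image)
 have "tiling (f ` D)"
 proof
  show "finite (f ` D)" using d(1) by simp
  show "0 < tor t" if "t : f ` D" for t
  proof -
   obtain T where "T : D" "t = f T" using \<open>t : f ` D\<close> by (elim imageE)
   then show ?thesis using f by simp
  qed
  show "otri s Int otri t = {}" if "s : f ` D" "t : f ` D" "s ~= t" for s t
  proof -
   obtain S T where ST: "S : D" "T : D" "s = f S" "t = f T"
    using \<open>s : f ` D\<close> \<open>t : f ` D\<close> by (elim imageE)
   then have "S ~= T" using \<open>s ~= t\<close> by (rule_tac notI) simp
   have "interior S = otri s" "interior T = otri t"
    using interior_ctri[of s] interior_ctri[of t] f[OF ST(1)] f[OF ST(2)] unfolding ST(3,4) by simp_all
   moreover have "interior S Int interior T = {}" using d(4)[OF ST(1,2) \<open>S ~= T\<close>] .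
   ultimately show ?thesis by simp
  qed
  show "\<Union>(ctri ` f ` D) = unit_square" unfolding img by (rule d(5))
 qed
 moreover have "card (f ` D) = n" using card_image[OF inj] d(2) by simp
 ultimately show ?thesis using img by blast
qed

lemma distinct5_rest:
 assumes "finite P" "card P = 7" "distinct [d1, d2, d3, d4, d5]" "{d1, d2, d3, d4, d5} <= P"
 obtains d6 d7 where "distinct [d1, d2, d3, d4, d5, d6, d7]" "P = {d1, d2, d3, d4, d5, d6, d7}"
proof -
 have "card (P - {d1, d2, d3, d4, d5}) = 2"
  using assms distinct_card[OF assms(3)] by (subst card_Diff_subset) auto
 then obtain d6 d7 where "P - {d1, d2, d3, d4, d5} = {d6, d7}" "d6 ~= d7" by (meson card_2_iff)
 then show ?thesis using that[of d6 d7] assms(3,4) by auto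
qed

text \<open>All areas are within \<open>r7\<close> of the mean 1/7, hence within the tolerance
  0.00021 of the search. Its five triangles of weight 1 have the areas of five distinct pieces; on
  the two other pieces the total area and the range alone decide.\<close>

lemma tiling_extremal:
 assumes t: "tiling D" and c: "card D = 7" and r: "!!s t. s : D ==> t : D ==> tor s / 2 <= tor t / 2 + r7"
 shows "image_mset (%t. tor t / 2) (mset_set D) = {#H7, H7, H7, H7, L7, L7, L7#}"
proof -
 interpret D: tiling D by fact
 have ne: "D ~= {}" using c by auto
 define m where "m = Min ((%t. tor t / 2) ` D)"
 have "m : (%t. tor t / 2) ` D" unfolding m_def using D.fin ne by (intro Min_in) auto
 then obtain t0 where t0: "t0 : D" "m = tor t0 / 2" by blast
 have m: "m <= tor d / 2 & tor d / 2 <= m + r7" if "d : D" for d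
 proof
  show "m <= tor d / 2" unfolding m_def by (rule Min_le) (use D.fin that in simp_all)
  show "tor d / 2 <= m + r7" using r[OF that t0(1)] t0(2) by simp
 qed
 have "(\<Sum>d\<in>D. tor d / 2) = 1" using D.total_area by (simp add: sum_divide_distrib[symmetric])
 moreover have "(\<Sum>d\<in>D. m) <= (\<Sum>d\<in>D. tor d / 2)" "(\<Sum>d\<in>D. tor d / 2) <= (\<Sum>d\<in>D. m + r7)"
  using m by (intro sum_mono; blast)+
 ultimately have m1: "7 * m <= 1" "1 <= 7 * (m + r7)" using c by simp_all
 have r7: "r7 < 2011757 / 10^10" using r7_bounds(2) by simp
 have "19145775 <= 67108864 * tor d & 67108864 * tor d <= 19202147" if "d : D" for d
  using m[OF that] m1 r7 by simp
 from coarse_wtiling[OF t c this] obtain P wt where P: "wtiling P wt"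
  "!!t. t : P ==> wt t = 1 ==> EX d:D. ctri d <= ctri t & tor d = tor t" by blast
 interpret P: wtiling P wt by (rule P(1))
 obtain t1 t2 t3 t4 t5 where tt: "distinct [t1, t2, t3, t4, t5]" "{t1, t2, t3, t4, t5} <= {t : P. wt t = 1}"
  "area_rel (tor t1 / 2) (tor t2 / 2) (tor t3 / 2) (tor t4 / 2) (tor t5 / 2)"
  using wtiling_opt[OF P(1)] unfolding opt_tiling_def by blast
 have "ALL t:{t1, t2, t3, t4, t5}. EX d. d : D & ctri d <= ctri t & tor d = tor t" using P(2) tt(2) by blast
 then obtain g where g: "!!t. t : {t1, t2, t3, t4, t5} ==> g t : D & ctri (g t) <= ctri t & tor (g t) = tor t"
  using bchoice by metis
 have gi: "s = t" if "s : {t1, t2, t3, t4, t5}" "t : {t1, t2, t3, t4, t5}" "g s = g t" for s t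
 proof (rule ccontr)
  assume "s ~= t"
  then have "otri s Int otri t = {}" using P.disj that(1,2) tt(2) by blast
  moreover have "otri (g s) <= otri s" "otri (g s) <= otri t"
   using ctri_subset_otri D.pos P.pos g that tt(2) by (smt (verit, best) mem_Collect_eq subsetD)+
  ultimately show False using otri_nonempty[OF D.pos] g[OF that(1)] by blast
 qed
 have "inj_on g (set [t1, t2, t3, t4, t5])" by (rule inj_onI) (rule gi; simp only: list.set)
 then have "distinct (map g [t1, t2, t3, t4, t5])" unfolding distinct_map using tt(1) by blast
 then have dg: "distinct [g t1, g t2, g t3, g t4, g t5]" by (simp only: list.map)
 have gD: "{g t1, g t2, g t3, g t4, g t5} <= D" using g by simp
 obtain d6 d7 where d: "distinct [g t1, g t2, g t3, g t4, g t5, d6, d7]" "D = {g t1, g t2, g t3, g t4, g t5, d6, d7}"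
  using distinct5_rest[OF D.fin c dg gD] .
 have rel: "area_rel (tor (g t1) / 2) (tor (g t2) / 2) (tor (g t3) / 2) (tor (g t4) / 2) (tor (g t5) / 2)"
  using tt(3) g by simp
 have "tor (g t1) + tor (g t2) + tor (g t3) + tor (g t4) + tor (g t5) + tor d6 + tor d7 = 2"
  using D.total_area d(1) unfolding d(2) by simp
 then have sum: "tor (g t1) / 2 + tor (g t2) / 2 + tor (g t3) / 2 + tor (g t4) / 2 + tor (g t5) / 2 + tor d6 / 2 + tor d7 / 2 = 1"
  by simp
 have a: "tor (g t1) / 2 = H7" "tor (g t2) / 2 = H7" "tor (g t3) / 2 = L7" "tor (g t4) / 2 = H7" "tor (g t5) / 2 = H7"
  "tor d6 / 2 = L7" "tor d7 / 2 = L7"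
 proof -
  have "m <= x & x <= m + r7" if "x : (%t. tor t / 2) ` D" for x using m that by blast
  then have "m <= x & x <= m + r7" if "x : {tor (g t1) / 2, tor (g t2) / 2, tor (g t3) / 2, tor (g t4) / 2, tor (g t5) / 2,
    tor d6 / 2, tor d7 / 2}" for x
   using that unfolding d(2) image_insert image_empty by blast
  from opt_areas[OF rel sum this]
  show "tor (g t1) / 2 = H7" "tor (g t2) / 2 = H7" "tor (g t3) / 2 = L7" "tor (g t4) / 2 = H7" "tor (g t5) / 2 = H7"
   "tor d6 / 2 = L7" "tor d7 / 2 = L7" by blast+
 qed
 have "mset_set D = {#g t1, g t2, g t3, g t4, g t5, d6, d7#}"
  using mset_set_set[OF d(1)] unfolding d(2) by simp
 then show ?thesis by (simp only: a image_mset_add_mset image_mset_empty) (simp add: ac_simps)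
qed

text \<open>The hypothesis is an inequality, so that the same statement yields the lower bound for
  the range and the areas of minimizing dissections.\<close>

lemma dissection_extremal:
 assumes D: "dissection 7 D" and r: "area_range D <= r7"
 shows "area_mset D = {#H7, H7, H7, H7, L7, L7, L7#}"
proof -
 obtain P where P: "tiling P" "card P = 7" "ctri ` P = D" using dissection_tiling[OF D] by blast
 interpret tiling P by fact
 have fD: "finite D" using P(3) fin by blast
 have "tor s / 2 <= tor t / 2 + r7" if "s : P" "t : P" for s t
 proof -
  have "area (ctri s) <= Max (area ` D)" "Min (area ` D) <= area (ctri t)" using fD P(3) that by auto
  then show ?thesis using r area_ctri[OF pos[OF that(1)]] area_ctri[OF pos[OF that(2)]] by (simp add: area_range_def)
 qed
 then show ?thesis using tiling_extremal[OF P(1,2)] area_mset_tiling[OF P(1)] P(3) by simp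
qed

lemma area_range_mset:
 assumes "finite D" "area_mset D = {#H7, H7, H7, H7, L7, L7, L7#}"
 shows "area ` D = {H7, L7}" "area_range D = r7"
proof -
 have "area ` D = set_mset (area_mset D)" using assms(1) by (simp add: area_mset_def)
 then show "area ` D = {H7, L7}" using assms(2) by simp
 then show "area_range D = r7" using HL7(1,3) by (simp add: area_range_def)
qed

lemma finite_dissection: "dissection n D ==> finite D"
 by (simp add: dissection_def)

text \<open>A range below \<open>r7\<close> would force the extremal areas, whose range is
  \<open>r7\<close>.\<close>

lemma area_range_ge: "dissection 7 D ==> r7 <= area_range D"
 using dissection_extremal[of D] area_range_mset(2)[of D] finite_dissection[of 7 D] by linarith

lemma Delta_7: "\<Delta> 7 = r7"
proof -
 obtain D where D: "dissection 7 D" "area_mset D = {#H7, H7, H7, H7, L7, L7, L7#}" using opt_dissection by blast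
 have "area_range D = r7" using area_range_mset(2)[OF finite_dissection[OF D(1)] D(2)] .
 then have "r7 : {area_range D | D. dissection 7 D}" using D(1) by (intro CollectI exI[of _ D]) simp
 then show ?thesis unfolding \<Delta>_def by (rule cInf_eq_minimum) (use area_range_ge in blast)
qed

lemma minimizing_iff:
 assumes "dissection 7 D" shows "minimizing D \<longleftrightarrow> area_mset D = {#H7, H7, H7, H7, L7, L7, L7#}"
 using assms dissection_extremal[of D] area_range_mset(2)[of D] finite_dissection[of 7 D]
 by (auto simp: minimizing_def Delta_7)

lemma count_area_mset: "finite D ==> count (area_mset D) x = card {T : D. area T = x}"
proof -
 assume f: "finite D"
 have "count (area_mset D) x = (\<Sum>T | T : D & x = area T. 1)"
  using f by (simp add: area_mset_def count_image_mset' )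
 then show ?thesis by (simp add: eq_commute)
qed

theorem theorem2:
 shows "(\<exists>!r. 0 < r \<and> r < 1/4900 \<and> Q7 r = 0) \<and>
  (\<forall>D. dissection 7 D \<longrightarrow> area_range D \<ge> r7) \<and>
  2011756316409390820336285676 / 10^31 \<le> r7 \<and>
  r7 < 2011756316409390820336285677 / 10^31 \<and>
  (\<forall>D. dissection 7 D \<longrightarrow>
    (minimizing D \<longleftrightarrow> area_mset D = {#H7, H7, H7, H7, L7, L7, L7#})) \<and>
  L7 < H7 \<and>
  (\<forall>D. minimizing D \<longrightarrow>
    card (area ` D) = 2 \<and>
    card {T \<in> D. area T = H7} = 4 \<and>
    card {T \<in> D. area T = L7} = 3)"
proof -
 have "card (area ` D) = 2 & card {T : D. area T = H7} = 4 & card {T : D. area T = L7} = 3" if "minimizing D" for D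
 proof -
  have D: "dissection 7 D" using that by (simp add: minimizing_def)
  then have m: "area_mset D = {#H7, H7, H7, H7, L7, L7, L7#}" using minimizing_iff that by blast
  have f: "finite D" using finite_dissection D .
  show ?thesis
   using count_area_mset[OF f, of H7] count_area_mset[OF f, of L7] area_range_mset(1)[OF f m] HL7(3) by (simp add: m)
 qed
 then show ?thesis using r7_ex1 area_range_ge r7_bounds minimizing_iff HL7(3) by blast
qed

end
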